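(* Let $\mathbf{PsDBL}_\ell$ be the 2-category of large pseudo double categories, lax double functors and vertical natural transformations. The 2-functor $\mathrm{Enr}\colon\mathbf{PsDBL}_\ell\to2\text{-}\mathbf{CAT}$ sending a pseudo double category $\mathbb D$ to the 2-category of small categories, functors and natural transformations enriched over $\mathbb D$ is a parametric right 2-adjoint.
   Context: Size: fix Grothendieck universes $\mathcal U_1\in\mathcal U_2$; small means in $\mathcal U_1$, large means in $\mathcal U_2$. $2\text{-}\mathbf{CAT}$ is the 2-category of large 2-categories, 2-functors and 2-natural transformations; slices are strict slice 2-categories. For a 2-category $\mathscr K$ with a terminal object $1$, a 2-functor $R\colon\mathscr K\to\mathscr L$ is a parametric right 2-adjoint if the 2-functor $R_1\colon\mathscr K\to\mathscr L/R1$, $K\mapsto(R!_K\colon RK\to R1)$, has a left 2-adjoint. Virtual double categories. A virtual double category $\mathbb A$ consists of: a category $\mathbb A_{\mathrm{vert}}$, whose objects and morphisms are the objects and vertical morphisms of $\mathbb A$; for each pair of objects a set of horizontal morphisms $\Gamma\colon A\nrightarrow A'$; for each $n\ge0$, each path of horizontal morphisms $\Gamma_i\colon A_{i-1}\nrightarrow A_i$ ($1\le i\le n$), each $\Delta\colon B\nrightarrow B'$ and vertical $u\colon A_0\to B$, $u'\colon A_n\to B'$, a set of multicells, written $\theta\colon(\Gamma_1,\dots,\Gamma_n)\Rightarrow\Delta$ over $(u,u')$ (for $n=0$ the top is a single object $A_0$; a cell is a multicell with $n=1$); identity cells $\mathrm{id}_\Gamma\colon(\Gamma)\Rightarrow\Gamma$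 over identities; composites: for $\theta_i\colon(\Gamma_{i,1},\dots,\Gamma_{i,n_i})\Rightarrow\Delta_i$ over $(u_{i-1},u_i)$ ($1\le i\le m$) and $\kappa\colon(\Delta_1,\dots,\Delta_m)\Rightarrow\Lambda$ over $(v,v')$, a multicell $\kappa\circ(\theta_1,\dots,\theta_m)\colon(\Gamma_{1,1},\dots,\Gamma_{m,n_m})\Rightarrow\Lambda$ over $(vu_0,v'u_m)$; for $m=0$, given $\kappa\colon()\Rightarrow\Lambda$ over $(v,v')$ with top $B$ and vertical $u\colon A\to B$, a composite $\kappa\circ(u)$ over $(vu,v'u)$. Evident unit and associativity axioms hold. A virtual double functor preserves all this structure (objects, vertical and horizontal morphisms, multicells, vertical composition, identity cells, composites); a vertical transformation $\alpha\colon F\to G$ has vertical components $\alpha_A\colon FA\to GA$, natural in $A$, and cells $\alpha_\Gamma\colon(F\Gamma)\Rightarrow G\Gamma$ over $(\alpha_A,\alpha_{A'})$ with $\alpha_\Gamma\circ(F\theta)=G\theta\circ(\alpha_{\Gamma_1},\dots,\alpha_{\Gamma_n})$ for each multicell $\theta\colon(\Gamma_1,\dots,\Gamma_n)\Rightarrow\Gamma$. These form the 2-category $\mathbf{VDBL}$ of large virtual double categories. Enrichment over a virtual double category. An $\mathbb A$-category $\mathsf C$ has: a set $\mathrm{ob}(\mathsf C)$; for each $c$ an object $|c|$ of $\mathbb A$; horizontal morphisms $\mathsf C(c,c')\colon|c|\nrightarrow|c'|$; multicells $\eta_c\colon()\Rightarrow\mathsf C(c,c)$ and $\mu_{c_0,c_1,c_2}\colon(\mathsf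 C(c_0,c_1),\mathsf C(c_1,c_2))\Rightarrow\mathsf C(c_0,c_2)$ over identities, with $\mu\circ(\eta_c,\mathrm{id})=\mathrm{id}=\mu\circ(\mathrm{id},\eta_{c'})$ and $\mu\circ(\mu,\mathrm{id})=\mu\circ(\mathrm{id},\mu)$; it is small if $\mathrm{ob}(\mathsf C)$ is. An $\mathbb A$-functor $f\colon\mathsf C\to\mathsf D$ has a function $c\mapsto fc$ on objects, vertical morphisms $f_c\colon|c|\to|fc|$ and cells $\omega^f_{c,c'}\colon(\mathsf C(c,c'))\Rightarrow\mathsf D(fc,fc')$ over $(f_c,f_{c'})$ with $\omega^f_{c,c}\circ(\eta_c)=\eta_{fc}\circ(f_c)$ and $\omega^f_{c_0,c_2}\circ(\mu)=\mu\circ(\omega^f_{c_0,c_1},\omega^f_{c_1,c_2})$. An $\mathbb A$-natural transformation $\alpha\colon f\to f'$ is a family of multicells $\alpha_c\colon()\Rightarrow\mathsf D(fc,f'c)$ over $(f_c,f'_c)$ with $\mu\circ(\alpha_c,\omega^{f'}_{c,c'})=\mu\circ(\omega^f_{c,c'},\alpha_{c'})$. Composition: $(gf)_c=g_{fc}f_c$, $\omega^{gf}=\omega^g\circ(\omega^f)$; $(\beta\alpha)_c=\mu\circ(\alpha_c,\beta_c)$ with identities $\eta_{fc}\circ(f_c)$; $(g\alpha)_c=\omega^g\circ(\alpha_c)$; $(\alpha h)_b=\alpha_{hb}\circ(h_b)$. With small $\mathbb A$-categories this gives a 2-category $\mathbb A\text{-}\mathbf{Cat}$, and $\mathbb A\mapsto\mathbb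 A\text{-}\mathbf{Cat}$ extends in the evident way to a 2-functor $\mathrm{Enr}\colon\mathbf{VDBL}\to2\text{-}\mathbf{CAT}$. Pseudo double categories. There is a fully faithful 2-functor $\mathbf{PsDBL}_\ell\to\mathbf{VDBL}$ sending a pseudo double category $\mathbb D$ (strict vertical composition, horizontal composition associative and unital up to coherent isomorphism) to the virtual double category with the same objects, vertical and horizontal morphisms, whose multicells $(\Gamma_1,\dots,\Gamma_n)\Rightarrow\Delta$ over $(u,u')$ are the cells of $\mathbb D$ from the $n$-fold horizontal composite of $\Gamma_1,\dots,\Gamma_n$ (a horizontal identity if $n=0$) to $\Delta$ with vertical boundaries $u,u'$. Here $\mathrm{Enr}\colon\mathbf{PsDBL}_\ell\to2\text{-}\mathbf{CAT}$ is the composite of this 2-functor with $\mathrm{Enr}\colon\mathbf{VDBL}\to2\text{-}\mathbf{CAT}$. *)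

theory Defs
  imports "HOL-Library.FuncSet"
begin

section \<open>Grothendieck universes and coding of tuples and functions\<close>

text \<open>
  Sets are the elements of a type \<open>'v\<close>; \<open>elts x\<close> is the extension of \<open>x\<close>. The ambient
  set theory enters only through extensionality of \<open>elts\<close> and the closure
  properties of a universe. The power clause is second-order: every subset of an element
  of a universe is (the extension of) an element of the universe.
\<close>

definition grothendieck_universe :: "('v \<Rightarrow> 'v set) \<Rightarrow> 'v \<Rightarrow> bool" where
  "grothendieck_universe elts U \<longleftrightarrow>
     elts U \<noteq> {} \<and>
     (\<forall>x\<in>elts U. elts x \<subseteq> elts U) \<and>
     (\<forall>x\<in>elts U. \<forall>y\<in>elts U. \<exists>z\<in>elts U. elts z = {x, y}) \<and>
     (\<forall>x\<in>elts U. \<exists>p\<in>elts U. elts ` elts p = Pow (elts x)) \<and>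
     (\<forall>i\<in>elts U. \<forall>f. f ` elts i \<subseteq> elts U \<longrightarrow> (\<exists>z\<in>elts U. elts z = (\<Union>j\<in>elts i. elts (f j))))"

definition universe_pair :: "('v \<Rightarrow> 'v set) \<Rightarrow> 'v \<Rightarrow> 'v \<Rightarrow> bool" where
  "universe_pair elts U1 U2 \<longleftrightarrow>
     inj elts \<and> grothendieck_universe elts U1 \<and> grothendieck_universe elts U2 \<and> U1 \<in> elts U2"

text \<open>With \<open>U1\<close> for \<open>U\<close> this is smallness, with \<open>U2\<close> it is largeness.\<close>

definition of_size :: "('v \<Rightarrow> 'v set) \<Rightarrow> 'v \<Rightarrow> 'v set \<Rightarrow> bool" where
  "of_size elts U S \<longleftrightarrow> (\<exists>x\<in>elts U. elts x = S)"

context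
  fixes elts :: "'v \<Rightarrow> 'v set"
begin

definition vset :: "'v set \<Rightarrow> 'v" where
  "vset S = (THE x. elts x = S)"

definition vpair :: "'v \<Rightarrow> 'v \<Rightarrow> 'v" where
  "vpair x y = vset {vset {x}, vset {x, y}}"

fun vtuple :: "'v list \<Rightarrow> 'v" where
  "vtuple [] = vset {}"
| "vtuple (x # xs) = vpair x (vtuple xs)"

definition vlam :: "'v set \<Rightarrow> ('v \<Rightarrow> 'v) \<Rightarrow> 'v" where
  "vlam S f = vset ((\<lambda>x. vpair x (f x)) ` S)"

end


section \<open>Categories\<close>

record ('o, 'a) cat =
  obj :: "'o set"
  arr :: "'a set"
  src :: "'a \<Rightarrow> 'o"
  tgt :: "'a \<Rightarrow> 'o"
  ide :: "'o \<Rightarrow> 'a"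
  cmp :: "'a \<Rightarrow> 'a \<Rightarrow> 'a"

text \<open>\<open>cmp C g f\<close> is \<open>g\<close> after \<open>f\<close>.\<close>

definition composable :: "('o, 'a) cat \<Rightarrow> 'a \<Rightarrow> 'a \<Rightarrow> bool" where
  "composable C g f \<longleftrightarrow> g \<in> arr C \<and> f \<in> arr C \<and> src C g = tgt C f"

definition category :: "('o, 'a) cat \<Rightarrow> bool" where
  "category C \<longleftrightarrow>
     (\<forall>f\<in>arr C. src C f \<in> obj C \<and> tgt C f \<in> obj C) \<and>
     (\<forall>x\<in>obj C. ide C x \<in> arr C \<and> src C (ide C x) = x \<and> tgt C (ide C x) = x) \<and>
     (\<forall>g f. composable C g f \<longrightarrow>
        cmp C g f \<in> arr C \<and> src C (cmp C g f) = src C f \<and> tgt C (cmp C g f) = tgt C g) \<and>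
     (\<forall>f\<in>arr C. cmp C f (ide C (src C f)) = f \<and> cmp C (ide C (tgt C f)) f = f) \<and>
     (\<forall>h g f. composable C h g \<and> composable C g f \<longrightarrow>
        cmp C h (cmp C g f) = cmp C (cmp C h g) f)"

definition cat_functor ::
  "('o, 'a) cat \<Rightarrow> ('p, 'b) cat \<Rightarrow> ('o \<Rightarrow> 'p) \<Rightarrow> ('a \<Rightarrow> 'b) \<Rightarrow> bool" where
  "cat_functor C D F0 F1 \<longleftrightarrow>
     (\<forall>x\<in>obj C. F0 x \<in> obj D) \<and>
     (\<forall>f\<in>arr C. F1 f \<in> arr D \<and> src D (F1 f) = F0 (src C f) \<and> tgt D (F1 f) = F0 (tgt C f)) \<and>
     (\<forall>x\<in>obj C. F1 (ide C x) = ide D (F0 x)) \<and>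
     (\<forall>g f. composable C g f \<longrightarrow> F1 (cmp C g f) = cmp D (F1 g) (F1 f))"

definition inverses :: "('o, 'a) cat \<Rightarrow> 'a \<Rightarrow> 'a \<Rightarrow> bool" where
  "inverses C f g \<longleftrightarrow> composable C f g \<and> composable C g f \<and>
     cmp C g f = ide C (src C f) \<and> cmp C f g = ide C (tgt C f)"

definition inverse_of :: "('o, 'a) cat \<Rightarrow> 'a \<Rightarrow> 'a" where
  "inverse_of C f = (THE g. inverses C f g)"

text \<open>
  The operations of a structure that is an object of some 2-category are required to be
  \<open>undefined\<close> outside their domain, so that equality of records is equality of structures.
\<close>

definition ext_cat :: "('o, 'a) cat \<Rightarrow> bool" where
  "ext_cat C \<longleftrightarrow>
     src C \<in> extensional (arr C) \<and> tgt C \<in> extensional (arr C) \<and>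
     ide C \<in> extensional (obj C) \<and>
     (\<forall>g f. \<not> composable C g f \<longrightarrow> cmp C g f = undefined)"

definition cat_of_size :: "('v \<Rightarrow> 'v set) \<Rightarrow> 'v \<Rightarrow> ('v, 'v) cat \<Rightarrow> bool" where
  "cat_of_size elts U C \<longleftrightarrow> of_size elts U (obj C) \<and> of_size elts U (arr C)"

text \<open>A morphism given by data \<open>amap\<close> that does not determine its source and target.\<close>

datatype ('s, 'm) arrow = Arrow (asrc: 's) (amap: 'm) (atgt: 's)


section \<open>2-categories\<close>

text \<open>
  Strict 2-categories. \<open>cat1\<close> is the underlying category, \<open>cat2\<close> the category of 1-cells and 2-cells under
  vertical composition, and \<open>hcmp K b a\<close> the horizontal composite \<open>b * a\<close>.
\<close>

record ('o, 'a, 'c) two_cat =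
  cat1 :: "('o, 'a) cat"
  cat2 :: "('a, 'c) cat"
  hcmp :: "'c \<Rightarrow> 'c \<Rightarrow> 'c"

text \<open>The category of 0-cells and 2-cells under horizontal composition.\<close>

definition hcat :: "('o, 'a, 'c) two_cat \<Rightarrow> ('o, 'c) cat" where
  "hcat K =
     \<lparr>obj = obj (cat1 K), arr = arr (cat2 K),
      src = (\<lambda>a. src (cat1 K) (src (cat2 K) a)),
      tgt = (\<lambda>a. tgt (cat1 K) (src (cat2 K) a)),
      ide = (\<lambda>x. ide (cat2 K) (ide (cat1 K) x)),
      cmp = hcmp K\<rparr>"

definition two_category :: "('o, 'a, 'c) two_cat \<Rightarrow> bool" where
  "two_category K \<longleftrightarrow>
     category (cat1 K) \<and> category (cat2 K) \<and> category (hcat K) \<and>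
     obj (cat2 K) = arr (cat1 K) \<and>
     (\<forall>a\<in>arr (cat2 K).
        src (cat1 K) (tgt (cat2 K) a) = src (cat1 K) (src (cat2 K) a) \<and>
        tgt (cat1 K) (tgt (cat2 K) a) = tgt (cat1 K) (src (cat2 K) a)) \<and>
     (\<forall>b a. composable (hcat K) b a \<longrightarrow>
        src (cat2 K) (hcmp K b a) = cmp (cat1 K) (src (cat2 K) b) (src (cat2 K) a) \<and>
        tgt (cat2 K) (hcmp K b a) = cmp (cat1 K) (tgt (cat2 K) b) (tgt (cat2 K) a)) \<and>
     (\<forall>g f. composable (cat1 K) g f \<longrightarrow>
        hcmp K (ide (cat2 K) g) (ide (cat2 K) f) = ide (cat2 K) (cmp (cat1 K) g f)) \<and>
     (\<forall>d c b a. composable (cat2 K) d c \<and> composable (cat2 K) b a \<and> composable (hcat K) c a \<longrightarrow>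
        hcmp K (cmp (cat2 K) d c) (cmp (cat2 K) b a) =
        cmp (cat2 K) (hcmp K d b) (hcmp K c a))"

record ('o, 'a, 'c, 'p, 'b, 'd) two_fun =
  on0 :: "'o \<Rightarrow> 'p"
  on1 :: "'a \<Rightarrow> 'b"
  on2 :: "'c \<Rightarrow> 'd"

definition two_functor ::
  "('o, 'a, 'c) two_cat \<Rightarrow> ('p, 'b, 'd) two_cat \<Rightarrow> ('o, 'a, 'c, 'p, 'b, 'd) two_fun \<Rightarrow> bool" where
  "two_functor K L F \<longleftrightarrow>
     two_category K \<and> two_category L \<and>
     cat_functor (cat1 K) (cat1 L) (on0 F) (on1 F) \<and>
     cat_functor (cat2 K) (cat2 L) (on1 F) (on2 F) \<and>
     cat_functor (hcat K) (hcat L) (on0 F) (on2 F)"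

definition id_two_fun :: "('o, 'a, 'c, 'o, 'a, 'c) two_fun" where
  "id_two_fun = \<lparr>on0 = id, on1 = id, on2 = id\<rparr>"

definition comp_two_fun ::
  "('p, 'b, 'd, 'q, 'e, 'f) two_fun \<Rightarrow> ('o, 'a, 'c, 'p, 'b, 'd) two_fun \<Rightarrow>
   ('o, 'a, 'c, 'q, 'e, 'f) two_fun" where
  "comp_two_fun G F = \<lparr>on0 = on0 G \<circ> on0 F, on1 = on1 G \<circ> on1 F, on2 = on2 G \<circ> on2 F\<rparr>"

definition two_natural ::
  "('o, 'a, 'c) two_cat \<Rightarrow> ('p, 'b, 'd) two_cat \<Rightarrow> ('o, 'a, 'c, 'p, 'b, 'd) two_fun \<Rightarrow>
   ('o, 'a, 'c, 'p, 'b, 'd) two_fun \<Rightarrow> ('o \<Rightarrow> 'b) \<Rightarrow> bool" where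
  "two_natural K L F G t \<longleftrightarrow>
     (\<forall>x\<in>obj (cat1 K). t x \<in> arr (cat1 L) \<and>
        src (cat1 L) (t x) = on0 F x \<and> tgt (cat1 L) (t x) = on0 G x) \<and>
     (\<forall>f\<in>arr (cat1 K).
        cmp (cat1 L) (on1 G f) (t (src (cat1 K) f)) =
        cmp (cat1 L) (t (tgt (cat1 K) f)) (on1 F f)) \<and>
     (\<forall>a\<in>arr (cat2 K).
        hcmp L (on2 G a) (ide (cat2 L) (t (src (hcat K) a))) =
        hcmp L (ide (cat2 L) (t (tgt (hcat K) a))) (on2 F a))"

text \<open>Strict slice 2-category over \<open>x\<close>; its 1-cells are strictly commuting triangles.\<close>

definition slice1 :: "('o, 'a, 'c) two_cat \<Rightarrow> 'o \<Rightarrow> ('a, ('a, 'a) arrow) cat" where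
  "slice1 L x =
     \<lparr>obj = {p \<in> arr (cat1 L). tgt (cat1 L) p = x},
      arr = {Arrow p h q | p h q.
               p \<in> arr (cat1 L) \<and> tgt (cat1 L) p = x \<and> q \<in> arr (cat1 L) \<and> tgt (cat1 L) q = x \<and>
               h \<in> arr (cat1 L) \<and> src (cat1 L) h = src (cat1 L) p \<and>
               tgt (cat1 L) h = src (cat1 L) q \<and> cmp (cat1 L) q h = p},
      src = asrc,
      tgt = atgt,
      ide = (\<lambda>p. Arrow p (ide (cat1 L) (src (cat1 L) p)) p),
      cmp = (\<lambda>k h. Arrow (asrc h) (cmp (cat1 L) (amap k) (amap h)) (atgt k))\<rparr>"

definition slice2 ::
  "('o, 'a, 'c) two_cat \<Rightarrow> 'o \<Rightarrow> (('a, 'a) arrow, (('a, 'a) arrow, 'c) arrow) cat" where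
  "slice2 L x =
     \<lparr>obj = arr (slice1 L x),
      arr = {Arrow h a k | h a k.
               h \<in> arr (slice1 L x) \<and> k \<in> arr (slice1 L x) \<and>
               asrc h = asrc k \<and> atgt h = atgt k \<and>
               a \<in> arr (cat2 L) \<and> src (cat2 L) a = amap h \<and> tgt (cat2 L) a = amap k \<and>
               hcmp L (ide (cat2 L) (atgt h)) a = ide (cat2 L) (asrc h)},
      src = asrc,
      tgt = atgt,
      ide = (\<lambda>h. Arrow h (ide (cat2 L) (amap h)) h),
      cmp = (\<lambda>b a. Arrow (asrc a) (cmp (cat2 L) (amap b) (amap a)) (atgt b))\<rparr>"

definition slice ::
  "('o, 'a, 'c) two_cat \<Rightarrow> 'o \<Rightarrow> ('a, ('a, 'a) arrow, (('a, 'a) arrow, 'c) arrow) two_cat" where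
  "slice L x =
     \<lparr>cat1 = slice1 L x,
      cat2 = slice2 L x,
      hcmp = (\<lambda>b a. Arrow (cmp (slice1 L x) (asrc b) (asrc a)) (hcmp L (amap b) (amap a))
                          (cmp (slice1 L x) (atgt b) (atgt a)))\<rparr>"

definition has_left_2adjoint ::
  "('o, 'a, 'c) two_cat \<Rightarrow> ('p, 'b, 'd) two_cat \<Rightarrow> ('o, 'a, 'c, 'p, 'b, 'd) two_fun \<Rightarrow> bool" where
  "has_left_2adjoint X Y G \<longleftrightarrow>
     two_functor X Y G \<and>
     (\<exists>F unit counit.
        two_functor Y X F \<and>
        two_natural Y Y id_two_fun (comp_two_fun G F) unit \<and>
        two_natural X X (comp_two_fun F G) id_two_fun counit \<and>
        (\<forall>x\<in>obj (cat1 X).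
           cmp (cat1 Y) (on1 G (counit x)) (unit (on0 G x)) = ide (cat1 Y) (on0 G x)) \<and>
        (\<forall>y\<in>obj (cat1 Y).
           cmp (cat1 X) (counit (on0 F y)) (on1 F (unit y)) = ide (cat1 X) (on0 F y)))"

text \<open>Terminal in the 2-categorical sense: hom-categories into \<open>t\<close> have one object and one arrow.\<close>

definition terminal_object :: "('o, 'a, 'c) two_cat \<Rightarrow> 'o \<Rightarrow> bool" where
  "terminal_object K t \<longleftrightarrow>
     t \<in> obj (cat1 K) \<and>
     (\<forall>x\<in>obj (cat1 K). \<exists>!f. f \<in> arr (cat1 K) \<and> src (cat1 K) f = x \<and> tgt (cat1 K) f = t) \<and>
     (\<forall>x\<in>obj (cat1 K). \<exists>!a. a \<in> arr (cat2 K) \<and> src (hcat K) a = x \<and> tgt (hcat K) a = t)"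

definition to_terminal :: "('o, 'a, 'c) two_cat \<Rightarrow> 'o \<Rightarrow> 'o \<Rightarrow> 'a" where
  "to_terminal K t x = (THE f. f \<in> arr (cat1 K) \<and> src (cat1 K) f = x \<and> tgt (cat1 K) f = t)"

definition lift_to_slice ::
  "('o, 'a, 'c) two_cat \<Rightarrow> 'o \<Rightarrow> ('o, 'a, 'c, 'p, 'b, 'd) two_fun \<Rightarrow>
   ('o, 'a, 'c, 'b, ('b, 'b) arrow, (('b, 'b) arrow, 'd) arrow) two_fun" where
  "lift_to_slice K t R =
     (let R0 = (\<lambda>x. on1 R (to_terminal K t x));
          R1 = (\<lambda>f. Arrow (R0 (src (cat1 K) f)) (on1 R f) (R0 (tgt (cat1 K) f)))
      in \<lparr>on0 = R0, on1 = R1,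
          on2 = (\<lambda>a. Arrow (R1 (src (cat2 K) a)) (on2 R a) (R1 (tgt (cat2 K) a)))\<rparr>)"

definition parametric_right_2adjoint ::
  "('o, 'a, 'c) two_cat \<Rightarrow> ('p, 'b, 'd) two_cat \<Rightarrow> ('o, 'a, 'c, 'p, 'b, 'd) two_fun \<Rightarrow> bool" where
  "parametric_right_2adjoint K L R \<longleftrightarrow>
     two_functor K L R \<and>
     (\<exists>t. terminal_object K t \<and>
          has_left_2adjoint K (slice L (on0 R t)) (lift_to_slice K t R))"


section \<open>The 2-category of large 2-categories\<close>

type_synonym 'v ltwo_cat = "('v, 'v, 'v) two_cat"
type_synonym 'v ltwo_fun = "('v, 'v, 'v, 'v, 'v, 'v) two_fun"

definition large_two_category :: "('v \<Rightarrow> 'v set) \<Rightarrow> 'v \<Rightarrow> 'v ltwo_cat \<Rightarrow> bool" where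
  "large_two_category elts U2 K \<longleftrightarrow>
     two_category K \<and>
     cat_of_size elts U2 (cat1 K) \<and> cat_of_size elts U2 (cat2 K) \<and>
     ext_cat (cat1 K) \<and> ext_cat (cat2 K) \<and>
     (\<forall>b a. \<not> composable (hcat K) b a \<longrightarrow> hcmp K b a = undefined)"

definition ext_two_fun :: "'v ltwo_cat \<Rightarrow> 'v ltwo_fun \<Rightarrow> bool" where
  "ext_two_fun K F \<longleftrightarrow>
     on0 F \<in> extensional (obj (cat1 K)) \<and> on1 F \<in> extensional (arr (cat1 K)) \<and>
     on2 F \<in> extensional (arr (cat2 K))"

definition restrict_two_fun :: "'v ltwo_cat \<Rightarrow> 'v ltwo_fun \<Rightarrow> 'v ltwo_fun" where
  "restrict_two_fun K F =
     \<lparr>on0 = restrict (on0 F) (obj (cat1 K)), on1 = restrict (on1 F) (arr (cat1 K)),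
      on2 = restrict (on2 F) (arr (cat2 K))\<rparr>"

definition TwoCAT1 ::
  "('v \<Rightarrow> 'v set) \<Rightarrow> 'v \<Rightarrow> ('v ltwo_cat, ('v ltwo_cat, 'v ltwo_fun) arrow) cat" where
  "TwoCAT1 elts U2 =
     \<lparr>obj = {K. large_two_category elts U2 K},
      arr = {Arrow K F L | K F L.
               large_two_category elts U2 K \<and> large_two_category elts U2 L \<and>
               two_functor K L F \<and> ext_two_fun K F},
      src = asrc,
      tgt = atgt,
      ide = (\<lambda>K. Arrow K (restrict_two_fun K id_two_fun) K),
      cmp = (\<lambda>G F. Arrow (asrc F)
               (restrict_two_fun (asrc F) (comp_two_fun (amap G) (amap F))) (atgt G))\<rparr>"

definition TwoCAT ::
  "('v \<Rightarrow> 'v set) \<Rightarrow> 'v \<Rightarrow>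
   ('v ltwo_cat, ('v ltwo_cat, 'v ltwo_fun) arrow,
    (('v ltwo_cat, 'v ltwo_fun) arrow, 'v \<Rightarrow> 'v) arrow) two_cat" where
  "TwoCAT elts U2 =
     \<lparr>cat1 = TwoCAT1 elts U2,
      cat2 =
        \<lparr>obj = arr (TwoCAT1 elts U2),
         arr = {Arrow F t G | F t G.
                  F \<in> arr (TwoCAT1 elts U2) \<and> G \<in> arr (TwoCAT1 elts U2) \<and>
                  asrc F = asrc G \<and> atgt F = atgt G \<and>
                  two_natural (asrc F) (atgt F) (amap F) (amap G) t \<and>
                  t \<in> extensional (obj (cat1 (asrc F)))},
         src = asrc,
         tgt = atgt,
         ide = (\<lambda>F. Arrow F
                 (\<lambda>x\<in>obj (cat1 (asrc F)). ide (cat1 (atgt F)) (on0 (amap F) x)) F),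
         cmp = (\<lambda>s t. Arrow (asrc t)
                 (\<lambda>x\<in>obj (cat1 (asrc (asrc t))).
                    cmp (cat1 (atgt (asrc t))) (amap s x) (amap t x)) (atgt s))\<rparr>,
      hcmp = (\<lambda>s t. Arrow
               (cmp (TwoCAT1 elts U2) (asrc s) (asrc t))
               (\<lambda>x\<in>obj (cat1 (asrc (asrc t))).
                  cmp (cat1 (atgt (asrc s)))
                    (amap s (on0 (amap (atgt t)) x)) (on1 (amap (asrc s)) (amap t x)))
               (cmp (TwoCAT1 elts U2) (atgt s) (atgt t)))\<rparr>"


section \<open>Pseudo double categories\<close>

text \<open>
  \<open>vcat\<close>: objects and vertical morphisms. \<open>ccat\<close>: horizontal morphisms and cells, a cell
  running from its top to its bottom boundary. \<open>cleft\<close>, \<open>cright\<close>: vertical boundaries of cells.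
  Horizontal composition \<open>hcomp\<close>, \<open>chcomp\<close> is written in diagrammatic order.
\<close>

record 'v psdbl =
  vcat :: "('v, 'v) cat"
  ccat :: "('v, 'v) cat"
  hsrc :: "'v \<Rightarrow> 'v"
  htgt :: "'v \<Rightarrow> 'v"
  cleft :: "'v \<Rightarrow> 'v"
  cright :: "'v \<Rightarrow> 'v"
  hid :: "'v \<Rightarrow> 'v"
  chid :: "'v \<Rightarrow> 'v"
  hcomp :: "'v \<Rightarrow> 'v \<Rightarrow> 'v"
  chcomp :: "'v \<Rightarrow> 'v \<Rightarrow> 'v"
  hassoc :: "'v \<Rightarrow> 'v \<Rightarrow> 'v \<Rightarrow> 'v"
  hlunit :: "'v \<Rightarrow> 'v"
  hrunit :: "'v \<Rightarrow> 'v"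

definition hcomposable :: "'v psdbl \<Rightarrow> 'v \<Rightarrow> 'v \<Rightarrow> bool" where
  "hcomposable D g d \<longleftrightarrow> g \<in> obj (ccat D) \<and> d \<in> obj (ccat D) \<and> htgt D g = hsrc D d"

definition chcomposable :: "'v psdbl \<Rightarrow> 'v \<Rightarrow> 'v \<Rightarrow> bool" where
  "chcomposable D x y \<longleftrightarrow> x \<in> arr (ccat D) \<and> y \<in> arr (ccat D) \<and> cright D x = cleft D y"

text \<open>\<open>x\<close> is a cell from \<open>g\<close> to \<open>d\<close> over \<open>(u, u')\<close>.\<close>

definition cell_over :: "'v psdbl \<Rightarrow> 'v \<Rightarrow> 'v \<Rightarrow> 'v \<Rightarrow> 'v \<Rightarrow> 'v \<Rightarrow> bool" where
  "cell_over D x g d u u' \<longleftrightarrow>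
     x \<in> arr (ccat D) \<and> src (ccat D) x = g \<and> tgt (ccat D) x = d \<and> cleft D x = u \<and> cright D x = u'"

definition globular_cell :: "'v psdbl \<Rightarrow> 'v \<Rightarrow> 'v \<Rightarrow> 'v \<Rightarrow> bool" where
  "globular_cell D x g d \<longleftrightarrow>
     cell_over D x g d (ide (vcat D) (hsrc D g)) (ide (vcat D) (htgt D g))"

definition globular_iso :: "'v psdbl \<Rightarrow> 'v \<Rightarrow> 'v \<Rightarrow> 'v \<Rightarrow> bool" where
  "globular_iso D x g d \<longleftrightarrow> globular_cell D x g d \<and> (\<exists>y. inverses (ccat D) x y)"

definition pseudo_double_category :: "'v psdbl \<Rightarrow> bool" where
  "pseudo_double_category D \<longleftrightarrow>
     category (vcat D) \<and> category (ccat D) \<and>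
     cat_functor (ccat D) (vcat D) (hsrc D) (cleft D) \<and>
     cat_functor (ccat D) (vcat D) (htgt D) (cright D) \<and>
     cat_functor (vcat D) (ccat D) (hid D) (chid D) \<and>
     (\<forall>x\<in>obj (vcat D). hsrc D (hid D x) = x \<and> htgt D (hid D x) = x) \<and>
     (\<forall>u\<in>arr (vcat D). cleft D (chid D u) = u \<and> cright D (chid D u) = u) \<and>
     (\<forall>g d. hcomposable D g d \<longrightarrow>
        hcomp D g d \<in> obj (ccat D) \<and>
        hsrc D (hcomp D g d) = hsrc D g \<and> htgt D (hcomp D g d) = htgt D d) \<and>
     (\<forall>x y. chcomposable D x y \<longrightarrow>
        cell_over D (chcomp D x y)
          (hcomp D (src (ccat D) x) (src (ccat D) y)) (hcomp D (tgt (ccat D) x) (tgt (ccat D) y))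
          (cleft D x) (cright D y)) \<and>
     (\<forall>g d. hcomposable D g d \<longrightarrow>
        chcomp D (ide (ccat D) g) (ide (ccat D) d) = ide (ccat D) (hcomp D g d)) \<and>
     (\<forall>x' x y' y. composable (ccat D) x' x \<and> composable (ccat D) y' y \<and>
        chcomposable D x y \<and> chcomposable D x' y' \<longrightarrow>
        chcomp D (cmp (ccat D) x' x) (cmp (ccat D) y' y) =
        cmp (ccat D) (chcomp D x' y') (chcomp D x y)) \<and>
     (\<forall>g d e. hcomposable D g d \<and> hcomposable D d e \<longrightarrow>
        globular_iso D (hassoc D g d e) (hcomp D (hcomp D g d) e) (hcomp D g (hcomp D d e))) \<and>
     (\<forall>g\<in>obj (ccat D).
        globular_iso D (hlunit D g) (hcomp D (hid D (hsrc D g)) g) g \<and>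
        globular_iso D (hrunit D g) (hcomp D g (hid D (htgt D g))) g) \<and>
     (\<forall>x y z. chcomposable D x y \<and> chcomposable D y z \<longrightarrow>
        cmp (ccat D) (hassoc D (tgt (ccat D) x) (tgt (ccat D) y) (tgt (ccat D) z))
          (chcomp D (chcomp D x y) z) =
        cmp (ccat D) (chcomp D x (chcomp D y z))
          (hassoc D (src (ccat D) x) (src (ccat D) y) (src (ccat D) z))) \<and>
     (\<forall>x\<in>arr (ccat D).
        cmp (ccat D) (hlunit D (tgt (ccat D) x)) (chcomp D (chid D (cleft D x)) x) =
        cmp (ccat D) x (hlunit D (src (ccat D) x)) \<and>
        cmp (ccat D) (hrunit D (tgt (ccat D) x)) (chcomp D x (chid D (cright D x))) =
        cmp (ccat D) x (hrunit D (src (ccat D) x))) \<and>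
     (\<forall>g d e k. hcomposable D g d \<and> hcomposable D d e \<and> hcomposable D e k \<longrightarrow>
        cmp (ccat D) (chcomp D (ide (ccat D) g) (hassoc D d e k))
          (cmp (ccat D) (hassoc D g (hcomp D d e) k)
            (chcomp D (hassoc D g d e) (ide (ccat D) k))) =
        cmp (ccat D) (hassoc D g d (hcomp D e k)) (hassoc D (hcomp D g d) e k)) \<and>
     (\<forall>g d. hcomposable D g d \<longrightarrow>
        cmp (ccat D) (chcomp D (ide (ccat D) g) (hlunit D d)) (hassoc D g (hid D (htgt D g)) d) =
        chcomp D (hrunit D g) (ide (ccat D) d))"

definition large_pseudo_double_category :: "('v \<Rightarrow> 'v set) \<Rightarrow> 'v \<Rightarrow> 'v psdbl \<Rightarrow> bool" where
  "large_pseudo_double_category elts U2 D \<longleftrightarrow>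
     pseudo_double_category D \<and>
     cat_of_size elts U2 (vcat D) \<and> cat_of_size elts U2 (ccat D) \<and>
     ext_cat (vcat D) \<and> ext_cat (ccat D) \<and>
     hsrc D \<in> extensional (obj (ccat D)) \<and> htgt D \<in> extensional (obj (ccat D)) \<and>
     cleft D \<in> extensional (arr (ccat D)) \<and> cright D \<in> extensional (arr (ccat D)) \<and>
     hid D \<in> extensional (obj (vcat D)) \<and> chid D \<in> extensional (arr (vcat D)) \<and>
     (\<forall>g d. \<not> hcomposable D g d \<longrightarrow> hcomp D g d = undefined) \<and>
     (\<forall>x y. \<not> chcomposable D x y \<longrightarrow> chcomp D x y = undefined) \<and>
     (\<forall>g d e. \<not> (hcomposable D g d \<and> hcomposable D d e) \<longrightarrow> hassoc D g d e = undefined) \<and>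
     hlunit D \<in> extensional (obj (ccat D)) \<and> hrunit D \<in> extensional (obj (ccat D))"

record 'v lax_fun =
  lob :: "'v \<Rightarrow> 'v"
  lver :: "'v \<Rightarrow> 'v"
  lhor :: "'v \<Rightarrow> 'v"
  lcell :: "'v \<Rightarrow> 'v"
  lax_unit :: "'v \<Rightarrow> 'v"
  lax_comp :: "'v \<Rightarrow> 'v \<Rightarrow> 'v"

definition lax_double_functor :: "'v psdbl \<Rightarrow> 'v psdbl \<Rightarrow> 'v lax_fun \<Rightarrow> bool" where
  "lax_double_functor D E F \<longleftrightarrow>
     cat_functor (vcat D) (vcat E) (lob F) (lver F) \<and>
     cat_functor (ccat D) (ccat E) (lhor F) (lcell F) \<and>
     (\<forall>g\<in>obj (ccat D).
        hsrc E (lhor F g) = lob F (hsrc D g) \<and> htgt E (lhor F g) = lob F (htgt D g)) \<and>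
     (\<forall>x\<in>arr (ccat D).
        cleft E (lcell F x) = lver F (cleft D x) \<and> cright E (lcell F x) = lver F (cright D x)) \<and>
     (\<forall>a\<in>obj (vcat D). globular_cell E (lax_unit F a) (hid E (lob F a)) (lhor F (hid D a))) \<and>
     (\<forall>g d. hcomposable D g d \<longrightarrow>
        globular_cell E (lax_comp F g d) (hcomp E (lhor F g) (lhor F d)) (lhor F (hcomp D g d))) \<and>
     (\<forall>u\<in>arr (vcat D).
        cmp (ccat E) (lcell F (chid D u)) (lax_unit F (src (vcat D) u)) =
        cmp (ccat E) (lax_unit F (tgt (vcat D) u)) (chid E (lver F u))) \<and>
     (\<forall>x y. chcomposable D x y \<longrightarrow>
        cmp (ccat E) (lcell F (chcomp D x y)) (lax_comp F (src (ccat D) x) (src (ccat D) y)) =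
        cmp (ccat E) (lax_comp F (tgt (ccat D) x) (tgt (ccat D) y))
          (chcomp E (lcell F x) (lcell F y))) \<and>
     (\<forall>g d e. hcomposable D g d \<and> hcomposable D d e \<longrightarrow>
        cmp (ccat E) (lcell F (hassoc D g d e))
          (cmp (ccat E) (lax_comp F (hcomp D g d) e)
            (chcomp E (lax_comp F g d) (ide (ccat E) (lhor F e)))) =
        cmp (ccat E) (lax_comp F g (hcomp D d e))
          (cmp (ccat E) (chcomp E (ide (ccat E) (lhor F g)) (lax_comp F d e))
            (hassoc E (lhor F g) (lhor F d) (lhor F e)))) \<and>
     (\<forall>g\<in>obj (ccat D).
        cmp (ccat E) (lcell F (hlunit D g))
          (cmp (ccat E) (lax_comp F (hid D (hsrc D g)) g)
            (chcomp E (lax_unit F (hsrc D g)) (ide (ccat E) (lhor F g)))) =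
        hlunit E (lhor F g) \<and>
        cmp (ccat E) (lcell F (hrunit D g))
          (cmp (ccat E) (lax_comp F g (hid D (htgt D g)))
            (chcomp E (ide (ccat E) (lhor F g)) (lax_unit F (htgt D g)))) =
        hrunit E (lhor F g))"

definition ext_lax_fun :: "'v psdbl \<Rightarrow> 'v lax_fun \<Rightarrow> bool" where
  "ext_lax_fun D F \<longleftrightarrow>
     lob F \<in> extensional (obj (vcat D)) \<and> lver F \<in> extensional (arr (vcat D)) \<and>
     lhor F \<in> extensional (obj (ccat D)) \<and> lcell F \<in> extensional (arr (ccat D)) \<and>
     lax_unit F \<in> extensional (obj (vcat D)) \<and>
     (\<forall>g d. \<not> hcomposable D g d \<longrightarrow> lax_comp F g d = undefined)"

definition id_lax_fun :: "'v psdbl \<Rightarrow> 'v lax_fun" where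
  "id_lax_fun D =
     \<lparr>lob = (\<lambda>a\<in>obj (vcat D). a), lver = (\<lambda>u\<in>arr (vcat D). u),
      lhor = (\<lambda>g\<in>obj (ccat D). g), lcell = (\<lambda>x\<in>arr (ccat D). x),
      lax_unit = (\<lambda>a\<in>obj (vcat D). ide (ccat D) (hid D a)),
      lax_comp = (\<lambda>g d. if hcomposable D g d then ide (ccat D) (hcomp D g d) else undefined)\<rparr>"

text \<open>\<open>comp_lax_fun D E' G F\<close> is \<open>G\<close> after \<open>F\<close>, where \<open>D\<close> is the domain of \<open>F\<close> and
  \<open>E'\<close> the codomain of \<open>G\<close>.\<close>

definition comp_lax_fun :: "'v psdbl \<Rightarrow> 'v psdbl \<Rightarrow> 'v lax_fun \<Rightarrow> 'v lax_fun \<Rightarrow> 'v lax_fun" where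
  "comp_lax_fun D E' G F =
     \<lparr>lob = (\<lambda>a\<in>obj (vcat D). lob G (lob F a)), lver = (\<lambda>u\<in>arr (vcat D). lver G (lver F u)),
      lhor = (\<lambda>g\<in>obj (ccat D). lhor G (lhor F g)), lcell = (\<lambda>x\<in>arr (ccat D). lcell G (lcell F x)),
      lax_unit = (\<lambda>a\<in>obj (vcat D).
        cmp (ccat E') (lcell G (lax_unit F a)) (lax_unit G (lob F a))),
      lax_comp = (\<lambda>g d. if hcomposable D g d
        then cmp (ccat E') (lcell G (lax_comp F g d)) (lax_comp G (lhor F g) (lhor F d))
        else undefined)\<rparr>"

record 'v vert_trans =
  tob :: "'v \<Rightarrow> 'v"
  thor :: "'v \<Rightarrow> 'v"

definition vertical_transformation ::
  "'v psdbl \<Rightarrow> 'v psdbl \<Rightarrow> 'v lax_fun \<Rightarrow> 'v lax_fun \<Rightarrow> 'v vert_trans \<Rightarrow> bool" where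
  "vertical_transformation D E F G t \<longleftrightarrow>
     (\<forall>a\<in>obj (vcat D). tob t a \<in> arr (vcat E) \<and>
        src (vcat E) (tob t a) = lob F a \<and> tgt (vcat E) (tob t a) = lob G a) \<and>
     (\<forall>u\<in>arr (vcat D).
        cmp (vcat E) (lver G u) (tob t (src (vcat D) u)) =
        cmp (vcat E) (tob t (tgt (vcat D) u)) (lver F u)) \<and>
     (\<forall>g\<in>obj (ccat D).
        cell_over E (thor t g) (lhor F g) (lhor G g) (tob t (hsrc D g)) (tob t (htgt D g))) \<and>
     (\<forall>x\<in>arr (ccat D).
        cmp (ccat E) (lcell G x) (thor t (src (ccat D) x)) =
        cmp (ccat E) (thor t (tgt (ccat D) x)) (lcell F x)) \<and>
     (\<forall>a\<in>obj (vcat D).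
        cmp (ccat E) (thor t (hid D a)) (lax_unit F a) =
        cmp (ccat E) (lax_unit G a) (chid E (tob t a))) \<and>
     (\<forall>g d. hcomposable D g d \<longrightarrow>
        cmp (ccat E) (thor t (hcomp D g d)) (lax_comp F g d) =
        cmp (ccat E) (lax_comp G g d) (chcomp E (thor t g) (thor t d)))"

definition ext_vert_trans :: "'v psdbl \<Rightarrow> 'v vert_trans \<Rightarrow> bool" where
  "ext_vert_trans D t \<longleftrightarrow>
     tob t \<in> extensional (obj (vcat D)) \<and> thor t \<in> extensional (obj (ccat D))"

definition PsDBL1 ::
  "('v \<Rightarrow> 'v set) \<Rightarrow> 'v \<Rightarrow> ('v psdbl, ('v psdbl, 'v lax_fun) arrow) cat" where
  "PsDBL1 elts U2 =
     \<lparr>obj = {D. large_pseudo_double_category elts U2 D},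
      arr = {Arrow D F E | D F E.
               large_pseudo_double_category elts U2 D \<and> large_pseudo_double_category elts U2 E \<and>
               lax_double_functor D E F \<and> ext_lax_fun D F},
      src = asrc,
      tgt = atgt,
      ide = (\<lambda>D. Arrow D (id_lax_fun D) D),
      cmp = (\<lambda>G F. Arrow (asrc F) (comp_lax_fun (asrc F) (atgt G) (amap G) (amap F)) (atgt G))\<rparr>"

definition PsDBL ::
  "('v \<Rightarrow> 'v set) \<Rightarrow> 'v \<Rightarrow>
   ('v psdbl, ('v psdbl, 'v lax_fun) arrow,
    (('v psdbl, 'v lax_fun) arrow, 'v vert_trans) arrow) two_cat" where
  "PsDBL elts U2 =
     \<lparr>cat1 = PsDBL1 elts U2,
      cat2 =
        \<lparr>obj = arr (PsDBL1 elts U2),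
         arr = {Arrow F t G | F t G.
                  F \<in> arr (PsDBL1 elts U2) \<and> G \<in> arr (PsDBL1 elts U2) \<and>
                  asrc F = asrc G \<and> atgt F = atgt G \<and>
                  vertical_transformation (asrc F) (atgt F) (amap F) (amap G) t \<and>
                  ext_vert_trans (asrc F) t},
         src = asrc,
         tgt = atgt,
         ide = (\<lambda>F. Arrow F
                 \<lparr>tob = (\<lambda>a\<in>obj (vcat (asrc F)). ide (vcat (atgt F)) (lob (amap F) a)),
                  thor = (\<lambda>g\<in>obj (ccat (asrc F)). ide (ccat (atgt F)) (lhor (amap F) g))\<rparr> F),
         cmp = (\<lambda>s t. Arrow (asrc t)
                 \<lparr>tob = (\<lambda>a\<in>obj (vcat (asrc (asrc t))).
                    cmp (vcat (atgt (asrc t))) (tob (amap s) a) (tob (amap t) a)),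
                  thor = (\<lambda>g\<in>obj (ccat (asrc (asrc t))).
                    cmp (ccat (atgt (asrc t))) (thor (amap s) g) (thor (amap t) g))\<rparr> (atgt s))\<rparr>,
      hcmp = (\<lambda>s t. Arrow
               (cmp (PsDBL1 elts U2) (asrc s) (asrc t))
               \<lparr>tob = (\<lambda>a\<in>obj (vcat (asrc (asrc t))).
                  cmp (vcat (atgt (asrc s)))
                    (tob (amap s) (lob (amap (atgt t)) a)) (lver (amap (asrc s)) (tob (amap t) a))),
                thor = (\<lambda>g\<in>obj (ccat (asrc (asrc t))).
                  cmp (ccat (atgt (asrc s)))
                    (thor (amap s) (lhor (amap (atgt t)) g))
                    (lcell (amap (asrc s)) (thor (amap t) g)))\<rparr>
               (cmp (PsDBL1 elts U2) (atgt s) (atgt t)))\<rparr>"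


section \<open>Virtual double categories\<close>

text \<open>
  A multicell \<open>MCell gs u u' d x\<close> consists of its frame (top \<open>gs\<close>, left and right vertical
  boundaries \<open>u\<close>, \<open>u'\<close>, bottom \<open>d\<close>) and an element \<open>x\<close> of the set of multicells with
  that frame. If \<open>gs\<close> is empty, its top object is the source of \<open>u\<close> and of \<open>u'\<close>.
\<close>

datatype 'v mcell =
  MCell (mtop: "'v list") (mleft: 'v) (mright: 'v) (mbot: 'v) (mname: 'v)

text \<open>
  \<open>mcomp A k u ts\<close> is the composite of \<open>k\<close> with \<open>ts\<close>, where \<open>u\<close> is the left boundary of
  the path \<open>ts\<close>: for empty \<open>ts\<close> it is the vertical morphism with which the nullary \<open>k\<close> is
  composed, otherwise it is the left boundary of the first multicell in \<open>ts\<close>.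
  Only the data of virtual double categories and their morphisms are recorded: the
  construction of \<open>Enr\<close> uses the data alone, and it is applied only to those arising from
  pseudo double categories, where the axioms are consequences.
\<close>

record 'v vdbl =
  vvert :: "('v, 'v) cat"
  vhor :: "'v set"
  vhsrc :: "'v \<Rightarrow> 'v"
  vhtgt :: "'v \<Rightarrow> 'v"
  mcells :: "'v mcell set"
  mid :: "'v \<Rightarrow> 'v mcell"
  mcomp :: "'v mcell \<Rightarrow> 'v \<Rightarrow> 'v mcell list \<Rightarrow> 'v mcell"

abbreviation mcomp1 :: "'v vdbl \<Rightarrow> 'v mcell \<Rightarrow> 'v mcell list \<Rightarrow> 'v mcell" where
  "mcomp1 A k ts \<equiv> mcomp A k (mleft (hd ts)) ts"

record 'v vdbl_fun =
  vfob :: "'v \<Rightarrow> 'v"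
  vfver :: "'v \<Rightarrow> 'v"
  vfhor :: "'v \<Rightarrow> 'v"
  vfcell :: "'v mcell \<Rightarrow> 'v mcell"

record 'v vdbl_trans =
  vtob :: "'v \<Rightarrow> 'v"
  vthor :: "'v \<Rightarrow> 'v mcell"


section \<open>Pseudo double categories as virtual double categories\<close>

fun hpath :: "'v psdbl \<Rightarrow> 'v \<Rightarrow> 'v list \<Rightarrow> 'v \<Rightarrow> bool" where
  "hpath D a [] b \<longleftrightarrow> a \<in> obj (vcat D) \<and> a = b"
| "hpath D a (g # gs) b \<longleftrightarrow> g \<in> obj (ccat D) \<and> hsrc D g = a \<and> hpath D (htgt D g) gs b"

definition path_end :: "'v psdbl \<Rightarrow> 'v \<Rightarrow> 'v list \<Rightarrow> 'v" where
  "path_end D a gs = (if gs = [] then a else htgt D (last gs))"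

text \<open>The composite of a path of horizontal morphisms starting at \<open>a\<close>, bracketed to the right,
  and similarly for cells.\<close>

fun hcomps :: "'v psdbl \<Rightarrow> 'v \<Rightarrow> 'v list \<Rightarrow> 'v" where
  "hcomps D a [] = hid D a"
| "hcomps D a [g] = g"
| "hcomps D a (g # g' # gs) = hcomp D g (hcomps D (htgt D g) (g' # gs))"

fun chcomps :: "'v psdbl \<Rightarrow> 'v \<Rightarrow> 'v list \<Rightarrow> 'v" where
  "chcomps D u [] = chid D u"
| "chcomps D u [x] = x"
| "chcomps D u (x # x' # xs) = chcomp D x (chcomps D (cright D x) (x' # xs))"

text \<open>The coherence isomorphism from the composite of \<open>hcomps D a gs\<close> and \<open>hcomps D b ds\<close>
  to \<open>hcomps D a (gs @ ds)\<close>, where \<open>b\<close> is the end of \<open>gs\<close>.\<close>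

fun hjoin :: "'v psdbl \<Rightarrow> 'v \<Rightarrow> 'v list \<Rightarrow> 'v list \<Rightarrow> 'v" where
  "hjoin D a [] ds = hlunit D (hcomps D a ds)"
| "hjoin D a [g] ds =
     (if ds = [] then hrunit D g else ide (ccat D) (hcomp D g (hcomps D (htgt D g) ds)))"
| "hjoin D a (g # g' # gs) ds =
     cmp (ccat D) (chcomp D (ide (ccat D) g) (hjoin D (htgt D g) (g' # gs) ds))
       (hassoc D g (hcomps D (htgt D g) (g' # gs))
         (hcomps D (path_end D (htgt D g) (g' # gs)) ds))"

text \<open>The coherence isomorphism from the composite of the composites of consecutive paths
  \<open>gss\<close> to the composite of \<open>concat gss\<close>.\<close>

fun hflatten :: "'v psdbl \<Rightarrow> 'v \<Rightarrow> 'v list list \<Rightarrow> 'v" where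
  "hflatten D a [] = ide (ccat D) (hid D a)"
| "hflatten D a [gs] = ide (ccat D) (hcomps D a gs)"
| "hflatten D a (gs # gs' # gss) =
     cmp (ccat D) (hjoin D a gs (concat (gs' # gss)))
       (chcomp D (ide (ccat D) (hcomps D a gs)) (hflatten D (path_end D a gs) (gs' # gss)))"

definition vdbl_of :: "'v psdbl \<Rightarrow> 'v vdbl" where
  "vdbl_of D =
     \<lparr>vvert = vcat D,
      vhor = obj (ccat D),
      vhsrc = hsrc D,
      vhtgt = htgt D,
      mcells = {MCell gs u u' d x | gs u u' d x.
                  u \<in> arr (vcat D) \<and> u' \<in> arr (vcat D) \<and>
                  hpath D (src (vcat D) u) gs (src (vcat D) u') \<and>
                  cell_over D x (hcomps D (src (vcat D) u) gs) d u u'},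
      mid = (\<lambda>g. MCell [g] (ide (vcat D) (hsrc D g)) (ide (vcat D) (htgt D g)) g (ide (ccat D) g)),
      mcomp = (\<lambda>k u ts. MCell
                 (concat (map mtop ts))
                 (cmp (vcat D) (mleft k) u)
                 (cmp (vcat D) (mright k) (if ts = [] then u else mright (last ts)))
                 (mbot k)
                 (cmp (ccat D) (mname k)
                   (cmp (ccat D) (chcomps D u (map mname ts))
                     (inverse_of (ccat D) (hflatten D (src (vcat D) u) (map mtop ts))))))\<rparr>"

text \<open>The comparison cell of \<open>F\<close> from the composite of \<open>map (lhor F) gs\<close> to the image
  of the composite of \<open>gs\<close>.\<close>

fun lax_comps :: "'v psdbl \<Rightarrow> 'v psdbl \<Rightarrow> 'v lax_fun \<Rightarrow> 'v \<Rightarrow> 'v list \<Rightarrow> 'v" where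
  "lax_comps D E F a [] = lax_unit F a"
| "lax_comps D E F a [g] = ide (ccat E) (lhor F g)"
| "lax_comps D E F a (g # g' # gs) =
     cmp (ccat E) (lax_comp F g (hcomps D (htgt D g) (g' # gs)))
       (chcomp E (ide (ccat E) (lhor F g)) (lax_comps D E F (htgt D g) (g' # gs)))"

definition vdbl_fun_of :: "'v psdbl \<Rightarrow> 'v psdbl \<Rightarrow> 'v lax_fun \<Rightarrow> 'v vdbl_fun" where
  "vdbl_fun_of D E F =
     \<lparr>vfob = lob F,
      vfver = lver F,
      vfhor = lhor F,
      vfcell = (\<lambda>k. MCell (map (lhor F) (mtop k)) (lver F (mleft k)) (lver F (mright k))
                     (lhor F (mbot k))
                     (cmp (ccat E) (lcell F (mname k))
                       (lax_comps D E F (src (vcat D) (mleft k)) (mtop k))))\<rparr>"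

definition vdbl_trans_of ::
  "'v psdbl \<Rightarrow> 'v lax_fun \<Rightarrow> 'v lax_fun \<Rightarrow> 'v vert_trans \<Rightarrow> 'v vdbl_trans" where
  "vdbl_trans_of D F G t =
     \<lparr>vtob = tob t,
      vthor = (\<lambda>g. MCell [lhor F g] (tob t (hsrc D g)) (tob t (htgt D g)) (lhor G g) (thor t g))\<rparr>"

type_synonym 'v vdbl_arrow = "('v vdbl, 'v vdbl_fun) arrow"
type_synonym 'v vdbl_two_cell = "('v vdbl_arrow, 'v vdbl_trans) arrow"

definition PsDBL_to_VDBL ::
  "('v psdbl, ('v psdbl, 'v lax_fun) arrow, (('v psdbl, 'v lax_fun) arrow, 'v vert_trans) arrow,
    'v vdbl, 'v vdbl_arrow, 'v vdbl_two_cell) two_fun" where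
  "PsDBL_to_VDBL =
     (let V = (\<lambda>F. Arrow (vdbl_of (asrc F)) (vdbl_fun_of (asrc F) (atgt F) (amap F))
                         (vdbl_of (atgt F)))
      in \<lparr>on0 = vdbl_of, on1 = V,
          on2 = (\<lambda>t. Arrow (V (asrc t))
                  (vdbl_trans_of (asrc (asrc t)) (amap (asrc t)) (amap (atgt t)) (amap t))
                  (V (atgt t)))\<rparr>)"


section \<open>Enrichment over a virtual double category\<close>

record 'v ecat =
  eob :: "'v set"
  eext :: "'v \<Rightarrow> 'v"
  ehom :: "'v \<Rightarrow> 'v \<Rightarrow> 'v"
  eunit :: "'v \<Rightarrow> 'v mcell"
  emult :: "'v \<Rightarrow> 'v \<Rightarrow> 'v \<Rightarrow> 'v mcell"

definition mcell_over ::
  "'v vdbl \<Rightarrow> 'v mcell \<Rightarrow> 'v list \<Rightarrow> 'v \<Rightarrow> 'v \<Rightarrow> 'v \<Rightarrow> bool" where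
  "mcell_over A k gs d u u' \<longleftrightarrow>
     k \<in> mcells A \<and> mtop k = gs \<and> mbot k = d \<and> mleft k = u \<and> mright k = u'"

abbreviation eid :: "'v vdbl \<Rightarrow> 'v ecat \<Rightarrow> 'v \<Rightarrow> 'v" where
  "eid A C c \<equiv> ide (vvert A) (eext C c)"

definition enriched_category :: "'v vdbl \<Rightarrow> 'v ecat \<Rightarrow> bool" where
  "enriched_category A C \<longleftrightarrow>
     (\<forall>c\<in>eob C. eext C c \<in> obj (vvert A)) \<and>
     (\<forall>c\<in>eob C. \<forall>c'\<in>eob C. ehom C c c' \<in> vhor A \<and>
        vhsrc A (ehom C c c') = eext C c \<and> vhtgt A (ehom C c c') = eext C c') \<and>
     (\<forall>c\<in>eob C. mcell_over A (eunit C c) [] (ehom C c c) (eid A C c) (eid A C c)) \<and>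
     (\<forall>c0\<in>eob C. \<forall>c1\<in>eob C. \<forall>c2\<in>eob C.
        mcell_over A (emult C c0 c1 c2) [ehom C c0 c1, ehom C c1 c2] (ehom C c0 c2)
          (eid A C c0) (eid A C c2)) \<and>
     (\<forall>c\<in>eob C. \<forall>c'\<in>eob C.
        mcomp1 A (emult C c c c') [eunit C c, mid A (ehom C c c')] = mid A (ehom C c c') \<and>
        mcomp1 A (emult C c c' c') [mid A (ehom C c c'), eunit C c'] = mid A (ehom C c c')) \<and>
     (\<forall>c0\<in>eob C. \<forall>c1\<in>eob C. \<forall>c2\<in>eob C. \<forall>c3\<in>eob C.
        mcomp1 A (emult C c0 c2 c3) [emult C c0 c1 c2, mid A (ehom C c2 c3)] =
        mcomp1 A (emult C c0 c1 c3) [mid A (ehom C c0 c1), emult C c1 c2 c3])"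

definition ext_ecat :: "'v ecat \<Rightarrow> bool" where
  "ext_ecat C \<longleftrightarrow>
     eext C = (\<lambda>c\<in>eob C. eext C c) \<and>
     ehom C = (\<lambda>c\<in>eob C. \<lambda>c'\<in>eob C. ehom C c c') \<and>
     eunit C = (\<lambda>c\<in>eob C. eunit C c) \<and>
     emult C = (\<lambda>c0\<in>eob C. \<lambda>c1\<in>eob C. \<lambda>c2\<in>eob C. emult C c0 c1 c2)"

record 'v efun =
  fob :: "'v \<Rightarrow> 'v"
  fver :: "'v \<Rightarrow> 'v"
  fcell :: "'v \<Rightarrow> 'v \<Rightarrow> 'v mcell"

definition enriched_functor :: "'v vdbl \<Rightarrow> 'v ecat \<Rightarrow> 'v ecat \<Rightarrow> 'v efun \<Rightarrow> bool" where
  "enriched_functor A C D f \<longleftrightarrow>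
     (\<forall>c\<in>eob C. fob f c \<in> eob D) \<and>
     (\<forall>c\<in>eob C. fver f c \<in> arr (vvert A) \<and>
        src (vvert A) (fver f c) = eext C c \<and> tgt (vvert A) (fver f c) = eext D (fob f c)) \<and>
     (\<forall>c\<in>eob C. \<forall>c'\<in>eob C.
        mcell_over A (fcell f c c') [ehom C c c'] (ehom D (fob f c) (fob f c'))
          (fver f c) (fver f c')) \<and>
     (\<forall>c\<in>eob C.
        mcomp1 A (fcell f c c) [eunit C c] = mcomp A (eunit D (fob f c)) (fver f c) []) \<and>
     (\<forall>c0\<in>eob C. \<forall>c1\<in>eob C. \<forall>c2\<in>eob C.
        mcomp1 A (fcell f c0 c2) [emult C c0 c1 c2] =
        mcomp1 A (emult D (fob f c0) (fob f c1) (fob f c2)) [fcell f c0 c1, fcell f c1 c2])"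

definition ext_efun :: "'v ecat \<Rightarrow> 'v efun \<Rightarrow> bool" where
  "ext_efun C f \<longleftrightarrow>
     fob f = (\<lambda>c\<in>eob C. fob f c) \<and> fver f = (\<lambda>c\<in>eob C. fver f c) \<and>
     fcell f = (\<lambda>c\<in>eob C. \<lambda>c'\<in>eob C. fcell f c c')"

definition enriched_natural ::
  "'v vdbl \<Rightarrow> 'v ecat \<Rightarrow> 'v ecat \<Rightarrow> 'v efun \<Rightarrow> 'v efun \<Rightarrow> ('v \<Rightarrow> 'v mcell) \<Rightarrow> bool" where
  "enriched_natural A C D f f' t \<longleftrightarrow>
     (\<forall>c\<in>eob C. mcell_over A (t c) [] (ehom D (fob f c) (fob f' c)) (fver f c) (fver f' c)) \<and>
     (\<forall>c\<in>eob C. \<forall>c'\<in>eob C.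
        mcomp1 A (emult D (fob f c) (fob f' c) (fob f' c')) [t c, fcell f' c c'] =
        mcomp1 A (emult D (fob f c) (fob f c') (fob f' c')) [fcell f c c', t c'])"

type_synonym 'v earrow = "('v ecat, 'v efun) arrow"
type_synonym 'v etwo_cell = "('v earrow, 'v \<Rightarrow> 'v mcell) arrow"

definition enr1 :: "('v \<Rightarrow> 'v set) \<Rightarrow> 'v \<Rightarrow> 'v vdbl \<Rightarrow> ('v ecat, 'v earrow) cat" where
  "enr1 elts U1 A =
     \<lparr>obj = {C. enriched_category A C \<and> ext_ecat C \<and> of_size elts U1 (eob C)},
      arr = {Arrow C f D | C f D.
               enriched_category A C \<and> ext_ecat C \<and> of_size elts U1 (eob C) \<and>
               enriched_category A D \<and> ext_ecat D \<and> of_size elts U1 (eob D) \<and>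
               enriched_functor A C D f \<and> ext_efun C f},
      src = asrc,
      tgt = atgt,
      ide = (\<lambda>C. Arrow C
              \<lparr>fob = (\<lambda>c\<in>eob C. c), fver = (\<lambda>c\<in>eob C. eid A C c),
               fcell = (\<lambda>c\<in>eob C. \<lambda>c'\<in>eob C. mid A (ehom C c c'))\<rparr> C),
      cmp = (\<lambda>g f. Arrow (asrc f)
              \<lparr>fob = (\<lambda>c\<in>eob (asrc f). fob (amap g) (fob (amap f) c)),
               fver = (\<lambda>c\<in>eob (asrc f).
                 cmp (vvert A) (fver (amap g) (fob (amap f) c)) (fver (amap f) c)),
               fcell = (\<lambda>c\<in>eob (asrc f). \<lambda>c'\<in>eob (asrc f).
                 mcomp1 A (fcell (amap g) (fob (amap f) c) (fob (amap f) c'))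
                   [fcell (amap f) c c'])\<rparr> (atgt g))\<rparr>"

definition enr2 :: "('v \<Rightarrow> 'v set) \<Rightarrow> 'v \<Rightarrow> 'v vdbl \<Rightarrow> ('v earrow, 'v etwo_cell) cat" where
  "enr2 elts U1 A =
     \<lparr>obj = arr (enr1 elts U1 A),
      arr = {Arrow f t f' | f t f'.
               f \<in> arr (enr1 elts U1 A) \<and> f' \<in> arr (enr1 elts U1 A) \<and>
               asrc f = asrc f' \<and> atgt f = atgt f' \<and>
               enriched_natural A (asrc f) (atgt f) (amap f) (amap f') t \<and>
               t \<in> extensional (eob (asrc f))},
      src = asrc,
      tgt = atgt,
      ide = (\<lambda>f. Arrow f
              (\<lambda>c\<in>eob (asrc f).
                 mcomp A (eunit (atgt f) (fob (amap f) c)) (fver (amap f) c) []) f),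
      cmp = (\<lambda>s t. Arrow (asrc t)
              (\<lambda>c\<in>eob (asrc (asrc t)).
                 mcomp1 A (emult (atgt (asrc t)) (fob (amap (asrc t)) c)
                            (fob (amap (atgt t)) c) (fob (amap (atgt s)) c))
                   [amap t c, amap s c]) (atgt s))\<rparr>"

text \<open>The whiskerings \<open>g t\<close> and \<open>s h\<close>.\<close>

definition enr_lwhisker ::
  "('v \<Rightarrow> 'v set) \<Rightarrow> 'v \<Rightarrow> 'v vdbl \<Rightarrow> 'v earrow \<Rightarrow> 'v etwo_cell \<Rightarrow> 'v etwo_cell" where
  "enr_lwhisker elts U1 A g t = Arrow
     (cmp (enr1 elts U1 A) g (asrc t))
     (\<lambda>c\<in>eob (asrc (asrc t)).
        mcomp1 A (fcell (amap g) (fob (amap (asrc t)) c) (fob (amap (atgt t)) c)) [amap t c])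
     (cmp (enr1 elts U1 A) g (atgt t))"

definition enr_rwhisker ::
  "('v \<Rightarrow> 'v set) \<Rightarrow> 'v \<Rightarrow> 'v vdbl \<Rightarrow> 'v etwo_cell \<Rightarrow> 'v earrow \<Rightarrow> 'v etwo_cell" where
  "enr_rwhisker elts U1 A s h = Arrow
     (cmp (enr1 elts U1 A) (asrc s) h)
     (\<lambda>b\<in>eob (asrc h). mcomp A (amap s (fob (amap h) b)) (fver (amap h) b) [])
     (cmp (enr1 elts U1 A) (atgt s) h)"

definition enr ::
  "('v \<Rightarrow> 'v set) \<Rightarrow> 'v \<Rightarrow> 'v vdbl \<Rightarrow> ('v ecat, 'v earrow, 'v etwo_cell) two_cat" where
  "enr elts U1 A =
     \<lparr>cat1 = enr1 elts U1 A,
      cat2 = enr2 elts U1 A,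
      hcmp = (\<lambda>s t. cmp (enr2 elts U1 A)
               (enr_rwhisker elts U1 A s (atgt t)) (enr_lwhisker elts U1 A (asrc s) t))\<rparr>"


section \<open>The 2-functor \<open>Enr\<close>\<close>

text \<open>
  The objects of \<open>TwoCAT\<close> have elements of \<open>'v\<close> as cells, so \<open>enr elts U1 A\<close> is transported
  along the usual set-theoretic coding of tuples and functions. The names suffice to code
  multicells whose frame is determined by the other components.
\<close>

context
  fixes elts :: "'v \<Rightarrow> 'v set"
begin

definition code0 :: "'v ecat \<Rightarrow> 'v" where
  "code0 C = vtuple elts
     [vset elts (eob C),
      vlam elts (eob C) (eext C),
      vlam elts (eob C) (\<lambda>c. vlam elts (eob C) (ehom C c)),
      vlam elts (eob C) (\<lambda>c. mname (eunit C c)),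
      vlam elts (eob C) (\<lambda>c0. vlam elts (eob C) (\<lambda>c1. vlam elts (eob C) (\<lambda>c2.
        mname (emult C c0 c1 c2))))]"

definition code1 :: "'v earrow \<Rightarrow> 'v" where
  "code1 f = vtuple elts
     [code0 (asrc f),
      code0 (atgt f),
      vlam elts (eob (asrc f)) (fob (amap f)),
      vlam elts (eob (asrc f)) (fver (amap f)),
      vlam elts (eob (asrc f)) (\<lambda>c. vlam elts (eob (asrc f)) (\<lambda>c'. mname (fcell (amap f) c c')))]"

definition code2 :: "'v etwo_cell \<Rightarrow> 'v" where
  "code2 t = vtuple elts
     [code1 (asrc t),
      code1 (atgt t),
      vlam elts (eob (asrc (asrc t))) (\<lambda>c. mname (amap t c))]"

end

text \<open>The function corresponding to \<open>f\<close>, defined on \<open>S\<close>, when the elements of \<open>S\<close> are coded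
  by \<open>d\<close> and values by \<open>e\<close>.\<close>

definition recode :: "('x \<Rightarrow> 'v) \<Rightarrow> 'x set \<Rightarrow> ('y \<Rightarrow> 'w) \<Rightarrow> ('x \<Rightarrow> 'y) \<Rightarrow> 'v \<Rightarrow> 'w" where
  "recode d S e f = (\<lambda>x\<in>d ` S. e (f (inv_into S d x)))"

definition coded_cat :: "('o \<Rightarrow> 'v) \<Rightarrow> ('a \<Rightarrow> 'v) \<Rightarrow> ('o, 'a) cat \<Rightarrow> ('v, 'v) cat" where
  "coded_cat d e C =
     \<lparr>obj = d ` obj C,
      arr = e ` arr C,
      src = recode e (arr C) d (src C),
      tgt = recode e (arr C) d (tgt C),
      ide = recode d (obj C) e (ide C),
      cmp = (\<lambda>y x. if x \<in> e ` arr C \<and> y \<in> e ` arr C \<and>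
                     composable C (inv_into (arr C) e y) (inv_into (arr C) e x)
                   then e (cmp C (inv_into (arr C) e y) (inv_into (arr C) e x))
                   else undefined)\<rparr>"

definition Enr0 :: "('v \<Rightarrow> 'v set) \<Rightarrow> 'v \<Rightarrow> 'v vdbl \<Rightarrow> 'v ltwo_cat" where
  "Enr0 elts U1 A =
     (let E = enr elts U1 A
      in \<lparr>cat1 = coded_cat (code0 elts) (code1 elts) (cat1 E),
          cat2 = coded_cat (code1 elts) (code2 elts) (cat2 E),
          hcmp = cmp (coded_cat (code0 elts) (code2 elts) (hcat E))\<rparr>)"

definition push_ecat :: "'v vdbl_fun \<Rightarrow> 'v ecat \<Rightarrow> 'v ecat" where
  "push_ecat F C =
     \<lparr>eob = eob C,
      eext = (\<lambda>c\<in>eob C. vfob F (eext C c)),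
      ehom = (\<lambda>c\<in>eob C. \<lambda>c'\<in>eob C. vfhor F (ehom C c c')),
      eunit = (\<lambda>c\<in>eob C. vfcell F (eunit C c)),
      emult = (\<lambda>c0\<in>eob C. \<lambda>c1\<in>eob C. \<lambda>c2\<in>eob C. vfcell F (emult C c0 c1 c2))\<rparr>"

definition push_efun :: "'v vdbl_fun \<Rightarrow> 'v earrow \<Rightarrow> 'v earrow" where
  "push_efun F f = Arrow (push_ecat F (asrc f))
     \<lparr>fob = fob (amap f),
      fver = (\<lambda>c\<in>eob (asrc f). vfver F (fver (amap f) c)),
      fcell = (\<lambda>c\<in>eob (asrc f). \<lambda>c'\<in>eob (asrc f). vfcell F (fcell (amap f) c c'))\<rparr>
     (push_ecat F (atgt f))"

definition push_enat :: "'v vdbl_fun \<Rightarrow> 'v etwo_cell \<Rightarrow> 'v etwo_cell" where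
  "push_enat F t = Arrow (push_efun F (asrc t))
     (\<lambda>c\<in>eob (asrc (asrc t)). vfcell F (amap t c)) (push_efun F (atgt t))"

definition push_component :: "'v vdbl_two_cell \<Rightarrow> 'v ecat \<Rightarrow> 'v earrow" where
  "push_component t C = Arrow (push_ecat (amap (asrc t)) C)
     \<lparr>fob = (\<lambda>c\<in>eob C. c),
      fver = (\<lambda>c\<in>eob C. vtob (amap t) (eext C c)),
      fcell = (\<lambda>c\<in>eob C. \<lambda>c'\<in>eob C. vthor (amap t) (ehom C c c'))\<rparr>
     (push_ecat (amap (atgt t)) C)"

definition Enr1 ::
  "('v \<Rightarrow> 'v set) \<Rightarrow> 'v \<Rightarrow> 'v vdbl_arrow \<Rightarrow> ('v ltwo_cat, 'v ltwo_fun) arrow" where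
  "Enr1 elts U1 F =
     (let E = enr elts U1 (asrc F)
      in Arrow (Enr0 elts U1 (asrc F))
           \<lparr>on0 = recode (code0 elts) (obj (cat1 E)) (code0 elts) (push_ecat (amap F)),
            on1 = recode (code1 elts) (arr (cat1 E)) (code1 elts) (push_efun (amap F)),
            on2 = recode (code2 elts) (arr (cat2 E)) (code2 elts) (push_enat (amap F))\<rparr>
           (Enr0 elts U1 (atgt F)))"

definition Enr2 ::
  "('v \<Rightarrow> 'v set) \<Rightarrow> 'v \<Rightarrow> 'v vdbl_two_cell \<Rightarrow> (('v ltwo_cat, 'v ltwo_fun) arrow, 'v \<Rightarrow> 'v) arrow"
  where
  "Enr2 elts U1 t = Arrow (Enr1 elts U1 (asrc t))
     (recode (code0 elts) (obj (enr1 elts U1 (asrc (asrc t)))) (code1 elts) (push_component t))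
     (Enr1 elts U1 (atgt t))"

definition Enr_VDBL ::
  "('v \<Rightarrow> 'v set) \<Rightarrow> 'v \<Rightarrow>
   ('v vdbl, 'v vdbl_arrow, 'v vdbl_two_cell,
    'v ltwo_cat, ('v ltwo_cat, 'v ltwo_fun) arrow,
    (('v ltwo_cat, 'v ltwo_fun) arrow, 'v \<Rightarrow> 'v) arrow) two_fun" where
  "Enr_VDBL elts U1 = \<lparr>on0 = Enr0 elts U1, on1 = Enr1 elts U1, on2 = Enr2 elts U1\<rparr>"

definition Enr ::
  "('v \<Rightarrow> 'v set) \<Rightarrow> 'v \<Rightarrow>
   ('v psdbl, ('v psdbl, 'v lax_fun) arrow, (('v psdbl, 'v lax_fun) arrow, 'v vert_trans) arrow,
    'v ltwo_cat, ('v ltwo_cat, 'v ltwo_fun) arrow,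
    (('v ltwo_cat, 'v ltwo_fun) arrow, 'v \<Rightarrow> 'v) arrow) two_fun" where
  "Enr elts U1 = comp_two_fun (Enr_VDBL elts U1) PsDBL_to_VDBL"

end

theory Submission
  imports Defs
begin

text \<open>
  Write \<open>1\<close> for the terminal pseudo double category. A category enriched over \<open>1\<close> is just a set, an enriched
  functor is a function, and between any two parallel functors there is exactly one natural
  transformation. So a large 2-category \<open>X\<close> over the 2-category of \<open>1\<close>-categories amounts to a small set \<open>S x\<close>
  for each object \<open>x\<close> and a function \<open>act f\<close> from \<open>S x\<close> to \<open>S y\<close> for each 1-cell \<open>f\<close> from \<open>x\<close> to \<open>y\<close>,
  functorially in \<open>f\<close>. A 2-functor \<open>H\<close> over it from \<open>X\<close> to the 2-category of \<open>D\<close>-categories consists of \<open>D\<close>-categories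
  \<open>H x\<close> with object set \<open>S x\<close>, of \<open>D\<close>-functors \<open>H f\<close> that act on objects as \<open>act f\<close>, and of \<open>D\<close>-natural
  transformations.

  Such an \<open>H\<close> is the same thing as a lax double functor to \<open>D\<close> from the double category of elements \<open>FX\<close>. Its
  objects are the pairs \<open>(x, c)\<close> with \<open>c \<in> S x\<close>, its vertical morphisms are \<open>(f, c)\<close> from
  \<open>(x, c)\<close> to \<open>(y, act f c)\<close>, there is one horizontal morphism \<open>(x, c, d)\<close> from \<open>(x, c)\<close> to \<open>(x, d)\<close> for all
  \<open>c, d \<in> S x\<close>, and for each 2-cell \<open>a\<close> from \<open>f\<close> to \<open>g\<close> there is one cell \<open>(a, c, d)\<close> from \<open>(x, c, d)\<close> to
  \<open>(y, act f c, act g d)\<close> over \<open>(f, c)\<close> and \<open>(g, d)\<close>. The lax functor \<open>K\<close> that corresponds to \<open>H\<close> sends \<open>(x, c, d)\<close> to the hom-object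
  \<open>H x (c, d)\<close>, and its comparison cells at identities and composites are the units and the multiplications of
  the categories \<open>H x\<close>. The left 2-adjoint sends \<open>(X, S, act)\<close> to \<open>FX\<close>.

  The step with content concerns the cells of \<open>FX\<close>. A natural transformation \<open>t\<close> from \<open>f\<close> to \<open>g\<close> only has components
  \<open>t c\<close> with empty top, whereas \<open>K\<close> needs a cell from \<open>C(c, d)\<close> to \<open>C'(f c, g d)\<close>. This is the common value of the two sides of
  the naturality equation, called \<open>wc c d\<close> below. These cells are compatible with multiplication on
  either side (\<open>wc_mu_left\<close>, \<open>wc_mu_right\<close>), with vertical and horizontal composition of transformations
  (\<open>wcell_c2\<close>, \<open>wcell_hcmp\<close>), and \<open>wc c c\<close> gives back the component (\<open>wc_et\<close>). Hence \<open>K\<close> is a lax functor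
  (\<open>lax_K\<close>). Conversely \<open>(a, c, d)\<close> is the horizontal composite of \<open>(a, c, c)\<close> with \<open>(1, c, d)\<close>, so the value of a
  lax functor at the former is determined by its values at the latter two and its comparison cells (\<open>wcell_lcell\<close>).

  The unit of the adjunction is the tautological 2-functor \<open>univ\<close> from \<open>X\<close> to \<open>FX\<close>-categories, which sends \<open>x\<close> to the
  category with object set \<open>S x\<close> and hom-objects \<open>(x, c, d)\<close>; change of base along \<open>K\<close> turns it into \<open>H\<close>
  (\<open>push_K_ob\<close>, \<open>push_K_mor\<close>, \<open>push_K_cell\<close>). Its universal property is proved for 1-cells in
  \<open>unit_factor\<close> and \<open>unit_factor_unique\<close>, and for 2-cells in \<open>unit_cell_factor\<close> and \<open>unit_cell_unique\<close>: a
  vertical transformation between lax functors on \<open>FX\<close> is a 2-natural transformation whose components are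
  identities on objects. Universal arrows in this 2-categorical sense yield a left 2-adjoint by
  \<open>has_left_2adjointI\<close>.

  That enrichment is a 2-functor at all is \<open>two_functor_Enr\<close>. There the composites of multicells are first
  reduced to binary horizontal composites and unit or associativity constraints, after which everything takes
  place in a pseudo double category (locale \<open>pdc\<close>); the coding of cells as sets is handled once and for all by the
  locale \<open>coding\<close>.
\<close>


section \<open>Universes: sizes of sets and coding of tuples and functions\<close>

locale universe =
  fixes elts :: "'v \<Rightarrow> 'v set" and U :: 'v
  assumes inj_elts: "inj elts" and univ: "grothendieck_universe elts U"
begin

lemma universe_nonempty: "elts U \<noteq> {}"
  and universe_trans: "x \<in> elts U \<Longrightarrow> elts x \<subseteq> elts U"
  and universe_pairs: "x \<in> elts U \<Longrightarrow> y \<in> elts U \<Longrightarrow> \<exists>z\<in>elts U. elts z = {x, y}"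
  and universe_Pow: "x \<in> elts U \<Longrightarrow> \<exists>p\<in>elts U. elts ` elts p = Pow (elts x)"
  and universe_UN: "x \<in> elts U \<Longrightarrow> f ` elts x \<subseteq> elts U \<Longrightarrow>
    \<exists>z\<in>elts U. elts z = (\<Union>j\<in>elts x. elts (f j))"
  using univ unfolding grothendieck_universe_def by simp_all

lemma vset_elts [simp]: "vset elts (elts x) = x"
  unfolding vset_def using inj_elts by (auto simp: inj_def intro!: the_equality)

lemma elts_vset: "of_size elts U S \<Longrightarrow> elts (vset elts S) = S"
  and vset_in: "of_size elts U S \<Longrightarrow> vset elts S \<in> elts U"
  unfolding of_size_def by auto

lemma of_sizeI: "x \<in> elts U \<Longrightarrow> of_size elts U (elts x)"
  unfolding of_size_def by blast

lemma of_size_elems: "of_size elts U S \<Longrightarrow> x \<in> S \<Longrightarrow> x \<in> elts U"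
  using universe_trans unfolding of_size_def by blast

lemma of_size_subset:
  assumes "of_size elts U S" "T \<subseteq> S" shows "of_size elts U T"
proof -
  obtain x where x: "x \<in> elts U" "elts x = S" using assms(1) unfolding of_size_def by blast
  obtain p where p: "p \<in> elts U" "elts ` elts p = Pow (elts x)"
    using universe_Pow[OF x(1)] by blast
  have "T \<in> elts ` elts p" using assms(2) x(2) p(2) by simp
  then obtain z where "z \<in> elts p" "elts z = T" by blast
  then show ?thesis
    using of_size_elems[OF of_sizeI[OF p(1)]] of_sizeI by blast
qed

lemma of_size_pair: "x \<in> elts U \<Longrightarrow> y \<in> elts U \<Longrightarrow> of_size elts U {x, y}"
  using universe_pairs unfolding of_size_def by blast

lemma of_size_singleton: "x \<in> elts U \<Longrightarrow> of_size elts U {x}"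
  using of_size_pair[of x x] by simp

lemma of_size_empty: "of_size elts U {}"
proof -
  obtain x where "x \<in> elts U" using universe_nonempty by blast
  then show ?thesis using of_size_subset of_sizeI by blast
qed

lemma of_size_UN:
  assumes "of_size elts U I" "\<And>i. i \<in> I \<Longrightarrow> of_size elts U (A i)"
  shows "of_size elts U (\<Union>i\<in>I. A i)"
proof -
  obtain x where x: "x \<in> elts U" "elts x = I" using assms(1) unfolding of_size_def by blast
  have "(\<lambda>i. vset elts (A i)) ` elts x \<subseteq> elts U" using assms(2) x by (auto intro: vset_in)
  from universe_UN[OF x(1) this]
  obtain z where "z \<in> elts U" "elts z = (\<Union>i\<in>elts x. elts (vset elts (A i)))" by auto
  moreover have "(\<Union>i\<in>elts x. elts (vset elts (A i))) = (\<Union>i\<in>I. A i)"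
    using assms(2) x by (auto simp: elts_vset)
  ultimately show ?thesis unfolding of_size_def by auto
qed

lemma of_size_image:
  assumes "of_size elts U I" "\<And>i. i \<in> I \<Longrightarrow> f i \<in> elts U"
  shows "of_size elts U (f ` I)"
proof -
  have "of_size elts U (\<Union>i\<in>I. {f i})"
    by (rule of_size_UN) (auto intro: assms of_size_singleton)
  then show ?thesis by (simp add: UNION_singleton_eq_range)
qed

lemma of_size_Pow:
  assumes "of_size elts U S" shows "of_size elts U (vset elts ` Pow S)"
proof -
  obtain x where x: "x \<in> elts U" "elts x = S" using assms unfolding of_size_def by blast
  obtain p where p: "p \<in> elts U" "elts ` elts p = Pow (elts x)"
    using universe_Pow[OF x(1)] by blast
  have "vset elts ` Pow S = vset elts ` elts ` elts p" using p x by simp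
  also have "\<dots> = elts p" by (simp add: image_image)
  finally show ?thesis using p(1) of_sizeI by simp
qed

lemma vset_inject:
  "of_size elts U S \<Longrightarrow> of_size elts U T \<Longrightarrow> vset elts S = vset elts T \<longleftrightarrow> S = T"
  using elts_vset by metis

lemma vpair_in: "x \<in> elts U \<Longrightarrow> y \<in> elts U \<Longrightarrow> vpair elts x y \<in> elts U"
  unfolding vpair_def by (intro vset_in of_size_pair of_size_singleton)

lemma vpair_inject:
  assumes "x \<in> elts U" "y \<in> elts U" "x' \<in> elts U" "y' \<in> elts U"
  shows "vpair elts x y = vpair elts x' y' \<longleftrightarrow> x = x' \<and> y = y'"
proof
  assume "vpair elts x y = vpair elts x' y'"
  then have "{vset elts {x}, vset elts {x, y}} = {vset elts {x'}, vset elts {x', y'}}"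
    unfolding vpair_def using assms
    by (subst (asm) vset_inject) (auto intro!: of_size_pair of_size_singleton vset_in)
  then have "elts ` {vset elts {x}, vset elts {x, y}} = elts ` {vset elts {x'}, vset elts {x', y'}}"
    by simp
  then have "{{x}, {x, y}} = {{x'}, {x', y'}}"
    using assms by (simp add: elts_vset of_size_pair of_size_singleton)
  then show "x = x' \<and> y = y'" by (metis doubleton_eq_iff singleton_insert_inj_eq)
qed simp

definition vfst :: "'v \<Rightarrow> 'v" where
  "vfst p = (THE x. \<exists>y. x \<in> elts U \<and> y \<in> elts U \<and> p = vpair elts x y)"

definition vsnd :: "'v \<Rightarrow> 'v" where
  "vsnd p = (THE y. \<exists>x. x \<in> elts U \<and> y \<in> elts U \<and> p = vpair elts x y)"

lemma vfst_vpair [simp]: "x \<in> elts U \<Longrightarrow> y \<in> elts U \<Longrightarrow> vfst (vpair elts x y) = x"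
  and vsnd_vpair [simp]: "x \<in> elts U \<Longrightarrow> y \<in> elts U \<Longrightarrow> vsnd (vpair elts x y) = y"
  unfolding vfst_def vsnd_def by (auto simp: vpair_inject intro!: the_equality)

fun tuples :: "'v set list \<Rightarrow> 'v set" where
  "tuples [] = {vset elts {}}"
| "tuples (A # As) = (\<Union>a\<in>A. vpair elts a ` tuples As)"

lemma of_size_tuples:
  "(\<And>A. A \<in> set As \<Longrightarrow> of_size elts U A) \<Longrightarrow> of_size elts U (tuples As)"
proof (induction As)
  case Nil
  then show ?case by (auto intro!: of_size_singleton vset_in of_size_empty)
next
  case (Cons A As)
  then have *: "of_size elts U (tuples As)" "of_size elts U A" by auto
  then show ?case
    unfolding tuples.simps
  proof (intro of_size_UN[OF *(2)])
    fix a assume "a \<in> A"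
    then show "of_size elts U (vpair elts a ` tuples As)"
      using * by (intro of_size_image) (simp_all add: vpair_in of_size_elems)
  qed
qed

lemma vtuple_in_tuples: "list_all2 (\<in>) xs As \<Longrightarrow> vtuple elts xs \<in> tuples As"
  by (induction xs As rule: list_all2_induct) auto

lemma vtuple_in: "set xs \<subseteq> elts U \<Longrightarrow> vtuple elts xs \<in> elts U"
  by (induction xs) (auto intro: vpair_in vset_in of_size_empty)

lemma vtuple_inject:
  "length xs = length ys \<Longrightarrow> set xs \<subseteq> elts U \<Longrightarrow> set ys \<subseteq> elts U \<Longrightarrow>
   vtuple elts xs = vtuple elts ys \<longleftrightarrow> xs = ys"
  by (induction xs ys rule: list_induct2) (auto simp: vpair_inject vtuple_in)

text \<open>The codes of the functions from a subset of \<open>A\<close> to \<open>B\<close>.\<close>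

definition lams :: "'v set \<Rightarrow> 'v set \<Rightarrow> 'v set" where
  "lams A B = {vlam elts S f | S f. S \<subseteq> A \<and> f ` S \<subseteq> B}"

lemma of_size_graph:
  "of_size elts U S \<Longrightarrow> f ` S \<subseteq> elts U \<Longrightarrow> of_size elts U ((\<lambda>x. vpair elts x (f x)) ` S)"
  by (rule of_size_image) (auto intro: vpair_in of_size_elems)

lemma of_size_lams:
  assumes "of_size elts U A" "of_size elts U B" shows "of_size elts U (lams A B)"
proof (rule of_size_subset)
  let ?P = "\<Union>a\<in>A. vpair elts a ` B"
  have "of_size elts U ?P"
  proof (rule of_size_UN[OF assms(1)])
    fix a assume "a \<in> A"
    then show "of_size elts U (vpair elts a ` B)"
      using assms by (intro of_size_image) (simp_all add: vpair_in of_size_elems)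
  qed
  then show "of_size elts U (vset elts ` Pow ?P)" by (rule of_size_Pow)
  show "lams A B \<subseteq> vset elts ` Pow ?P"   proof
    fix y assume "y \<in> lams A B"
    then obtain S f where "y = vlam elts S f" "S \<subseteq> A" "f ` S \<subseteq> B" unfolding lams_def by blast
    then have "y = vset elts ((\<lambda>x. vpair elts x (f x)) ` S)"
      "(\<lambda>x. vpair elts x (f x)) ` S \<in> Pow ?P" unfolding vlam_def by fast+
    then show "y \<in> vset elts ` Pow ?P" by (rule image_eqI)
  qed
qed

lemma lams_I: "S \<subseteq> A \<Longrightarrow> (\<And>x. x \<in> S \<Longrightarrow> f x \<in> B) \<Longrightarrow> vlam elts S f \<in> lams A B"
  unfolding lams_def by blast

lemma vlam_in: "of_size elts U S \<Longrightarrow> f ` S \<subseteq> elts U \<Longrightarrow> vlam elts S f \<in> elts U"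
  unfolding vlam_def by (intro vset_in of_size_graph)

lemma vlam_inject:
  assumes "of_size elts U S" "\<And>x. x \<in> S \<Longrightarrow> f x \<in> elts U" "\<And>x. x \<in> S \<Longrightarrow> g x \<in> elts U"
  shows "vlam elts S f = vlam elts S g \<longleftrightarrow> (\<forall>x\<in>S. f x = g x)"
proof
  assume "vlam elts S f = vlam elts S g"
  then have eq: "(\<lambda>x. vpair elts x (f x)) ` S = (\<lambda>x. vpair elts x (g x)) ` S"
    unfolding vlam_def using assms by (subst (asm) vset_inject) (auto intro!: of_size_graph)
  show "\<forall>x\<in>S. f x = g x"
  proof
    fix x assume x: "x \<in> S"
    then obtain y where "y \<in> S" "vpair elts x (f x) = vpair elts y (g y)" using eq by blast
    then have "x = y \<and> f x = g y"
      using vpair_inject[of x "f x" y "g y"] assms(2)[of x] assms(3)[of y] x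
        of_size_elems[OF assms(1)] by blast
    then show "f x = g x" by auto
  qed
next
  assume "\<forall>x\<in>S. f x = g x"
  then have "(\<lambda>x. vpair elts x (f x)) ` S = (\<lambda>x. vpair elts x (g x)) ` S" by auto
  then show "vlam elts S f = vlam elts S g" by (simp add: vlam_def)
qed

end


section \<open>Categories and 2-categories\<close>

lemma cat_simps [simp]:
  assumes "category C"
  shows "f \<in> arr C \<Longrightarrow> src C f \<in> obj C"
    and "f \<in> arr C \<Longrightarrow> tgt C f \<in> obj C"
    and "x \<in> obj C \<Longrightarrow> ide C x \<in> arr C"
    and "x \<in> obj C \<Longrightarrow> src C (ide C x) = x"
    and "x \<in> obj C \<Longrightarrow> tgt C (ide C x) = x"
    and "g \<in> arr C \<Longrightarrow> f \<in> arr C \<Longrightarrow> src C g = tgt C f \<Longrightarrow> cmp C g f \<in> arr C"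
    and "g \<in> arr C \<Longrightarrow> f \<in> arr C \<Longrightarrow> src C g = tgt C f \<Longrightarrow> src C (cmp C g f) = src C f"
    and "g \<in> arr C \<Longrightarrow> f \<in> arr C \<Longrightarrow> src C g = tgt C f \<Longrightarrow> tgt C (cmp C g f) = tgt C g"
    and "f \<in> arr C \<Longrightarrow> src C f = x \<Longrightarrow> cmp C f (ide C x) = f"
    and "f \<in> arr C \<Longrightarrow> tgt C f = x \<Longrightarrow> cmp C (ide C x) f = f"
    and "h \<in> arr C \<Longrightarrow> g \<in> arr C \<Longrightarrow> f \<in> arr C \<Longrightarrow> src C h = tgt C g \<Longrightarrow> src C g = tgt C f \<Longrightarrow>
      cmp C (cmp C h g) f = cmp C h (cmp C g f)"
  using assms unfolding category_def composable_def by auto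

lemma category_arrowI:
  assumes "\<And>x m y. P x m y \<Longrightarrow> x \<in> X \<and> y \<in> X"
    and "\<And>x. x \<in> X \<Longrightarrow> P x (i x) x"
    and "\<And>x m y n z. P x m y \<Longrightarrow> P y n z \<Longrightarrow> P x (k (Arrow y n z) (Arrow x m y)) z"
    and "\<And>x m y. P x m y \<Longrightarrow> k (Arrow x m y) (Arrow x (i x) x) = m"
    and "\<And>x m y. P x m y \<Longrightarrow> k (Arrow y (i y) y) (Arrow x m y) = m"
    and "\<And>w l x m y n z. P w l x \<Longrightarrow> P x m y \<Longrightarrow> P y n z \<Longrightarrow>
      k (Arrow y n z) (Arrow w (k (Arrow x m y) (Arrow w l x)) y) =
      k (Arrow x (k (Arrow y n z) (Arrow x m y)) z) (Arrow w l x)"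
  shows "category \<lparr>obj = X, arr = {Arrow x m y | x m y. P x m y}, src = asrc, tgt = atgt,
    ide = (\<lambda>x. Arrow x (i x) x), cmp = (\<lambda>g f. Arrow (asrc f) (k g f) (atgt g))\<rparr>"
  unfolding category_def composable_def using assms(1,2)
  by (auto simp: assms(3-5) assms(6))

lemma cat_functor_simps:
  assumes "cat_functor C D F0 F1"
  shows "x \<in> obj C \<Longrightarrow> F0 x \<in> obj D"
    and "f \<in> arr C \<Longrightarrow> F1 f \<in> arr D"
    and "f \<in> arr C \<Longrightarrow> src D (F1 f) = F0 (src C f)"
    and "f \<in> arr C \<Longrightarrow> tgt D (F1 f) = F0 (tgt C f)"
    and "x \<in> obj C \<Longrightarrow> F1 (ide C x) = ide D (F0 x)"
    and "g \<in> arr C \<Longrightarrow> f \<in> arr C \<Longrightarrow> src C g = tgt C f \<Longrightarrow> F1 (cmp C g f) = cmp D (F1 g) (F1 f)"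
  using assms unfolding cat_functor_def composable_def by auto

abbreviation "ob K \<equiv> obj (cat1 K)"
abbreviation "mor K \<equiv> arr (cat1 K)"
abbreviation "cell K \<equiv> arr (cat2 K)"
abbreviation "s1 K \<equiv> src (cat1 K)"
abbreviation "t1 K \<equiv> tgt (cat1 K)"
abbreviation "i1 K \<equiv> ide (cat1 K)"
abbreviation "c1 K \<equiv> cmp (cat1 K)"
abbreviation "s2 K \<equiv> src (cat2 K)"
abbreviation "t2 K \<equiv> tgt (cat2 K)"
abbreviation "i2 K \<equiv> ide (cat2 K)"
abbreviation "c2 K \<equiv> cmp (cat2 K)"

lemma hcat_sel [simp]:
  "obj (hcat K) = ob K" "arr (hcat K) = cell K"
  "src (hcat K) a = s1 K (s2 K a)" "tgt (hcat K) a = t1 K (s2 K a)"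
  "ide (hcat K) x = i2 K (i1 K x)" "cmp (hcat K) = hcmp K"
  by (simp_all add: hcat_def)

lemma two_categoryI:
  assumes "category (cat1 K)" "category (cat2 K)" "obj (cat2 K) = mor K"
    and "\<And>a. a \<in> cell K \<Longrightarrow> s1 K (t2 K a) = s1 K (s2 K a) \<and> t1 K (t2 K a) = t1 K (s2 K a)"
    and hc: "\<And>b a. b \<in> cell K \<Longrightarrow> a \<in> cell K \<Longrightarrow> s1 K (s2 K b) = t1 K (s2 K a) \<Longrightarrow>
      hcmp K b a \<in> cell K \<and> s2 K (hcmp K b a) = c1 K (s2 K b) (s2 K a) \<and>
      t2 K (hcmp K b a) = c1 K (t2 K b) (t2 K a)"
    and "\<And>a. a \<in> cell K \<Longrightarrow> hcmp K a (i2 K (i1 K (s1 K (s2 K a)))) = a"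
    and "\<And>a. a \<in> cell K \<Longrightarrow> hcmp K (i2 K (i1 K (t1 K (s2 K a)))) a = a"
    and "\<And>c b a. c \<in> cell K \<Longrightarrow> b \<in> cell K \<Longrightarrow> a \<in> cell K \<Longrightarrow>
      s1 K (s2 K c) = t1 K (s2 K b) \<Longrightarrow> s1 K (s2 K b) = t1 K (s2 K a) \<Longrightarrow>
      hcmp K c (hcmp K b a) = hcmp K (hcmp K c b) a"
    and "\<And>g f. g \<in> mor K \<Longrightarrow> f \<in> mor K \<Longrightarrow> s1 K g = t1 K f \<Longrightarrow>
      hcmp K (i2 K g) (i2 K f) = i2 K (c1 K g f)"
    and "\<And>d c b a. d \<in> cell K \<Longrightarrow> c \<in> cell K \<Longrightarrow> b \<in> cell K \<Longrightarrow> a \<in> cell K \<Longrightarrow>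
      s2 K d = t2 K c \<Longrightarrow> s2 K b = t2 K a \<Longrightarrow> s1 K (s2 K c) = t1 K (s2 K a) \<Longrightarrow>
      hcmp K (c2 K d c) (c2 K b a) = c2 K (hcmp K d b) (hcmp K c a)"
  shows "two_category K"
proof -
  have *: "f \<in> mor K \<Longrightarrow> i2 K f \<in> cell K \<and> s2 K (i2 K f) = f \<and> t2 K (i2 K f) = f"
    "a \<in> cell K \<Longrightarrow> s2 K a \<in> mor K \<and> t2 K a \<in> mor K" for f a
    using assms(2,3) by (metis cat_simps)+
  have "category (hcat K)"
    using assms(1) * hc assms(6-8) unfolding category_def[of "hcat K"] composable_def by simp
  then show ?thesis
    unfolding two_category_def using assms by (auto simp: composable_def)
qed

lemma two_cat_simps [simp]:
  assumes "two_category K"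
  shows "category (cat1 K)" "category (cat2 K)" "category (hcat K)" "obj (cat2 K) = mor K"
    and "a \<in> cell K \<Longrightarrow> s2 K a \<in> mor K"
    and "a \<in> cell K \<Longrightarrow> t2 K a \<in> mor K"
    and "f \<in> mor K \<Longrightarrow> i2 K f \<in> cell K"
    and "f \<in> mor K \<Longrightarrow> s2 K (i2 K f) = f"
    and "f \<in> mor K \<Longrightarrow> t2 K (i2 K f) = f"
    and "a \<in> cell K \<Longrightarrow> s1 K (t2 K a) = s1 K (s2 K a)"
    and "a \<in> cell K \<Longrightarrow> t1 K (t2 K a) = t1 K (s2 K a)"
    and "b \<in> cell K \<Longrightarrow> a \<in> cell K \<Longrightarrow> s1 K (s2 K b) = t1 K (s2 K a) \<Longrightarrow> hcmp K b a \<in> cell K"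
    and "b \<in> cell K \<Longrightarrow> a \<in> cell K \<Longrightarrow> s1 K (s2 K b) = t1 K (s2 K a) \<Longrightarrow>
      s2 K (hcmp K b a) = c1 K (s2 K b) (s2 K a)"
    and "b \<in> cell K \<Longrightarrow> a \<in> cell K \<Longrightarrow> s1 K (s2 K b) = t1 K (s2 K a) \<Longrightarrow>
      t2 K (hcmp K b a) = c1 K (t2 K b) (t2 K a)"
    and "a \<in> cell K \<Longrightarrow> s1 K (s2 K a) = x \<Longrightarrow> hcmp K a (i2 K (i1 K x)) = a"
    and "a \<in> cell K \<Longrightarrow> t1 K (s2 K a) = x \<Longrightarrow> hcmp K (i2 K (i1 K x)) a = a"
    and "c \<in> cell K \<Longrightarrow> b \<in> cell K \<Longrightarrow> a \<in> cell K \<Longrightarrow>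
      s1 K (s2 K c) = t1 K (s2 K b) \<Longrightarrow> s1 K (s2 K b) = t1 K (s2 K a) \<Longrightarrow>
      hcmp K (hcmp K c b) a = hcmp K c (hcmp K b a)"
    and "g \<in> mor K \<Longrightarrow> f \<in> mor K \<Longrightarrow> s1 K g = t1 K f \<Longrightarrow>
      hcmp K (i2 K g) (i2 K f) = i2 K (c1 K g f)"
proof -
  show c: "category (cat1 K)" "category (cat2 K)" and h: "category (hcat K)" and o: "obj (cat2 K) = mor K"
    using assms unfolding two_category_def by auto
  show "a \<in> cell K \<Longrightarrow> s2 K a \<in> mor K" "a \<in> cell K \<Longrightarrow> t2 K a \<in> mor K"
    "f \<in> mor K \<Longrightarrow> i2 K f \<in> cell K" "f \<in> mor K \<Longrightarrow> s2 K (i2 K f) = f"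
    "f \<in> mor K \<Longrightarrow> t2 K (i2 K f) = f"
    using c o by (metis cat_simps)+
  show "b \<in> cell K \<Longrightarrow> a \<in> cell K \<Longrightarrow> s1 K (s2 K b) = t1 K (s2 K a) \<Longrightarrow> hcmp K b a \<in> cell K"
    "a \<in> cell K \<Longrightarrow> s1 K (s2 K a) = x \<Longrightarrow> hcmp K a (i2 K (i1 K x)) = a"
    "a \<in> cell K \<Longrightarrow> t1 K (s2 K a) = x \<Longrightarrow> hcmp K (i2 K (i1 K x)) a = a"
    "c \<in> cell K \<Longrightarrow> b \<in> cell K \<Longrightarrow> a \<in> cell K \<Longrightarrow>
      s1 K (s2 K c) = t1 K (s2 K b) \<Longrightarrow> s1 K (s2 K b) = t1 K (s2 K a) \<Longrightarrow>
      hcmp K (hcmp K c b) a = hcmp K c (hcmp K b a)"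
    using cat_simps[OF h] by simp_all
qed (use assms in \<open>auto simp: two_category_def composable_def\<close>)

lemma interchange:
  assumes "two_category K" "d \<in> cell K" "c \<in> cell K" "b \<in> cell K" "a \<in> cell K"
    "s2 K d = t2 K c" "s2 K b = t2 K a" "s1 K (s2 K c) = t1 K (s2 K a)"
  shows "hcmp K (c2 K d c) (c2 K b a) = c2 K (hcmp K d b) (hcmp K c a)"
  using assms unfolding two_category_def composable_def by simp

lemma two_functorI:
  assumes "two_category K" "two_category L"
    "\<And>x. x \<in> ob K \<Longrightarrow> on0 F x \<in> ob L"
    "\<And>f. f \<in> mor K \<Longrightarrow> on1 F f \<in> mor L \<and> s1 L (on1 F f) = on0 F (s1 K f) \<and> t1 L (on1 F f) = on0 F (t1 K f)"
    "\<And>x. x \<in> ob K \<Longrightarrow> on1 F (i1 K x) = i1 L (on0 F x)"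
    "\<And>g f. g \<in> mor K \<Longrightarrow> f \<in> mor K \<Longrightarrow> s1 K g = t1 K f \<Longrightarrow> on1 F (c1 K g f) = c1 L (on1 F g) (on1 F f)"
    "\<And>f. f \<in> cell K \<Longrightarrow> on2 F f \<in> cell L \<and> s2 L (on2 F f) = on1 F (s2 K f) \<and> t2 L (on2 F f) = on1 F (t2 K f)"
    "\<And>x. x \<in> mor K \<Longrightarrow> on2 F (i2 K x) = i2 L (on1 F x)"
    "\<And>g f. g \<in> cell K \<Longrightarrow> f \<in> cell K \<Longrightarrow> s2 K g = t2 K f \<Longrightarrow> on2 F (c2 K g f) = c2 L (on2 F g) (on2 F f)"
    "\<And>g f. g \<in> cell K \<Longrightarrow> f \<in> cell K \<Longrightarrow> s1 K (s2 K g) = t1 K (s2 K f) \<Longrightarrow>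
      on2 F (hcmp K g f) = hcmp L (on2 F g) (on2 F f)"
  shows "two_functor K L F"
  using assms unfolding two_functor_def cat_functor_def composable_def by simp

lemma two_functor_simps:
  assumes "two_functor K L F"
  shows "two_category K" "two_category L"
    and "x \<in> ob K \<Longrightarrow> on0 F x \<in> ob L"
    and "f \<in> mor K \<Longrightarrow> on1 F f \<in> mor L"
    and "f \<in> mor K \<Longrightarrow> s1 L (on1 F f) = on0 F (s1 K f)"
    and "f \<in> mor K \<Longrightarrow> t1 L (on1 F f) = on0 F (t1 K f)"
    and "x \<in> ob K \<Longrightarrow> on1 F (i1 K x) = i1 L (on0 F x)"
    and "g \<in> mor K \<Longrightarrow> f \<in> mor K \<Longrightarrow> s1 K g = t1 K f \<Longrightarrow> on1 F (c1 K g f) = c1 L (on1 F g) (on1 F f)"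
    and "a \<in> cell K \<Longrightarrow> on2 F a \<in> cell L"
    and "a \<in> cell K \<Longrightarrow> s2 L (on2 F a) = on1 F (s2 K a)"
    and "a \<in> cell K \<Longrightarrow> t2 L (on2 F a) = on1 F (t2 K a)"
    and "f \<in> mor K \<Longrightarrow> on2 F (i2 K f) = i2 L (on1 F f)"
    and "b \<in> cell K \<Longrightarrow> a \<in> cell K \<Longrightarrow> s2 K b = t2 K a \<Longrightarrow> on2 F (c2 K b a) = c2 L (on2 F b) (on2 F a)"
    and "b \<in> cell K \<Longrightarrow> a \<in> cell K \<Longrightarrow> s1 K (s2 K b) = t1 K (s2 K a) \<Longrightarrow>
      on2 F (hcmp K b a) = hcmp L (on2 F b) (on2 F a)"
  using assms unfolding two_functor_def cat_functor_def composable_def by simp_all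

lemma two_naturalI:
  assumes "\<And>x. x \<in> ob K \<Longrightarrow> t x \<in> mor L \<and> s1 L (t x) = on0 F x \<and> t1 L (t x) = on0 G x"
    "\<And>f. f \<in> mor K \<Longrightarrow> c1 L (on1 G f) (t (s1 K f)) = c1 L (t (t1 K f)) (on1 F f)"
    "\<And>a. a \<in> cell K \<Longrightarrow> hcmp L (on2 G a) (i2 L (t (s1 K (s2 K a)))) =
       hcmp L (i2 L (t (t1 K (s2 K a)))) (on2 F a)"
  shows "two_natural K L F G t"
  using assms unfolding two_natural_def by simp

lemma two_natural_simps:
  assumes "two_natural K L F G t"
  shows "x \<in> ob K \<Longrightarrow> t x \<in> mor L"
    and "x \<in> ob K \<Longrightarrow> s1 L (t x) = on0 F x"
    and "x \<in> ob K \<Longrightarrow> t1 L (t x) = on0 G x"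
    and "f \<in> mor K \<Longrightarrow> c1 L (on1 G f) (t (s1 K f)) = c1 L (t (t1 K f)) (on1 F f)"
    and "a \<in> cell K \<Longrightarrow> hcmp L (on2 G a) (i2 L (t (s1 K (s2 K a)))) =
       hcmp L (i2 L (t (t1 K (s2 K a)))) (on2 F a)"
  using assms unfolding two_natural_def by simp_all

lemma comp_two_fun_sel [simp]:
  "on0 (comp_two_fun G F) x = on0 G (on0 F x)" "on1 (comp_two_fun G F) f = on1 G (on1 F f)"
  "on2 (comp_two_fun G F) a = on2 G (on2 F a)"
  by (simp_all add: comp_two_fun_def)

lemma id_two_fun_sel [simp]:
  "on0 id_two_fun x = x" "on1 id_two_fun f = f" "on2 id_two_fun a = a"
  by (simp_all add: id_two_fun_def)

lemma two_functor_id: "two_category K \<Longrightarrow> two_functor K K id_two_fun"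
  by (rule two_functorI) simp_all

lemma two_functor_comp:
  assumes F: "two_functor K L F" and G: "two_functor L M G"
  shows "two_functor K M (comp_two_fun G F)"
  by (rule two_functorI) (simp_all add: two_functor_simps[OF F] two_functor_simps[OF G])

lemma two_natural_vcomp:
  assumes F: "two_functor K L F" and G: "two_functor K L G" and H: "two_functor K L H"
    and t: "two_natural K L F G t" and s: "two_natural K L G H s"
  shows "two_natural K L F H (\<lambda>x. c1 L (s x) (t x))"
proof -
  note [simp] = two_functor_simps[OF F] two_functor_simps[OF G] two_functor_simps[OF H]
    two_natural_simps(1-3)[OF t] two_natural_simps(1-3)[OF s]
  show ?thesis
  proof (rule two_naturalI)
    fix f assume f: "f \<in> mor K"
    have "c1 L (on1 H f) (c1 L (s (s1 K f)) (t (s1 K f))) = c1 L (c1 L (on1 H f) (s (s1 K f))) (t (s1 K f))"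
      using f by simp
    also have "\<dots> = c1 L (s (t1 K f)) (c1 L (on1 G f) (t (s1 K f)))"
      using f by (simp add: two_natural_simps(4)[OF s])
    also have "\<dots> = c1 L (c1 L (s (t1 K f)) (t (t1 K f))) (on1 F f)"
      using f by (simp add: two_natural_simps(4)[OF t])
    finally show "c1 L (on1 H f) (c1 L (s (s1 K f)) (t (s1 K f))) =
      c1 L (c1 L (s (t1 K f)) (t (t1 K f))) (on1 F f)" .
  next
    fix a assume a: "a \<in> cell K"
    let ?x = "s1 K (s2 K a)" and ?y = "t1 K (s2 K a)"
    have "hcmp L (on2 H a) (i2 L (c1 L (s ?x) (t ?x))) =
      hcmp L (hcmp L (on2 H a) (i2 L (s ?x))) (i2 L (t ?x))" using a by simp
    also have "\<dots> = hcmp L (i2 L (s ?y)) (hcmp L (on2 G a) (i2 L (t ?x)))"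
      using a by (subst two_natural_simps(5)[OF s]) simp_all
    also have "\<dots> = hcmp L (hcmp L (i2 L (s ?y)) (i2 L (t ?y))) (on2 F a)"
      using a by (subst two_natural_simps(5)[OF t]) (simp_all del: two_cat_simps(18))
    finally show "hcmp L (on2 H a) (i2 L (c1 L (s ?x) (t ?x))) =
      hcmp L (i2 L (c1 L (s ?y) (t ?y))) (on2 F a)" using a by simp
  qed simp
qed

lemma two_natural_lwhisker:
  assumes F: "two_functor K L F" and F': "two_functor K L F'" and G: "two_functor L M G"
    and t: "two_natural K L F F' t"
  shows "two_natural K M (comp_two_fun G F) (comp_two_fun G F') (\<lambda>x. on1 G (t x))"
proof -
  note [simp] = two_functor_simps[OF F] two_functor_simps[OF F'] two_functor_simps[OF G]
    two_natural_simps(1-3)[OF t]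
  have 1: "f \<in> mor K \<Longrightarrow> on1 G (c1 L (on1 F' f) (t (s1 K f))) = on1 G (c1 L (t (t1 K f)) (on1 F f))" for f
    by (simp add: two_natural_simps(4)[OF t] del: two_functor_simps(8)[OF G])
  have 2: "a \<in> cell K \<Longrightarrow> on2 G (hcmp L (on2 F' a) (i2 L (t (s1 K (s2 K a))))) =
       on2 G (hcmp L (i2 L (t (t1 K (s2 K a)))) (on2 F a))" for a
    by (simp add: two_natural_simps(5)[OF t] del: two_functor_simps(14)[OF G])
  show ?thesis by (rule two_naturalI) (use 1 2 in simp_all)
qed

lemma two_natural_rwhisker:
  assumes F: "two_functor K L F" and s: "two_natural L M G G' s"
  shows "two_natural K M (comp_two_fun G F) (comp_two_fun G' F) (\<lambda>x. s (on0 F x))"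
proof -
  note [simp] = two_functor_simps[OF F] two_natural_simps(1-3)[OF s]
  show ?thesis
    by (rule two_naturalI) (simp_all flip: two_functor_simps(5,6,10)[OF F]
      add: two_natural_simps(4)[OF s] two_natural_simps(5)[OF s])
qed


lemma two_functor_cong:
  assumes F: "two_functor K L F"
    and "\<And>x. x \<in> ob K \<Longrightarrow> on0 F' x = on0 F x" "\<And>f. f \<in> mor K \<Longrightarrow> on1 F' f = on1 F f"
    "\<And>a. a \<in> cell K \<Longrightarrow> on2 F' a = on2 F a"
  shows "two_functor K L F'"
  by (rule two_functorI) (simp_all add: assms two_functor_simps[OF F])

lemma restrict_two_fun_sel [simp]:
  "on0 (restrict_two_fun K F) = restrict (on0 F) (ob K)"
  "on1 (restrict_two_fun K F) = restrict (on1 F) (mor K)"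
  "on2 (restrict_two_fun K F) = restrict (on2 F) (cell K)"
  by (simp_all add: restrict_two_fun_def)

lemma two_functor_restrict: "two_functor K L F \<Longrightarrow> two_functor K L (restrict_two_fun K F)"
  by (rule two_functor_cong[where F=F]) simp_all

lemma ext_restrict: "ext_two_fun K (restrict_two_fun K F)"
  by (simp add: ext_two_fun_def)

lemma two_fun_eqI:
  assumes "ext_two_fun K F" "ext_two_fun K G"
    "\<And>x. x \<in> ob K \<Longrightarrow> on0 F x = on0 G x" "\<And>f. f \<in> mor K \<Longrightarrow> on1 F f = on1 G f"
    "\<And>a. a \<in> cell K \<Longrightarrow> on2 F a = on2 G a"
  shows "F = (G :: 'v ltwo_fun)"
proof -
  have "on0 F = on0 G" "on1 F = on1 G" "on2 F = on2 G"
    using assms unfolding ext_two_fun_def by (auto intro: extensionalityI)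
  then show ?thesis by simp
qed

lemma two_natural_cong:
  assumes t: "two_natural K L F G t" and K: "two_category K"
    and "\<And>x. x \<in> ob K \<Longrightarrow> on0 F' x = on0 F x" "\<And>f. f \<in> mor K \<Longrightarrow> on1 F' f = on1 F f"
    "\<And>a. a \<in> cell K \<Longrightarrow> on2 F' a = on2 F a"
    and "\<And>x. x \<in> ob K \<Longrightarrow> on0 G' x = on0 G x" "\<And>f. f \<in> mor K \<Longrightarrow> on1 G' f = on1 G f"
    "\<And>a. a \<in> cell K \<Longrightarrow> on2 G' a = on2 G a"
    and "\<And>x. x \<in> ob K \<Longrightarrow> t' x = t x"
  shows "two_natural K L F' G' t'"
  by (rule two_naturalI) (simp_all add: assms(3-) two_natural_simps[OF t] K)


section \<open>The 2-category of large 2-categories\<close>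

lemma large_two_category_D [simp]: "large_two_category elts U K \<Longrightarrow> two_category K"
  by (simp add: large_two_category_def)

lemma mor_TwoCAT1:
  "F \<in> arr (TwoCAT1 elts U) \<longleftrightarrow> large_two_category elts U (asrc F) \<and> large_two_category elts U (atgt F) \<and>
     two_functor (asrc F) (atgt F) (amap F) \<and> ext_two_fun (asrc F) (amap F)"
  by (cases F) (auto simp: TwoCAT1_def)

lemma TwoCAT1_sel [simp]:
  "obj (TwoCAT1 elts U) = {K. large_two_category elts U K}"
  "src (TwoCAT1 elts U) = asrc" "tgt (TwoCAT1 elts U) = atgt"
  "ide (TwoCAT1 elts U) K = Arrow K (restrict_two_fun K id_two_fun) K"
  "cmp (TwoCAT1 elts U) G F = Arrow (asrc F)
     (restrict_two_fun (asrc F) (comp_two_fun (amap G) (amap F))) (atgt G)"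
  by (simp_all add: TwoCAT1_def)

lemma category_TwoCAT1: "category (TwoCAT1 elts U)"
  unfolding TwoCAT1_def
proof (rule category_arrowI, goal_cases)
  case (2 K)
  then show ?case by (simp add: two_functor_restrict two_functor_id ext_restrict)
next
  case (3 K F L G M)
  then show ?case by (auto simp: ext_restrict intro!: two_functor_restrict intro: two_functor_comp)
next
  case (4 K F L)
  then have F: "two_functor K L F" and "ext_two_fun K F" by auto
  then show ?case by (intro two_fun_eqI[where K=K]) (simp_all add: ext_restrict two_functor_simps[OF F])
next
  case (5 K F L)
  then have F: "two_functor K L F" and "ext_two_fun K F" by auto
  then show ?case by (intro two_fun_eqI[where K=K]) (simp_all add: ext_restrict two_functor_simps[OF F])
next
  case (6 J F K G L H M)
  then have F: "two_functor J K F" and G: "two_functor K L G" by auto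
  then show ?case
    by (intro two_fun_eqI[where K=J]) (simp_all add: ext_restrict two_functor_simps[OF F] two_functor_simps[OF G])
qed simp

lemma TwoCAT_sel [simp]:
  "cat1 (TwoCAT elts U) = TwoCAT1 elts U"
  "obj (cat2 (TwoCAT elts U)) = arr (TwoCAT1 elts U)"
  "src (cat2 (TwoCAT elts U)) = asrc" "tgt (cat2 (TwoCAT elts U)) = atgt"
  "ide (cat2 (TwoCAT elts U)) F = Arrow F
                 (\<lambda>x\<in>obj (cat1 (asrc F)). ide (cat1 (atgt F)) (on0 (amap F) x)) F"
  "cmp (cat2 (TwoCAT elts U)) s t = Arrow (asrc t)
                 (\<lambda>x\<in>obj (cat1 (asrc (asrc t))).
                    cmp (cat1 (atgt (asrc t))) (amap s x) (amap t x)) (atgt s)"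
  "hcmp (TwoCAT elts U) s t = Arrow
               (cmp (TwoCAT1 elts U) (asrc s) (asrc t))
               (\<lambda>x\<in>obj (cat1 (asrc (asrc t))).
                  cmp (cat1 (atgt (asrc s)))
                    (amap s (on0 (amap (atgt t)) x)) (on1 (amap (asrc s)) (amap t x)))
               (cmp (TwoCAT1 elts U) (atgt s) (atgt t))"
  by (simp_all add: TwoCAT_def)

lemma cell_TwoCAT:
  "t \<in> arr (cat2 (TwoCAT elts U)) \<longleftrightarrow>
     asrc t \<in> arr (TwoCAT1 elts U) \<and> atgt t \<in> arr (TwoCAT1 elts U) \<and>
     asrc (asrc t) = asrc (atgt t) \<and> atgt (asrc t) = atgt (atgt t) \<and>
     two_natural (asrc (asrc t)) (atgt (asrc t)) (amap (asrc t)) (amap (atgt t)) (amap t) \<and>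
     amap t \<in> extensional (ob (asrc (asrc t)))"
  by (cases t) (auto simp: TwoCAT_def)

lemma two_natural_ide:
  "two_functor K L F \<Longrightarrow> two_natural K L F F (\<lambda>x. i1 L (on0 F x))"
  by (rule two_naturalI) (simp_all add: two_functor_simps)

lemma category_TwoCAT2: "category (cat2 (TwoCAT elts U))"
  unfolding TwoCAT_def two_cat.simps
proof (rule category_arrowI, goal_cases)
  case (2 F)
  then have F: "two_functor (asrc F) (atgt F) (amap F)" by (simp add: mor_TwoCAT1)
  show ?case
    using 2 by (auto intro!: two_natural_cong[OF two_natural_ide[OF F]] simp: two_functor_simps[OF F])
next
  case (3 F t G s H)
  then have F: "two_functor (asrc F) (atgt F) (amap F)" "two_functor (asrc F) (atgt F) (amap G)"
    "two_functor (asrc F) (atgt F) (amap H)" 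
    and t: "two_natural (asrc F) (atgt F) (amap F) (amap G) t"
    and s: "two_natural (asrc F) (atgt F) (amap G) (amap H) s" by (auto simp: mor_TwoCAT1)
  from two_natural_cong[OF two_natural_vcomp[OF F t s]] have
    "two_natural (asrc F) (atgt F) (amap F) (amap H) (\<lambda>x\<in>ob (asrc F). c1 (atgt F) (s x) (t x))"
    by (simp add: two_functor_simps[OF F(1)])
  then show ?case using 3 by auto
next
  case (4 F t G)
  then have F: "two_functor (asrc F) (atgt F) (amap F)"
    and t: "two_natural (asrc F) (atgt F) (amap F) (amap G) t" and ext: "t \<in> extensional (ob (asrc F))" by (auto simp: mor_TwoCAT1)
  show ?case
    by (rule extensionalityI[OF _ ext]) (simp_all add: two_functor_simps[OF F] two_natural_simps[OF t])
next
  case (5 F t G)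
  then have F: "two_functor (asrc F) (atgt F) (amap F)"
    and t: "two_natural (asrc F) (atgt F) (amap F) (amap G) t" and ext: "t \<in> extensional (ob (asrc F))"
    and [simp]: "asrc G = asrc F" "atgt G = atgt F" by (auto simp: mor_TwoCAT1)
  show ?case
    by (rule extensionalityI[OF _ ext]) (simp_all add: two_functor_simps[OF F] two_natural_simps[OF t])
next
  case (6 E r F t G s H)
  then have F: "two_functor (asrc E) (atgt E) (amap F)"
    and t: "two_natural (asrc E) (atgt E) (amap F) (amap G) t"
    and r: "two_natural (asrc E) (atgt E) (amap E) (amap F) r"
    and s: "two_natural (asrc E) (atgt E) (amap G) (amap H) s" by (auto simp: mor_TwoCAT1)
  have "asrc F = asrc E" "atgt F = atgt E" using 6 by auto
  then show ?case
    by (intro extensionalityI[where A="ob (asrc E)"])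
      (simp_all add: two_functor_simps[OF F] two_natural_simps[OF t] two_natural_simps[OF s]
        two_natural_simps[OF r])
qed auto

lemma two_category_TwoCAT: "two_category (TwoCAT elts U)" (is "two_category ?T")
proof (rule two_categoryI, goal_cases)
  case (5 s t)
  let ?K = "asrc (asrc t)" and ?L = "atgt (asrc t)" and ?M = "atgt (asrc s)"
  have K: "large_two_category elts U ?K" "large_two_category elts U ?M"
    and F: "two_functor ?K ?L (amap (asrc t))" "two_functor ?K ?L (amap (atgt t))"
    and G: "two_functor ?L ?M (amap (asrc s))" "two_functor ?L ?M (amap (atgt s))"
    and t: "two_natural ?K ?L (amap (asrc t)) (amap (atgt t)) (amap t)"
    and s: "two_natural ?L ?M (amap (asrc s)) (amap (atgt s)) (amap s)"
    and [simp]: "asrc (atgt t) = ?K" "atgt (atgt t) = ?L" "asrc (atgt s) = ?L" "atgt (atgt s) = ?M" "asrc (asrc s) = ?L"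
    using 5 by (auto simp: cell_TwoCAT mor_TwoCAT1)
  have "two_natural ?K ?M (comp_two_fun (amap (asrc s)) (amap (asrc t)))
      (comp_two_fun (amap (atgt s)) (amap (atgt t)))
      (\<lambda>x. c1 ?M (amap s (on0 (amap (atgt t)) x)) (on1 (amap (asrc s)) (amap t x)))"
    by (rule two_natural_vcomp[OF two_functor_comp[OF F(1) G(1)] two_functor_comp[OF F(2) G(1)]
          two_functor_comp[OF F(2) G(2)] two_natural_lwhisker[OF F G(1) t] two_natural_rwhisker[OF F(2) s]])
  from two_natural_cong[OF this] show ?case
    using K two_functor_restrict[OF two_functor_comp[OF F(1) G(1)]]
      two_functor_restrict[OF two_functor_comp[OF F(2) G(2)]]
    by (auto simp: cell_TwoCAT mor_TwoCAT1 ext_restrict)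
next
  case (6 t)
  then have F: "two_functor (asrc (asrc t)) (atgt (asrc t)) (amap (asrc t))" "two_functor (asrc (asrc t)) (atgt (asrc t)) (amap (atgt t))"
    and t: "two_natural (asrc (asrc t)) (atgt (asrc t)) (amap (asrc t)) (amap (atgt t)) (amap t)"
    by (auto simp: cell_TwoCAT mor_TwoCAT1)
  have c: "category (TwoCAT1 elts U)" "asrc t \<in> arr (TwoCAT1 elts U)" "atgt t \<in> arr (TwoCAT1 elts U)"
    "asrc (atgt t) = asrc (asrc t)"
    using category_TwoCAT1 6 by (auto simp: cell_TwoCAT)
  have *: "cmp (TwoCAT1 elts U) (asrc t) (ide (TwoCAT1 elts U) (asrc (asrc t))) = asrc t"
    "cmp (TwoCAT1 elts U) (atgt t) (ide (TwoCAT1 elts U) (asrc (asrc t))) = atgt t"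
    using cat_simps(9)[OF c(1), of _ "asrc (asrc t)"] c(2-) by (auto simp del: TwoCAT1_sel(4,5))
  have "(\<lambda>x\<in>ob (asrc (asrc t)). c1 (atgt (asrc t)) (amap t x)
         (on1 (amap (asrc t)) (i1 (asrc (asrc t)) x))) = amap t"
  proof (rule extensionalityI[where A="ob (asrc (asrc t))"])
    show "amap t \<in> extensional (ob (asrc (asrc t)))" using 6 unfolding cell_TwoCAT by blast
  qed (simp_all add: two_functor_simps[OF F(1)] two_natural_simps[OF t])
  then show ?case
    using * by (cases t) (auto simp: two_functor_simps[OF F(1)] cong: restrict_cong)
next
  case (7 t)
  then have F: "two_functor (asrc (asrc t)) (atgt (asrc t)) (amap (asrc t))" "two_functor (asrc (asrc t)) (atgt (asrc t)) (amap (atgt t))"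
    and t: "two_natural (asrc (asrc t)) (atgt (asrc t)) (amap (asrc t)) (amap (atgt t)) (amap t)"
    by (auto simp: cell_TwoCAT mor_TwoCAT1)
  have c: "category (TwoCAT1 elts U)" "asrc t \<in> arr (TwoCAT1 elts U)" "atgt t \<in> arr (TwoCAT1 elts U)"
    "atgt (atgt t) = atgt (asrc t)" "asrc (atgt t) = asrc (asrc t)"
    using category_TwoCAT1 7 by (auto simp: cell_TwoCAT)
  have *: "cmp (TwoCAT1 elts U) (ide (TwoCAT1 elts U) (atgt (asrc t))) (asrc t) = asrc t"
    "cmp (TwoCAT1 elts U) (ide (TwoCAT1 elts U) (atgt (asrc t))) (atgt t) = atgt t"
    using cat_simps(10)[OF c(1), of _ "atgt (asrc t)"] c(2-) by (auto simp del: TwoCAT1_sel(4,5))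
  have "(\<lambda>x\<in>ob (asrc (asrc t)). c1 (atgt (asrc t)) (i1 (atgt (asrc t)) (on0 (amap (atgt t)) x))
         (amap t x)) = amap t"
  proof (rule extensionalityI[where A="ob (asrc (asrc t))"])
    show "amap t \<in> extensional (ob (asrc (asrc t)))" using 7 unfolding cell_TwoCAT by blast
  qed (simp_all add: two_functor_simps[OF F(1)] two_natural_simps[OF t])
  then show ?case
    using * c(4,5) by (intro arrow.expand)
     (simp_all add: two_functor_simps[OF F(1)] two_functor_simps[OF F(2)] two_natural_simps[OF t] cong: restrict_cong)
next
  case (8 r s t)
  let ?K = "asrc (asrc t)" and ?L = "atgt (asrc t)" and ?M = "atgt (asrc s)" and ?N = "atgt (asrc r)"
  have K: "asrc t \<in> arr (TwoCAT1 elts U)" "atgt t \<in> arr (TwoCAT1 elts U)"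
     "asrc s \<in> arr (TwoCAT1 elts U)" "atgt s \<in> arr (TwoCAT1 elts U)"
     "asrc r \<in> arr (TwoCAT1 elts U)" "atgt r \<in> arr (TwoCAT1 elts U)"
    and F: "two_functor ?K ?L (amap (asrc t))" "two_functor ?K ?L (amap (atgt t))"
    and G: "two_functor ?L ?M (amap (asrc s))" "two_functor ?L ?M (amap (atgt s))"
    and H: "two_functor ?M ?N (amap (asrc r))" "two_functor ?M ?N (amap (atgt r))"
    and t: "two_natural ?K ?L (amap (asrc t)) (amap (atgt t)) (amap t)"
    and s: "two_natural ?L ?M (amap (asrc s)) (amap (atgt s)) (amap s)"
    and r: "two_natural ?M ?N (amap (asrc r)) (amap (atgt r)) (amap r)"
    and [simp]: "asrc (atgt t) = ?K" "atgt (atgt t) = ?L" "asrc (atgt s) = ?L" "atgt (atgt s) = ?M" "asrc (asrc s) = ?L"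
      "asrc (atgt r) = ?M" "atgt (atgt r) = ?N" "asrc (asrc r) = ?M"
    using 8 by (auto simp: cell_TwoCAT mor_TwoCAT1)
  have *: "cmp (TwoCAT1 elts U) (asrc r) (cmp (TwoCAT1 elts U) (asrc s) (asrc t)) =
    cmp (TwoCAT1 elts U) (cmp (TwoCAT1 elts U) (asrc r) (asrc s)) (asrc t)"
    "cmp (TwoCAT1 elts U) (atgt r) (cmp (TwoCAT1 elts U) (atgt s) (atgt t)) =
    cmp (TwoCAT1 elts U) (cmp (TwoCAT1 elts U) (atgt r) (atgt s)) (atgt t)"
    by (intro cat_simps(11)[OF category_TwoCAT1, symmetric]; use K in simp)+
  show ?case
    using * by (auto simp: two_functor_simps[OF F(1)] two_functor_simps[OF F(2)]
        two_functor_simps[OF G(1)] two_functor_simps[OF G(2)] two_functor_simps[OF H(1)] two_functor_simps[OF H(2)]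
        two_natural_simps[OF t] two_natural_simps[OF s] two_natural_simps[OF r] cong: restrict_cong)
next
  case (9 G F)
  let ?K = "asrc F" and ?L = "atgt F" and ?M = "atgt G"
  have F: "two_functor ?K ?L (amap F)" and G: "two_functor ?L ?M (amap G)"
    using 9 by (auto simp: mor_TwoCAT1)
  show ?case using 9
    by (auto simp: two_functor_simps[OF F] two_functor_simps[OF G] cong: restrict_cong)
next
  case (10 d c b a)
  let ?K = "asrc (asrc a)" and ?L = "atgt (asrc a)" and ?M = "atgt (asrc c)"
  have F: "two_functor ?K ?L (amap (asrc a))" "two_functor ?K ?L (amap (atgt a))" "two_functor ?K ?L (amap (atgt b))"
    and G: "two_functor ?L ?M (amap (asrc c))" "two_functor ?L ?M (amap (atgt c))" "two_functor ?L ?M (amap (atgt d))"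
    and a: "two_natural ?K ?L (amap (asrc a)) (amap (atgt a)) (amap a)"
    and b: "two_natural ?K ?L (amap (atgt a)) (amap (atgt b)) (amap b)"
    and c: "two_natural ?L ?M (amap (asrc c)) (amap (atgt c)) (amap c)"
    and d: "two_natural ?L ?M (amap (atgt c)) (amap (atgt d)) (amap d)"
    and [simp]: "asrc (atgt a) = ?K" "atgt (atgt a) = ?L" "asrc (atgt c) = ?L" "atgt (atgt c) = ?M"
      "asrc (asrc c) = ?L" "asrc (asrc b) = ?K" "atgt (asrc b) = ?L" "atgt (asrc d) = ?M" "asrc b = atgt a" "asrc d = atgt c"
    using 10 by (auto simp: cell_TwoCAT mor_TwoCAT1)
  note [simp] = two_functor_simps[OF F(1)] two_functor_simps[OF F(2)] two_functor_simps[OF F(3)]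
     two_functor_simps[OF G(1)] two_functor_simps[OF G(2)] two_functor_simps[OF G(3)]
     two_natural_simps(1-3)[OF a] two_natural_simps(1-3)[OF b] two_natural_simps(1-3)[OF c] two_natural_simps(1-3)[OF d]
  have "c1 ?M (c1 ?M (amap d (on0 (amap (atgt b)) x)) (amap c (on0 (amap (atgt b)) x)))
      (on1 (amap (asrc c)) (c1 ?L (amap b x) (amap a x))) =
    c1 ?M (c1 ?M (amap d (on0 (amap (atgt b)) x)) (on1 (amap (atgt c)) (amap b x)))
      (c1 ?M (amap c (on0 (amap (atgt a)) x)) (on1 (amap (asrc c)) (amap a x)))"
    if x: "x \<in> ob ?K" for x
  proof -
    have "c1 ?M (amap c (on0 (amap (atgt b)) x)) (c1 ?M (on1 (amap (asrc c)) (amap b x)) z) =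
      c1 ?M (on1 (amap (atgt c)) (amap b x)) (c1 ?M (amap c (on0 (amap (atgt a)) x)) z)"
      if "z \<in> mor ?M" "t1 ?M z = on0 (amap (asrc c)) (on0 (amap (atgt a)) x)" for z
      using two_natural_simps(4)[OF c, of "amap b x"] x that
      by (simp flip: cat_simps(11))
    then show ?thesis using x by simp
  qed
  then show ?case by (auto cong: restrict_cong)
qed (auto simp: category_TwoCAT1 category_TwoCAT2 cell_TwoCAT)


section \<open>Slice 2-categories\<close>

lemma slice_sel [simp]:
  "cat1 (slice L x) = slice1 L x" "cat2 (slice L x) = slice2 L x"
  "hcmp (slice L x) b a = Arrow (cmp (slice1 L x) (asrc b) (asrc a)) (hcmp L (amap b) (amap a))
                          (cmp (slice1 L x) (atgt b) (atgt a))"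
  by (simp_all add: slice_def)

lemma slice1_sel [simp]:
  "obj (slice1 L x) = {p \<in> mor L. t1 L p = x}"
  "src (slice1 L x) = asrc" "tgt (slice1 L x) = atgt"
  "ide (slice1 L x) p = Arrow p (i1 L (s1 L p)) p"
  "cmp (slice1 L x) k h = Arrow (asrc h) (c1 L (amap k) (amap h)) (atgt k)"
  by (simp_all add: slice1_def)

lemma slice2_sel [simp]:
  "obj (slice2 L x) = arr (slice1 L x)"
  "src (slice2 L x) = asrc" "tgt (slice2 L x) = atgt"
  "ide (slice2 L x) h = Arrow h (i2 L (amap h)) h"
  "cmp (slice2 L x) b a = Arrow (asrc a) (c2 L (amap b) (amap a)) (atgt b)"
  by (simp_all add: slice2_def)

lemma arr_slice1:
  "h \<in> arr (slice1 L x) \<longleftrightarrow> asrc h \<in> mor L \<and> t1 L (asrc h) = x \<and> atgt h \<in> mor L \<and> t1 L (atgt h) = x \<and>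
     amap h \<in> mor L \<and> s1 L (amap h) = s1 L (asrc h) \<and> t1 L (amap h) = s1 L (atgt h) \<and>
     c1 L (atgt h) (amap h) = asrc h"
  by (cases h) (auto simp: slice1_def)

lemma arr_slice2:
  "a \<in> arr (slice2 L x) \<longleftrightarrow> asrc a \<in> arr (slice1 L x) \<and> atgt a \<in> arr (slice1 L x) \<and>
     asrc (asrc a) = asrc (atgt a) \<and> atgt (asrc a) = atgt (atgt a) \<and>
     amap a \<in> cell L \<and> s2 L (amap a) = amap (asrc a) \<and> t2 L (amap a) = amap (atgt a) \<and>
     hcmp L (i2 L (atgt (asrc a))) (amap a) = i2 L (asrc (asrc a))"
  by (cases a) (auto simp: slice2_def)

lemma two_category_slice:
  assumes [simp]: "two_category L"
  shows "two_category (slice L x)"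
proof -
  have c1: "category (slice1 L x)"
    unfolding slice1_def
  proof (rule category_arrowI, goal_cases)
    case (3 p h q k r)
    then have "c1 L r (c1 L k h) = c1 L (c1 L r k) h" by (intro cat_simps(11)[symmetric]) auto
    then show ?case using 3 by simp
  qed auto
  have c2: "category (slice2 L x)"
    unfolding slice2_def
  proof (rule category_arrowI, goal_cases)
    case (2 h)
    then show ?case by (auto simp: arr_slice1)
  next
    case (3 h a k b l)
    then have q: "i2 L (atgt h) \<in> cell L" "s2 L (i2 L (atgt h)) = atgt h" "t2 L (i2 L (atgt h)) = atgt h"
      and m: "b \<in> cell L" "a \<in> cell L" "s2 L b = t2 L a" and st: "s1 L (atgt h) = t1 L (s2 L a)"
      and p: "asrc h \<in> mor L"
      and e: "hcmp L (i2 L (atgt h)) b = i2 L (asrc h)" "hcmp L (i2 L (atgt h)) a = i2 L (asrc h)"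
      by (cases h; cases k; cases l; simp add: arr_slice1)+
    have "hcmp L (c2 L (i2 L (atgt h)) (i2 L (atgt h))) (c2 L b a) =
      c2 L (hcmp L (i2 L (atgt h)) b) (hcmp L (i2 L (atgt h)) a)"
      using q m st by (intro interchange) simp_all
    moreover have "c2 L (i2 L (atgt h)) (i2 L (atgt h)) = i2 L (atgt h)"
      using q cat_simps(9)[of "cat2 L" "i2 L (atgt h)" "atgt h"] by simp
    moreover have "c2 L (i2 L (asrc h)) (i2 L (asrc h)) = i2 L (asrc h)"
      using p cat_simps(9)[of "cat2 L" "i2 L (asrc h)" "asrc h"] by simp
    ultimately have "hcmp L (i2 L (atgt h)) (c2 L b a) = i2 L (asrc h)" using e by simp
    then show ?case using 3 m by simp
  qed auto
  have form: "\<exists>p h q m k. a = Arrow (Arrow p h q) m (Arrow p k q) \<and>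
      p \<in> mor L \<and> q \<in> mor L \<and> t1 L p = x \<and> t1 L q = x \<and> m \<in> cell L \<and> s2 L m = h \<and> t2 L m = k \<and>
      s1 L h = s1 L p \<and> t1 L h = s1 L q \<and> c1 L q h = p \<and> c1 L q k = p \<and>
      hcmp L (i2 L q) m = i2 L p \<and> h \<in> mor L \<and> k \<in> mor L \<and> s1 L k = s1 L p \<and> t1 L k = s1 L q"
    if "a \<in> arr (slice2 L x)" for a
    using that by (cases a; cases "asrc a"; cases "atgt a") (auto simp: arr_slice1 arr_slice2)
  show ?thesis
  proof (rule two_categoryI, goal_cases)
    case (5 b a)
    from form[OF 5(2)[unfolded slice_sel]] obtain p h q m k where a: "a = Arrow (Arrow p h q) m (Arrow p k q)"
      "p \<in> mor L" "q \<in> mor L" "t1 L p = x" "t1 L q = x" "m \<in> cell L" "s2 L m = h" "t2 L m = k"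
      "s1 L h = s1 L p" "t1 L h = s1 L q" "c1 L q h = p" "c1 L q k = p" "hcmp L (i2 L q) m = i2 L p"
      by blast
    from form[OF 5(1)[unfolded slice_sel]] 5(3) a(1) obtain h' r m' k' where b: "b = Arrow (Arrow q h' r) m' (Arrow q k' r)"
      "r \<in> mor L" "t1 L r = x" "m' \<in> cell L" "s2 L m' = h'" "t2 L m' = k'"
      "s1 L h' = s1 L q" "t1 L h' = s1 L r" "c1 L r h' = q" "c1 L r k' = q" "hcmp L (i2 L r) m' = i2 L q"
      by (auto simp del: two_cat_simps)
    have ty: "h \<in> mor L" "k \<in> mor L" "h' \<in> mor L" "k' \<in> mor L" "s1 L k = s1 L p" "t1 L k = s1 L q"
      "s1 L k' = s1 L q" "t1 L k' = s1 L r"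
      using a(6-10) b(4-8) by auto
    have "hcmp L (i2 L r) (hcmp L m' m) = hcmp L (hcmp L (i2 L r) m') m"
      using a(6-10) b(2,4-8) by (intro two_cat_simps(17)[symmetric]) simp_all
    then have "hcmp L (i2 L r) (hcmp L m' m) = i2 L p" using a b by simp
    moreover have "c1 L r (c1 L h' h) = c1 L (c1 L r h') h" "c1 L r (c1 L k' k) = c1 L (c1 L r k') k"
      using ty a(9,10) b(2,7,8) by (intro cat_simps(11)[symmetric]; simp)+
    then have "c1 L r (c1 L h' h) = p" "c1 L r (c1 L k' k) = p"
      unfolding a(11,12) b(9,10) by simp_all
    ultimately show ?case
      unfolding a(1) b(1) using a(2-10) b(2-8) ty by (simp add: arr_slice1 arr_slice2)
  next
    case (6 a)
    from form[OF 6[unfolded slice_sel]] show ?case by (elim exE conjE) simp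
  next
    case (7 a)
    from form[OF 7[unfolded slice_sel]] show ?case by (elim exE conjE) simp
  next
    case (8 c b a)
    from form[OF 8(1)[unfolded slice_sel]] form[OF 8(2)[unfolded slice_sel]]
      form[OF 8(3)[unfolded slice_sel]] 8(4,5) show ?case by (elim exE conjE) simp
  next
    case (10 d c b a)
    from form[OF 10(1)[unfolded slice_sel]] form[OF 10(2)[unfolded slice_sel]]
      form[OF 10(3)[unfolded slice_sel]] form[OF 10(4)[unfolded slice_sel]] 10(5-7) show ?case
      by (elim exE conjE) (simp add: interchange)
  qed (auto simp: c1 c2 arr_slice2 arr_slice1)
qed

text \<open>The functor to the slice over the image of a terminal object only adds the projections: the
  triangles commute because any two parallel 1-cells or 2-cells into a terminal object agree.\<close>

lemma to_terminal:
  assumes "terminal_object K t" "x \<in> ob K"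
  shows "to_terminal K t x \<in> mor K" "s1 K (to_terminal K t x) = x" "t1 K (to_terminal K t x) = t"
proof -
  have "\<exists>!f. f \<in> mor K \<and> s1 K f = x \<and> t1 K f = t" using assms unfolding terminal_object_def by blast
  from theI'[OF this] show "to_terminal K t x \<in> mor K" "s1 K (to_terminal K t x) = x"
    "t1 K (to_terminal K t x) = t" unfolding to_terminal_def by blast+
qed

lemma terminal_unique1:
  assumes "terminal_object K t" "f \<in> mor K" "g \<in> mor K" "s1 K f = s1 K g" "t1 K f = t" "t1 K g = t"
    "two_category K"
  shows "f = g"
proof -
  have "s1 K f \<in> ob K" using assms by simp
  then have "\<exists>!h. h \<in> mor K \<and> s1 K h = s1 K f \<and> t1 K h = t"
    using assms(1) unfolding terminal_object_def by blast
  then show ?thesis using assms(2-6) by auto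
qed

lemma terminal_unique2:
  assumes "terminal_object K t" "a \<in> cell K" "b \<in> cell K" "s1 K (s2 K a) = s1 K (s2 K b)"
    "t1 K (s2 K a) = t" "t1 K (s2 K b) = t" "two_category K"
  shows "a = b"
proof -
  have "s1 K (s2 K a) \<in> ob K" using assms by simp
  then have "\<exists>!c. c \<in> cell K \<and> s1 K (s2 K c) = s1 K (s2 K a) \<and> t1 K (s2 K c) = t"
    using assms(1) unfolding terminal_object_def by simp
  then show ?thesis using assms(2-6) by auto
qed

lemma two_functor_lift_to_slice:
  assumes R: "two_functor K L R" and t: "terminal_object K t"
  shows "two_functor K (slice L (on0 R t)) (lift_to_slice K t R)"
proof -
  note [simp] = two_functor_simps[OF R] to_terminal[OF t]
  have tt: "f \<in> mor K \<Longrightarrow> c1 L (on1 R (to_terminal K t (t1 K f))) (on1 R f) = on1 R (to_terminal K t (s1 K f))" for f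
    using terminal_unique1[OF t, of "c1 K (to_terminal K t (t1 K f)) f" "to_terminal K t (s1 K f)"]
    by (simp flip: two_functor_simps(8)[OF R])
  have tt2: "a \<in> cell K \<Longrightarrow> hcmp L (i2 L (on1 R (to_terminal K t (t1 K (s2 K a))))) (on2 R a) =
     i2 L (on1 R (to_terminal K t (s1 K (s2 K a))))" for a
    using terminal_unique2[OF t, of "hcmp K (i2 K (to_terminal K t (t1 K (s2 K a)))) a" "i2 K (to_terminal K t (s1 K (s2 K a)))"]
    by (simp flip: two_functor_simps(12,14)[OF R])
  have tt': "a \<in> cell K \<Longrightarrow> c1 L (on1 R (to_terminal K t (t1 K (s2 K a)))) (on1 R (t2 K a)) =
     on1 R (to_terminal K t (s1 K (s2 K a)))" for a
    using tt[of "t2 K a"] by simp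
  show ?thesis
    by (rule two_functorI)
      (auto simp: two_category_slice lift_to_slice_def Let_def arr_slice1 arr_slice2 tt tt' tt2)
qed


section \<open>Left 2-adjoints from universal arrows\<close>

text \<open>The functor and the counit are obtained from the universal arrows by choice; uniqueness of factorizations
  makes the choices functorial and natural.\<close>

locale universal_arrows =
  fixes X :: "('o, 'a) cat" and Y :: "('p, 'b) cat" and G0 :: "'o \<Rightarrow> 'p" and G1 :: "'a \<Rightarrow> 'b"
    and F0 :: "'p \<Rightarrow> 'o" and u :: "'p \<Rightarrow> 'b"
  assumes X [simp]: "category X" and Y [simp]: "category Y" and G: "cat_functor X Y G0 G1"
    and F0 [simp]: "y \<in> obj Y \<Longrightarrow> F0 y \<in> obj X"
    and u [simp]: "y \<in> obj Y \<Longrightarrow> u y \<in> arr Y" "y \<in> obj Y \<Longrightarrow> src Y (u y) = y"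
      "y \<in> obj Y \<Longrightarrow> tgt Y (u y) = G0 (F0 y)"
    and ex: "\<And>y x h. y \<in> obj Y \<Longrightarrow> x \<in> obj X \<Longrightarrow> h \<in> arr Y \<Longrightarrow> src Y h = y \<Longrightarrow> tgt Y h = G0 x \<Longrightarrow>
      \<exists>k. k \<in> arr X \<and> src X k = F0 y \<and> tgt X k = x \<and> cmp Y (G1 k) (u y) = h"
    and uniq: "\<And>y k k'. y \<in> obj Y \<Longrightarrow> k \<in> arr X \<Longrightarrow> k' \<in> arr X \<Longrightarrow> src X k = F0 y \<Longrightarrow> src X k' = F0 y \<Longrightarrow>
      tgt X k = tgt X k' \<Longrightarrow> cmp Y (G1 k) (u y) = cmp Y (G1 k') (u y) \<Longrightarrow> k = k'"
begin

lemmas G_simps [simp] = cat_functor_simps[OF G]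

definition extension :: "'b \<Rightarrow> 'o \<Rightarrow> 'a" where
  "extension h x = (SOME k. k \<in> arr X \<and> src X k = F0 (src Y h) \<and> tgt X k = x \<and>
     cmp Y (G1 k) (u (src Y h)) = h)"

lemma extension:
  assumes "h \<in> arr Y" "x \<in> obj X" "tgt Y h = G0 x"
  shows "extension h x \<in> arr X" "src X (extension h x) = F0 (src Y h)" "tgt X (extension h x) = x"
    "cmp Y (G1 (extension h x)) (u (src Y h)) = h"
  using someI_ex[OF ex[of "src Y h" x h]] assms unfolding extension_def by simp_all

definition F1 :: "'b \<Rightarrow> 'a" where
  "F1 f = extension (cmp Y (u (tgt Y f)) f) (F0 (tgt Y f))"

definition counit :: "'o \<Rightarrow> 'a" where
  "counit x = extension (ide Y (G0 x)) x"

lemma F1 [simp]: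
  assumes "f \<in> arr Y"
  shows "F1 f \<in> arr X" "src X (F1 f) = F0 (src Y f)" "tgt X (F1 f) = F0 (tgt Y f)"
    "cmp Y (G1 (F1 f)) (u (src Y f)) = cmp Y (u (tgt Y f)) f"
  using extension[of "cmp Y (u (tgt Y f)) f" "F0 (tgt Y f)"] assms by (simp_all add: F1_def)

lemma F1': 
  assumes "f \<in> arr Y" "z \<in> arr Y" "tgt Y z = src Y f"
  shows "cmp Y (G1 (F1 f)) (cmp Y (u (src Y f)) z) = cmp Y (u (tgt Y f)) (cmp Y f z)"
  using assms by (simp flip: cat_simps(11))

lemma counit [simp]:
  assumes "x \<in> obj X"
  shows "counit x \<in> arr X" "src X (counit x) = F0 (G0 x)" "tgt X (counit x) = x"
    "cmp Y (G1 (counit x)) (u (G0 x)) = ide Y (G0 x)"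
  using extension[of "ide Y (G0 x)" x] assms by (simp_all add: counit_def)

lemma counit':
  assumes "x \<in> obj X" "z \<in> arr Y" "tgt Y z = G0 x"
  shows "cmp Y (G1 (counit x)) (cmp Y (u (G0 x)) z) = z"
  using assms by (simp flip: cat_simps(11))

lemma functor_F: "cat_functor Y X F0 F1"
  unfolding cat_functor_def composable_def
proof (intro conjI ballI allI impI)
  fix y assume y: "y \<in> obj Y"
  show "F1 (ide Y y) = ide X (F0 y)"
    by (rule uniq[of y]) (use y F1(4)[of "ide Y y"] in simp_all)
next
  fix g f assume "g \<in> arr Y \<and> f \<in> arr Y \<and> src Y g = tgt Y f"
  then show "F1 (cmp Y g f) = cmp X (F1 g) (F1 f)"
    using F1(4)[of "cmp Y g f"] F1'[of g f]
    by (intro uniq[of "src Y f"]) simp_all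
qed simp_all

lemma counit_natural:
  assumes "k \<in> arr X"
  shows "cmp X k (counit (src X k)) = cmp X (counit (tgt X k)) (F1 (G1 k))"
  using assms F1(4)[of "G1 k"]
  by (intro uniq[of "G0 (src X k)"]) (simp_all add: counit')

lemma counit_unit:
  assumes "y \<in> obj Y" shows "cmp X (counit (F0 y)) (F1 (u y)) = ide X (F0 y)"
  using assms F1(4)[of "u y"]
  by (intro uniq[of y]) (simp_all add: counit')

end

text \<open>A universal arrow in the 2-categorical sense is at the same time one for the underlying
  categories and one for the categories of 0-cells and 2-cells, so that the 1-categorical construction
  of the left adjoint applies twice; universality for 2-cells makes the two results agree.\<close>

lemma has_left_2adjointI:
  fixes G :: "('o, 'a, 'c, 'p, 'b, 'd) two_fun"
  assumes G: "two_functor X Y G"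
    and F0: "\<And>y. y \<in> ob Y \<Longrightarrow> F0 y \<in> ob X"
    and u: "\<And>y. y \<in> ob Y \<Longrightarrow> u y \<in> mor Y \<and> s1 Y (u y) = y \<and> t1 Y (u y) = on0 G (F0 y)"
    and ex1: "\<And>y x h. y \<in> ob Y \<Longrightarrow> x \<in> ob X \<Longrightarrow> h \<in> mor Y \<Longrightarrow> s1 Y h = y \<Longrightarrow> t1 Y h = on0 G x \<Longrightarrow>
      \<exists>k. k \<in> mor X \<and> s1 X k = F0 y \<and> t1 X k = x \<and> c1 Y (on1 G k) (u y) = h"
    and uniq1: "\<And>y k k'. y \<in> ob Y \<Longrightarrow> k \<in> mor X \<Longrightarrow> k' \<in> mor X \<Longrightarrow> s1 X k = F0 y \<Longrightarrow> s1 X k' = F0 y \<Longrightarrow>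
      t1 X k = t1 X k' \<Longrightarrow> c1 Y (on1 G k) (u y) = c1 Y (on1 G k') (u y) \<Longrightarrow> k = k'"
    and ex2: "\<And>y k k' b. y \<in> ob Y \<Longrightarrow> k \<in> mor X \<Longrightarrow> k' \<in> mor X \<Longrightarrow> s1 X k = F0 y \<Longrightarrow> s1 X k' = F0 y \<Longrightarrow>
      t1 X k = t1 X k' \<Longrightarrow> b \<in> cell Y \<Longrightarrow> s2 Y b = c1 Y (on1 G k) (u y) \<Longrightarrow> t2 Y b = c1 Y (on1 G k') (u y) \<Longrightarrow>
      \<exists>a. a \<in> cell X \<and> s2 X a = k \<and> t2 X a = k' \<and> hcmp Y (on2 G a) (i2 Y (u y)) = b"
    and uniq2: "\<And>y a a'. y \<in> ob Y \<Longrightarrow> a \<in> cell X \<Longrightarrow> a' \<in> cell X \<Longrightarrow> s2 X a = s2 X a' \<Longrightarrow> t2 X a = t2 X a' \<Longrightarrow>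
      s1 X (s2 X a) = F0 y \<Longrightarrow>
      hcmp Y (on2 G a) (i2 Y (u y)) = hcmp Y (on2 G a') (i2 Y (u y)) \<Longrightarrow> a = a'"
  shows "has_left_2adjoint X Y G"
proof -
  note [simp] = two_functor_simps[OF G]
  interpret I1: universal_arrows "cat1 X" "cat1 Y" "on0 G" "on1 G" F0 u
    using G u F0 ex1 uniq1 by unfold_locales (simp_all add: two_functor_def)
  have sk: "s2 X k = s2 X k' \<and> t2 X k = t2 X k'"
    if "y \<in> ob Y" "k \<in> cell X" "k' \<in> cell X" "s1 X (s2 X k) = F0 y" "s1 X (s2 X k') = F0 y"
      "t1 X (s2 X k) = t1 X (s2 X k')" "hcmp Y (on2 G k) (i2 Y (u y)) = hcmp Y (on2 G k') (i2 Y (u y))" for y k k'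
  proof -
    have "c1 Y (on1 G (s2 X k)) (u y) = c1 Y (on1 G (s2 X k')) (u y)"
      "c1 Y (on1 G (t2 X k)) (u y) = c1 Y (on1 G (t2 X k')) (u y)"
      using arg_cong[OF that(7), of "s2 Y"] arg_cong[OF that(7), of "t2 Y"] that(1-6) by (simp_all add: u)
    then show ?thesis using that(1-6) by (intro conjI uniq1[of y]) (simp_all add: u)
  qed
  interpret I2: universal_arrows "hcat X" "hcat Y" "on0 G" "on2 G" F0 "\<lambda>y. i2 Y (u y)"
  proof (unfold_locales, goal_cases)
    case (8 y x h)
    have "s2 Y h \<in> mor Y" "t2 Y h \<in> mor Y" using 8 by auto
    then obtain k k' where "k \<in> mor X" "s1 X k = F0 y" "t1 X k = x" "c1 Y (on1 G k) (u y) = s2 Y h"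
      "k' \<in> mor X" "s1 X k' = F0 y" "t1 X k' = x" "c1 Y (on1 G k') (u y) = t2 Y h"
      using ex1[of y x "s2 Y h"] ex1[of y x "t2 Y h"] 8 by auto
    then show ?case using ex2[of y k k' h] 8 by auto
  next
    case (9 y k k')
    then show ?case using sk[of y k k'] by (intro uniq2[of y]) simp_all
  qed (use G u F0 in \<open>simp_all add: two_functor_def\<close>)
  have s2F: "s2 X (I2.F1 b) = I1.F1 (s2 Y b) \<and> t2 X (I2.F1 b) = I1.F1 (t2 Y b)" if b: "b \<in> cell Y" for b
  proof -
    have "s2 Y (hcmp Y (on2 G (I2.F1 b)) (i2 Y (u (s1 Y (s2 Y b))))) = s2 Y (hcmp Y (i2 Y (u (t1 Y (s2 Y b)))) b)"
      "t2 Y (hcmp Y (on2 G (I2.F1 b)) (i2 Y (u (s1 Y (s2 Y b))))) = t2 Y (hcmp Y (i2 Y (u (t1 Y (s2 Y b)))) b)"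
      using I2.F1(4)[of b] b by simp_all
    then show ?thesis using b I2.F1(1-3)[of b] I1.F1(4)[of "s2 Y b"] I1.F1(4)[of "t2 Y b"]
      by (intro conjI uniq1[of "s1 Y (s2 Y b)"]) (simp_all add: u)
  qed
  have iF: "I2.F1 (i2 Y f) = i2 X (I1.F1 f)" if f: "f \<in> mor Y" for f
    using f I2.F1[of "i2 Y f"] by (intro I2.uniq[of "s1 Y f"]) (simp_all add: u)
  have counit: "I2.counit x = i2 X (I1.counit x)" if x: "x \<in> ob X" for x
    using x I2.counit[of x] by (intro I2.uniq[of "on0 G x"]) (simp_all add: u)
  have cF: "I2.F1 (c2 Y b a) = c2 X (I2.F1 b) (I2.F1 a)"
    if ba: "b \<in> cell Y" "a \<in> cell Y" "s2 Y b = t2 Y a" for b a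
  proof (rule uniq2[of "s1 Y (s2 Y a)"])
    let ?x = "s1 Y (s2 Y a)" and ?y = "t1 Y (s2 Y a)"
    have st: "s1 Y (s2 Y b) = ?x" "t1 Y (s2 Y b) = ?y" using ba by simp_all
    note * = s2F[OF ba(1)] s2F[OF ba(2)] I2.F1[of b] I2.F1[of a]
    have "hcmp Y (on2 G (I2.F1 (c2 Y b a))) (i2 Y (u ?x)) = hcmp Y (i2 Y (u ?y)) (c2 Y b a)"
      using ba I2.F1(4)[of "c2 Y b a"] by simp
    also have "\<dots> = hcmp Y (c2 Y (i2 Y (u ?y)) (i2 Y (u ?y))) (c2 Y b a)"
      using ba by (simp add: u)
    also have "\<dots> = c2 Y (hcmp Y (i2 Y (u ?y)) b) (hcmp Y (i2 Y (u ?y)) a)"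
      using ba st by (intro interchange) (simp_all add: u)
    also have "\<dots> = c2 Y (hcmp Y (on2 G (I2.F1 b)) (i2 Y (u ?x))) (hcmp Y (on2 G (I2.F1 a)) (i2 Y (u ?x)))"
      using ba st * by simp
    also have "\<dots> = hcmp Y (c2 Y (on2 G (I2.F1 b)) (on2 G (I2.F1 a))) (c2 Y (i2 Y (u ?x)) (i2 Y (u ?x)))"
      using ba st * by (intro interchange[symmetric]) (simp_all add: u)
    also have "\<dots> = hcmp Y (on2 G (c2 X (I2.F1 b) (I2.F1 a))) (i2 Y (u ?x))"
      using ba st * by (simp add: u)
    finally show "hcmp Y (on2 G (I2.F1 (c2 Y b a))) (i2 Y (u ?x)) =
      hcmp Y (on2 G (c2 X (I2.F1 b) (I2.F1 a))) (i2 Y (u ?x))" .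
  qed (use ba I2.F1[of "c2 Y b a"] I2.F1[of b] I2.F1[of a] s2F in simp_all)
  let ?F = "\<lparr>on0 = F0, on1 = I1.F1, on2 = I2.F1\<rparr>"
  have F: "two_functor Y X ?F"
    unfolding two_functor_def cat_functor_def[of "cat2 Y"] composable_def
    using I1.functor_F I2.functor_F s2F iF cF I2.F1 by simp
  have "two_natural Y Y id_two_fun (comp_two_fun G ?F) u"
    by (rule two_naturalI) (use I1.F1(4) I2.F1(4) in \<open>simp_all add: u F0\<close>)
  moreover have "two_natural X X (comp_two_fun ?F G) id_two_fun I1.counit"
    by (rule two_naturalI) (use I1.counit_natural I2.counit_natural counit in simp_all)
  ultimately show ?thesis
    unfolding has_left_2adjoint_def using G F I1.counit(4) I1.counit_unit
    by (intro conjI exI[of _ ?F] exI[of _ u] exI[of _ I1.counit]) simp_all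
qed


section \<open>Transport of a 2-category along a coding of its cells\<close>

definition coded :: "('o \<Rightarrow> 'v) \<Rightarrow> ('a \<Rightarrow> 'v) \<Rightarrow> ('c \<Rightarrow> 'v) \<Rightarrow> ('o, 'a, 'c) two_cat \<Rightarrow> 'v ltwo_cat" where
  "coded d0 d1 d2 E = \<lparr>cat1 = coded_cat d0 d1 (cat1 E), cat2 = coded_cat d1 d2 (cat2 E),
     hcmp = cmp (coded_cat d0 d2 (hcat E))\<rparr>"

text \<open>The cells of \<open>E\<close> are records, the cells of its copy \<open>K\<close> are their codes. Injectivity on the cells of \<open>E\<close> is all
  that the transport needs, so the shape of the codes only matters for their size.\<close>

locale coding =
  fixes E :: "('o, 'a, 'c) two_cat" and d0 :: "'o \<Rightarrow> 'v" and d1 :: "'a \<Rightarrow> 'v" and d2 :: "'c \<Rightarrow> 'v"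
  assumes E [simp]: "two_category E" and inj0: "inj_on d0 (ob E)" and inj1: "inj_on d1 (mor E)"
    and inj2: "inj_on d2 (cell E)"
begin

abbreviation "K \<equiv> coded d0 d1 d2 E"

lemma coded_sel [simp]:
  "ob K = d0 ` ob E" "mor K = d1 ` mor E" "obj (cat2 K) = d1 ` mor E" "cell K = d2 ` cell E"
  by (simp_all add: coded_def coded_cat_def)

lemma inv0 [simp]: "x \<in> ob E \<Longrightarrow> inv_into (ob E) d0 (d0 x) = x"
  and inv1 [simp]: "f \<in> mor E \<Longrightarrow> inv_into (mor E) d1 (d1 f) = f"
  and inv2 [simp]: "a \<in> cell E \<Longrightarrow> inv_into (cell E) d2 (d2 a) = a"
  by (simp_all add: inj0 inj1 inj2)

lemma coded_ops [simp]:
  "f \<in> mor E \<Longrightarrow> s1 K (d1 f) = d0 (s1 E f)" "f \<in> mor E \<Longrightarrow> t1 K (d1 f) = d0 (t1 E f)"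
  "x \<in> ob E \<Longrightarrow> i1 K (d0 x) = d1 (i1 E x)"
  "g \<in> mor E \<Longrightarrow> f \<in> mor E \<Longrightarrow> s1 E g = t1 E f \<Longrightarrow> c1 K (d1 g) (d1 f) = d1 (c1 E g f)"
  "a \<in> cell E \<Longrightarrow> s2 K (d2 a) = d1 (s2 E a)" "a \<in> cell E \<Longrightarrow> t2 K (d2 a) = d1 (t2 E a)"
  "f \<in> mor E \<Longrightarrow> i2 K (d1 f) = d2 (i2 E f)"
  "b \<in> cell E \<Longrightarrow> a \<in> cell E \<Longrightarrow> s2 E b = t2 E a \<Longrightarrow> c2 K (d2 b) (d2 a) = d2 (c2 E b a)"
  "b \<in> cell E \<Longrightarrow> a \<in> cell E \<Longrightarrow> s1 E (s2 E b) = t1 E (s2 E a) \<Longrightarrow> hcmp K (d2 b) (d2 a) = d2 (hcmp E b a)"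
  by (simp_all add: coded_def coded_cat_def recode_def composable_def)

lemma d0_eq [simp]: "x \<in> ob E \<Longrightarrow> y \<in> ob E \<Longrightarrow> d0 x = d0 y \<longleftrightarrow> x = y"
  and d1_eq [simp]: "f \<in> mor E \<Longrightarrow> g \<in> mor E \<Longrightarrow> d1 f = d1 g \<longleftrightarrow> f = g"
  and d2_eq [simp]: "a \<in> cell E \<Longrightarrow> b \<in> cell E \<Longrightarrow> d2 a = d2 b \<longleftrightarrow> a = b"
  using inj0 inj1 inj2 by (auto simp: inj_on_def)

lemma category_coded:
  "category C \<Longrightarrow> inj_on d (obj C) \<Longrightarrow> inj_on e (arr C) \<Longrightarrow> category (coded_cat d e C)"
  unfolding category_def[of "coded_cat d e C"]
  by (auto simp: coded_cat_def recode_def composable_def inj_on_eq_iff)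

lemma two_category_coded: "two_category K"
proof -
  have 1: "category (cat1 K)" "category (cat2 K)"
    by (simp_all add: coded_def category_coded inj0 inj1 inj2)
  show ?thesis by (rule two_categoryI) (auto simp: 1 interchange)
qed

definition dec :: "('v, 'v, 'v, 'o, 'a, 'c) two_fun" where
  "dec = \<lparr>on0 = inv_into (ob E) d0, on1 = inv_into (mor E) d1, on2 = inv_into (cell E) d2\<rparr>"

definition enc :: "('o, 'a, 'c, 'v, 'v, 'v) two_fun" where
  "enc = \<lparr>on0 = d0, on1 = d1, on2 = d2\<rparr>"

lemma enc_dec_sel [simp]:
  "on0 enc = d0" "on1 enc = d1" "on2 enc = d2"
  "on0 dec = inv_into (ob E) d0" "on1 dec = inv_into (mor E) d1" "on2 dec = inv_into (cell E) d2"
  by (simp_all add: enc_def dec_def)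

lemma two_functor_enc: "two_functor E K enc"
  by (rule two_functorI) (simp_all add: two_category_coded)

lemma two_functor_dec: "two_functor K E dec"
  by (rule two_functorI) (auto simp: two_category_coded)

lemma ext_coded: "ext_cat (cat1 K)" "ext_cat (cat2 K)" "\<not> composable (hcat K) b a \<Longrightarrow> hcmp K b a = undefined"
  by (auto simp: coded_def coded_cat_def ext_cat_def recode_def composable_def)

end


section \<open>Pseudo double categories\<close>

abbreviation "hors D \<equiv> obj (ccat D)"
abbreviation "cells D \<equiv> arr (ccat D)"
abbreviation "ctop D \<equiv> src (ccat D)"
abbreviation "cbot D \<equiv> tgt (ccat D)"
abbreviation "cid D \<equiv> ide (ccat D)"
abbreviation "objs D \<equiv> obj (vcat D)"
abbreviation "vers D \<equiv> arr (vcat D)"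
abbreviation "vsrc D \<equiv> src (vcat D)"
abbreviation "vtgt D \<equiv> tgt (vcat D)"
abbreviation "vid D \<equiv> ide (vcat D)"
abbreviation "vcmp D \<equiv> cmp (vcat D)"

lemma inverses_unique:
  assumes "category C" "inverses C f g" "inverses C f h" shows "g = h"
proof -
  have *: "f \<in> arr C" "g \<in> arr C" "h \<in> arr C" "src C f = tgt C g" "src C g = tgt C f"
     "src C f = tgt C h" "src C h = tgt C f" "cmp C g f = ide C (src C f)" "cmp C f h = ide C (tgt C f)"
    using assms unfolding inverses_def composable_def by auto
  have "g = cmp C g (cmp C f h)" using * assms(1) by simp
  also have "\<dots> = cmp C (cmp C g f) h" using * assms(1) by (intro cat_simps(11)[symmetric]) auto
  also have "\<dots> = h" using * assms(1) by simp
  finally show ?thesis .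
qed

lemma inverse_of_eq: "category C \<Longrightarrow> inverses C f g \<Longrightarrow> inverse_of C f = g"
  unfolding inverse_of_def by (blast intro: inverses_unique)

lemma inverse_of_ide [simp]: "category C \<Longrightarrow> x \<in> obj C \<Longrightarrow> inverse_of C (ide C x) = ide C x"
  by (rule inverse_of_eq) (simp_all add: inverses_def composable_def)

lemma pd_simps [simp]:
  assumes "pseudo_double_category D"
  shows "category (vcat D)" "category (ccat D)"
    and "g \<in> hors D \<Longrightarrow> hsrc D g \<in> objs D" "g \<in> hors D \<Longrightarrow> htgt D g \<in> objs D"
    and "x \<in> cells D \<Longrightarrow> cleft D x \<in> vers D" "x \<in> cells D \<Longrightarrow> cright D x \<in> vers D"
    and "x \<in> cells D \<Longrightarrow> vsrc D (cleft D x) = hsrc D (ctop D x)"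
    and "x \<in> cells D \<Longrightarrow> vtgt D (cleft D x) = hsrc D (cbot D x)"
    and "x \<in> cells D \<Longrightarrow> vsrc D (cright D x) = htgt D (ctop D x)"
    and "x \<in> cells D \<Longrightarrow> vtgt D (cright D x) = htgt D (cbot D x)"
    and "g \<in> hors D \<Longrightarrow> cleft D (cid D g) = vid D (hsrc D g)"
    and "g \<in> hors D \<Longrightarrow> cright D (cid D g) = vid D (htgt D g)"
    and "y \<in> cells D \<Longrightarrow> x \<in> cells D \<Longrightarrow> ctop D y = cbot D x \<Longrightarrow>
      cleft D (cmp (ccat D) y x) = vcmp D (cleft D y) (cleft D x)"
    and "y \<in> cells D \<Longrightarrow> x \<in> cells D \<Longrightarrow> ctop D y = cbot D x \<Longrightarrow>
      cright D (cmp (ccat D) y x) = vcmp D (cright D y) (cright D x)"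
    and "a \<in> objs D \<Longrightarrow> hid D a \<in> hors D" "a \<in> objs D \<Longrightarrow> hsrc D (hid D a) = a"
    and "a \<in> objs D \<Longrightarrow> htgt D (hid D a) = a"
    and "u \<in> vers D \<Longrightarrow> chid D u \<in> cells D" "u \<in> vers D \<Longrightarrow> ctop D (chid D u) = hid D (vsrc D u)"
    and "u \<in> vers D \<Longrightarrow> cbot D (chid D u) = hid D (vtgt D u)"
    and "u \<in> vers D \<Longrightarrow> cleft D (chid D u) = u" "u \<in> vers D \<Longrightarrow> cright D (chid D u) = u"
    and "a \<in> objs D \<Longrightarrow> chid D (vid D a) = cid D (hid D a)"
    and "v \<in> vers D \<Longrightarrow> u \<in> vers D \<Longrightarrow> vsrc D v = vtgt D u \<Longrightarrow>
      chid D (vcmp D v u) = cmp (ccat D) (chid D v) (chid D u)"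
    and "g \<in> hors D \<Longrightarrow> d \<in> hors D \<Longrightarrow> htgt D g = hsrc D d \<Longrightarrow> hcomp D g d \<in> hors D"
    and "g \<in> hors D \<Longrightarrow> d \<in> hors D \<Longrightarrow> htgt D g = hsrc D d \<Longrightarrow> hsrc D (hcomp D g d) = hsrc D g"
    and "g \<in> hors D \<Longrightarrow> d \<in> hors D \<Longrightarrow> htgt D g = hsrc D d \<Longrightarrow> htgt D (hcomp D g d) = htgt D d"
    and "x \<in> cells D \<Longrightarrow> y \<in> cells D \<Longrightarrow> cright D x = cleft D y \<Longrightarrow> chcomp D x y \<in> cells D"
    and "x \<in> cells D \<Longrightarrow> y \<in> cells D \<Longrightarrow> cright D x = cleft D y \<Longrightarrow>
      ctop D (chcomp D x y) = hcomp D (ctop D x) (ctop D y)"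
    and "x \<in> cells D \<Longrightarrow> y \<in> cells D \<Longrightarrow> cright D x = cleft D y \<Longrightarrow>
      cbot D (chcomp D x y) = hcomp D (cbot D x) (cbot D y)"
    and "x \<in> cells D \<Longrightarrow> y \<in> cells D \<Longrightarrow> cright D x = cleft D y \<Longrightarrow> cleft D (chcomp D x y) = cleft D x"
    and "x \<in> cells D \<Longrightarrow> y \<in> cells D \<Longrightarrow> cright D x = cleft D y \<Longrightarrow> cright D (chcomp D x y) = cright D y"
    and "g \<in> hors D \<Longrightarrow> d \<in> hors D \<Longrightarrow> htgt D g = hsrc D d \<Longrightarrow>
      chcomp D (cid D g) (cid D d) = cid D (hcomp D g d)"
  using assms unfolding pseudo_double_category_def cat_functor_def composable_def hcomposable_def
    chcomposable_def cell_over_def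
  by auto

lemma htgt_hsrc [simp]:
  assumes "pseudo_double_category D" "x \<in> cells D" "y \<in> cells D" "cright D x = cleft D y"
  shows "(htgt D (ctop D x) = hsrc D (ctop D y)) = True" "(htgt D (cbot D x) = hsrc D (cbot D y)) = True"
  using assms pd_simps(7-10)[OF assms(1)] by metis+

locale pdc =
  fixes D :: "'v psdbl"
  assumes pd [simp]: "pseudo_double_category D"
begin

abbreviation vert (infixr "\<odot>" 60) where "y \<odot> x \<equiv> cmp (ccat D) y x"
abbreviation tens (infixr "\<otimes>" 70) where "x \<otimes> y \<equiv> chcomp D x y"
abbreviation "lu \<equiv> hlunit D"
abbreviation "ru \<equiv> hrunit D"
abbreviation "as \<equiv> hassoc D"
abbreviation "li g \<equiv> inverse_of (ccat D) (lu g)"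
abbreviation "ri g \<equiv> inverse_of (ccat D) (ru g)"
abbreviation "ai g d e \<equiv> inverse_of (ccat D) (as g d e)"

lemma ichg:
  "x' \<in> cells D \<Longrightarrow> x \<in> cells D \<Longrightarrow> y' \<in> cells D \<Longrightarrow> y \<in> cells D \<Longrightarrow> ctop D x' = cbot D x \<Longrightarrow>
   ctop D y' = cbot D y \<Longrightarrow> cright D x = cleft D y \<Longrightarrow> cright D x' = cleft D y' \<Longrightarrow>
   (x' \<otimes> y') \<odot> (x \<otimes> y) = (x' \<odot> x) \<otimes> (y' \<odot> y)"
  using pd unfolding pseudo_double_category_def composable_def chcomposable_def by auto

lemma ichg':
  "x' \<in> cells D \<Longrightarrow> x \<in> cells D \<Longrightarrow> y' \<in> cells D \<Longrightarrow> y \<in> cells D \<Longrightarrow> ctop D x' = cbot D x \<Longrightarrow>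
   ctop D y' = cbot D y \<Longrightarrow> cright D x = cleft D y \<Longrightarrow> cright D x' = cleft D y' \<Longrightarrow>
   z \<in> cells D \<Longrightarrow> cbot D z = hcomp D (ctop D x) (ctop D y) \<Longrightarrow>
   (x' \<otimes> y') \<odot> (x \<otimes> y) \<odot> z = ((x' \<odot> x) \<otimes> (y' \<odot> y)) \<odot> z"
  by (simp add: ichg flip: cat_simps(11))

lemma globular_iso_inverse:
  assumes "globular_iso D x g d" "g \<in> hors D"
  shows "inverse_of (ccat D) x \<in> cells D" "ctop D (inverse_of (ccat D) x) = d"
    "cbot D (inverse_of (ccat D) x) = g"
    "x \<odot> inverse_of (ccat D) x = cid D d" "inverse_of (ccat D) x \<odot> x = cid D g"
    "cleft D (inverse_of (ccat D) x) = vid D (hsrc D g)"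
    "cright D (inverse_of (ccat D) x) = vid D (htgt D g)"
proof -
  obtain y where y: "inverses (ccat D) x y" using assms unfolding globular_iso_def by blast
  have [simp]: "inverse_of (ccat D) x = y" using y by (simp add: inverse_of_eq)
  have x: "x \<in> cells D" "ctop D x = g" "cbot D x = d" "cleft D x = vid D (hsrc D g)" "cright D x = vid D (htgt D g)"
    using assms unfolding globular_iso_def globular_cell_def cell_over_def by auto
  have yy: "y \<in> cells D" "ctop D y = d" "cbot D y = g" "x \<odot> y = cid D d" "y \<odot> x = cid D g"
    using y x unfolding inverses_def composable_def by auto
  then show "inverse_of (ccat D) x \<in> cells D" "ctop D (inverse_of (ccat D) x) = d"
    "cbot D (inverse_of (ccat D) x) = g"
    "x \<odot> inverse_of (ccat D) x = cid D d" "inverse_of (ccat D) x \<odot> x = cid D g" by simp_all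
  have h: "hsrc D d = hsrc D g" "htgt D d = htgt D g"
    using pd_simps(8)[OF pd x(1)] pd_simps(10)[OF pd x(1)] x assms(2) by simp_all
  have "cleft D (y \<odot> x) = cleft D y" using yy(1-3) x assms(2) h by simp
  moreover have "cright D (y \<odot> x) = cright D y" using yy(1-3) x assms(2) h by simp
  ultimately show "cleft D (inverse_of (ccat D) x) = vid D (hsrc D g)"
    "cright D (inverse_of (ccat D) x) = vid D (htgt D g)" using yy assms(2) by simp_all
qed

lemma lu_iso: "g \<in> hors D \<Longrightarrow> globular_iso D (lu g) (hcomp D (hid D (hsrc D g)) g) g"
  and ru_iso: "g \<in> hors D \<Longrightarrow> globular_iso D (ru g) (hcomp D g (hid D (htgt D g))) g"
  and as_iso: "g \<in> hors D \<Longrightarrow> d \<in> hors D \<Longrightarrow> e \<in> hors D \<Longrightarrow> htgt D g = hsrc D d \<Longrightarrow> htgt D d = hsrc D e \<Longrightarrow>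
    globular_iso D (as g d e) (hcomp D (hcomp D g d) e) (hcomp D g (hcomp D d e))"
  using pd unfolding pseudo_double_category_def hcomposable_def by blast+

lemma lu [simp]:
  assumes "g \<in> hors D"
  shows "lu g \<in> cells D" "ctop D (lu g) = hcomp D (hid D (hsrc D g)) g" "cbot D (lu g) = g"
    "cleft D (lu g) = vid D (hsrc D g)" "cright D (lu g) = vid D (htgt D g)"
    "li g \<in> cells D" "cbot D (li g) = hcomp D (hid D (hsrc D g)) g" "ctop D (li g) = g"
    "cleft D (li g) = vid D (hsrc D g)" "cright D (li g) = vid D (htgt D g)"
    "lu g \<odot> li g = cid D g" "li g \<odot> lu g = cid D (hcomp D (hid D (hsrc D g)) g)"
  using lu_iso[OF assms] globular_iso_inverse[OF lu_iso[OF assms]] assms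
  by (simp_all add: globular_iso_def globular_cell_def cell_over_def)

lemma ru [simp]:
  assumes "g \<in> hors D"
  shows "ru g \<in> cells D" "ctop D (ru g) = hcomp D g (hid D (htgt D g))" "cbot D (ru g) = g"
    "cleft D (ru g) = vid D (hsrc D g)" "cright D (ru g) = vid D (htgt D g)"
    "ri g \<in> cells D" "cbot D (ri g) = hcomp D g (hid D (htgt D g))" "ctop D (ri g) = g"
    "cleft D (ri g) = vid D (hsrc D g)" "cright D (ri g) = vid D (htgt D g)"
    "ru g \<odot> ri g = cid D g" "ri g \<odot> ru g = cid D (hcomp D g (hid D (htgt D g)))"
  using ru_iso[OF assms] globular_iso_inverse[OF ru_iso[OF assms]] assms
  by (simp_all add: globular_iso_def globular_cell_def cell_over_def)

lemma as [simp]: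
  assumes "g \<in> hors D" "d \<in> hors D" "e \<in> hors D" "htgt D g = hsrc D d" "htgt D d = hsrc D e"
  shows "as g d e \<in> cells D" "ctop D (as g d e) = hcomp D (hcomp D g d) e"
    "cbot D (as g d e) = hcomp D g (hcomp D d e)"
    "cleft D (as g d e) = vid D (hsrc D g)" "cright D (as g d e) = vid D (htgt D e)"
    "ai g d e \<in> cells D" "cbot D (ai g d e) = hcomp D (hcomp D g d) e"
    "ctop D (ai g d e) = hcomp D g (hcomp D d e)"
    "cleft D (ai g d e) = vid D (hsrc D g)" "cright D (ai g d e) = vid D (htgt D e)"
    "as g d e \<odot> ai g d e = cid D (hcomp D g (hcomp D d e))"
    "ai g d e \<odot> as g d e = cid D (hcomp D (hcomp D g d) e)"
  using as_iso[OF assms] globular_iso_inverse[OF as_iso[OF assms]] assms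
  by (simp_all add: globular_iso_def globular_cell_def cell_over_def)

lemma inv_cancel [simp]:
  "g \<in> hors D \<Longrightarrow> z \<in> cells D \<Longrightarrow> cbot D z = g \<Longrightarrow> lu g \<odot> li g \<odot> z = z"
  "g \<in> hors D \<Longrightarrow> z \<in> cells D \<Longrightarrow> cbot D z = hcomp D (hid D (hsrc D g)) g \<Longrightarrow> li g \<odot> lu g \<odot> z = z"
  "g \<in> hors D \<Longrightarrow> z \<in> cells D \<Longrightarrow> cbot D z = g \<Longrightarrow> ru g \<odot> ri g \<odot> z = z"
  "g \<in> hors D \<Longrightarrow> z \<in> cells D \<Longrightarrow> cbot D z = hcomp D g (hid D (htgt D g)) \<Longrightarrow> ri g \<odot> ru g \<odot> z = z"
  "g \<in> hors D \<Longrightarrow> d \<in> hors D \<Longrightarrow> e \<in> hors D \<Longrightarrow> htgt D g = hsrc D d \<Longrightarrow> htgt D d = hsrc D e \<Longrightarrow>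
    z \<in> cells D \<Longrightarrow> cbot D z = hcomp D (hcomp D g d) e \<Longrightarrow> ai g d e \<odot> as g d e \<odot> z = z"
  by (simp_all flip: cat_simps(11))

lemma lu_nat: "x \<in> cells D \<Longrightarrow> lu (cbot D x) \<odot> (chid D (cleft D x) \<otimes> x) = x \<odot> lu (ctop D x)"
  and ru_nat: "x \<in> cells D \<Longrightarrow> ru (cbot D x) \<odot> (x \<otimes> chid D (cright D x)) = x \<odot> ru (ctop D x)"
  and as_nat: "x \<in> cells D \<Longrightarrow> y \<in> cells D \<Longrightarrow> z \<in> cells D \<Longrightarrow> cright D x = cleft D y \<Longrightarrow> cright D y = cleft D z \<Longrightarrow>
    as (cbot D x) (cbot D y) (cbot D z) \<odot> ((x \<otimes> y) \<otimes> z) =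
    (x \<otimes> (y \<otimes> z)) \<odot> as (ctop D x) (ctop D y) (ctop D z)"
  and pentagon: "g \<in> hors D \<Longrightarrow> d \<in> hors D \<Longrightarrow> e \<in> hors D \<Longrightarrow> k \<in> hors D \<Longrightarrow>
    htgt D g = hsrc D d \<Longrightarrow> htgt D d = hsrc D e \<Longrightarrow> htgt D e = hsrc D k \<Longrightarrow>
    (cid D g \<otimes> as d e k) \<odot> as g (hcomp D d e) k \<odot> (as g d e \<otimes> cid D k) =
    as g d (hcomp D e k) \<odot> as (hcomp D g d) e k"
  and triangle: "g \<in> hors D \<Longrightarrow> d \<in> hors D \<Longrightarrow> htgt D g = hsrc D d \<Longrightarrow>
    (cid D g \<otimes> lu d) \<odot> as g (hid D (htgt D g)) d = ru g \<otimes> cid D d"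
  using pd unfolding pseudo_double_category_def hcomposable_def chcomposable_def by blast+

lemma li_nat:
  assumes "x \<in> cells D" shows "(chid D (cleft D x) \<otimes> x) \<odot> li (ctop D x) = li (cbot D x) \<odot> x"
proof -
  have "(chid D (cleft D x) \<otimes> x) \<odot> li (ctop D x) =
    li (cbot D x) \<odot> (lu (cbot D x) \<odot> (chid D (cleft D x) \<otimes> x)) \<odot> li (ctop D x)"
    using assms by simp
  also have "\<dots> = li (cbot D x) \<odot> x" unfolding lu_nat[OF assms] using assms by simp
  finally show ?thesis .
qed

lemma ri_nat:
  assumes "x \<in> cells D" shows "(x \<otimes> chid D (cright D x)) \<odot> ri (ctop D x) = ri (cbot D x) \<odot> x"
proof -
  have "(x \<otimes> chid D (cright D x)) \<odot> ri (ctop D x) =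
    ri (cbot D x) \<odot> (ru (cbot D x) \<odot> (x \<otimes> chid D (cright D x))) \<odot> ri (ctop D x)"
    using assms by simp
  also have "\<dots> = ri (cbot D x) \<odot> x" unfolding ru_nat[OF assms] using assms by simp
  finally show ?thesis .
qed

text \<open>Kelly's derivation: tensoring with a horizontal identity on the left is faithful on globular
  cells, and after tensoring the equation follows from the pentagon and two triangles.\<close>

lemma lu_hcomp:
  assumes "g \<in> hors D" "d \<in> hors D" "htgt D g = hsrc D d"
  shows "lu (hcomp D g d) \<odot> as (hid D (hsrc D g)) g d = lu g \<otimes> cid D d"
proof -
  define I where "I = hid D (hsrc D g)"
  have I [simp]: "I \<in> hors D" "hsrc D I = hsrc D g" "htgt D I = hsrc D g" using assms by (simp_all add: I_def)
  define P where "P = as I (hcomp D I g) d \<odot> (as I I g \<otimes> cid D d)"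
  define Q where "Q = (ai I I g \<otimes> cid D d) \<odot> ai I (hcomp D I g) d"
  have PQ: "P \<odot> Q = cid D (hcomp D I (hcomp D (hcomp D I g) d))"
    using assms unfolding P_def Q_def by (simp add: ichg')
  have P: "P \<in> cells D" "Q \<in> cells D" "ctop D P = cbot D Q" "cbot D P = hcomp D I (hcomp D (hcomp D I g) d)"
    using assms by (simp_all add: P_def Q_def)
  let ?x = "lu (hcomp D g d) \<odot> as I g d" and ?y = "lu g \<otimes> cid D d"
  have "(cid D I \<otimes> ?x) \<odot> P = (cid D I \<otimes> lu (hcomp D g d)) \<odot> (cid D I \<otimes> as I g d) \<odot> P"
    using assms P by (simp add: ichg' I_def[symmetric])
  also have "\<dots> = (cid D I \<otimes> lu (hcomp D g d)) \<odot> as I I (hcomp D g d) \<odot> as (hcomp D I I) g d"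
    unfolding P_def using assms by (simp add: pentagon)
  also have "\<dots> = ((cid D I \<otimes> lu (hcomp D g d)) \<odot> as I I (hcomp D g d)) \<odot> as (hcomp D I I) g d"
    using assms by (simp add: I_def[symmetric])
  also have "\<dots> = (ru I \<otimes> cid D (hcomp D g d)) \<odot> as (hcomp D I I) g d"
    using assms triangle[of I "hcomp D g d"] by (simp add: I_def[symmetric])
  also have "\<dots> = as I g d \<odot> ((ru I \<otimes> cid D g) \<otimes> cid D d)"
    using as_nat[of "ru I" "cid D g" "cid D d"] assms by (simp add: I_def[symmetric])
  also have "\<dots> = as I g d \<odot> (((cid D I \<otimes> lu g) \<odot> as I I g) \<otimes> cid D d)"
    using triangle[of I g] assms by (simp add: I_def[symmetric])
  also have "\<dots> = (as I g d \<odot> ((cid D I \<otimes> lu g) \<otimes> cid D d)) \<odot> (as I I g \<otimes> cid D d)"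
    using assms by (simp add: ichg I_def[symmetric])
  also have "\<dots> = (cid D I \<otimes> ?y) \<odot> P"
    using as_nat[of "cid D I" "lu g" "cid D d"] assms by (simp add: P_def I_def[symmetric])
  finally have "((cid D I \<otimes> ?x) \<odot> P) \<odot> Q = ((cid D I \<otimes> ?y) \<odot> P) \<odot> Q" by simp
  then have "(cid D I \<otimes> ?x) \<odot> (P \<odot> Q) = (cid D I \<otimes> ?y) \<odot> (P \<odot> Q)"
    using P assms by (simp add: I_def[symmetric])
  then have e: "cid D I \<otimes> ?x = cid D I \<otimes> ?y"
    unfolding PQ using assms by (simp add: I_def[symmetric])
  have "?x \<odot> lu (hcomp D (hcomp D I g) d) = ?y \<odot> lu (hcomp D (hcomp D I g) d)"
    using lu_nat[of ?x] lu_nat[of ?y] e assms by (simp add: I_def[symmetric])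
  then have "(?x \<odot> lu (hcomp D (hcomp D I g) d)) \<odot> li (hcomp D (hcomp D I g) d) =
    (?y \<odot> lu (hcomp D (hcomp D I g) d)) \<odot> li (hcomp D (hcomp D I g) d)" by simp
  then show ?thesis using assms by (simp add: I_def[symmetric])
qed

text \<open>The two coherence laws in the form in which they are used: they turn a unit constraint of a composite into
  a unit constraint of one factor.\<close>

lemma as_li:
  assumes "g \<in> hors D" "d \<in> hors D" "htgt D g = hsrc D d"
  shows "as (hid D (hsrc D g)) g d \<odot> (li g \<otimes> cid D d) = li (hcomp D g d)"
proof -
  have "as (hid D (hsrc D g)) g d \<odot> (li g \<otimes> cid D d) =
    li (hcomp D g d) \<odot> (lu (hcomp D g d) \<odot> as (hid D (hsrc D g)) g d) \<odot> (li g \<otimes> cid D d)"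
    using assms inv_cancel(2)[of "hcomp D g d"] by simp
  also have "\<dots> = li (hcomp D g d)" unfolding lu_hcomp[OF assms] using assms by (simp add: ichg)
  finally show ?thesis .
qed

lemma as_ri:
  assumes "g \<in> hors D" "d \<in> hors D" "htgt D g = hsrc D d"
  shows "as g (hid D (htgt D g)) d \<odot> (ri g \<otimes> cid D d) = cid D g \<otimes> li d"
proof -
  have "as g (hid D (htgt D g)) d \<odot> (ri g \<otimes> cid D d) =
    (cid D g \<otimes> li d) \<odot> ((cid D g \<otimes> lu d) \<odot> as g (hid D (htgt D g)) d) \<odot> (ri g \<otimes> cid D d)"
    using assms by (simp add: ichg')
  also have "\<dots> = cid D g \<otimes> li d" unfolding triangle[OF assms] using assms by (simp add: ichg)
  finally show ?thesis .
qed

lemma li_hid: "a \<in> objs D \<Longrightarrow> li (hid D a) = ri (hid D a)"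
proof -
  assume a: "a \<in> objs D"
  let ?I = "hid D a"
  have "lu (hcomp D ?I ?I) = cid D ?I \<otimes> lu ?I"
  proof -
    have "lu ?I \<odot> lu (hcomp D ?I ?I) = lu ?I \<odot> (cid D ?I \<otimes> lu ?I)" using lu_nat[of "lu ?I"] a by simp
    then have "li ?I \<odot> lu ?I \<odot> lu (hcomp D ?I ?I) = li ?I \<odot> lu ?I \<odot> (cid D ?I \<otimes> lu ?I)" by simp
    then show ?thesis using a by simp
  qed
  then have e: "lu ?I \<otimes> cid D ?I = ru ?I \<otimes> cid D ?I"
    using lu_hcomp[of ?I ?I] triangle[of ?I ?I] a by simp
  have "lu ?I \<odot> ru (hcomp D ?I ?I) = ru ?I \<odot> ru (hcomp D ?I ?I)"
    using ru_nat[of "lu ?I"] ru_nat[of "ru ?I"] e a by simp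
  then have "(lu ?I \<odot> ru (hcomp D ?I ?I)) \<odot> ri (hcomp D ?I ?I) =
    (ru ?I \<odot> ru (hcomp D ?I ?I)) \<odot> ri (hcomp D ?I ?I)" by simp
  then show "li ?I = ri ?I" using a by simp
qed

end


section \<open>Lax double functors and vertical transformations\<close>

locale lax_functor = pdc D for C D :: "'v psdbl" and F :: "'v lax_fun" +
  assumes pdC [simp]: "pseudo_double_category C" and F: "lax_double_functor C D F"
begin

lemma F_simps [simp]:
  "a \<in> objs C \<Longrightarrow> lob F a \<in> objs D" "u \<in> vers C \<Longrightarrow> lver F u \<in> vers D"
  "u \<in> vers C \<Longrightarrow> vsrc D (lver F u) = lob F (vsrc C u)" "u \<in> vers C \<Longrightarrow> vtgt D (lver F u) = lob F (vtgt C u)"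
  "a \<in> objs C \<Longrightarrow> lver F (vid C a) = vid D (lob F a)"
  "v \<in> vers C \<Longrightarrow> u \<in> vers C \<Longrightarrow> vsrc C v = vtgt C u \<Longrightarrow> lver F (vcmp C v u) = vcmp D (lver F v) (lver F u)"
  "g \<in> hors C \<Longrightarrow> lhor F g \<in> hors D"
  "g \<in> hors C \<Longrightarrow> hsrc D (lhor F g) = lob F (hsrc C g)" "g \<in> hors C \<Longrightarrow> htgt D (lhor F g) = lob F (htgt C g)"
  "x \<in> cells C \<Longrightarrow> lcell F x \<in> cells D"
  "x \<in> cells C \<Longrightarrow> ctop D (lcell F x) = lhor F (ctop C x)" "x \<in> cells C \<Longrightarrow> cbot D (lcell F x) = lhor F (cbot C x)"
  "x \<in> cells C \<Longrightarrow> cleft D (lcell F x) = lver F (cleft C x)" "x \<in> cells C \<Longrightarrow> cright D (lcell F x) = lver F (cright C x)"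
  "g \<in> hors C \<Longrightarrow> lcell F (cid C g) = cid D (lhor F g)"
  "y \<in> cells C \<Longrightarrow> x \<in> cells C \<Longrightarrow> ctop C y = cbot C x \<Longrightarrow> lcell F (cmp (ccat C) y x) = lcell F y \<odot> lcell F x"
  "a \<in> objs C \<Longrightarrow> lax_unit F a \<in> cells D" "a \<in> objs C \<Longrightarrow> ctop D (lax_unit F a) = hid D (lob F a)"
  "a \<in> objs C \<Longrightarrow> cbot D (lax_unit F a) = lhor F (hid C a)"
  "a \<in> objs C \<Longrightarrow> cleft D (lax_unit F a) = vid D (lob F a)" "a \<in> objs C \<Longrightarrow> cright D (lax_unit F a) = vid D (lob F a)"
  "g \<in> hors C \<Longrightarrow> d \<in> hors C \<Longrightarrow> htgt C g = hsrc C d \<Longrightarrow> lax_comp F g d \<in> cells D"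
  "g \<in> hors C \<Longrightarrow> d \<in> hors C \<Longrightarrow> htgt C g = hsrc C d \<Longrightarrow>
    ctop D (lax_comp F g d) = hcomp D (lhor F g) (lhor F d)"
  "g \<in> hors C \<Longrightarrow> d \<in> hors C \<Longrightarrow> htgt C g = hsrc C d \<Longrightarrow> cbot D (lax_comp F g d) = lhor F (hcomp C g d)"
  "g \<in> hors C \<Longrightarrow> d \<in> hors C \<Longrightarrow> htgt C g = hsrc C d \<Longrightarrow> cleft D (lax_comp F g d) = vid D (lob F (hsrc C g))"
  "g \<in> hors C \<Longrightarrow> d \<in> hors C \<Longrightarrow> htgt C g = hsrc C d \<Longrightarrow> cright D (lax_comp F g d) = vid D (lob F (htgt C d))"
proof -
  have f: "cat_functor (vcat C) (vcat D) (lob F) (lver F)" "cat_functor (ccat C) (ccat D) (lhor F) (lcell F)"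
    and h: "g \<in> hors C \<Longrightarrow> hsrc D (lhor F g) = lob F (hsrc C g)" "g \<in> hors C \<Longrightarrow> htgt D (lhor F g) = lob F (htgt C g)"
    and c: "x \<in> cells C \<Longrightarrow> cleft D (lcell F x) = lver F (cleft C x)" "x \<in> cells C \<Longrightarrow> cright D (lcell F x) = lver F (cright C x)"
    and u: "a \<in> objs C \<Longrightarrow> globular_cell D (lax_unit F a) (hid D (lob F a)) (lhor F (hid C a))"
    and m: "g \<in> hors C \<Longrightarrow> d \<in> hors C \<Longrightarrow> htgt C g = hsrc C d \<Longrightarrow>
      globular_cell D (lax_comp F g d) (hcomp D (lhor F g) (lhor F d)) (lhor F (hcomp C g d))" for a g d x
    using F unfolding lax_double_functor_def hcomposable_def by blast+
  note [simp] = cat_functor_simps[OF f(1)] cat_functor_simps[OF f(2)] h c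
  show "a \<in> objs C \<Longrightarrow> lob F a \<in> objs D" "u \<in> vers C \<Longrightarrow> lver F u \<in> vers D"
    "u \<in> vers C \<Longrightarrow> vsrc D (lver F u) = lob F (vsrc C u)" "u \<in> vers C \<Longrightarrow> vtgt D (lver F u) = lob F (vtgt C u)"
    "a \<in> objs C \<Longrightarrow> lver F (vid C a) = vid D (lob F a)"
    "v \<in> vers C \<Longrightarrow> u \<in> vers C \<Longrightarrow> vsrc C v = vtgt C u \<Longrightarrow> lver F (vcmp C v u) = vcmp D (lver F v) (lver F u)"
    "g \<in> hors C \<Longrightarrow> lhor F g \<in> hors D"
    "g \<in> hors C \<Longrightarrow> hsrc D (lhor F g) = lob F (hsrc C g)" "g \<in> hors C \<Longrightarrow> htgt D (lhor F g) = lob F (htgt C g)"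
    "x \<in> cells C \<Longrightarrow> lcell F x \<in> cells D"
    "x \<in> cells C \<Longrightarrow> ctop D (lcell F x) = lhor F (ctop C x)" "x \<in> cells C \<Longrightarrow> cbot D (lcell F x) = lhor F (cbot C x)"
    "x \<in> cells C \<Longrightarrow> cleft D (lcell F x) = lver F (cleft C x)" "x \<in> cells C \<Longrightarrow> cright D (lcell F x) = lver F (cright C x)"
    "g \<in> hors C \<Longrightarrow> lcell F (cid C g) = cid D (lhor F g)"
    "y \<in> cells C \<Longrightarrow> x \<in> cells C \<Longrightarrow> ctop C y = cbot C x \<Longrightarrow> lcell F (cmp (ccat C) y x) = lcell F y \<odot> lcell F x"
    by simp_all
  show "a \<in> objs C \<Longrightarrow> lax_unit F a \<in> cells D" "a \<in> objs C \<Longrightarrow> ctop D (lax_unit F a) = hid D (lob F a)"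
    "a \<in> objs C \<Longrightarrow> cbot D (lax_unit F a) = lhor F (hid C a)"
    "a \<in> objs C \<Longrightarrow> cleft D (lax_unit F a) = vid D (lob F a)" "a \<in> objs C \<Longrightarrow> cright D (lax_unit F a) = vid D (lob F a)"
    using u[of a] by (simp_all add: globular_cell_def cell_over_def)
  show "g \<in> hors C \<Longrightarrow> d \<in> hors C \<Longrightarrow> htgt C g = hsrc C d \<Longrightarrow> lax_comp F g d \<in> cells D"
    "g \<in> hors C \<Longrightarrow> d \<in> hors C \<Longrightarrow> htgt C g = hsrc C d \<Longrightarrow> ctop D (lax_comp F g d) = hcomp D (lhor F g) (lhor F d)"
    "g \<in> hors C \<Longrightarrow> d \<in> hors C \<Longrightarrow> htgt C g = hsrc C d \<Longrightarrow> cbot D (lax_comp F g d) = lhor F (hcomp C g d)"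
    "g \<in> hors C \<Longrightarrow> d \<in> hors C \<Longrightarrow> htgt C g = hsrc C d \<Longrightarrow> cleft D (lax_comp F g d) = vid D (lob F (hsrc C g))"
    "g \<in> hors C \<Longrightarrow> d \<in> hors C \<Longrightarrow> htgt C g = hsrc C d \<Longrightarrow> cright D (lax_comp F g d) = vid D (lob F (htgt C d))"
    using m[of g d] by (simp_all add: globular_cell_def cell_over_def)
qed

lemma unit_nat: "u \<in> vers C \<Longrightarrow>
    lcell F (chid C u) \<odot> lax_unit F (vsrc C u) = lax_unit F (vtgt C u) \<odot> chid D (lver F u)"
  and comp_nat: "x \<in> cells C \<Longrightarrow> y \<in> cells C \<Longrightarrow> cright C x = cleft C y \<Longrightarrow>
    lcell F (chcomp C x y) \<odot> lax_comp F (ctop C x) (ctop C y) =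
    lax_comp F (cbot C x) (cbot C y) \<odot> (lcell F x \<otimes> lcell F y)"
  and comp_assoc: "g \<in> hors C \<Longrightarrow> d \<in> hors C \<Longrightarrow> e \<in> hors C \<Longrightarrow> htgt C g = hsrc C d \<Longrightarrow> htgt C d = hsrc C e \<Longrightarrow>
    lcell F (hassoc C g d e) \<odot> lax_comp F (hcomp C g d) e \<odot> (lax_comp F g d \<otimes> cid D (lhor F e)) =
    lax_comp F g (hcomp C d e) \<odot> (cid D (lhor F g) \<otimes> lax_comp F d e) \<odot> as (lhor F g) (lhor F d) (lhor F e)"
  and comp_lunit: "g \<in> hors C \<Longrightarrow> lcell F (hlunit C g) \<odot> lax_comp F (hid C (hsrc C g)) g \<odot>
    (lax_unit F (hsrc C g) \<otimes> cid D (lhor F g)) = lu (lhor F g)"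
  and comp_runit: "g \<in> hors C \<Longrightarrow> lcell F (hrunit C g) \<odot> lax_comp F g (hid C (htgt C g)) \<odot>
    (cid D (lhor F g) \<otimes> lax_unit F (htgt C g)) = ru (lhor F g)"
  using F unfolding lax_double_functor_def hcomposable_def chcomposable_def by blast+

end

lemma lax_functorI:
  assumes "pseudo_double_category C" "pseudo_double_category D" "lax_double_functor C D F"
  shows "lax_functor C D F"
  using assms by unfold_locales

lemma lax_double_functorI:
  fixes C D :: "'v psdbl"
  assumes "pseudo_double_category C" "pseudo_double_category D"
    "\<And>a. a \<in> objs C \<Longrightarrow> lob F a \<in> objs D"
    "\<And>u. u \<in> vers C \<Longrightarrow> lver F u \<in> vers D \<and> vsrc D (lver F u) = lob F (vsrc C u) \<and> vtgt D (lver F u) = lob F (vtgt C u)"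
    "\<And>a. a \<in> objs C \<Longrightarrow> lver F (vid C a) = vid D (lob F a)"
    "\<And>v u. v \<in> vers C \<Longrightarrow> u \<in> vers C \<Longrightarrow> vsrc C v = vtgt C u \<Longrightarrow> lver F (vcmp C v u) = vcmp D (lver F v) (lver F u)"
    "\<And>g. g \<in> hors C \<Longrightarrow> lhor F g \<in> hors D \<and> hsrc D (lhor F g) = lob F (hsrc C g) \<and> htgt D (lhor F g) = lob F (htgt C g)"
    "\<And>x. x \<in> cells C \<Longrightarrow> cell_over D (lcell F x) (lhor F (ctop C x)) (lhor F (cbot C x)) (lver F (cleft C x)) (lver F (cright C x))"
    "\<And>g. g \<in> hors C \<Longrightarrow> lcell F (cid C g) = cid D (lhor F g)"
    "\<And>y x. y \<in> cells C \<Longrightarrow> x \<in> cells C \<Longrightarrow> ctop C y = cbot C x \<Longrightarrow>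
      lcell F (cmp (ccat C) y x) = cmp (ccat D) (lcell F y) (lcell F x)"
    "\<And>a. a \<in> objs C \<Longrightarrow> cell_over D (lax_unit F a) (hid D (lob F a)) (lhor F (hid C a)) (vid D (lob F a)) (vid D (lob F a))"
    "\<And>g d. g \<in> hors C \<Longrightarrow> d \<in> hors C \<Longrightarrow> htgt C g = hsrc C d \<Longrightarrow>
      cell_over D (lax_comp F g d) (hcomp D (lhor F g) (lhor F d)) (lhor F (hcomp C g d))
        (vid D (lob F (hsrc C g))) (vid D (lob F (htgt C d)))"
    "\<And>u. u \<in> vers C \<Longrightarrow> cmp (ccat D) (lcell F (chid C u)) (lax_unit F (vsrc C u)) =
       cmp (ccat D) (lax_unit F (vtgt C u)) (chid D (lver F u))"
    "\<And>x y. x \<in> cells C \<Longrightarrow> y \<in> cells C \<Longrightarrow> cright C x = cleft C y \<Longrightarrow>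
      cmp (ccat D) (lcell F (chcomp C x y)) (lax_comp F (ctop C x) (ctop C y)) =
      cmp (ccat D) (lax_comp F (cbot C x) (cbot C y)) (chcomp D (lcell F x) (lcell F y))"
    "\<And>g d e. g \<in> hors C \<Longrightarrow> d \<in> hors C \<Longrightarrow> e \<in> hors C \<Longrightarrow> htgt C g = hsrc C d \<Longrightarrow> htgt C d = hsrc C e \<Longrightarrow>
        cmp (ccat D) (lcell F (hassoc C g d e))
          (cmp (ccat D) (lax_comp F (hcomp C g d) e)
            (chcomp D (lax_comp F g d) (ide (ccat D) (lhor F e)))) =
        cmp (ccat D) (lax_comp F g (hcomp C d e))
          (cmp (ccat D) (chcomp D (ide (ccat D) (lhor F g)) (lax_comp F d e))
            (hassoc D (lhor F g) (lhor F d) (lhor F e)))"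
    "\<And>g. g \<in> hors C \<Longrightarrow> cmp (ccat D) (lcell F (hlunit C g))
          (cmp (ccat D) (lax_comp F (hid C (hsrc C g)) g)
            (chcomp D (lax_unit F (hsrc C g)) (ide (ccat D) (lhor F g)))) = hlunit D (lhor F g)"
    "\<And>g. g \<in> hors C \<Longrightarrow> cmp (ccat D) (lcell F (hrunit C g))
          (cmp (ccat D) (lax_comp F g (hid C (htgt C g)))
            (chcomp D (ide (ccat D) (lhor F g)) (lax_unit F (htgt C g)))) = hrunit D (lhor F g)"
  shows "lax_double_functor C D F"
proof -
  have 1: "x \<in> cells C \<Longrightarrow> lcell F x \<in> cells D \<and> ctop D (lcell F x) = lhor F (ctop C x) \<and>
     cbot D (lcell F x) = lhor F (cbot C x) \<and> cleft D (lcell F x) = lver F (cleft C x) \<and>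
     cright D (lcell F x) = lver F (cright C x)" for x
    using assms(8)[of x] by (simp add: cell_over_def)
  show ?thesis
    unfolding lax_double_functor_def cat_functor_def hcomposable_def chcomposable_def composable_def globular_cell_def
    by (simp add: 1 assms(1-7) assms(9-))
qed

lemma id_lax_fun_sel [simp]:
  "a \<in> objs D \<Longrightarrow> lob (id_lax_fun D) a = a" "u \<in> vers D \<Longrightarrow> lver (id_lax_fun D) u = u"
  "g \<in> hors D \<Longrightarrow> lhor (id_lax_fun D) g = g" "x \<in> cells D \<Longrightarrow> lcell (id_lax_fun D) x = x"
  "a \<in> objs D \<Longrightarrow> lax_unit (id_lax_fun D) a = cid D (hid D a)"
  "g \<in> hors D \<Longrightarrow> d \<in> hors D \<Longrightarrow> htgt D g = hsrc D d \<Longrightarrow> lax_comp (id_lax_fun D) g d = cid D (hcomp D g d)"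
  by (simp_all add: id_lax_fun_def hcomposable_def)

lemma lax_double_functor_id:
  assumes "pseudo_double_category D" shows "lax_double_functor D D (id_lax_fun D)"
proof -
  interpret pdc D using assms by unfold_locales
  show ?thesis by (rule lax_double_functorI) (simp_all add: cell_over_def)
qed

lemma comp_lax_fun_sel [simp]:
  "a \<in> objs B \<Longrightarrow> lob (comp_lax_fun B D G F) a = lob G (lob F a)"
  "u \<in> vers B \<Longrightarrow> lver (comp_lax_fun B D G F) u = lver G (lver F u)"
  "g \<in> hors B \<Longrightarrow> lhor (comp_lax_fun B D G F) g = lhor G (lhor F g)"
  "x \<in> cells B \<Longrightarrow> lcell (comp_lax_fun B D G F) x = lcell G (lcell F x)"
  "a \<in> objs B \<Longrightarrow> lax_unit (comp_lax_fun B D G F) a = cmp (ccat D) (lcell G (lax_unit F a)) (lax_unit G (lob F a))"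
  "g \<in> hors B \<Longrightarrow> d \<in> hors B \<Longrightarrow> htgt B g = hsrc B d \<Longrightarrow> lax_comp (comp_lax_fun B D G F) g d =
     cmp (ccat D) (lcell G (lax_comp F g d)) (lax_comp G (lhor F g) (lhor F d))"
  by (simp_all add: comp_lax_fun_def hcomposable_def)

lemma lax_double_functor_comp:
  fixes B C D :: "'v psdbl"
  assumes "lax_functor B C F" "lax_functor C D G"
  shows "lax_double_functor B D (comp_lax_fun B D G F)"
proof -
  interpret F: lax_functor B C F by fact
  interpret G: lax_functor C D G by fact
  interpret B: pdc B by unfold_locales simp
  note ichg = G.ichg and ichg' = G.ichg'
  let ?GF = "comp_lax_fun B D G F"
  show ?thesis
  proof (rule lax_double_functorI, goal_cases)
    case (13 u)
    have "cmp (ccat D) (lcell G (lcell F (chid B u))) (cmp (ccat D) (lcell G (lax_unit F (vsrc B u))) (lax_unit G (lob F (vsrc B u)))) =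
      cmp (ccat D) (lcell G (cmp (ccat C) (lcell F (chid B u)) (lax_unit F (vsrc B u)))) (lax_unit G (lob F (vsrc B u)))"
      using 13 by simp
    also have "\<dots> = cmp (ccat D) (lcell G (lax_unit F (vtgt B u)))
        (cmp (ccat D) (lcell G (chid C (lver F u))) (lax_unit G (lob F (vsrc B u))))"
      using 13 by (simp add: F.unit_nat)
    also have "\<dots> = cmp (ccat D) (lcell G (lax_unit F (vtgt B u)))
        (cmp (ccat D) (lax_unit G (lob F (vtgt B u))) (chid D (lver G (lver F u))))"
      using 13 G.unit_nat[of "lver F u"] by simp
    finally show ?case using 13 by simp
  next
    case (14 x y)
    note xy = 14
    have h: "htgt B (ctop B x) = hsrc B (ctop B y)" "htgt B (cbot B x) = hsrc B (cbot B y)"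
      using 14 pd_simps(7-10)[OF F.pdC] by metis+
    have "cmp (ccat D) (lcell G (lcell F (chcomp B x y))) (cmp (ccat D) (lcell G (lax_comp F (ctop B x) (ctop B y)))
        (lax_comp G (lhor F (ctop B x)) (lhor F (ctop B y)))) =
      cmp (ccat D) (lcell G (cmp (ccat C) (lcell F (chcomp B x y)) (lax_comp F (ctop B x) (ctop B y))))
        (lax_comp G (lhor F (ctop B x)) (lhor F (ctop B y)))"
      using 14 by (simp add: h)
    also have "\<dots> = cmp (ccat D) (lcell G (lax_comp F (cbot B x) (cbot B y)))
       (cmp (ccat D) (lcell G (chcomp C (lcell F x) (lcell F y))) (lax_comp G (lhor F (ctop B x)) (lhor F (ctop B y))))"
      using 14 by (simp add: h F.comp_nat)
    also have "\<dots> = cmp (ccat D) (lcell G (lax_comp F (cbot B x) (cbot B y)))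
       (cmp (ccat D) (lax_comp G (lhor F (cbot B x)) (lhor F (cbot B y))) (chcomp D (lcell G (lcell F x)) (lcell G (lcell F y))))"
      using 14 G.comp_nat[of "lcell F x" "lcell F y"] by (simp add: h)
    finally show ?case using 14 by (simp add: h)
  next
    case (15 g d e)
    let ?g = "lhor F g" and ?d = "lhor F d" and ?e = "lhor F e"
    let ?a = "hassoc B g d e" and ?gd = "hcomp B g d" and ?de = "hcomp B d e"
    have n1: "cmp (ccat D) (lax_comp G (lhor F ?gd) ?e) (chcomp D (lcell G (lax_comp F g d)) (cid D (lhor G ?e))) =
      cmp (ccat D) (lcell G (chcomp C (lax_comp F g d) (cid C ?e))) (lax_comp G (hcomp C ?g ?d) ?e)"
      using 15 G.comp_nat[of "lax_comp F g d" "cid C ?e"] by simp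
    have n2: "cmp (ccat D) (lax_comp G ?g (lhor F ?de)) (chcomp D (cid D (lhor G ?g)) (lcell G (lax_comp F d e))) =
      cmp (ccat D) (lcell G (chcomp C (cid C ?g) (lax_comp F d e))) (lax_comp G ?g (hcomp C ?d ?e))"
      using 15 G.comp_nat[of "cid C ?g" "lax_comp F d e"] by simp
    have "cmp (ccat D) (lcell ?GF ?a) (cmp (ccat D) (lax_comp ?GF ?gd e)
            (chcomp D (lax_comp ?GF g d) (ide (ccat D) (lhor ?GF e)))) =
      cmp (ccat D) (lcell G (cmp (ccat C) (lcell F ?a) (lax_comp F ?gd e))) (cmp (ccat D)
        (cmp (ccat D) (lax_comp G (lhor F ?gd) ?e) (chcomp D (lcell G (lax_comp F g d)) (cid D (lhor G ?e))))
        (chcomp D (lax_comp G ?g ?d) (cid D (lhor G ?e))))"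
      using 15 by (simp add: ichg)
    also have "\<dots> = cmp (ccat D) (lcell G (cmp (ccat C) (lcell F ?a) (cmp (ccat C) (lax_comp F ?gd e) (chcomp C (lax_comp F g d) (cid C ?e)))))
         (cmp (ccat D) (lax_comp G (hcomp C ?g ?d) ?e) (chcomp D (lax_comp G ?g ?d) (cid D (lhor G ?e))))"
      unfolding n1 using 15 by simp
    also have "\<dots> = cmp (ccat D) (lcell G (cmp (ccat C) (lax_comp F g ?de) (chcomp C (cid C ?g) (lax_comp F d e))))
         (cmp (ccat D) (lcell G (hassoc C ?g ?d ?e)) (cmp (ccat D) (lax_comp G (hcomp C ?g ?d) ?e) (chcomp D (lax_comp G ?g ?d) (cid D (lhor G ?e)))))"
      using 15 by (simp add: F.comp_assoc)
    also have "\<dots> = cmp (ccat D) (lcell G (lax_comp F g ?de)) (cmp (ccat D) (cmp (ccat D) (lcell G (chcomp C (cid C ?g) (lax_comp F d e)))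
         (lax_comp G ?g (hcomp C ?d ?e))) (cmp (ccat D)
          (chcomp D (cid D (lhor G ?g)) (lax_comp G ?d ?e)) (hassoc D (lhor G ?g) (lhor G ?d) (lhor G ?e))))"
      using 15 G.comp_assoc[of ?g ?d ?e] by simp
    also have "\<dots> = cmp (ccat D) (lax_comp ?GF g ?de)
          (cmp (ccat D) (chcomp D (ide (ccat D) (lhor ?GF g)) (lax_comp ?GF d e))
            (hassoc D (lhor ?GF g) (lhor ?GF d) (lhor ?GF e)))"
      unfolding n2[symmetric] using 15 by (simp add: ichg')
    finally show ?case .
  next
    case (16 g)
    let ?g = "lhor F g" and ?I = "hid B (hsrc B g)"
    have n: "cmp (ccat D) (lax_comp G (lhor F ?I) ?g) (chcomp D (lcell G (lax_unit F (hsrc B g))) (cid D (lhor G ?g))) =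
      cmp (ccat D) (lcell G (chcomp C (lax_unit F (hsrc B g)) (cid C ?g))) (lax_comp G (hid C (hsrc C ?g)) ?g)"
      using 16 G.comp_nat[of "lax_unit F (hsrc B g)" "cid C ?g"] by simp
    have "cmp (ccat D) (lcell ?GF (hlunit B g)) (cmp (ccat D) (lax_comp ?GF ?I g)
            (chcomp D (lax_unit ?GF (hsrc B g)) (ide (ccat D) (lhor ?GF g)))) =
      cmp (ccat D) (lcell G (cmp (ccat C) (lcell F (hlunit B g)) (lax_comp F ?I g))) (cmp (ccat D)
        (cmp (ccat D) (lax_comp G (lhor F ?I) ?g) (chcomp D (lcell G (lax_unit F (hsrc B g))) (cid D (lhor G ?g))))
        (chcomp D (lax_unit G (hsrc C ?g)) (cid D (lhor G ?g))))"
      using 16 by (simp add: ichg)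
    also have "\<dots> = cmp (ccat D) (lcell G (cmp (ccat C) (lcell F (hlunit B g)) (cmp (ccat C) (lax_comp F ?I g) (chcomp C (lax_unit F (hsrc B g)) (cid C ?g)))))
         (cmp (ccat D) (lax_comp G (hid C (hsrc C ?g)) ?g) (chcomp D (lax_unit G (hsrc C ?g)) (cid D (lhor G ?g))))"
      unfolding n using 16 by simp
    also have "\<dots> = hlunit D (lhor G ?g)"
      using 16 G.comp_lunit[of ?g] by (simp only: F.comp_lunit) (simp add: F.comp_lunit)
    finally show ?case using 16 by simp
  next
    case (17 g)
    let ?g = "lhor F g" and ?I = "hid B (htgt B g)"
    have n: "cmp (ccat D) (lax_comp G ?g (lhor F ?I)) (chcomp D (cid D (lhor G ?g)) (lcell G (lax_unit F (htgt B g)))) =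
      cmp (ccat D) (lcell G (chcomp C (cid C ?g) (lax_unit F (htgt B g)))) (lax_comp G ?g (hid C (htgt C ?g)))"
      using 17 G.comp_nat[of "cid C ?g" "lax_unit F (htgt B g)"] by simp
    have "cmp (ccat D) (lcell ?GF (hrunit B g)) (cmp (ccat D) (lax_comp ?GF g ?I)
            (chcomp D (ide (ccat D) (lhor ?GF g)) (lax_unit ?GF (htgt B g)))) =
      cmp (ccat D) (lcell G (cmp (ccat C) (lcell F (hrunit B g)) (lax_comp F g ?I))) (cmp (ccat D)
        (cmp (ccat D) (lax_comp G ?g (lhor F ?I)) (chcomp D (cid D (lhor G ?g)) (lcell G (lax_unit F (htgt B g)))))
        (chcomp D (cid D (lhor G ?g)) (lax_unit G (htgt C ?g))))"
      using 17 by (simp add: ichg)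
    also have "\<dots> = cmp (ccat D) (lcell G (cmp (ccat C) (lcell F (hrunit B g)) (cmp (ccat C) (lax_comp F g ?I) (chcomp C (cid C ?g) (lax_unit F (htgt B g))))))
         (cmp (ccat D) (lax_comp G ?g (hid C (htgt C ?g))) (chcomp D (cid D (lhor G ?g)) (lax_unit G (htgt C ?g))))"
      unfolding n using 17 by simp
    also have "\<dots> = hrunit D (lhor G ?g)"
      using 17 G.comp_runit[of ?g] by (simp only: F.comp_runit) (simp add: F.comp_runit)
    finally show ?case using 17 by simp
  qed (auto simp: cell_over_def)
qed

lemma lax_fun_eqI:
  assumes "ext_lax_fun D F" "ext_lax_fun D G"
    "\<And>a. a \<in> objs D \<Longrightarrow> lob F a = lob G a" "\<And>u. u \<in> vers D \<Longrightarrow> lver F u = lver G u"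
    "\<And>g. g \<in> hors D \<Longrightarrow> lhor F g = lhor G g" "\<And>x. x \<in> cells D \<Longrightarrow> lcell F x = lcell G x"
    "\<And>a. a \<in> objs D \<Longrightarrow> lax_unit F a = lax_unit G a"
    "\<And>g d. g \<in> hors D \<Longrightarrow> d \<in> hors D \<Longrightarrow> htgt D g = hsrc D d \<Longrightarrow> lax_comp F g d = lax_comp G g d"
  shows "F = (G :: 'v lax_fun)"
proof -
  have "lob F = lob G" "lver F = lver G" "lhor F = lhor G" "lcell F = lcell G" "lax_unit F = lax_unit G"
    using assms unfolding ext_lax_fun_def by (auto intro: extensionalityI)
  moreover have "lax_comp F = lax_comp G"
    using assms(1,2,8) unfolding ext_lax_fun_def by (intro ext) (metis hcomposable_def)
  ultimately show ?thesis by simp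
qed

lemma ext_comp_lax_fun: "ext_lax_fun B (comp_lax_fun B D G F)" "ext_lax_fun D (id_lax_fun D)"
  by (simp_all add: ext_lax_fun_def comp_lax_fun_def id_lax_fun_def)

lemma large_psdbl_D [simp]: "large_pseudo_double_category elts U D \<Longrightarrow> pseudo_double_category D"
  by (simp add: large_pseudo_double_category_def)

lemma arr_PsDBL1:
  "F \<in> arr (PsDBL1 elts U) \<longleftrightarrow> large_pseudo_double_category elts U (asrc F) \<and>
     large_pseudo_double_category elts U (atgt F) \<and>
     lax_double_functor (asrc F) (atgt F) (amap F) \<and> ext_lax_fun (asrc F) (amap F)"
  by (cases F) (auto simp: PsDBL1_def)

lemma PsDBL1_sel [simp]:
  "obj (PsDBL1 elts U) = {D. large_pseudo_double_category elts U D}"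
  "src (PsDBL1 elts U) = asrc" "tgt (PsDBL1 elts U) = atgt"
  "ide (PsDBL1 elts U) D = Arrow D (id_lax_fun D) D"
  "cmp (PsDBL1 elts U) G F = Arrow (asrc F) (comp_lax_fun (asrc F) (atgt G) (amap G) (amap F)) (atgt G)"
  by (simp_all add: PsDBL1_def)

lemma category_PsDBL1: "category (PsDBL1 elts U)"
  unfolding PsDBL1_def
proof (rule category_arrowI, goal_cases)
  case (2 D)
  then show ?case by (simp add: lax_double_functor_id ext_comp_lax_fun)
next
  case (3 B F C G D)
  then show ?case by (auto simp: ext_comp_lax_fun intro!: lax_double_functor_comp lax_functorI)
next
  case (4 C F D)
  then interpret F: lax_functor C D F by (intro lax_functorI) auto
  show ?case using 4 by (intro lax_fun_eqI[where D=C]) (simp_all add: ext_comp_lax_fun)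
next
  case (5 C F D)
  then interpret F: lax_functor C D F by (intro lax_functorI) auto
  show ?case using 5 by (intro lax_fun_eqI[where D=C]) (simp_all add: ext_comp_lax_fun)
next
  case (6 A F B G C H D)
  then interpret F: lax_functor A B F by (intro lax_functorI) auto
  interpret G: lax_functor B C G using 6 by (intro lax_functorI) auto
  interpret H: lax_functor C D H using 6 by (intro lax_functorI) auto
  show ?case by (intro lax_fun_eqI[where D=A]) (simp_all add: ext_comp_lax_fun)
qed simp


lemma vertical_transformationD:
  assumes "vertical_transformation C D F G t" "pseudo_double_category D"
  shows "a \<in> objs C \<Longrightarrow> tob t a \<in> vers D" "a \<in> objs C \<Longrightarrow> vsrc D (tob t a) = lob F a"
    "a \<in> objs C \<Longrightarrow> vtgt D (tob t a) = lob G a"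
    "g \<in> hors C \<Longrightarrow> thor t g \<in> cells D" "g \<in> hors C \<Longrightarrow> ctop D (thor t g) = lhor F g"
    "g \<in> hors C \<Longrightarrow> cbot D (thor t g) = lhor G g"
    "g \<in> hors C \<Longrightarrow> cleft D (thor t g) = tob t (hsrc C g)"
    "g \<in> hors C \<Longrightarrow> cright D (thor t g) = tob t (htgt C g)"
    "u \<in> vers C \<Longrightarrow> vcmp D (lver G u) (tob t (vsrc C u)) = vcmp D (tob t (vtgt C u)) (lver F u)"
    "x \<in> cells C \<Longrightarrow> cmp (ccat D) (lcell G x) (thor t (ctop C x)) = cmp (ccat D) (thor t (cbot C x)) (lcell F x)"
    "a \<in> objs C \<Longrightarrow> cmp (ccat D) (thor t (hid C a)) (lax_unit F a) = cmp (ccat D) (lax_unit G a) (chid D (tob t a))"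
    "g \<in> hors C \<Longrightarrow> d \<in> hors C \<Longrightarrow> htgt C g = hsrc C d \<Longrightarrow>
      cmp (ccat D) (thor t (hcomp C g d)) (lax_comp F g d) =
      cmp (ccat D) (lax_comp G g d) (chcomp D (thor t g) (thor t d))"
  using assms unfolding vertical_transformation_def cell_over_def hcomposable_def by blast+

lemma vertical_transformationI:
  assumes "\<And>a. a \<in> objs C \<Longrightarrow> tob t a \<in> vers D \<and> vsrc D (tob t a) = lob F a \<and> vtgt D (tob t a) = lob G a"
    "\<And>g. g \<in> hors C \<Longrightarrow> cell_over D (thor t g) (lhor F g) (lhor G g) (tob t (hsrc C g)) (tob t (htgt C g))"
    "\<And>u. u \<in> vers C \<Longrightarrow> vcmp D (lver G u) (tob t (vsrc C u)) = vcmp D (tob t (vtgt C u)) (lver F u)"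
    "\<And>x. x \<in> cells C \<Longrightarrow> cmp (ccat D) (lcell G x) (thor t (ctop C x)) = cmp (ccat D) (thor t (cbot C x)) (lcell F x)"
    "\<And>a. a \<in> objs C \<Longrightarrow> cmp (ccat D) (thor t (hid C a)) (lax_unit F a) = cmp (ccat D) (lax_unit G a) (chid D (tob t a))"
    "\<And>g d. g \<in> hors C \<Longrightarrow> d \<in> hors C \<Longrightarrow> htgt C g = hsrc C d \<Longrightarrow>
      cmp (ccat D) (thor t (hcomp C g d)) (lax_comp F g d) =
      cmp (ccat D) (lax_comp G g d) (chcomp D (thor t g) (thor t d))"
  shows "vertical_transformation C D F G t"
  using assms unfolding vertical_transformation_def hcomposable_def by blast

lemma vert_trans_eqI:
  assumes "ext_vert_trans D s" "ext_vert_trans D t"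
    "\<And>a. a \<in> objs D \<Longrightarrow> tob s a = tob t a" "\<And>g. g \<in> hors D \<Longrightarrow> thor s g = thor t g"
  shows "s = (t :: 'v vert_trans)"
proof -
  have "tob s = tob t" "thor s = thor t"
    using assms unfolding ext_vert_trans_def by (auto intro: extensionalityI)
  then show ?thesis by simp
qed

text \<open>Composites of vertical transformations are treated up to their values on the carrier, because
  the structure maps of the 2-category of pseudo double categories produce restricted functions.\<close>

lemma vertical_transformation_cong:
  assumes C: "pseudo_double_category C" and t: "vertical_transformation C D F G t"
    and e: "\<And>a. a \<in> objs C \<Longrightarrow> tob t' a = tob t a" "\<And>g. g \<in> hors C \<Longrightarrow> thor t' g = thor t g"
    and F: "\<And>a. a \<in> objs C \<Longrightarrow> lob F' a = lob F a" "\<And>u. u \<in> vers C \<Longrightarrow> lver F' u = lver F u"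
    "\<And>g. g \<in> hors C \<Longrightarrow> lhor F' g = lhor F g" "\<And>x. x \<in> cells C \<Longrightarrow> lcell F' x = lcell F x"
    "\<And>a. a \<in> objs C \<Longrightarrow> lax_unit F' a = lax_unit F a"
    "\<And>g d. g \<in> hors C \<Longrightarrow> d \<in> hors C \<Longrightarrow> htgt C g = hsrc C d \<Longrightarrow> lax_comp F' g d = lax_comp F g d"
    and G: "\<And>a. a \<in> objs C \<Longrightarrow> lob G' a = lob G a" "\<And>u. u \<in> vers C \<Longrightarrow> lver G' u = lver G u"
    "\<And>g. g \<in> hors C \<Longrightarrow> lhor G' g = lhor G g" "\<And>x. x \<in> cells C \<Longrightarrow> lcell G' x = lcell G x"
    "\<And>a. a \<in> objs C \<Longrightarrow> lax_unit G' a = lax_unit G a"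
    "\<And>g d. g \<in> hors C \<Longrightarrow> d \<in> hors C \<Longrightarrow> htgt C g = hsrc C d \<Longrightarrow> lax_comp G' g d = lax_comp G g d"
  shows "vertical_transformation C D F' G' t'"
  using t C unfolding vertical_transformation_def hcomposable_def by (auto simp: e F G)

lemma vertical_transformation_ide:
  assumes "lax_functor C D F"
  shows "vertical_transformation C D F F \<lparr>tob = (\<lambda>a. vid D (lob F a)), thor = (\<lambda>g. cid D (lhor F g))\<rparr>"
proof -
  interpret lax_functor C D F by fact
  show ?thesis by (rule vertical_transformationI) (simp_all add: cell_over_def)
qed

lemma vertical_transformation_vcomp:
  assumes F: "lax_functor C D F" and G: "lax_functor C D G" and H: "lax_functor C D H"
    and t: "vertical_transformation C D F G t" and s: "vertical_transformation C D G H s"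
  shows "vertical_transformation C D F H \<lparr>tob = (\<lambda>a. vcmp D (tob s a) (tob t a)),
     thor = (\<lambda>g. cmp (ccat D) (thor s g) (thor t g))\<rparr>"
proof -
  interpret F: lax_functor C D F by fact
  interpret G: lax_functor C D G by fact
  interpret H: lax_functor C D H by fact
  note t [simp] = vertical_transformationD[OF t F.pd] and s [simp] = vertical_transformationD[OF s F.pd]
  show ?thesis
  proof (rule vertical_transformationI, goal_cases)
    case (3 u)
    then have "vcmp D (vcmp D (lver H u) (tob s (vsrc C u))) (tob t (vsrc C u)) =
      vcmp D (tob s (vtgt C u)) (vcmp D (lver G u) (tob t (vsrc C u)))" by simp
    then show ?case using 3 by (simp del: s(9))
  next
    case (4 x)
    then have "cmp (ccat D) (cmp (ccat D) (lcell H x) (thor s (ctop C x))) (thor t (ctop C x)) =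
      cmp (ccat D) (thor s (cbot C x)) (cmp (ccat D) (lcell G x) (thor t (ctop C x)))" by simp
    then show ?case using 4 by (simp del: s(10))
  next
    case (5 a)
    then have "cmp (ccat D) (cmp (ccat D) (thor s (hid C a)) (lax_unit G a)) (chid D (tob t a)) =
      cmp (ccat D) (cmp (ccat D) (lax_unit H a) (chid D (tob s a))) (chid D (tob t a))" by simp
    then show ?case using 5 by (simp del: s(11))
  next
    case (6 g d)
    then have "cmp (ccat D) (cmp (ccat D) (thor s (hcomp C g d)) (lax_comp G g d)) (chcomp D (thor t g) (thor t d)) =
      cmp (ccat D) (cmp (ccat D) (lax_comp H g d) (chcomp D (thor s g) (thor s d))) (chcomp D (thor t g) (thor t d))" by simp
    then show ?case using 6 by (simp add: F.ichg del: s(12))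
  qed (simp_all add: cell_over_def)
qed

lemma vertical_transformation_lwhisker:
  assumes F: "lax_functor B C F" and F': "lax_functor B C F'" and G: "lax_functor C D G"
    and t: "vertical_transformation B C F F' t"
  shows "vertical_transformation B D (comp_lax_fun B D G F) (comp_lax_fun B D G F')
    \<lparr>tob = (\<lambda>a. lver G (tob t a)), thor = (\<lambda>g. lcell G (thor t g))\<rparr>"
proof -
  interpret F: lax_functor B C F by fact
  interpret F': lax_functor B C F' by fact
  interpret G: lax_functor C D G by fact
  note t [simp] = vertical_transformationD[OF t F.pd]
  show ?thesis
  proof (rule vertical_transformationI, goal_cases)
    case (3 u)
    then show ?case using arg_cong[OF t(9)[OF 3], of "lver G"] by (simp del: t(9))
  next
    case (4 x)
    then show ?case using arg_cong[OF t(10)[OF 4], of "lcell G"] by (simp del: t(10))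
  next
    case (5 a)
    then have "cmp (ccat D) (lcell G (cmp (ccat C) (thor t (hid B a)) (lax_unit F a))) (lax_unit G (lob F a)) =
      cmp (ccat D) (lcell G (lax_unit F' a)) (cmp (ccat D) (lcell G (chid C (tob t a))) (lax_unit G (lob F a)))"
      by simp
    then show ?case using 5 G.unit_nat[of "tob t a"] by (simp del: t(11))
  next
    case (6 g d)
    then have "cmp (ccat D) (lcell G (cmp (ccat C) (thor t (hcomp B g d)) (lax_comp F g d))) (lax_comp G (lhor F g) (lhor F d)) =
      cmp (ccat D) (lcell G (lax_comp F' g d)) (cmp (ccat D) (lcell G (chcomp C (thor t g) (thor t d))) (lax_comp G (lhor F g) (lhor F d)))"
      by simp
    then show ?case using 6 G.comp_nat[of "thor t g" "thor t d"] by (simp del: t(12))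
  qed (simp_all add: cell_over_def)
qed

lemma vertical_transformation_rwhisker:
  assumes F: "lax_functor B C F" and G: "lax_functor C D G" and G': "lax_functor C D G'"
    and s: "vertical_transformation C D G G' s"
  shows "vertical_transformation B D (comp_lax_fun B D G F) (comp_lax_fun B D G' F)
    \<lparr>tob = (\<lambda>a. tob s (lob F a)), thor = (\<lambda>g. thor s (lhor F g))\<rparr>"
proof -
  interpret F: lax_functor B C F by fact
  interpret G: lax_functor C D G by fact
  interpret G': lax_functor C D G' by fact
  note s [simp] = vertical_transformationD[OF s G.pd]
  show ?thesis
  proof (rule vertical_transformationI, goal_cases)
    case (3 u)
    then show ?case using s(9)[of "lver F u"] by simp
  next
    case (4 x)
    then show ?case using s(10)[of "lcell F x"] by simp
  next
    case (5 a)
    then show ?case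
      using arg_cong[OF s(10)[of "lax_unit F a"], of "\<lambda>z. cmp (ccat D) z (lax_unit G (lob F a))"]
      by (simp del: s(10))
  next
    case (6 g d)
    then show ?case
      using arg_cong[OF s(10)[of "lax_comp F g d"], of "\<lambda>z. cmp (ccat D) z (lax_comp G (lhor F g) (lhor F d))"]
      by (simp del: s(10))
  qed (simp_all add: cell_over_def)
qed

lemma PsDBL_sel [simp]:
  "cat1 (PsDBL elts U) = PsDBL1 elts U"
  "obj (cat2 (PsDBL elts U)) = arr (PsDBL1 elts U)"
  "src (cat2 (PsDBL elts U)) = asrc" "tgt (cat2 (PsDBL elts U)) = atgt"
  "ide (cat2 (PsDBL elts U)) F = Arrow F
                 \<lparr>tob = (\<lambda>a\<in>obj (vcat (asrc F)). ide (vcat (atgt F)) (lob (amap F) a)),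
                  thor = (\<lambda>g\<in>obj (ccat (asrc F)). ide (ccat (atgt F)) (lhor (amap F) g))\<rparr> F"
  "cmp (cat2 (PsDBL elts U)) s t = Arrow (asrc t)
                 \<lparr>tob = (\<lambda>a\<in>obj (vcat (asrc (asrc t))).
                    cmp (vcat (atgt (asrc t))) (tob (amap s) a) (tob (amap t) a)),
                  thor = (\<lambda>g\<in>obj (ccat (asrc (asrc t))).
                    cmp (ccat (atgt (asrc t))) (thor (amap s) g) (thor (amap t) g))\<rparr> (atgt s)"
  "hcmp (PsDBL elts U) s t = Arrow
               (cmp (PsDBL1 elts U) (asrc s) (asrc t))
               \<lparr>tob = (\<lambda>a\<in>obj (vcat (asrc (asrc t))).
                  cmp (vcat (atgt (asrc s)))
                    (tob (amap s) (lob (amap (atgt t)) a)) (lver (amap (asrc s)) (tob (amap t) a))),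
                thor = (\<lambda>g\<in>obj (ccat (asrc (asrc t))).
                  cmp (ccat (atgt (asrc s)))
                    (thor (amap s) (lhor (amap (atgt t)) g))
                    (lcell (amap (asrc s)) (thor (amap t) g)))\<rparr>
               (cmp (PsDBL1 elts U) (atgt s) (atgt t))"
  by (simp_all add: PsDBL_def)

lemma cell_PsDBL:
  "t \<in> arr (cat2 (PsDBL elts U)) \<longleftrightarrow>
     asrc t \<in> arr (PsDBL1 elts U) \<and> atgt t \<in> arr (PsDBL1 elts U) \<and>
     asrc (asrc t) = asrc (atgt t) \<and> atgt (asrc t) = atgt (atgt t) \<and>
     vertical_transformation (asrc (asrc t)) (atgt (asrc t)) (amap (asrc t)) (amap (atgt t)) (amap t) \<and>
     ext_vert_trans (asrc (asrc t)) (amap t)"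
  by (cases t) (auto simp: PsDBL_def)

lemma lax_functor_PsDBL1: "F \<in> arr (PsDBL1 elts U) \<Longrightarrow> lax_functor (asrc F) (atgt F) (amap F)"
  by (intro lax_functorI) (auto simp: arr_PsDBL1)

lemma ext_vert_trans_restrict:
  "ext_vert_trans D \<lparr>tob = restrict f (objs D), thor = restrict h (hors D)\<rparr>"
  by (simp add: ext_vert_trans_def)

lemma category_PsDBL2: "category (cat2 (PsDBL elts U))"
  unfolding PsDBL_def two_cat.simps
proof (rule category_arrowI, goal_cases)
  case (2 F)
  then have lF: "lax_functor (asrc F) (atgt F) (amap F)" by (rule lax_functor_PsDBL1)
  then interpret lax_functor "asrc F" "atgt F" "amap F" .
  show ?case
    using 2 by (auto intro!: vertical_transformation_cong[OF _ vertical_transformation_ide[OF lF]] simp: ext_vert_trans_restrict)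
next
  case (3 F t G s H)
  then have lF: "lax_functor (asrc F) (atgt F) (amap F)" "lax_functor (asrc F) (atgt F) (amap G)"
    "lax_functor (asrc F) (atgt F) (amap H)"
    and t: "vertical_transformation (asrc F) (atgt F) (amap F) (amap G) t"
    and s: "vertical_transformation (asrc F) (atgt F) (amap G) (amap H) s"
    and e: "asrc G = asrc F" "atgt G = atgt F" "asrc H = asrc F" "atgt H = atgt F"
    using lax_functor_PsDBL1[of F elts U] lax_functor_PsDBL1[of G elts U] lax_functor_PsDBL1[of H elts U] by auto
  interpret lax_functor "asrc F" "atgt F" "amap F" by fact
  have "vertical_transformation (asrc F) (atgt F) (amap F) (amap H)
     \<lparr>tob = (\<lambda>a\<in>objs (asrc F). vcmp (atgt F) (tob s a) (tob t a)),
      thor = (\<lambda>g\<in>hors (asrc F). cmp (ccat (atgt F)) (thor s g) (thor t g))\<rparr>"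
    by (rule vertical_transformation_cong[OF pdC vertical_transformation_vcomp[OF lF t s]]) simp_all
  moreover have "F \<in> arr (PsDBL1 elts U)" "H \<in> arr (PsDBL1 elts U)" using 3 by auto
  ultimately show ?case by (simp add: e ext_vert_trans_restrict)
next
  case (4 F t G)
  then have F: "lax_functor (asrc F) (atgt F) (amap F)" by (intro lax_functor_PsDBL1) auto
  then interpret lax_functor "asrc F" "atgt F" "amap F" .
  have t: "vertical_transformation (asrc F) (atgt F) (amap F) (amap G) t" "ext_vert_trans (asrc F) t"
    using 4 by auto
  show ?case by (rule vert_trans_eqI[OF _ t(2)])
    (simp_all add: ext_vert_trans_restrict vertical_transformationD[OF t(1) pd])
next
  case (5 F t G)
  then have F: "lax_functor (asrc F) (atgt F) (amap F)" by (intro lax_functor_PsDBL1) auto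
  then interpret lax_functor "asrc F" "atgt F" "amap F" .
  have t: "vertical_transformation (asrc F) (atgt F) (amap F) (amap G) t" "ext_vert_trans (asrc F) t"
    and [simp]: "asrc G = asrc F" "atgt G = atgt F" using 5 by auto
  show ?case by (rule vert_trans_eqI[OF _ t(2)])
    (simp_all add: ext_vert_trans_restrict vertical_transformationD[OF t(1) pd])
next
  case (6 E r F t G s H)
  then have F: "lax_functor (asrc E) (atgt E) (amap E)" by (intro lax_functor_PsDBL1) auto
  then interpret lax_functor "asrc E" "atgt E" "amap E" .
  have t: "vertical_transformation (asrc E) (atgt E) (amap F) (amap G) t"
    and r: "vertical_transformation (asrc E) (atgt E) (amap E) (amap F) r"
    and s: "vertical_transformation (asrc E) (atgt E) (amap G) (amap H) s"
    and [simp]: "asrc F = asrc E" "atgt F = atgt E" using 6 by auto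
  show ?case by (rule vert_trans_eqI[where D="asrc E"])
    (simp_all add: ext_vert_trans_restrict vertical_transformationD[OF t pd]
       vertical_transformationD[OF r pd] vertical_transformationD[OF s pd])
qed auto

lemma two_category_PsDBL: "two_category (PsDBL elts U)"
proof (rule two_categoryI, goal_cases)
  case (5 s t)
  let ?B = "asrc (asrc t)" and ?C = "atgt (asrc t)" and ?D = "atgt (asrc s)"
  have m: "asrc t \<in> arr (PsDBL1 elts U)" "atgt t \<in> arr (PsDBL1 elts U)"
     "asrc s \<in> arr (PsDBL1 elts U)" "atgt s \<in> arr (PsDBL1 elts U)"
    and [simp]: "asrc (atgt t) = ?B" "atgt (atgt t) = ?C" "asrc (atgt s) = ?C" "atgt (atgt s) = ?D" "asrc (asrc s) = ?C"
    and t: "vertical_transformation ?B ?C (amap (asrc t)) (amap (atgt t)) (amap t)"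
    and s: "vertical_transformation ?C ?D (amap (asrc s)) (amap (atgt s)) (amap s)"
    using 5 by (auto simp: cell_PsDBL)
  have lF: "lax_functor ?B ?C (amap (asrc t))" "lax_functor ?B ?C (amap (atgt t))"
    and lG: "lax_functor ?C ?D (amap (asrc s))" "lax_functor ?C ?D (amap (atgt s))"
    using m[THEN lax_functor_PsDBL1] by simp_all
  interpret lax_functor ?B ?C "amap (asrc t)" by fact
  have c: "lax_functor ?B ?D (comp_lax_fun ?B ?D (amap G) (amap F))"
    if "lax_functor ?B ?C (amap F)" "lax_functor ?C ?D (amap G)" for F G :: "('a psdbl, 'a lax_fun) arrow"
    using that lax_double_functor_comp[OF that] by (auto simp: lax_functor_def lax_functor_axioms_def)
  have c1: "cmp (PsDBL1 elts U) (asrc s) (asrc t) \<in> arr (PsDBL1 elts U)"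
    "cmp (PsDBL1 elts U) (atgt s) (atgt t) \<in> arr (PsDBL1 elts U)"
    by (intro cat_simps(6)[OF category_PsDBL1]; use m in simp)+
  from vertical_transformation_cong[OF pdC vertical_transformation_vcomp[OF c[OF lF(1) lG(1)] c[OF lF(2) lG(1)]
      c[OF lF(2) lG(2)] vertical_transformation_lwhisker[OF lF lG(1) t] vertical_transformation_rwhisker[OF lF(2) lG s]]]
  show ?case using c1 by (simp add: cell_PsDBL ext_vert_trans_restrict)
next
  case (6 t)
  let ?B = "asrc (asrc t)" and ?C = "atgt (asrc t)"
  have m: "asrc t \<in> arr (PsDBL1 elts U)" "atgt t \<in> arr (PsDBL1 elts U)"
    and [simp]: "asrc (atgt t) = ?B" "atgt (atgt t) = ?C"
    and t: "vertical_transformation ?B ?C (amap (asrc t)) (amap (atgt t)) (amap t)" "ext_vert_trans ?B (amap t)"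
    using 6 by (auto simp: cell_PsDBL)
  then interpret F: lax_functor ?B ?C "amap (asrc t)" using m[THEN lax_functor_PsDBL1] by simp
  interpret G: lax_functor ?B ?C "amap (atgt t)" using m[THEN lax_functor_PsDBL1] by simp
  have *: "cmp (PsDBL1 elts U) (asrc t) (ide (PsDBL1 elts U) ?B) = asrc t"
    "cmp (PsDBL1 elts U) (atgt t) (ide (PsDBL1 elts U) ?B) = atgt t"
    using m by (intro cat_simps(9)[OF category_PsDBL1]; simp)+
  then show ?case
    by (intro arrow.expand) (auto intro!: vert_trans_eqI[OF _ t(2)]
        simp: ext_vert_trans_restrict vertical_transformationD[OF t(1) F.pd])
next
  case (7 t)
  let ?B = "asrc (asrc t)" and ?C = "atgt (asrc t)"
  have m: "asrc t \<in> arr (PsDBL1 elts U)" "atgt t \<in> arr (PsDBL1 elts U)"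
    and [simp]: "asrc (atgt t) = ?B" "atgt (atgt t) = ?C"
    and t: "vertical_transformation ?B ?C (amap (asrc t)) (amap (atgt t)) (amap t)" "ext_vert_trans ?B (amap t)"
    using 7 by (auto simp: cell_PsDBL)
  then interpret F: lax_functor ?B ?C "amap (asrc t)" using m[THEN lax_functor_PsDBL1] by simp
  interpret G: lax_functor ?B ?C "amap (atgt t)" using m[THEN lax_functor_PsDBL1] by simp
  have *: "cmp (PsDBL1 elts U) (ide (PsDBL1 elts U) ?C) (asrc t) = asrc t"
    "cmp (PsDBL1 elts U) (ide (PsDBL1 elts U) ?C) (atgt t) = atgt t"
    using m by (intro cat_simps(10)[OF category_PsDBL1]; simp)+
  then show ?case
    by (intro arrow.expand) (auto intro!: vert_trans_eqI[OF _ t(2)]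
        simp: ext_vert_trans_restrict vertical_transformationD[OF t(1) F.pd])
next
  case (8 r s t)
  let ?B = "asrc (asrc t)" and ?C = "atgt (asrc t)" and ?D = "atgt (asrc s)" and ?E = "atgt (asrc r)"
  have m: "asrc t \<in> arr (PsDBL1 elts U)" "atgt t \<in> arr (PsDBL1 elts U)"
     "asrc s \<in> arr (PsDBL1 elts U)" "atgt s \<in> arr (PsDBL1 elts U)"
     "asrc r \<in> arr (PsDBL1 elts U)" "atgt r \<in> arr (PsDBL1 elts U)"
    and [simp]: "asrc (atgt t) = ?B" "atgt (atgt t) = ?C" "asrc (atgt s) = ?C" "atgt (atgt s) = ?D" "asrc (asrc s) = ?C"
      "asrc (asrc r) = ?D" "asrc (atgt r) = ?D" "atgt (atgt r) = ?E"
    and t: "vertical_transformation ?B ?C (amap (asrc t)) (amap (atgt t)) (amap t)"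
    and s: "vertical_transformation ?C ?D (amap (asrc s)) (amap (atgt s)) (amap s)"
    and r: "vertical_transformation ?D ?E (amap (asrc r)) (amap (atgt r)) (amap r)"
    using 8 by (auto simp: cell_PsDBL)
  interpret F: lax_functor ?B ?C "amap (asrc t)" using m[THEN lax_functor_PsDBL1] by simp
  interpret F': lax_functor ?B ?C "amap (atgt t)" using m[THEN lax_functor_PsDBL1] by simp
  interpret G: lax_functor ?C ?D "amap (asrc s)" using m[THEN lax_functor_PsDBL1] by simp
  interpret G': lax_functor ?C ?D "amap (atgt s)" using m[THEN lax_functor_PsDBL1] by simp
  interpret H: lax_functor ?D ?E "amap (asrc r)" using m[THEN lax_functor_PsDBL1] by simp
  interpret H': lax_functor ?D ?E "amap (atgt r)" using m[THEN lax_functor_PsDBL1] by simp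
  have *: "cmp (PsDBL1 elts U) (asrc r) (cmp (PsDBL1 elts U) (asrc s) (asrc t)) =
    cmp (PsDBL1 elts U) (cmp (PsDBL1 elts U) (asrc r) (asrc s)) (asrc t)"
    "cmp (PsDBL1 elts U) (atgt r) (cmp (PsDBL1 elts U) (atgt s) (atgt t)) =
    cmp (PsDBL1 elts U) (cmp (PsDBL1 elts U) (atgt r) (atgt s)) (atgt t)"
    by (intro cat_simps(11)[OF category_PsDBL1, symmetric]; use m in simp)+
  then show ?case
    by (intro arrow.expand) (auto simp: vertical_transformationD[OF t F.pd] vertical_transformationD[OF s G.pd]
        vertical_transformationD[OF r H.pd] cong: restrict_cong)
next
  case (9 G F)
  let ?B = "asrc F" and ?C = "atgt F" and ?D = "atgt G"
  interpret F: lax_functor ?B ?C "amap F" using 9 lax_functor_PsDBL1 by auto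
  interpret G: lax_functor ?C ?D "amap G" using 9 lax_functor_PsDBL1[of G] by auto
  show ?case using 9 by (auto cong: restrict_cong)
next
  case (10 d c b a)
  let ?B = "asrc (asrc a)" and ?C = "atgt (asrc a)" and ?D = "atgt (asrc c)"
  have m: "asrc a \<in> arr (PsDBL1 elts U)" "atgt a \<in> arr (PsDBL1 elts U)" "atgt b \<in> arr (PsDBL1 elts U)"
     "asrc c \<in> arr (PsDBL1 elts U)" "atgt c \<in> arr (PsDBL1 elts U)" "atgt d \<in> arr (PsDBL1 elts U)"
    and a: "vertical_transformation ?B ?C (amap (asrc a)) (amap (atgt a)) (amap a)"
    and b: "vertical_transformation ?B ?C (amap (atgt a)) (amap (atgt b)) (amap b)"
    and c: "vertical_transformation ?C ?D (amap (asrc c)) (amap (atgt c)) (amap c)"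
    and d: "vertical_transformation ?C ?D (amap (atgt c)) (amap (atgt d)) (amap d)"
    and [simp]: "asrc (atgt a) = ?B" "atgt (atgt a) = ?C" "asrc (atgt c) = ?C" "atgt (atgt c) = ?D"
      "asrc (atgt b) = ?B" "atgt (atgt b) = ?C" "asrc (atgt d) = ?C" "atgt (atgt d) = ?D"
      "asrc (asrc c) = ?C" "asrc b = atgt a" "asrc d = atgt c"
    using 10 by (auto simp: cell_PsDBL)
  interpret F: lax_functor ?B ?C "amap (asrc a)" using m[THEN lax_functor_PsDBL1] by simp
  interpret F': lax_functor ?B ?C "amap (atgt a)" using m[THEN lax_functor_PsDBL1] by simp
  interpret F'': lax_functor ?B ?C "amap (atgt b)" using m[THEN lax_functor_PsDBL1] by simp
  interpret G: lax_functor ?C ?D "amap (asrc c)" using m[THEN lax_functor_PsDBL1] by simp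
  interpret G': lax_functor ?C ?D "amap (atgt c)" using m[THEN lax_functor_PsDBL1] by simp
  interpret G'': lax_functor ?C ?D "amap (atgt d)" using m[THEN lax_functor_PsDBL1] by simp
  note [simp] = vertical_transformationD(1-8)[OF a F.pd] vertical_transformationD(1-8)[OF b F.pd]
    vertical_transformationD(1-8)[OF c G.pd] vertical_transformationD(1-8)[OF d G.pd]
  have 1: "vcmp ?D (tob (amap c) (lob (amap (atgt b)) x)) (vcmp ?D (lver (amap (asrc c)) (tob (amap b) x)) z) =
      vcmp ?D (lver (amap (atgt c)) (tob (amap b) x)) (vcmp ?D (tob (amap c) (lob (amap (atgt a)) x)) z)"
    if "x \<in> objs ?B" "z \<in> vers ?D" "vtgt ?D z = lob (amap (asrc c)) (lob (amap (atgt a)) x)" for x z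
    using vertical_transformationD(9)[OF c G.pd, of "tob (amap b) x"] that
    by (simp flip: cat_simps(11))
  have 2: "cmp (ccat ?D) (thor (amap c) (lhor (amap (atgt b)) x)) (cmp (ccat ?D) (lcell (amap (asrc c)) (thor (amap b) x)) z) =
      cmp (ccat ?D) (lcell (amap (atgt c)) (thor (amap b) x)) (cmp (ccat ?D) (thor (amap c) (lhor (amap (atgt a)) x)) z)"
    if "x \<in> hors ?B" "z \<in> cells ?D" "cbot ?D z = lhor (amap (asrc c)) (lhor (amap (atgt a)) x)" for x z
    using vertical_transformationD(10)[OF c G.pd, of "thor (amap b) x"] that
    by (simp flip: cat_simps(11))
  show ?case by (auto simp: 1 2 cong: restrict_cong)
qed (auto simp: category_PsDBL1 category_PsDBL2 cell_PsDBL)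


section \<open>Categories enriched over a pseudo double category\<close>

lemma vdbl_of_sel [simp]:
  "vvert (vdbl_of D) = vcat D" "vhor (vdbl_of D) = hors D" "vhsrc (vdbl_of D) = hsrc D" "vhtgt (vdbl_of D) = htgt D"
  "mid (vdbl_of D) g = MCell [g] (vid D (hsrc D g)) (vid D (htgt D g)) g (cid D g)"
  by (simp_all add: vdbl_of_def)

lemma mcell_over_vdbl_of:
  "mcell_over (vdbl_of D) k gs d u u' \<longleftrightarrow> mtop k = gs \<and> mbot k = d \<and> mleft k = u \<and> mright k = u' \<and>
     u \<in> vers D \<and> u' \<in> vers D \<and> hpath D (vsrc D u) gs (vsrc D u') \<and>
     cell_over D (mname k) (hcomps D (vsrc D u) gs) d u u'"
  by (cases k) (auto simp: mcell_over_def vdbl_of_def)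

context pdc
begin

abbreviation "A \<equiv> vdbl_of D"

text \<open>In the composites that occur in enriched category theory the coherence isomorphism that flattens
  the tops is an identity, a unit constraint or an associativity constraint.\<close>

lemma mcomp_nil:
  "u \<in> vers D \<Longrightarrow> mcomp A k u [] =
     MCell [] (vcmp D (mleft k) u) (vcmp D (mright k) u) (mbot k) (mname k \<odot> chid D u)"
  by (simp add: vdbl_of_def)

lemma mcomp_1:
  "mname s \<in> cells D \<Longrightarrow> mleft s = u \<Longrightarrow> ctop D (mname s) = hcomps D (vsrc D u) (mtop s) \<Longrightarrow> mcomp A k u [s] =
     MCell (mtop s) (vcmp D (mleft k) u) (vcmp D (mright k) (mright s)) (mbot k) (mname k \<odot> mname s)"
  using cat_simps(1)[of "ccat D" "mname s"] by (simp add: vdbl_of_def)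

lemma mcomp_11:
  "mtop s = [g] \<Longrightarrow> mtop t = [d] \<Longrightarrow> g \<in> hors D \<Longrightarrow> d \<in> hors D \<Longrightarrow> htgt D g = hsrc D d \<Longrightarrow>
   mname s \<in> cells D \<Longrightarrow> mname t \<in> cells D \<Longrightarrow> ctop D (mname s) = g \<Longrightarrow> ctop D (mname t) = d \<Longrightarrow>
   cright D (mname s) = cleft D (mname t) \<Longrightarrow> mcomp A k u [s, t] =
     MCell [g, d] (vcmp D (mleft k) u) (vcmp D (mright k) (mright t)) (mbot k) (mname k \<odot> (mname s \<otimes> mname t))"
  by (simp add: vdbl_of_def path_end_def)

lemma mcomp_01:
  "mtop s = [] \<Longrightarrow> mtop t = [g] \<Longrightarrow> g \<in> hors D \<Longrightarrow> vsrc D u = hsrc D g \<Longrightarrow> mcomp A k u [s, t] =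
     MCell [g] (vcmp D (mleft k) u) (vcmp D (mright k) (mright t)) (mbot k) (mname k \<odot> (mname s \<otimes> mname t) \<odot> li g)"
  by (simp add: vdbl_of_def path_end_def)

lemma mcomp_10:
  "mtop s = [g] \<Longrightarrow> mtop t = [] \<Longrightarrow> g \<in> hors D \<Longrightarrow> mcomp A k u [s, t] =
     MCell [g] (vcmp D (mleft k) u) (vcmp D (mright k) (mright t)) (mbot k) (mname k \<odot> (mname s \<otimes> mname t) \<odot> ri g)"
  by (simp add: vdbl_of_def path_end_def)

lemma mcomp_00:
  "mtop s = [] \<Longrightarrow> mtop t = [] \<Longrightarrow> vsrc D u = a \<Longrightarrow> a \<in> objs D \<Longrightarrow> mcomp A k u [s, t] =
     MCell [] (vcmp D (mleft k) u) (vcmp D (mright k) (mright t)) (mbot k) (mname k \<odot> (mname s \<otimes> mname t) \<odot> li (hid D a))"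
  by (simp add: vdbl_of_def path_end_def)

lemma mcomp_21:
  "mtop s = [g, d] \<Longrightarrow> mtop t = [e] \<Longrightarrow> g \<in> hors D \<Longrightarrow> d \<in> hors D \<Longrightarrow> e \<in> hors D \<Longrightarrow>
   htgt D g = hsrc D d \<Longrightarrow> htgt D d = hsrc D e \<Longrightarrow> mcomp A k u [s, t] =
     MCell [g, d, e] (vcmp D (mleft k) u) (vcmp D (mright k) (mright t)) (mbot k)
       (mname k \<odot> (mname s \<otimes> mname t) \<odot> ai g d e)"
  by (simp add: vdbl_of_def path_end_def)

lemma mcomp_12:
  "mtop s = [g] \<Longrightarrow> mtop t = [d, e] \<Longrightarrow> g \<in> hors D \<Longrightarrow> d \<in> hors D \<Longrightarrow> e \<in> hors D \<Longrightarrow>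
   htgt D g = hsrc D d \<Longrightarrow> htgt D d = hsrc D e \<Longrightarrow>
   mname s \<in> cells D \<Longrightarrow> mname t \<in> cells D \<Longrightarrow> ctop D (mname s) = g \<Longrightarrow> ctop D (mname t) = hcomp D d e \<Longrightarrow>
   cright D (mname s) = cleft D (mname t) \<Longrightarrow> mcomp A k u [s, t] =
     MCell [g, d, e] (vcmp D (mleft k) u) (vcmp D (mright k) (mright t)) (mbot k) (mname k \<odot> (mname s \<otimes> mname t))"
  by (simp add: vdbl_of_def path_end_def)

text \<open>The ways to insert two horizontal identities next to a horizontal morphism agree, in each of the three
  relative positions.\<close>

lemma as_li_li: 
  "g \<in> hors D \<Longrightarrow> as (hid D (hsrc D g)) (hid D (hsrc D g)) g \<odot> (li (hid D (hsrc D g)) \<otimes> cid D g) \<odot> li g =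
     (cid D (hid D (hsrc D g)) \<otimes> li g) \<odot> li g"
  using li_nat[of "li g"] as_li[of "hid D (hsrc D g)" g] by (simp flip: cat_simps(11))

lemma as_li_ri:
  "g \<in> hors D \<Longrightarrow> as (hid D (hsrc D g)) g (hid D (htgt D g)) \<odot> (li g \<otimes> cid D (hid D (htgt D g))) \<odot> ri g =
     (cid D (hid D (hsrc D g)) \<otimes> ri g) \<odot> li g"
  using li_nat[of "ri g"] as_li[of g "hid D (htgt D g)"] by (simp flip: cat_simps(11))

lemma as_ri_ri:
  "g \<in> hors D \<Longrightarrow> as g (hid D (htgt D g)) (hid D (htgt D g)) \<odot> (ri g \<otimes> cid D (hid D (htgt D g))) \<odot> ri g =
     (cid D g \<otimes> li (hid D (htgt D g))) \<odot> ri g"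
  using as_ri[of g "hid D (htgt D g)"] by (simp flip: cat_simps(11))

lemma eq_lu_iff: "x \<in> cells D \<Longrightarrow> g \<in> hors D \<Longrightarrow> ctop D x = hcomp D (hid D (hsrc D g)) g \<Longrightarrow>
    x \<odot> li g = cid D g \<longleftrightarrow> x = lu g"
proof
  assume x: "x \<in> cells D" "g \<in> hors D" "ctop D x = hcomp D (hid D (hsrc D g)) g" and "x \<odot> li g = cid D g"
  then have "(x \<odot> li g) \<odot> lu g = cid D g \<odot> lu g" by simp
  then show "x = lu g" using x by simp
qed simp

lemma eq_ru_iff: "x \<in> cells D \<Longrightarrow> g \<in> hors D \<Longrightarrow> ctop D x = hcomp D g (hid D (htgt D g)) \<Longrightarrow>
    x \<odot> ri g = cid D g \<longleftrightarrow> x = ru g"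
proof
  assume x: "x \<in> cells D" "g \<in> hors D" "ctop D x = hcomp D g (hid D (htgt D g))" and "x \<odot> ri g = cid D g"
  then have "(x \<odot> ri g) \<odot> ru g = cid D g \<odot> ru g" by simp
  then show "x = ru g" using x by simp
qed simp

lemma eq_as_iff: "x \<in> cells D \<Longrightarrow> y \<in> cells D \<Longrightarrow> g \<in> hors D \<Longrightarrow> d \<in> hors D \<Longrightarrow> e \<in> hors D \<Longrightarrow>
    htgt D g = hsrc D d \<Longrightarrow> htgt D d = hsrc D e \<Longrightarrow> ctop D x = hcomp D (hcomp D g d) e \<Longrightarrow>
    ctop D y = hcomp D g (hcomp D d e) \<Longrightarrow> x \<odot> ai g d e = y \<longleftrightarrow> x = y \<odot> as g d e"
proof
  assume x: "x \<in> cells D" "g \<in> hors D" "d \<in> hors D" "e \<in> hors D" "htgt D g = hsrc D d" "htgt D d = hsrc D e"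
    "ctop D x = hcomp D (hcomp D g d) e" and "x \<odot> ai g d e = y"
  then have "(x \<odot> ai g d e) \<odot> as g d e = y \<odot> as g d e" by simp
  then show "x = y \<odot> as g d e" using x by simp
qed simp

text \<open>Stated inside the double category, an enriched category satisfies the laws of a monad with the
  constraints of the double category in place of equalities.\<close>

lemma enriched_category_iff:
  "enriched_category A C \<longleftrightarrow>
     (\<forall>c\<in>eob C. eext C c \<in> objs D) \<and>
     (\<forall>c\<in>eob C. \<forall>c'\<in>eob C. ehom C c c' \<in> hors D \<and>
        hsrc D (ehom C c c') = eext C c \<and> htgt D (ehom C c c') = eext C c') \<and>
     (\<forall>c\<in>eob C. mtop (eunit C c) = [] \<and> mbot (eunit C c) = ehom C c c \<and>
        mleft (eunit C c) = vid D (eext C c) \<and> mright (eunit C c) = vid D (eext C c) \<and>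
        cell_over D (mname (eunit C c)) (hid D (eext C c)) (ehom C c c) (vid D (eext C c)) (vid D (eext C c))) \<and>
     (\<forall>k\<in>eob C. \<forall>l\<in>eob C. \<forall>m\<in>eob C.
        mtop (emult C k l m) = [ehom C k l, ehom C l m] \<and> mbot (emult C k l m) = ehom C k m \<and>
        mleft (emult C k l m) = vid D (eext C k) \<and> mright (emult C k l m) = vid D (eext C m) \<and>
        cell_over D (mname (emult C k l m)) (hcomp D (ehom C k l) (ehom C l m)) (ehom C k m)
          (vid D (eext C k)) (vid D (eext C m))) \<and>
     (\<forall>c\<in>eob C. \<forall>c'\<in>eob C.
        mname (emult C c c c') \<odot> (mname (eunit C c) \<otimes> cid D (ehom C c c')) = lu (ehom C c c') \<and>
        mname (emult C c c' c') \<odot> (cid D (ehom C c c') \<otimes> mname (eunit C c')) = ru (ehom C c c')) \<and>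
     (\<forall>k\<in>eob C. \<forall>l\<in>eob C. \<forall>m\<in>eob C. \<forall>n\<in>eob C.
        mname (emult C k m n) \<odot> (mname (emult C k l m) \<otimes> cid D (ehom C m n)) =
        mname (emult C k l n) \<odot> (cid D (ehom C k l) \<otimes> mname (emult C l m n)) \<odot>
          as (ehom C k l) (ehom C l m) (ehom C m n))" (is "_ \<longleftrightarrow> ?O \<and> ?H \<and> ?U \<and> ?M \<and> ?L \<and> ?S")
proof -
  have typed: ?thesis if t: ?O ?H ?U ?M
  proof -
    have L: "mcomp1 A (emult C c c c') [eunit C c, mid A (ehom C c c')] = mid A (ehom C c c') \<and>
        mcomp1 A (emult C c c' c') [mid A (ehom C c c'), eunit C c'] = mid A (ehom C c c') \<longleftrightarrow>
        mname (emult C c c c') \<odot> (mname (eunit C c) \<otimes> cid D (ehom C c c')) = lu (ehom C c c') \<and>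
        mname (emult C c c' c') \<odot> (cid D (ehom C c c') \<otimes> mname (eunit C c')) = ru (ehom C c c')"
      if "c \<in> eob C" "c' \<in> eob C" for c c'
      using t that by (simp add: mcomp_01 mcomp_10 cell_over_def flip: eq_lu_iff eq_ru_iff)
    have S: "mcomp1 A (emult C k m n) [emult C k l m, mid A (ehom C m n)] =
        mcomp1 A (emult C k l n) [mid A (ehom C k l), emult C l m n] \<longleftrightarrow>
        mname (emult C k m n) \<odot> (mname (emult C k l m) \<otimes> cid D (ehom C m n)) =
        mname (emult C k l n) \<odot> (cid D (ehom C k l) \<otimes> mname (emult C l m n)) \<odot>
          as (ehom C k l) (ehom C l m) (ehom C m n)"
      if "k \<in> eob C" "l \<in> eob C" "m \<in> eob C" "n \<in> eob C" for k l m n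
      using t that eq_as_iff[of "mname (emult C k m n) \<odot> (mname (emult C k l m) \<otimes> cid D (ehom C m n))"
        "mname (emult C k l n) \<odot> (cid D (ehom C k l) \<otimes> mname (emult C l m n))"
        "ehom C k l" "ehom C l m" "ehom C m n"]
      by (simp add: mcomp_21 mcomp_12 cell_over_def)
    have U: "(\<forall>c\<in>eob C. mcell_over A (eunit C c) [] (ehom C c c) (vid D (eext C c)) (vid D (eext C c))) \<longleftrightarrow> ?U"
      using t(1) by (intro ball_cong refl) (auto simp: mcell_over_vdbl_of)
    have M: "(\<forall>k\<in>eob C. \<forall>l\<in>eob C. \<forall>m\<in>eob C. mcell_over A (emult C k l m) [ehom C k l, ehom C l m]
        (ehom C k m) (vid D (eext C k)) (vid D (eext C m))) \<longleftrightarrow> ?M"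
      using t(1,2) by (intro ball_cong refl) (auto simp: mcell_over_vdbl_of)
    have L': "(\<forall>c\<in>eob C. \<forall>c'\<in>eob C.
        mcomp1 A (emult C c c c') [eunit C c, mid A (ehom C c c')] = mid A (ehom C c c') \<and>
        mcomp1 A (emult C c c' c') [mid A (ehom C c c'), eunit C c'] = mid A (ehom C c c')) \<longleftrightarrow> ?L"
      by (intro ball_cong refl L)
    have S': "(\<forall>k\<in>eob C. \<forall>l\<in>eob C. \<forall>m\<in>eob C. \<forall>n\<in>eob C.
        mcomp1 A (emult C k m n) [emult C k l m, mid A (ehom C m n)] =
        mcomp1 A (emult C k l n) [mid A (ehom C k l), emult C l m n]) \<longleftrightarrow> ?S"
      by (intro ball_cong refl S)
    show ?thesis
      unfolding enriched_category_def L' S' unfolding vdbl_of_sel(1-4) U M ..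
  qed
  show ?thesis
  proof (cases "?O \<and> ?H \<and> ?U \<and> ?M")
    case True
    then show ?thesis using typed by blast
  next
    case False
    have "?O \<and> ?H \<and> ?U \<and> ?M" if e: "enriched_category A C"
    proof -
      have O: ?O and H: ?H using e unfolding enriched_category_def by simp_all
      moreover have ?U using e O unfolding enriched_category_def mcell_over_vdbl_of by simp
      moreover have ?M using e O unfolding enriched_category_def mcell_over_vdbl_of by simp
      ultimately show ?thesis by blast
    qed
    then show ?thesis using False by blast
  qed
qed

end

locale enr_cat = pdc D for D :: "'v psdbl" + fixes C :: "'v ecat"
  assumes C: "enriched_category (vdbl_of D) C"
begin

abbreviation "hm \<equiv> ehom C"
abbreviation "mu k l m \<equiv> mname (emult C k l m)"
abbreviation "et c \<equiv> mname (eunit C c)"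

lemma cat_facts [simp]:
  "c \<in> eob C \<Longrightarrow> eext C c \<in> objs D" "c \<in> eob C \<Longrightarrow> c' \<in> eob C \<Longrightarrow> hm c c' \<in> hors D"
  "c \<in> eob C \<Longrightarrow> c' \<in> eob C \<Longrightarrow> hsrc D (hm c c') = eext C c"
  "c \<in> eob C \<Longrightarrow> c' \<in> eob C \<Longrightarrow> htgt D (hm c c') = eext C c'"
  "c \<in> eob C \<Longrightarrow> mtop (eunit C c) = []" "c \<in> eob C \<Longrightarrow> mbot (eunit C c) = hm c c"
  "c \<in> eob C \<Longrightarrow> mleft (eunit C c) = vid D (eext C c)" "c \<in> eob C \<Longrightarrow> mright (eunit C c) = vid D (eext C c)"
  "c \<in> eob C \<Longrightarrow> et c \<in> cells D" "c \<in> eob C \<Longrightarrow> ctop D (et c) = hid D (eext C c)"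
  "c \<in> eob C \<Longrightarrow> cbot D (et c) = hm c c" "c \<in> eob C \<Longrightarrow> cleft D (et c) = vid D (eext C c)"
  "c \<in> eob C \<Longrightarrow> cright D (et c) = vid D (eext C c)"
  "k \<in> eob C \<Longrightarrow> l \<in> eob C \<Longrightarrow> m \<in> eob C \<Longrightarrow> mtop (emult C k l m) = [hm k l, hm l m]"
  "k \<in> eob C \<Longrightarrow> l \<in> eob C \<Longrightarrow> m \<in> eob C \<Longrightarrow> mbot (emult C k l m) = hm k m"
  "k \<in> eob C \<Longrightarrow> l \<in> eob C \<Longrightarrow> m \<in> eob C \<Longrightarrow> mleft (emult C k l m) = vid D (eext C k)"
  "k \<in> eob C \<Longrightarrow> l \<in> eob C \<Longrightarrow> m \<in> eob C \<Longrightarrow> mright (emult C k l m) = vid D (eext C m)"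
  "k \<in> eob C \<Longrightarrow> l \<in> eob C \<Longrightarrow> m \<in> eob C \<Longrightarrow> mu k l m \<in> cells D"
  "k \<in> eob C \<Longrightarrow> l \<in> eob C \<Longrightarrow> m \<in> eob C \<Longrightarrow> ctop D (mu k l m) = hcomp D (hm k l) (hm l m)"
  "k \<in> eob C \<Longrightarrow> l \<in> eob C \<Longrightarrow> m \<in> eob C \<Longrightarrow> cbot D (mu k l m) = hm k m"
  "k \<in> eob C \<Longrightarrow> l \<in> eob C \<Longrightarrow> m \<in> eob C \<Longrightarrow> cleft D (mu k l m) = vid D (eext C k)"
  "k \<in> eob C \<Longrightarrow> l \<in> eob C \<Longrightarrow> m \<in> eob C \<Longrightarrow> cright D (mu k l m) = vid D (eext C m)"
  using C unfolding enriched_category_iff cell_over_def by blast+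

lemma mu_lunit: "c \<in> eob C \<Longrightarrow> c' \<in> eob C \<Longrightarrow> mu c c c' \<odot> (et c \<otimes> cid D (hm c c')) = lu (hm c c')"
  and mu_runit: "c \<in> eob C \<Longrightarrow> c' \<in> eob C \<Longrightarrow> mu c c' c' \<odot> (cid D (hm c c') \<otimes> et c') = ru (hm c c')"
  and mu_assoc: "k \<in> eob C \<Longrightarrow> l \<in> eob C \<Longrightarrow> m \<in> eob C \<Longrightarrow> n \<in> eob C \<Longrightarrow>
    mu k m n \<odot> (mu k l m \<otimes> cid D (hm m n)) =
    mu k l n \<odot> (cid D (hm k l) \<otimes> mu l m n) \<odot> as (hm k l) (hm l m) (hm m n)"
  using C unfolding enriched_category_iff by blast+

text \<open>Associativity at arbitrary cells into the hom-objects, obtained from \<open>mu_assoc\<close> by naturality of the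
  associator.\<close>

lemma mu3:
  assumes c: "k \<in> eob C" "l \<in> eob C" "m \<in> eob C" "n \<in> eob C"
    and s: "s \<in> cells D" "cbot D s = hm k l" "t \<in> cells D" "cbot D t = hm l m" "r \<in> cells D" "cbot D r = hm m n"
    and st: "cright D s = cleft D t" "cright D t = cleft D r"
  shows "mu k m n \<odot> ((mu k l m \<odot> (s \<otimes> t)) \<otimes> r) =
    mu k l n \<odot> (s \<otimes> (mu l m n \<odot> (t \<otimes> r))) \<odot> as (ctop D s) (ctop D t) (ctop D r)"
proof -
  have "mu k m n \<odot> ((mu k l m \<odot> (s \<otimes> t)) \<otimes> r) =
    (mu k m n \<odot> (mu k l m \<otimes> cid D (hm m n))) \<odot> ((s \<otimes> t) \<otimes> r)"
    using assms by (simp add: ichg)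
  also have "\<dots> = mu k l n \<odot> (cid D (hm k l) \<otimes> mu l m n) \<odot>
      (as (cbot D s) (cbot D t) (cbot D r) \<odot> ((s \<otimes> t) \<otimes> r))"
    using assms by (simp add: mu_assoc)
  also have "\<dots> = mu k l n \<odot> (cid D (hm k l) \<otimes> mu l m n) \<odot>
      (s \<otimes> (t \<otimes> r)) \<odot> as (ctop D s) (ctop D t) (ctop D r)"
    unfolding as_nat[OF s(1,3,5) st] ..
  finally show ?thesis using assms htgt_hsrc[OF pd s(1,3) st(1)] htgt_hsrc[OF pd s(3,5) st(2)] by (simp add: ichg')
qed

text \<open>Associativity of multiplication for three multicells of which all but one have an empty top;
  the position of the exceptional one gives the name.\<close>

lemma mu_001:
  assumes c: "k \<in> eob C" "l \<in> eob C" "m \<in> eob C" "n \<in> eob C"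
    and s: "s \<in> cells D" "cbot D s = hm k l" "t \<in> cells D" "cbot D t = hm l m" "r \<in> cells D" "cbot D r = hm m n"
    and st: "cright D s = cleft D t" "cright D t = cleft D r"
    and g: "g \<in> hors D" "ctop D r = g" "ctop D s = hid D (hsrc D g)" "ctop D t = hid D (hsrc D g)"
  shows "mu k m n \<odot> ((mu k l m \<odot> (s \<otimes> t) \<odot> li (hid D (hsrc D g))) \<otimes> r) \<odot> li g =
    mu k l n \<odot> (s \<otimes> (mu l m n \<odot> (t \<otimes> r) \<odot> li g)) \<odot> li g"
proof -
  have "mu k m n \<odot> ((mu k l m \<odot> (s \<otimes> t) \<odot> li (hid D (hsrc D g))) \<otimes> r) \<odot> li g =
    (mu k m n \<odot> ((mu k l m \<odot> (s \<otimes> t)) \<otimes> r)) \<odot> (li (hid D (hsrc D g)) \<otimes> cid D g) \<odot> li g"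
    using assms by (simp add: ichg')
  also have "\<dots> = mu k l n \<odot> (s \<otimes> (mu l m n \<odot> (t \<otimes> r))) \<odot> (cid D (hid D (hsrc D g)) \<otimes> li g) \<odot> li g"
    unfolding mu3[OF c s st] using assms by (simp add: as_li_li)
  finally show ?thesis using assms by (simp add: ichg')
qed

lemma mu_010:
  assumes c: "k \<in> eob C" "l \<in> eob C" "m \<in> eob C" "n \<in> eob C"
    and s: "s \<in> cells D" "cbot D s = hm k l" "t \<in> cells D" "cbot D t = hm l m" "r \<in> cells D" "cbot D r = hm m n"
    and st: "cright D s = cleft D t" "cright D t = cleft D r"
    and g: "g \<in> hors D" "ctop D t = g" "ctop D s = hid D (hsrc D g)" "ctop D r = hid D (htgt D g)"
  shows "mu k m n \<odot> ((mu k l m \<odot> (s \<otimes> t) \<odot> li g) \<otimes> r) \<odot> ri g =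
    mu k l n \<odot> (s \<otimes> (mu l m n \<odot> (t \<otimes> r) \<odot> ri g)) \<odot> li g"
proof -
  have "mu k m n \<odot> ((mu k l m \<odot> (s \<otimes> t) \<odot> li g) \<otimes> r) \<odot> ri g =
    (mu k m n \<odot> ((mu k l m \<odot> (s \<otimes> t)) \<otimes> r)) \<odot> (li g \<otimes> cid D (hid D (htgt D g))) \<odot> ri g"
    using assms by (simp add: ichg')
  also have "\<dots> = mu k l n \<odot> (s \<otimes> (mu l m n \<odot> (t \<otimes> r))) \<odot> (cid D (hid D (hsrc D g)) \<otimes> ri g) \<odot> li g"
    unfolding mu3[OF c s st] using assms by (simp add: as_li_ri)
  finally show ?thesis using assms by (simp add: ichg')
qed

lemma mu_100:
  assumes c: "k \<in> eob C" "l \<in> eob C" "m \<in> eob C" "n \<in> eob C"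
    and s: "s \<in> cells D" "cbot D s = hm k l" "t \<in> cells D" "cbot D t = hm l m" "r \<in> cells D" "cbot D r = hm m n"
    and st: "cright D s = cleft D t" "cright D t = cleft D r"
    and g: "g \<in> hors D" "ctop D s = g" "ctop D t = hid D (htgt D g)" "ctop D r = hid D (htgt D g)"
  shows "mu k m n \<odot> ((mu k l m \<odot> (s \<otimes> t) \<odot> ri g) \<otimes> r) \<odot> ri g =
    mu k l n \<odot> (s \<otimes> (mu l m n \<odot> (t \<otimes> r) \<odot> li (hid D (htgt D g)))) \<odot> ri g"
proof -
  have "mu k m n \<odot> ((mu k l m \<odot> (s \<otimes> t) \<odot> ri g) \<otimes> r) \<odot> ri g =
    (mu k m n \<odot> ((mu k l m \<odot> (s \<otimes> t)) \<otimes> r)) \<odot> (ri g \<otimes> cid D (hid D (htgt D g))) \<odot> ri g"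
    using assms by (simp add: ichg')
  also have "\<dots> = mu k l n \<odot> (s \<otimes> (mu l m n \<odot> (t \<otimes> r))) \<odot> (cid D g \<otimes> li (hid D (htgt D g))) \<odot> ri g"
    unfolding mu3[OF c s st] using assms by (simp add: as_ri_ri)
  finally show ?thesis using assms by (simp add: ichg')
qed

lemma mu_et_l:
  assumes c: "c \<in> eob C" "c' \<in> eob C" and s: "s \<in> cells D" "cbot D s = hm c c'" and g: "ctop D s = g" and u: "cleft D s = u"
  shows "mu c c c' \<odot> ((et c \<odot> chid D u) \<otimes> s) \<odot> li g = s"
proof -
  have u': "u \<in> vers D" "vsrc D u = hsrc D g" "vtgt D u = eext C c" "g \<in> hors D"
    using assms pd_simps(5,7,8)[OF pd s(1)] by auto
  have "mu c c c' \<odot> ((et c \<odot> chid D u) \<otimes> s) \<odot> li g = (mu c c c' \<odot> (et c \<otimes> cid D (hm c c'))) \<odot> (chid D u \<otimes> s) \<odot> li g"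
    using assms u' by (simp add: ichg')
  also have "\<dots> = s" using assms li_nat[OF s(1)] by (simp add: mu_lunit)
  finally show ?thesis .
qed

lemma mu_et_r:
  assumes c: "c \<in> eob C" "c' \<in> eob C" and s: "s \<in> cells D" "cbot D s = hm c c'" and g: "ctop D s = g" and u: "cright D s = u"
  shows "mu c c' c' \<odot> (s \<otimes> (et c' \<odot> chid D u)) \<odot> ri g = s"
proof -
  have u': "u \<in> vers D" "vsrc D u = htgt D g" "vtgt D u = eext C c'" "g \<in> hors D"
    using assms pd_simps(6,9,10)[OF pd s(1)] by auto
  have "mu c c' c' \<odot> (s \<otimes> (et c' \<odot> chid D u)) \<odot> ri g = (mu c c' c' \<odot> (cid D (hm c c') \<otimes> et c')) \<odot> (s \<otimes> chid D u) \<odot> ri g"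
    using assms u' by (simp add: ichg')
  also have "\<dots> = s" using assms ri_nat[OF s(1)] by (simp add: mu_runit)
  finally show ?thesis .
qed

end


text \<open>Horizontal composition of enriched natural transformations is defined by whiskering. It suffices to check the
  axioms for the whiskerings and that the two ways to compose horizontally agree.\<close>

lemma two_category_whiskerI:
  fixes K :: "('o, 'a, 'c) two_cat" and L :: "'a \<Rightarrow> 'c \<Rightarrow> 'c" and R :: "'c \<Rightarrow> 'a \<Rightarrow> 'c"
  assumes c [simp]: "category (cat1 K)" "category (cat2 K)" "obj (cat2 K) = mor K"
    and glob [simp]: "\<And>a. a \<in> cell K \<Longrightarrow> s1 K (t2 K a) = s1 K (s2 K a)" "\<And>a. a \<in> cell K \<Longrightarrow> t1 K (t2 K a) = t1 K (s2 K a)"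
    and h: "\<And>b a. hcmp K b a = c2 K (R b (t2 K a)) (L (s2 K b) a)"
    and L [simp]: "\<And>g a. g \<in> mor K \<Longrightarrow> a \<in> cell K \<Longrightarrow> s1 K g = t1 K (s2 K a) \<Longrightarrow> L g a \<in> cell K"
      "\<And>g a. s2 K (L g a) = c1 K g (s2 K a)" "\<And>g a. t2 K (L g a) = c1 K g (t2 K a)"
    and R [simp]: "\<And>b f. b \<in> cell K \<Longrightarrow> f \<in> mor K \<Longrightarrow> s1 K (s2 K b) = t1 K f \<Longrightarrow> R b f \<in> cell K"
      "\<And>b f. s2 K (R b f) = c1 K (s2 K b) f" "\<And>b f. t2 K (R b f) = c1 K (t2 K b) f"
    and Lc: "\<And>g b a. g \<in> mor K \<Longrightarrow> b \<in> cell K \<Longrightarrow> a \<in> cell K \<Longrightarrow> s2 K b = t2 K a \<Longrightarrow> s1 K g = t1 K (s2 K a) \<Longrightarrow>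
        L g (c2 K b a) = c2 K (L g b) (L g a)"
    and Li: "\<And>g f. g \<in> mor K \<Longrightarrow> f \<in> mor K \<Longrightarrow> s1 K g = t1 K f \<Longrightarrow> L g (i2 K f) = i2 K (c1 K g f)"
    and L1: "\<And>a. a \<in> cell K \<Longrightarrow> L (i1 K (t1 K (s2 K a))) a = a"
    and LL: "\<And>g' g a. g' \<in> mor K \<Longrightarrow> g \<in> mor K \<Longrightarrow> a \<in> cell K \<Longrightarrow> s1 K g' = t1 K g \<Longrightarrow> s1 K g = t1 K (s2 K a) \<Longrightarrow>
        L (c1 K g' g) a = L g' (L g a)"
    and Rc: "\<And>b a f. b \<in> cell K \<Longrightarrow> a \<in> cell K \<Longrightarrow> f \<in> mor K \<Longrightarrow> s2 K b = t2 K a \<Longrightarrow> s1 K (s2 K a) = t1 K f \<Longrightarrow>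
        R (c2 K b a) f = c2 K (R b f) (R a f)"
    and Ri: "\<And>g f. g \<in> mor K \<Longrightarrow> f \<in> mor K \<Longrightarrow> s1 K g = t1 K f \<Longrightarrow> R (i2 K g) f = i2 K (c1 K g f)"
    and R1: "\<And>a. a \<in> cell K \<Longrightarrow> R a (i1 K (s1 K (s2 K a))) = a"
    and RR: "\<And>a f f'. a \<in> cell K \<Longrightarrow> f \<in> mor K \<Longrightarrow> f' \<in> mor K \<Longrightarrow> s1 K (s2 K a) = t1 K f \<Longrightarrow> s1 K f = t1 K f' \<Longrightarrow>
        R a (c1 K f f') = R (R a f) f'"
    and LR: "\<And>g a f. g \<in> mor K \<Longrightarrow> a \<in> cell K \<Longrightarrow> f \<in> mor K \<Longrightarrow> s1 K g = t1 K (s2 K a) \<Longrightarrow> s1 K (s2 K a) = t1 K f \<Longrightarrow>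
        L g (R a f) = R (L g a) f"
    and X: "\<And>b a. b \<in> cell K \<Longrightarrow> a \<in> cell K \<Longrightarrow> s1 K (s2 K b) = t1 K (s2 K a) \<Longrightarrow>
        c2 K (R b (t2 K a)) (L (s2 K b) a) = c2 K (L (t2 K b) a) (R b (s2 K a))"
  shows "two_category K"
proof -
  have m [simp]: "a \<in> cell K \<Longrightarrow> s2 K a \<in> mor K" "a \<in> cell K \<Longrightarrow> t2 K a \<in> mor K"
    "f \<in> mor K \<Longrightarrow> i2 K f \<in> cell K" "f \<in> mor K \<Longrightarrow> s2 K (i2 K f) = f" "f \<in> mor K \<Longrightarrow> t2 K (i2 K f) = f" for a f
    using c by (metis cat_simps)+
  show ?thesis
  proof (rule two_categoryI, goal_cases)
    case (8 c b a)
    then show ?case unfolding h by (simp add: Lc LL Rc RR LR)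
  next
    case (10 d c b a)
    have st: "s1 K (s2 K d) = s1 K (s2 K c)" "t1 K (s2 K b) = t1 K (s2 K a)" using 10 by simp_all
    have "hcmp K (c2 K d c) (c2 K b a) =
      c2 K (R d (t2 K b)) (c2 K (c2 K (R c (t2 K b)) (L (s2 K c) b)) (L (s2 K c) a))"
      using 10 st unfolding h by (simp add: Rc Lc)
    also have "\<dots> = c2 K (R d (t2 K b)) (c2 K (c2 K (L (t2 K c) b) (R c (s2 K b))) (L (s2 K c) a))"
      using 10 st by (simp only: X)
    also have "\<dots> = c2 K (hcmp K d b) (hcmp K c a)" using 10 st unfolding h by simp
    finally show ?case .
  qed (simp_all add: h Li L1 Ri R1)
qed


context pdc
begin

lemma enriched_functor_iff:
  assumes "enriched_category A C" "enriched_category A C'"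
  shows "enriched_functor A C C' f \<longleftrightarrow>
     (\<forall>c\<in>eob C. fob f c \<in> eob C') \<and>
     (\<forall>c\<in>eob C. fver f c \<in> vers D \<and> vsrc D (fver f c) = eext C c \<and> vtgt D (fver f c) = eext C' (fob f c)) \<and>
     (\<forall>c\<in>eob C. \<forall>c'\<in>eob C. mtop (fcell f c c') = [ehom C c c'] \<and>
        mbot (fcell f c c') = ehom C' (fob f c) (fob f c') \<and> mleft (fcell f c c') = fver f c \<and> mright (fcell f c c') = fver f c' \<and>
        cell_over D (mname (fcell f c c')) (ehom C c c') (ehom C' (fob f c) (fob f c')) (fver f c) (fver f c')) \<and>
     (\<forall>c\<in>eob C. mname (fcell f c c) \<odot> mname (eunit C c) = mname (eunit C' (fob f c)) \<odot> chid D (fver f c)) \<and>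
     (\<forall>k\<in>eob C. \<forall>l\<in>eob C. \<forall>m\<in>eob C.
        mname (fcell f k m) \<odot> mname (emult C k l m) =
        mname (emult C' (fob f k) (fob f l) (fob f m)) \<odot> (mname (fcell f k l) \<otimes> mname (fcell f l m)))"
    (is "_ \<longleftrightarrow> ?O \<and> ?V \<and> ?M \<and> ?U \<and> ?L")
proof -
  interpret S: enr_cat D C by unfold_locales fact
  interpret T: enr_cat D C' by unfold_locales fact
  have M: "(\<forall>c\<in>eob C. \<forall>c'\<in>eob C. mcell_over A (fcell f c c') [ehom C c c'] (ehom C' (fob f c) (fob f c'))
          (fver f c) (fver f c')) \<longleftrightarrow> ?M" if ?V
    using that by (intro ball_cong refl) (auto simp: mcell_over_vdbl_of)
  have U: "(\<forall>c\<in>eob C. mcomp1 A (fcell f c c) [eunit C c] = mcomp A (eunit C' (fob f c)) (fver f c) []) \<longleftrightarrow> ?U" if ?O ?V ?M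
    using that by (intro ball_cong refl) (auto simp: mcomp_1 mcomp_nil cell_over_def)
  have L: "(\<forall>k\<in>eob C. \<forall>l\<in>eob C. \<forall>m\<in>eob C. mcomp1 A (fcell f k m) [emult C k l m] =
        mcomp1 A (emult C' (fob f k) (fob f l) (fob f m)) [fcell f k l, fcell f l m]) \<longleftrightarrow> ?L" if ?O ?V ?M
    using that by (intro ball_cong refl) (auto simp: mcomp_1 mcomp_11 cell_over_def)
  show ?thesis
    unfolding enriched_functor_def vdbl_of_sel(1) using M U L by blast
qed

end

locale enr_fun = pdc D + S: enr_cat D C + T: enr_cat D C' for D :: "'v psdbl" and C C' :: "'v ecat" + fixes f :: "'v efun"
  assumes f: "enriched_functor (vdbl_of D) C C' f"
begin

abbreviation "om c c' \<equiv> mname (fcell f c c')"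

lemma fun_facts [simp]:
  "c \<in> eob C \<Longrightarrow> fob f c \<in> eob C'" "c \<in> eob C \<Longrightarrow> fver f c \<in> vers D" "c \<in> eob C \<Longrightarrow> vsrc D (fver f c) = eext C c"
  "c \<in> eob C \<Longrightarrow> vtgt D (fver f c) = eext C' (fob f c)"
  "c \<in> eob C \<Longrightarrow> c' \<in> eob C \<Longrightarrow> mtop (fcell f c c') = [ehom C c c']"
  "c \<in> eob C \<Longrightarrow> c' \<in> eob C \<Longrightarrow> mbot (fcell f c c') = ehom C' (fob f c) (fob f c')"
  "c \<in> eob C \<Longrightarrow> c' \<in> eob C \<Longrightarrow> mleft (fcell f c c') = fver f c"
  "c \<in> eob C \<Longrightarrow> c' \<in> eob C \<Longrightarrow> mright (fcell f c c') = fver f c'"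
  "c \<in> eob C \<Longrightarrow> c' \<in> eob C \<Longrightarrow> om c c' \<in> cells D" "c \<in> eob C \<Longrightarrow> c' \<in> eob C \<Longrightarrow> ctop D (om c c') = ehom C c c'"
  "c \<in> eob C \<Longrightarrow> c' \<in> eob C \<Longrightarrow> cbot D (om c c') = ehom C' (fob f c) (fob f c')"
  "c \<in> eob C \<Longrightarrow> c' \<in> eob C \<Longrightarrow> cleft D (om c c') = fver f c"
  "c \<in> eob C \<Longrightarrow> c' \<in> eob C \<Longrightarrow> cright D (om c c') = fver f c'"
  using f unfolding enriched_functor_iff[OF S.C T.C] cell_over_def by blast+

lemma om_et: "c \<in> eob C \<Longrightarrow> om c c \<odot> S.et c = T.et (fob f c) \<odot> chid D (fver f c)"
  and om_mu: "k \<in> eob C \<Longrightarrow> l \<in> eob C \<Longrightarrow> m \<in> eob C \<Longrightarrow>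
    om k m \<odot> S.mu k l m = T.mu (fob f k) (fob f l) (fob f m) \<odot> (om k l \<otimes> om l m)"
  using f unfolding enriched_functor_iff[OF S.C T.C] by blast+

lemma om_et': "c \<in> eob C \<Longrightarrow> z \<in> cells D \<Longrightarrow> cbot D z = hid D (eext C c) \<Longrightarrow>
    om c c \<odot> S.et c \<odot> z = T.et (fob f c) \<odot> chid D (fver f c) \<odot> z"
  using om_et by (simp flip: cat_simps(11))

lemma om_mu'': "k \<in> eob C \<Longrightarrow> l \<in> eob C \<Longrightarrow> m \<in> eob C \<Longrightarrow> z \<in> cells D \<Longrightarrow>
    cbot D z = hcomp D (ehom C k l) (ehom C l m) \<Longrightarrow>
    om k m \<odot> S.mu k l m \<odot> z = T.mu (fob f k) (fob f l) (fob f m) \<odot> (om k l \<otimes> om l m) \<odot> z"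
  using om_mu by (simp flip: cat_simps(11))

lemma om_mu':
  assumes "k \<in> eob C" "l \<in> eob C" "m \<in> eob C" "s \<in> cells D" "t \<in> cells D" "cbot D s = ehom C k l" "cbot D t = ehom C l m"
    "cright D s = cleft D t" "z \<in> cells D" "cbot D z = hcomp D (ctop D s) (ctop D t)"
  shows "om k m \<odot> S.mu k l m \<odot> (s \<otimes> t) \<odot> z = T.mu (fob f k) (fob f l) (fob f m) \<odot> ((om k l \<odot> s) \<otimes> (om l m \<odot> t)) \<odot> z"
proof -
  have "om k m \<odot> S.mu k l m \<odot> (s \<otimes> t) \<odot> z = (om k m \<odot> S.mu k l m) \<odot> (s \<otimes> t) \<odot> z" using assms by simp
  then show ?thesis using assms by (simp add: om_mu ichg')
qed

end

context enr_fun
begin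

lemma enriched_natural_iff:
  assumes "enriched_functor A C C' f'"
  shows "enriched_natural A C C' f f' t \<longleftrightarrow>
     (\<forall>c\<in>eob C. mtop (t c) = [] \<and> mbot (t c) = ehom C' (fob f c) (fob f' c) \<and> mleft (t c) = fver f c \<and> mright (t c) = fver f' c \<and>
        cell_over D (mname (t c)) (hid D (eext C c)) (ehom C' (fob f c) (fob f' c)) (fver f c) (fver f' c)) \<and>
     (\<forall>c\<in>eob C. \<forall>c'\<in>eob C.
        mname (emult C' (fob f c) (fob f' c) (fob f' c')) \<odot> (mname (t c) \<otimes> mname (fcell f' c c')) \<odot> li (ehom C c c') =
        mname (emult C' (fob f c) (fob f c') (fob f' c')) \<odot> (mname (fcell f c c') \<otimes> mname (t c')) \<odot> ri (ehom C c c'))"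
   (is "_ \<longleftrightarrow> ?M \<and> ?L")
proof -
  interpret G: enr_fun D C C' f' by unfold_locales fact
  have M: "(\<forall>c\<in>eob C. mcell_over A (t c) [] (ehom C' (fob f c) (fob f' c)) (fver f c) (fver f' c)) \<longleftrightarrow> ?M"
    by (intro ball_cong refl) (auto simp: mcell_over_vdbl_of)
  have L: "(\<forall>c\<in>eob C. \<forall>c'\<in>eob C.
        mcomp1 A (emult C' (fob f c) (fob f' c) (fob f' c')) [t c, fcell f' c c'] =
        mcomp1 A (emult C' (fob f c) (fob f c') (fob f' c')) [fcell f c c', t c']) \<longleftrightarrow> ?L" if ?M
    using that by (intro ball_cong refl) (auto simp: mcomp_01 mcomp_10 cell_over_def)
  show ?thesis unfolding enriched_natural_def using M L by blast
qed

end

locale enr_nat = pdc D + F: enr_fun D C C' f + G: enr_fun D C C' f'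
  for D :: "'v psdbl" and C C' :: "'v ecat" and f f' :: "'v efun" + fixes t :: "'v \<Rightarrow> 'v mcell"
  assumes t: "enriched_natural (vdbl_of D) C C' f f' t"
begin

abbreviation "ta c \<equiv> mname (t c)"

lemma nat_facts [simp]:
  "c \<in> eob C \<Longrightarrow> mtop (t c) = []" "c \<in> eob C \<Longrightarrow> mbot (t c) = ehom C' (fob f c) (fob f' c)"
  "c \<in> eob C \<Longrightarrow> mleft (t c) = fver f c" "c \<in> eob C \<Longrightarrow> mright (t c) = fver f' c"
  "c \<in> eob C \<Longrightarrow> ta c \<in> cells D" "c \<in> eob C \<Longrightarrow> ctop D (ta c) = hid D (eext C c)"
  "c \<in> eob C \<Longrightarrow> cbot D (ta c) = ehom C' (fob f c) (fob f' c)"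
  "c \<in> eob C \<Longrightarrow> cleft D (ta c) = fver f c" "c \<in> eob C \<Longrightarrow> cright D (ta c) = fver f' c"
  using t unfolding F.enriched_natural_iff[OF G.f] cell_over_def by blast+

lemma nat: "c \<in> eob C \<Longrightarrow> c' \<in> eob C \<Longrightarrow>
    F.T.mu (fob f c) (fob f' c) (fob f' c') \<odot> (ta c \<otimes> G.om c c') \<odot> li (ehom C c c') =
    F.T.mu (fob f c) (fob f c') (fob f' c') \<odot> (F.om c c' \<otimes> ta c') \<odot> ri (ehom C c c')"
  using t unfolding F.enriched_natural_iff[OF G.f] by blast

text \<open>Naturality at a cell into a hom-object instead of the hom-object itself: with the cells of an enriched
  functor it gives naturality of the whiskering with this functor, and with the components of a transformation it shows that
  the two ways to compose horizontally agree.\<close>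

lemma nat_pre:
  assumes "c \<in> eob C" "c' \<in> eob C" and x: "x \<in> cells D" "cbot D x = ehom C c c'" "cleft D x = u" "cright D x = u'" "ctop D x = g"
  shows "F.T.mu (fob f c) (fob f' c) (fob f' c') \<odot> ((ta c \<odot> chid D u) \<otimes> (G.om c c' \<odot> x)) \<odot> li g =
    F.T.mu (fob f c) (fob f c') (fob f' c') \<odot> ((F.om c c' \<odot> x) \<otimes> (ta c' \<odot> chid D u')) \<odot> ri g"
proof -
  have u: "u \<in> vers D" "vsrc D u = hsrc D g" "vtgt D u = eext C c" "u' \<in> vers D" "vsrc D u' = htgt D g" "vtgt D u' = eext C c'" "g \<in> hors D"
    using assms pd_simps(5-10)[OF pd x(1)] by auto
  have "F.T.mu (fob f c) (fob f' c) (fob f' c') \<odot> ((ta c \<odot> chid D u) \<otimes> (G.om c c' \<odot> x)) \<odot> li g =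
    F.T.mu (fob f c) (fob f' c) (fob f' c') \<odot> (ta c \<otimes> G.om c c') \<odot> ((chid D (cleft D x) \<otimes> x) \<odot> li (ctop D x))"
    using assms u by (simp add: ichg')
  also have "\<dots> = (F.T.mu (fob f c) (fob f' c) (fob f' c') \<odot> (ta c \<otimes> G.om c c') \<odot> li (ehom C c c')) \<odot> x"
    unfolding li_nat[OF x(1)] using assms u by simp
  also have "\<dots> = F.T.mu (fob f c) (fob f c') (fob f' c') \<odot> (F.om c c' \<otimes> ta c') \<odot> (ri (cbot D x) \<odot> x)"
    unfolding nat[OF assms(1,2)] using assms u by simp
  also have "\<dots> = F.T.mu (fob f c) (fob f c') (fob f' c') \<odot> ((F.om c c' \<odot> x) \<otimes> (ta c' \<odot> chid D u')) \<odot> ri g"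
    unfolding ri_nat[OF x(1), symmetric] using assms u by (simp add: ichg')
  finally show ?thesis .
qed

end

lemma ecat_eqI:
  assumes "ext_ecat C" "ext_ecat C'" "eob C = eob C'" "\<And>c. c \<in> eob C \<Longrightarrow> eext C c = eext C' c"
    "\<And>c c'. c \<in> eob C \<Longrightarrow> c' \<in> eob C \<Longrightarrow> ehom C c c' = ehom C' c c'" "\<And>c. c \<in> eob C \<Longrightarrow> eunit C c = eunit C' c"
    "\<And>k l m. k \<in> eob C \<Longrightarrow> l \<in> eob C \<Longrightarrow> m \<in> eob C \<Longrightarrow> emult C k l m = emult C' k l m"
  shows "C = (C' :: 'v ecat)"
proof -
  have "eext C = eext C'"
    using assms(1-4) unfolding ext_ecat_def by (metis (mono_tags, lifting) restrict_ext)
  moreover have "ehom C = ehom C'"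
  proof -
    have "ehom C = (\<lambda>c\<in>eob C. \<lambda>c'\<in>eob C. ehom C c c')" using assms(1) unfolding ext_ecat_def by blast
    also have "\<dots> = (\<lambda>c\<in>eob C'. \<lambda>c'\<in>eob C'. ehom C' c c')" using assms(3,5) by (auto cong: restrict_cong)
    also have "\<dots> = ehom C'" using assms(2) unfolding ext_ecat_def by metis
    finally show ?thesis .
  qed
  moreover have "eunit C = eunit C'"
    using assms(1,2,3,6) unfolding ext_ecat_def by (metis (mono_tags, lifting) restrict_ext)
  moreover have "emult C = emult C'"
  proof -
    have "emult C = (\<lambda>k\<in>eob C. \<lambda>l\<in>eob C. \<lambda>m\<in>eob C. emult C k l m)" using assms(1) unfolding ext_ecat_def by blast
    also have "\<dots> = (\<lambda>k\<in>eob C'. \<lambda>l\<in>eob C'. \<lambda>m\<in>eob C'. emult C' k l m)" using assms(3,7) by (auto cong: restrict_cong)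
    also have "\<dots> = emult C'" using assms(2) unfolding ext_ecat_def by metis
    finally show ?thesis .
  qed
  ultimately show ?thesis using assms(3) by simp
qed

lemma efun_eqI:
  assumes "ext_efun C f" "ext_efun C g" "\<And>c. c \<in> eob C \<Longrightarrow> fob f c = fob g c" "\<And>c. c \<in> eob C \<Longrightarrow> fver f c = fver g c"
    "\<And>c c'. c \<in> eob C \<Longrightarrow> c' \<in> eob C \<Longrightarrow> fcell f c c' = fcell g c c'"
  shows "f = (g :: 'v efun)"
proof -
  have "fob f = fob g" "fver f = fver g"
    using assms(1-4) unfolding ext_efun_def by (metis (mono_tags, lifting) restrict_ext)+
  moreover have "fcell f = fcell g"
  proof -
    have "fcell f = (\<lambda>c\<in>eob C. \<lambda>c'\<in>eob C. fcell f c c')" using assms(1) unfolding ext_efun_def by blast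
    also have "\<dots> = (\<lambda>c\<in>eob C. \<lambda>c'\<in>eob C. fcell g c c')" using assms(5) by (auto cong: restrict_cong)
    also have "\<dots> = fcell g" using assms(2) unfolding ext_efun_def by metis
    finally show ?thesis .
  qed
  ultimately show ?thesis by simp
qed

lemma ext_efunI: "ext_efun C \<lparr>fob = restrict a (eob C), fver = restrict b (eob C), fcell = (\<lambda>c\<in>eob C. restrict (d c) (eob C))\<rparr>"
  by (auto simp: ext_efun_def cong: restrict_cong)

lemma enr_sel [simp]:
  "cat1 (enr elts U1 A) = enr1 elts U1 A" "cat2 (enr elts U1 A) = enr2 elts U1 A"
  "hcmp (enr elts U1 A) s t = cmp (enr2 elts U1 A) (enr_rwhisker elts U1 A s (atgt t)) (enr_lwhisker elts U1 A (asrc s) t)"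
  by (simp_all add: enr_def)

lemma enr1_sel [simp]:
  "obj (enr1 elts U1 A) = {C. enriched_category A C \<and> ext_ecat C \<and> of_size elts U1 (eob C)}"
  "src (enr1 elts U1 A) = asrc" "tgt (enr1 elts U1 A) = atgt"
  "ide (enr1 elts U1 A) C = Arrow C
              \<lparr>fob = (\<lambda>c\<in>eob C. c), fver = (\<lambda>c\<in>eob C. eid A C c),
               fcell = (\<lambda>c\<in>eob C. \<lambda>c'\<in>eob C. mid A (ehom C c c'))\<rparr> C"
  "cmp (enr1 elts U1 A) g f = Arrow (asrc f)
              \<lparr>fob = (\<lambda>c\<in>eob (asrc f). fob (amap g) (fob (amap f) c)),
               fver = (\<lambda>c\<in>eob (asrc f).
                 cmp (vvert A) (fver (amap g) (fob (amap f) c)) (fver (amap f) c)),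
               fcell = (\<lambda>c\<in>eob (asrc f). \<lambda>c'\<in>eob (asrc f).
                 mcomp1 A (fcell (amap g) (fob (amap f) c) (fob (amap f) c'))
                   [fcell (amap f) c c'])\<rparr> (atgt g)"
  by (simp_all add: enr1_def)

lemma enr2_sel [simp]:
  "obj (enr2 elts U1 A) = arr (enr1 elts U1 A)" "src (enr2 elts U1 A) = asrc" "tgt (enr2 elts U1 A) = atgt"
  "ide (enr2 elts U1 A) f = Arrow f
              (\<lambda>c\<in>eob (asrc f).
                 mcomp A (eunit (atgt f) (fob (amap f) c)) (fver (amap f) c) []) f"
  "cmp (enr2 elts U1 A) s t = Arrow (asrc t)
              (\<lambda>c\<in>eob (asrc (asrc t)).
                 mcomp1 A (emult (atgt (asrc t)) (fob (amap (asrc t)) c)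
                            (fob (amap (atgt t)) c) (fob (amap (atgt s)) c))
                   [amap t c, amap s c]) (atgt s)"
  by (simp_all add: enr2_def)

lemma arr_enr1:
  "f \<in> arr (enr1 elts U1 A) \<longleftrightarrow> enriched_category A (asrc f) \<and> ext_ecat (asrc f) \<and> of_size elts U1 (eob (asrc f)) \<and>
     enriched_category A (atgt f) \<and> ext_ecat (atgt f) \<and> of_size elts U1 (eob (atgt f)) \<and>
     enriched_functor A (asrc f) (atgt f) (amap f) \<and> ext_efun (asrc f) (amap f)"
  by (cases f) (auto simp: enr1_def)

lemma arr_enr2:
  "t \<in> arr (enr2 elts U1 A) \<longleftrightarrow> asrc t \<in> arr (enr1 elts U1 A) \<and> atgt t \<in> arr (enr1 elts U1 A) \<and>
     asrc (asrc t) = asrc (atgt t) \<and> atgt (asrc t) = atgt (atgt t) \<and>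
     enriched_natural A (asrc (asrc t)) (atgt (asrc t)) (amap (asrc t)) (amap (atgt t)) (amap t) \<and>
     amap t \<in> extensional (eob (asrc (asrc t)))"
  by (cases t) (auto simp: enr2_def)

lemma enr_fun_arr: "pdc D \<Longrightarrow> f \<in> arr (enr1 elts U1 (vdbl_of D)) \<Longrightarrow> enr_fun D (asrc f) (atgt f) (amap f)"
  unfolding arr_enr1 by (simp add: enr_fun_def enr_cat_def enr_cat_axioms_def enr_fun_axioms_def)

lemma enr_nat_cell: "pdc D \<Longrightarrow> t \<in> arr (enr2 elts U1 (vdbl_of D)) \<Longrightarrow>
    enr_nat D (asrc (asrc t)) (atgt (asrc t)) (amap (asrc t)) (amap (atgt t)) (amap t)"
  unfolding arr_enr2 using enr_fun_arr[of D "asrc t"] enr_fun_arr[of D "atgt t"]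
  by (auto simp: enr_nat_def enr_nat_axioms_def)


section \<open>The 2-category of categories enriched over a pseudo double category\<close>

context pdc
begin

lemma enriched_functor_comp:
  assumes "enr_fun D C C' f" "enr_fun D C' C'' g"
  shows "enriched_functor A C C''
     \<lparr>fob = (\<lambda>c\<in>eob C. fob g (fob f c)), fver = (\<lambda>c\<in>eob C. vcmp D (fver g (fob f c)) (fver f c)),
      fcell = (\<lambda>c\<in>eob C. \<lambda>c'\<in>eob C. mcomp1 A (fcell g (fob f c) (fob f c')) [fcell f c c'])\<rparr>"
proof -
  interpret F: enr_fun D C C' f by fact
  interpret G: enr_fun D C' C'' g by fact
  show ?thesis unfolding enriched_functor_iff[OF F.S.C G.T.C]
    by (simp add: mcomp_1 cell_over_def F.om_et F.om_mu G.om_et' G.om_mu'' ichg)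
qed

lemma enriched_functor_id:
  assumes "enr_cat D C"
  shows "enriched_functor A C C
     \<lparr>fob = (\<lambda>c\<in>eob C. c), fver = (\<lambda>c\<in>eob C. eid A C c), fcell = (\<lambda>c\<in>eob C. \<lambda>c'\<in>eob C. mid A (ehom C c c'))\<rparr>"
proof -
  interpret enr_cat D C by fact
  show ?thesis unfolding enriched_functor_iff[OF C C] by (simp add: cell_over_def)
qed

lemma category_enr1: "category (enr1 elts U1 A)"
  unfolding enr1_def
proof (rule category_arrowI, goal_cases)
  case (2 C)
  then interpret enr_cat D C by unfold_locales simp
  show ?case using 2 enriched_functor_id[of C] by (simp add: enr_cat_axioms ext_efunI)
next
  case (3 C f C' g C'')
  then have "enr_fun D C C' f" "enr_fun D C' C'' g" by unfold_locales auto
  from enriched_functor_comp[OF this] show ?case using 3 by (simp add: ext_efunI)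
next
  case (4 C f C')
  then interpret enr_fun D C C' f by unfold_locales auto
  have "ext_efun C f" using 4 by simp
  then show ?case by (intro efun_eqI[where C=C]) (auto simp: ext_efunI mcomp_1 intro: mcell.expand)
next
  case (5 C f C')
  then interpret enr_fun D C C' f by unfold_locales auto
  have "ext_efun C f" using 5 by simp
  then show ?case by (intro efun_eqI[where C=C]) (auto simp: ext_efunI mcomp_1 intro: mcell.expand)
next
  case (6 B f C g C' h C'')
  then interpret F: enr_fun D B C f by unfold_locales auto
  interpret G: enr_fun D C C' g using 6 by unfold_locales auto
  interpret H: enr_fun D C' C'' h using 6 by unfold_locales auto
  show ?case by (intro efun_eqI[where C=B]) (simp_all add: ext_efunI mcomp_1)
qed auto

text \<open>Source and target determine the frames of the components, so only names have to be compared.\<close>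

lemma enr2_eqI:
  assumes "s \<in> arr (enr2 elts U1 A)" "t \<in> arr (enr2 elts U1 A)" "asrc s = asrc t" "atgt s = atgt t"
    "\<And>c. c \<in> eob (asrc (asrc t)) \<Longrightarrow> mname (amap s c) = mname (amap t c)"
  shows "s = t"
proof -
  interpret S: enr_nat D "asrc (asrc s)" "atgt (asrc s)" "amap (asrc s)" "amap (atgt s)" "amap s"
    by (rule enr_nat_cell[OF pdc_axioms assms(1)])
  interpret T: enr_nat D "asrc (asrc t)" "atgt (asrc t)" "amap (asrc t)" "amap (atgt t)" "amap t"
    by (rule enr_nat_cell[OF pdc_axioms assms(2)])
  have "amap s = amap t"
  proof (rule extensionalityI)
    show "amap s \<in> extensional (eob (asrc (asrc t)))" "amap t \<in> extensional (eob (asrc (asrc t)))"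
      using assms(1,2) assms(3) unfolding arr_enr2 by metis+
    fix c assume "c \<in> eob (asrc (asrc t))"
    then show "amap s c = amap t c"
      using assms(5) S.nat_facts(1-4)[of c] T.nat_facts(1-4)[of c] unfolding assms(3,4) by (intro mcell.expand) simp
  qed
  then show ?thesis using assms(3,4) by (intro arrow.expand) simp
qed

lemma enriched_natural_id:
  assumes "enr_fun D C C' f"
  shows "enriched_natural A C C' f f (\<lambda>c\<in>eob C. mcomp A (eunit C' (fob f c)) (fver f c) [])"
proof -
  interpret enr_fun D C C' f by fact
  show ?thesis unfolding enriched_natural_iff[OF f]
    by (simp add: cell_over_def mcomp_nil T.mu_et_l T.mu_et_r)
qed

lemma enriched_natural_vcomp:
  assumes "enr_nat D C C' f g s" "enr_nat D C C' g h t"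
  shows "enriched_natural A C C' f h
    (\<lambda>c\<in>eob C. mcomp1 A (emult C' (fob f c) (fob g c) (fob h c)) [s c, t c])"
proof -
  interpret S: enr_nat D C C' f g s by fact
  interpret T: enr_nat D C C' g h t by fact
  show ?thesis unfolding S.F.enriched_natural_iff[OF T.G.f]
  proof (intro conjI ballI, goal_cases)
    case (6 c c')
    let ?g = "ehom C c c'"
    have "S.F.T.mu (fob f c) (fob h c) (fob h c') \<odot>
        ((S.F.T.mu (fob f c) (fob g c) (fob h c) \<odot> (S.ta c \<otimes> T.ta c) \<odot> li (hid D (hsrc D ?g))) \<otimes> T.G.om c c') \<odot> li ?g =
      S.F.T.mu (fob f c) (fob g c) (fob h c') \<odot>
        (S.ta c \<otimes> (S.F.T.mu (fob g c) (fob h c) (fob h c') \<odot> (T.ta c \<otimes> T.G.om c c') \<odot> li ?g)) \<odot> li ?g"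
      using 6 by (intro S.F.T.mu_001) simp_all
    also have "\<dots> = S.F.T.mu (fob f c) (fob g c) (fob h c') \<odot>
        (S.ta c \<otimes> (S.F.T.mu (fob g c) (fob g c') (fob h c') \<odot> (S.G.om c c' \<otimes> T.ta c') \<odot> ri ?g)) \<odot> li ?g"
      using 6 by (simp add: T.nat)
    also have "\<dots> = S.F.T.mu (fob f c) (fob g c') (fob h c') \<odot>
        ((S.F.T.mu (fob f c) (fob g c) (fob g c') \<odot> (S.ta c \<otimes> S.G.om c c') \<odot> li ?g) \<otimes> T.ta c') \<odot> ri ?g"
      using 6 by (intro S.F.T.mu_010[symmetric]) simp_all
    also have "\<dots> = S.F.T.mu (fob f c) (fob g c') (fob h c') \<odot>
        ((S.F.T.mu (fob f c) (fob f c') (fob g c') \<odot> (S.F.om c c' \<otimes> S.ta c') \<odot> ri ?g) \<otimes> T.ta c') \<odot> ri ?g"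
      using 6 by (simp add: S.nat)
    also have "\<dots> = S.F.T.mu (fob f c) (fob f c') (fob h c') \<odot>
        (S.F.om c c' \<otimes> (S.F.T.mu (fob f c') (fob g c') (fob h c') \<odot> (S.ta c' \<otimes> T.ta c') \<odot> li (hid D (htgt D ?g)))) \<odot> ri ?g"
      using 6 by (intro S.F.T.mu_100) simp_all
    finally show ?case using 6 by (simp add: mcomp_00)
  qed (simp_all add: cell_over_def mcomp_00)
qed

lemma category_enr2: "category (enr2 elts U1 A)"
  unfolding enr2_def
proof (rule category_arrowI, goal_cases)
  case (2 f)
  from enriched_natural_id[OF enr_fun_arr[OF pdc_axioms this]] show ?case using 2 by simp
next
  case (3 f s g t h)
  then have "enr_nat D (asrc f) (atgt f) (amap f) (amap g) s" "enr_nat D (asrc f) (atgt f) (amap g) (amap h) t"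
    using enr_nat_cell[OF pdc_axioms, of "Arrow f s g" elts U1] enr_nat_cell[OF pdc_axioms, of "Arrow g t h" elts U1]
    by (auto simp: arr_enr2)
  from enriched_natural_vcomp[OF this] show ?case using 3 by simp
next
  case (4 f t g)
  then interpret enr_nat D "asrc f" "atgt f" "amap f" "amap g" t
    using enr_nat_cell[OF pdc_axioms, of "Arrow f t g" elts U1] by (auto simp: arr_enr2)
  have "t \<in> extensional (eob (asrc f))" using 4 by blast
  then show ?case
    by (intro extensionalityI[of _ "eob (asrc f)" t]) (auto simp: mcomp_00 mcomp_nil F.T.mu_et_l intro: mcell.expand)
next
  case (5 f t g)
  then interpret enr_nat D "asrc f" "atgt f" "amap f" "amap g" t
    using enr_nat_cell[OF pdc_axioms, of "Arrow f t g" elts U1] by (auto simp: arr_enr2)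
  have "t \<in> extensional (eob (asrc f))" and [simp]: "asrc g = asrc f" "atgt g = atgt f" using 5 by auto
  then show ?case
    by (intro extensionalityI[of _ "eob (asrc f)" t]) (auto simp: mcomp_00 mcomp_nil F.T.mu_et_r li_hid intro: mcell.expand)
next
  case (6 f r g s h t k)
  then interpret R: enr_nat D "asrc f" "atgt f" "amap f" "amap g" r
    using enr_nat_cell[OF pdc_axioms, of "Arrow f r g" elts U1] by (auto simp: arr_enr2)
  interpret S: enr_nat D "asrc f" "atgt f" "amap g" "amap h" s
    using 6 enr_nat_cell[OF pdc_axioms, of "Arrow g s h" elts U1] by (auto simp: arr_enr2)
  interpret T: enr_nat D "asrc f" "atgt f" "amap h" "amap k" t
    using 6 enr_nat_cell[OF pdc_axioms, of "Arrow h t k" elts U1] by (auto simp: arr_enr2)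
  have [simp]: "asrc g = asrc f" "atgt g = atgt f" using 6 by auto
  have "R.F.T.mu (fob (amap f) c) (fob (amap h) c) (fob (amap k) c) \<odot> ((R.F.T.mu (fob (amap f) c) (fob (amap g) c) (fob (amap h) c) \<odot> (R.ta c \<otimes> S.ta c) \<odot>
      li (hid D (hsrc D (hid D (eext (asrc f) c))))) \<otimes> T.ta c) \<odot> li (hid D (eext (asrc f) c)) =
    R.F.T.mu (fob (amap f) c) (fob (amap g) c) (fob (amap k) c) \<odot> (R.ta c \<otimes> (R.F.T.mu (fob (amap g) c) (fob (amap h) c) (fob (amap k) c) \<odot> (S.ta c \<otimes> T.ta c) \<odot>
      li (hid D (eext (asrc f) c)))) \<odot> li (hid D (eext (asrc f) c))" if "c \<in> eob (asrc f)" for c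
    using that by (intro R.F.T.mu_001) simp_all
  then show ?case by (auto simp: mcomp_00 cong: restrict_cong)
qed auto

lemma enr_lwhisker_arr:
  assumes g: "g \<in> arr (enr1 elts U1 A)" and t: "t \<in> arr (enr2 elts U1 A)" and gt: "asrc g = atgt (asrc t)"
  shows "enr_lwhisker elts U1 A g t \<in> arr (enr2 elts U1 A)"
proof -
  interpret T: enr_nat D "asrc (asrc t)" "atgt (asrc t)" "amap (asrc t)" "amap (atgt t)" "amap t"
    by (rule enr_nat_cell[OF pdc_axioms t])
  interpret G: enr_fun D "atgt (asrc t)" "atgt g" "amap g"
    using enr_fun_arr[OF pdc_axioms g] gt by simp
  have m: "asrc t \<in> arr (enr1 elts U1 A)" "atgt t \<in> arr (enr1 elts U1 A)" "asrc (atgt t) = asrc (asrc t)" "atgt (atgt t) = atgt (asrc t)"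
    using t by (auto simp: arr_enr2)
  have c: "cmp (enr1 elts U1 A) g (asrc t) \<in> arr (enr1 elts U1 A)" "cmp (enr1 elts U1 A) g (atgt t) \<in> arr (enr1 elts U1 A)"
    by (intro cat_simps(6)[OF category_enr1]; use g m gt in simp)+
  have f: "enriched_functor A (asrc (asrc t)) (atgt g) (amap (cmp (enr1 elts U1 A) g (asrc t)))"
    and f': "enriched_functor A (asrc (asrc t)) (atgt g) (amap (cmp (enr1 elts U1 A) g (atgt t)))"
    using c m by (simp_all add: arr_enr1)
  interpret GF: enr_fun D "asrc (asrc t)" "atgt g" "amap (cmp (enr1 elts U1 A) g (asrc t))" by unfold_locales fact
  have "enriched_natural A (asrc (asrc t)) (atgt g) (amap (cmp (enr1 elts U1 A) g (asrc t))) (amap (cmp (enr1 elts U1 A) g (atgt t)))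
     (amap (enr_lwhisker elts U1 A g t))"
    unfolding GF.enriched_natural_iff[OF f'] using m
    by (simp add: enr_lwhisker_def mcomp_1 cell_over_def T.nat flip: G.om_mu')
  then show ?thesis using c m by (simp add: arr_enr2 enr_lwhisker_def del: enr1_sel(5)) (simp add: arr_enr2 enr_lwhisker_def)
qed

lemma enr_rwhisker_arr:
  assumes h: "h \<in> arr (enr1 elts U1 A)" and s: "s \<in> arr (enr2 elts U1 A)" and sh: "asrc (asrc s) = atgt h"
  shows "enr_rwhisker elts U1 A s h \<in> arr (enr2 elts U1 A)"
proof -
  interpret H: enr_fun D "asrc h" "atgt h" "amap h"
    by (rule enr_fun_arr[OF pdc_axioms h])
  interpret S: enr_nat D "atgt h" "atgt (asrc s)" "amap (asrc s)" "amap (atgt s)" "amap s"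
    using enr_nat_cell[OF pdc_axioms s] sh by simp
  have m: "asrc s \<in> arr (enr1 elts U1 A)" "atgt s \<in> arr (enr1 elts U1 A)" "asrc (atgt s) = atgt h" "atgt (atgt s) = atgt (asrc s)"
    using s sh by (auto simp: arr_enr2)
  have c: "cmp (enr1 elts U1 A) (asrc s) h \<in> arr (enr1 elts U1 A)" "cmp (enr1 elts U1 A) (atgt s) h \<in> arr (enr1 elts U1 A)"
    by (intro cat_simps(6)[OF category_enr1]; use h m sh in simp)+
  have f: "enriched_functor A (asrc h) (atgt (asrc s)) (amap (cmp (enr1 elts U1 A) (asrc s) h))"
    and f': "enriched_functor A (asrc h) (atgt (asrc s)) (amap (cmp (enr1 elts U1 A) (atgt s) h))"
    using c m by (simp_all add: arr_enr1)
  interpret GF: enr_fun D "asrc h" "atgt (asrc s)" "amap (cmp (enr1 elts U1 A) (asrc s) h)" by unfold_locales fact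
  have "enriched_natural A (asrc h) (atgt (asrc s)) (amap (cmp (enr1 elts U1 A) (asrc s) h)) (amap (cmp (enr1 elts U1 A) (atgt s) h))
     (amap (enr_rwhisker elts U1 A s h))"
    unfolding GF.enriched_natural_iff[OF f'] using m
    by (simp add: enr_rwhisker_def mcomp_1 mcomp_nil cell_over_def S.nat_pre)
  then show ?thesis using c m by (simp add: arr_enr2 enr_rwhisker_def del: enr1_sel(5)) (simp add: arr_enr2 enr_rwhisker_def)
qed

lemma whisker_sel [simp]:
  "asrc (enr_lwhisker elts U1 A g t) = cmp (enr1 elts U1 A) g (asrc t)"
  "atgt (enr_lwhisker elts U1 A g t) = cmp (enr1 elts U1 A) g (atgt t)"
  "asrc (enr_rwhisker elts U1 A s h) = cmp (enr1 elts U1 A) (asrc s) h"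
  "atgt (enr_rwhisker elts U1 A s h) = cmp (enr1 elts U1 A) (atgt s) h"
  by (simp_all add: enr_lwhisker_def enr_rwhisker_def)

lemma name_c2:
  assumes "t \<in> arr (enr2 elts U1 A)" "s \<in> arr (enr2 elts U1 A)" "asrc s = atgt t" "c \<in> eob (asrc (asrc t))"
  shows "mname (amap (cmp (enr2 elts U1 A) s t) c) =
    mname (emult (atgt (asrc t)) (fob (amap (asrc t)) c) (fob (amap (atgt t)) c) (fob (amap (atgt s)) c)) \<odot>
      (mname (amap t c) \<otimes> mname (amap s c)) \<odot> li (hid D (eext (asrc (asrc t)) c))"
proof -
  interpret T: enr_nat D "asrc (asrc t)" "atgt (asrc t)" "amap (asrc t)" "amap (atgt t)" "amap t"
    by (rule enr_nat_cell[OF pdc_axioms assms(1)])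
  have "asrc (atgt t) = asrc (asrc t)" "atgt (atgt t) = atgt (asrc t)" using assms(1) by (auto simp: arr_enr2)
  then interpret S: enr_nat D "asrc (asrc t)" "atgt (asrc t)" "amap (atgt t)" "amap (atgt s)" "amap s"
    using enr_nat_cell[OF pdc_axioms assms(2)] assms(3) by simp
  show ?thesis using assms(4) by (simp add: mcomp_00)
qed

lemma name_i2:
  assumes "f \<in> arr (enr1 elts U1 A)" "c \<in> eob (asrc f)"
  shows "mname (amap (ide (enr2 elts U1 A) f) c) = mname (eunit (atgt f) (fob (amap f) c)) \<odot> chid D (fver (amap f) c)"
proof -
  interpret enr_fun D "asrc f" "atgt f" "amap f" by (rule enr_fun_arr[OF pdc_axioms assms(1)])
  show ?thesis using assms(2) by (simp add: mcomp_nil)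
qed

lemma name_lwhisker:
  assumes "t \<in> arr (enr2 elts U1 A)" "c \<in> eob (asrc (asrc t))"
  shows "mname (amap (enr_lwhisker elts U1 A g t) c) =
    mname (fcell (amap g) (fob (amap (asrc t)) c) (fob (amap (atgt t)) c)) \<odot> mname (amap t c)"
proof -
  interpret T: enr_nat D "asrc (asrc t)" "atgt (asrc t)" "amap (asrc t)" "amap (atgt t)" "amap t"
    by (rule enr_nat_cell[OF pdc_axioms assms(1)])
  show ?thesis using assms(2) by (simp add: mcomp_1 enr_lwhisker_def)
qed

lemma name_rwhisker:
  assumes "h \<in> arr (enr1 elts U1 A)" "c \<in> eob (asrc h)"
  shows "mname (amap (enr_rwhisker elts U1 A s h) c) = mname (amap s (fob (amap h) c)) \<odot> chid D (fver (amap h) c)"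
proof -
  interpret enr_fun D "asrc h" "atgt h" "amap h" by (rule enr_fun_arr[OF pdc_axioms assms(1)])
  show ?thesis using assms(2) by (simp add: mcomp_nil enr_rwhisker_def)
qed

lemma name_c1:
  assumes "f \<in> arr (enr1 elts U1 A)" "c \<in> eob (asrc f)" "c' \<in> eob (asrc f)"
  shows "mname (fcell (amap (cmp (enr1 elts U1 A) g f)) c c') =
    mname (fcell (amap g) (fob (amap f) c) (fob (amap f) c')) \<odot> mname (fcell (amap f) c c')"
proof -
  interpret enr_fun D "asrc f" "atgt f" "amap f" by (rule enr_fun_arr[OF pdc_axioms assms(1)])
  show ?thesis using assms(2,3) by (simp add: mcomp_1)
qed

lemma fob_c1: "c \<in> eob (asrc f) \<Longrightarrow> fob (amap (cmp (enr1 elts U1 A) g f)) c = fob (amap g) (fob (amap f) c)"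
  and fver_c1: "c \<in> eob (asrc f) \<Longrightarrow>
    fver (amap (cmp (enr1 elts U1 A) g f)) c = vcmp D (fver (amap g) (fob (amap f) c)) (fver (amap f) c)"
  by simp_all

lemma name_i1: "c \<in> eob C \<Longrightarrow> fob (amap (ide (enr1 elts U1 A) C)) c = c"
  "c \<in> eob C \<Longrightarrow> fver (amap (ide (enr1 elts U1 A) C)) c = vid D (eext C c)"
  "c \<in> eob C \<Longrightarrow> c' \<in> eob C \<Longrightarrow> mname (fcell (amap (ide (enr1 elts U1 A) C)) c c') = cid D (ehom C c c')"
  by simp_all

lemmas enr_names = name_i1 name_c2 name_i2 name_lwhisker name_rwhisker name_c1 fob_c1 fver_c1

lemma enr_ops [simp]:
  "asrc (cmp (enr1 elts U1 A) g f) = asrc f" "atgt (cmp (enr1 elts U1 A) g f) = atgt g"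
  "asrc (ide (enr1 elts U1 A) C) = C" "atgt (ide (enr1 elts U1 A) C) = C"
  "asrc (cmp (enr2 elts U1 A) t s) = asrc s" "atgt (cmp (enr2 elts U1 A) t s) = atgt t"
  "asrc (ide (enr2 elts U1 A) f) = f" "atgt (ide (enr2 elts U1 A) f) = f"
  by simp_all

lemma enr_closed [simp]:
  "category (enr1 elts U1 A)" "category (enr2 elts U1 A)"
  "t \<in> arr (enr2 elts U1 A) \<Longrightarrow> asrc t \<in> arr (enr1 elts U1 A)"
  "t \<in> arr (enr2 elts U1 A) \<Longrightarrow> atgt t \<in> arr (enr1 elts U1 A)"
  "t \<in> arr (enr2 elts U1 A) \<Longrightarrow> asrc (atgt t) = asrc (asrc t)"
  "t \<in> arr (enr2 elts U1 A) \<Longrightarrow> atgt (atgt t) = atgt (asrc t)"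
  "f \<in> arr (enr1 elts U1 A) \<Longrightarrow> ide (enr2 elts U1 A) f \<in> arr (enr2 elts U1 A)"
  "f \<in> arr (enr1 elts U1 A) \<Longrightarrow> ide (enr1 elts U1 A) (asrc f) \<in> arr (enr1 elts U1 A)"
  "f \<in> arr (enr1 elts U1 A) \<Longrightarrow> ide (enr1 elts U1 A) (atgt f) \<in> arr (enr1 elts U1 A)"
  using category_enr1 category_enr2 cat_simps(3)[OF category_enr2, of f]
    cat_simps(3)[OF category_enr1, OF cat_simps(1)[OF category_enr1, of f]]
    cat_simps(3)[OF category_enr1, OF cat_simps(2)[OF category_enr1, of f]]
  by (auto simp: arr_enr2 simp del: enr1_sel(4))

lemmas whisker_arr [simp] = enr_lwhisker_arr enr_rwhisker_arr

end

declare pdc.enr_ops [simp] enr1_sel(4,5) [simp del] enr2_sel(4,5) [simp del]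

context pdc
begin

lemma enr_fun': "f \<in> arr (enr1 elts U1 A) \<Longrightarrow> asrc f = B \<Longrightarrow> atgt f = C \<Longrightarrow> enr_fun D B C (amap f)"
  using enr_fun_arr[OF pdc_axioms] by metis

lemma enr_nat': "t \<in> arr (enr2 elts U1 A) \<Longrightarrow> asrc t = f \<Longrightarrow> atgt t = g \<Longrightarrow> asrc f = B \<Longrightarrow> atgt f = C \<Longrightarrow>
    enr_nat D B C (amap f) (amap g) (amap t)"
  using enr_nat_cell[OF pdc_axioms] by metis

lemma enr1_eqI:
  assumes "f \<in> arr (enr1 elts U1 A)" "g \<in> arr (enr1 elts U1 A)" "asrc f = asrc g" "atgt f = atgt g"
    "\<And>c. c \<in> eob (asrc g) \<Longrightarrow> fob (amap f) c = fob (amap g) c" "\<And>c. c \<in> eob (asrc g) \<Longrightarrow> fver (amap f) c = fver (amap g) c"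
    "\<And>c c'. c \<in> eob (asrc g) \<Longrightarrow> c' \<in> eob (asrc g) \<Longrightarrow> mname (fcell (amap f) c c') = mname (fcell (amap g) c c')"
  shows "f = g"
proof -
  interpret f: enr_fun D "asrc g" "atgt g" "amap f" by (rule enr_fun') (use assms in simp_all)
  interpret g: enr_fun D "asrc g" "atgt g" "amap g" by (rule enr_fun') (use assms in simp_all)
  have "ext_efun (asrc g) (amap f)" "ext_efun (asrc g) (amap g)" using assms(1-3) by (auto simp: arr_enr1)
  then have "amap f = amap g" by (rule efun_eqI) (use assms in \<open>auto intro!: mcell.expand\<close>)
  then show ?thesis using assms(3,4) by (intro arrow.expand) simp
qed

lemma lwhisker_ide:
  assumes "g \<in> arr (enr1 elts U1 A)" "f \<in> arr (enr1 elts U1 A)" "asrc g = atgt f"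
  shows "enr_lwhisker elts U1 A g (ide (enr2 elts U1 A) f) = ide (enr2 elts U1 A) (cmp (enr1 elts U1 A) g f)"
proof -
  interpret F: enr_fun D "asrc f" "atgt f" "amap f" by (rule enr_fun') (use assms in simp_all)
  interpret G: enr_fun D "atgt f" "atgt g" "amap g" by (rule enr_fun') (use assms in simp_all)
  show ?thesis by (rule enr2_eqI[where elts=elts and ?U1.0=U1]) (use assms in \<open>simp_all add: enr_names G.om_et'\<close>)
qed

lemma rwhisker_ide:
  assumes "g \<in> arr (enr1 elts U1 A)" "f \<in> arr (enr1 elts U1 A)" "asrc g = atgt f"
  shows "enr_rwhisker elts U1 A (ide (enr2 elts U1 A) g) f = ide (enr2 elts U1 A) (cmp (enr1 elts U1 A) g f)"
proof -
  interpret F: enr_fun D "asrc f" "atgt f" "amap f" by (rule enr_fun') (use assms in simp_all)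
  interpret G: enr_fun D "atgt f" "atgt g" "amap g" by (rule enr_fun') (use assms in simp_all)
  show ?thesis by (rule enr2_eqI[where elts=elts and ?U1.0=U1]) (use assms in \<open>simp_all add: enr_names\<close>)
qed

lemma hcmp_ide_right:
  assumes "a \<in> cell (enr elts U1 A)" "f \<in> mor (enr elts U1 A)" "asrc (asrc a) = atgt f"
  shows "hcmp (enr elts U1 A) a (i2 (enr elts U1 A) f) = enr_rwhisker elts U1 A a f"
proof -
  have "enr_rwhisker elts U1 A a f \<in> arr (enr2 elts U1 A)" by (rule enr_rwhisker_arr) (use assms in simp_all)
  then have "cmp (enr2 elts U1 A) (enr_rwhisker elts U1 A a f) (ide (enr2 elts U1 A) (cmp (enr1 elts U1 A) (asrc a) f)) =
    enr_rwhisker elts U1 A a f" by (intro cat_simps(9)[OF category_enr2]) simp_all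
  then show ?thesis using assms by (simp add: lwhisker_ide)
qed

lemma hcmp_ide_left:
  assumes "g \<in> mor (enr elts U1 A)" "a \<in> cell (enr elts U1 A)" "asrc g = atgt (asrc a)"
  shows "hcmp (enr elts U1 A) (i2 (enr elts U1 A) g) a = enr_lwhisker elts U1 A g a"
proof -
  have "enr_lwhisker elts U1 A g a \<in> arr (enr2 elts U1 A)" by (rule enr_lwhisker_arr) (use assms in simp_all)
  then have "cmp (enr2 elts U1 A) (ide (enr2 elts U1 A) (cmp (enr1 elts U1 A) g (atgt a))) (enr_lwhisker elts U1 A g a) =
    enr_lwhisker elts U1 A g a" by (intro cat_simps(10)[OF category_enr2]) simp_all
  then show ?thesis using assms by (simp add: rwhisker_ide)
qed

lemma two_category_enr: "two_category (enr elts U1 A)"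
proof (rule two_category_whiskerI[where L="enr_lwhisker elts U1 A" and R="enr_rwhisker elts U1 A"],
    unfold enr_sel enr1_sel(2,3) enr2_sel(2,3), goal_cases)
  case (13 g b a)
  then have e: "asrc g = atgt (asrc a)" "asrc b = atgt a" by simp_all
  interpret A: enr_nat D "asrc (asrc a)" "atgt (asrc a)" "amap (asrc a)" "amap (atgt a)" "amap a"
    by (rule enr_nat') (use 13 in simp_all)
  interpret B: enr_nat D "asrc (asrc a)" "atgt (asrc a)" "amap (atgt a)" "amap (atgt b)" "amap b"
    by (rule enr_nat') (use 13 in simp_all)
  interpret G: enr_fun D "atgt (asrc a)" "atgt g" "amap g" by (rule enr_fun') (use 13 in simp_all)
  show ?case by (rule enr2_eqI[where elts=elts and ?U1.0=U1]) (use 13 e in \<open>simp_all add: enr_names G.om_mu'\<close>)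
next
  case (14 g f) then show ?case by (rule lwhisker_ide)
next
  case (15 a)
  interpret A: enr_nat D "asrc (asrc a)" "atgt (asrc a)" "amap (asrc a)" "amap (atgt a)" "amap a"
    by (rule enr_nat') (use 15 in simp_all)
  show ?case by (rule enr2_eqI[where elts=elts and ?U1.0=U1]) (use 15 in \<open>simp_all add: enr_names\<close>)
next
  case (16 h g a)
  then have e: "asrc g = atgt (asrc a)" "asrc h = atgt g" by simp_all
  interpret A: enr_nat D "asrc (asrc a)" "atgt (asrc a)" "amap (asrc a)" "amap (atgt a)" "amap a"
    by (rule enr_nat') (use 16 in simp_all)
  interpret G: enr_fun D "atgt (asrc a)" "atgt g" "amap g" by (rule enr_fun') (use 16 in simp_all)
  interpret H: enr_fun D "atgt g" "atgt h" "amap h" by (rule enr_fun') (use 16 in simp_all)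
  show ?case by (rule enr2_eqI[where elts=elts and ?U1.0=U1]) (use 16 e in \<open>simp_all add: enr_names\<close>)
next
  case (17 b a f)
  then have e: "asrc (asrc a) = atgt f" "asrc b = atgt a" by simp_all
  interpret A: enr_nat D "atgt f" "atgt (asrc a)" "amap (asrc a)" "amap (atgt a)" "amap a"
    by (rule enr_nat') (use 17 in simp_all)
  interpret B: enr_nat D "atgt f" "atgt (asrc a)" "amap (atgt a)" "amap (atgt b)" "amap b"
    by (rule enr_nat') (use 17 in simp_all)
  interpret F: enr_fun D "asrc f" "atgt f" "amap f" by (rule enr_fun') (use 17 in simp_all)
  have "li (hid D (eext (atgt f) (fob (amap f) x))) \<odot> chid D (fver (amap f) x) =
    (chid D (fver (amap f) x) \<otimes> chid D (fver (amap f) x)) \<odot> li (hid D (eext (asrc f) x))" if "x \<in> eob (asrc f)" for x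
    using li_nat[of "chid D (fver (amap f) x)"] that by simp
  then show ?case by (intro enr2_eqI[where elts=elts and ?U1.0=U1]) (use 17 e in \<open>simp_all add: enr_names ichg'\<close>)
next
  case (18 g f) then show ?case by (rule rwhisker_ide)
next
  case (19 a)
  interpret A: enr_nat D "asrc (asrc a)" "atgt (asrc a)" "amap (asrc a)" "amap (atgt a)" "amap a"
    by (rule enr_nat') (use 19 in simp_all)
  show ?case by (rule enr2_eqI[where elts=elts and ?U1.0=U1]) (use 19 in \<open>simp_all add: enr_names\<close>)
next
  case (20 a f f')
  then have e: "asrc (asrc a) = atgt f" "asrc f = atgt f'" by simp_all
  interpret A: enr_nat D "atgt f" "atgt (asrc a)" "amap (asrc a)" "amap (atgt a)" "amap a"
    by (rule enr_nat') (use 20 in simp_all)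
  interpret F: enr_fun D "atgt f'" "atgt f" "amap f" by (rule enr_fun') (use 20 in simp_all)
  interpret F': enr_fun D "asrc f'" "atgt f'" "amap f'" by (rule enr_fun') (use 20 in simp_all)
  show ?case by (rule enr2_eqI[where elts=elts and ?U1.0=U1]) (use 20 e in \<open>simp_all add: enr_names\<close>)
next
  case (21 g a f)
  then have e: "asrc (asrc a) = atgt f" "asrc g = atgt (asrc a)" by simp_all
  interpret A: enr_nat D "atgt f" "atgt (asrc a)" "amap (asrc a)" "amap (atgt a)" "amap a"
    by (rule enr_nat') (use 21 in simp_all)
  interpret F: enr_fun D "asrc f" "atgt f" "amap f" by (rule enr_fun') (use 21 in simp_all)
  interpret G: enr_fun D "atgt (asrc a)" "atgt g" "amap g" by (rule enr_fun') (use 21 in simp_all)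
  show ?case by (rule enr2_eqI[where elts=elts and ?U1.0=U1]) (use 21 e in \<open>simp_all add: enr_names\<close>)
next
  case (22 b a)
  then have e: "asrc (asrc b) = atgt (asrc a)" by simp_all
  interpret A: enr_nat D "asrc (asrc a)" "atgt (asrc a)" "amap (asrc a)" "amap (atgt a)" "amap a"
    by (rule enr_nat') (use 22 in simp_all)
  interpret B: enr_nat D "atgt (asrc a)" "atgt (asrc b)" "amap (asrc b)" "amap (atgt b)" "amap b"
    by (rule enr_nat') (use 22 in simp_all)
  show ?case by (rule enr2_eqI[where elts=elts and ?U1.0=U1]) (use 22 e in \<open>simp_all add: enr_names B.nat_pre flip: li_hid\<close>)
qed simp_all

end


section \<open>Coding and size of the 2-category of enriched categories\<close>

locale two_universes =
  fixes elts :: "'v \<Rightarrow> 'v set" and U1 U2 :: 'v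
  assumes up: "universe_pair elts U1 U2"
begin

sublocale V1: universe elts U1 using up by unfold_locales (simp_all add: universe_pair_def)
sublocale V2: universe elts U2 using up by unfold_locales (simp_all add: universe_pair_def)

lemma small_sets: "of_size elts U2 (elts U1)"
  using up V2.of_sizeI by (simp add: universe_pair_def)

lemma small_subset: "of_size elts U1 S \<Longrightarrow> S \<subseteq> elts U1"
  using V1.of_size_elems by blast

lemma small_large: "of_size elts U1 S \<Longrightarrow> of_size elts U2 S"
  using V2.of_size_subset[OF small_sets small_subset] .

lemma elts_U1_U2: "x \<in> elts U1 \<Longrightarrow> x \<in> elts U2"
  using V2.of_size_elems[OF small_sets] .

end

locale large_pdc = two_universes elts U1 U2 + pdc D for elts :: "'v \<Rightarrow> 'v set" and U1 U2 and D :: "'v psdbl" +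
  assumes large: "large_pseudo_double_category elts U2 D"
begin

lemma sizes: "of_size elts U2 (objs D)" "of_size elts U2 (vers D)" "of_size elts U2 (hors D)" "of_size elts U2 (cells D)"
  using large unfolding large_pseudo_double_category_def cat_of_size_def by blast+

lemma elems [simp]:
  "x \<in> objs D \<Longrightarrow> x \<in> elts U2" "x \<in> vers D \<Longrightarrow> x \<in> elts U2"
  "x \<in> hors D \<Longrightarrow> x \<in> elts U2" "x \<in> cells D \<Longrightarrow> x \<in> elts U2"
  using sizes V2.of_size_elems by blast+

abbreviation "E \<equiv> enr elts U1 A"
abbreviation "W \<equiv> elts U1"

text \<open>The objects of small enriched categories belong to \<open>U1\<close>, hence all codes lie in sets built from \<open>U1\<close> and the
  carriers of \<open>D\<close>; these bounds make the 2-category large.\<close>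

definition "codes0 = V2.tuples [W, V2.lams W (objs D), V2.lams W (V2.lams W (hors D)),
  V2.lams W (cells D), V2.lams W (V2.lams W (V2.lams W (cells D)))]"
definition "codes1 = V2.tuples [codes0, codes0, V2.lams W W, V2.lams W (vers D), V2.lams W (V2.lams W (cells D))]"
definition "codes2 = V2.tuples [codes1, codes1, V2.lams W (cells D)]"

lemma of_size_codes: "of_size elts U2 codes0" "of_size elts U2 codes1" "of_size elts U2 codes2"
proof -
  note l = V2.of_size_lams[OF small_sets]
  show 0: "of_size elts U2 codes0"
    unfolding codes0_def by (rule V2.of_size_tuples) (auto intro!: l sizes small_sets)
  show 1: "of_size elts U2 codes1"
    unfolding codes1_def by (rule V2.of_size_tuples) (auto intro!: l sizes small_sets 0)
  show "of_size elts U2 codes2"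
    unfolding codes2_def by (rule V2.of_size_tuples) (auto intro!: l sizes small_sets 1)
qed

lemma ob_E: "C \<in> ob E \<Longrightarrow> enr_cat D C \<and> ext_ecat C \<and> of_size elts U1 (eob C)"
  by (simp add: enr_cat_def enr_cat_axioms_def pdc_axioms)

lemma code0_in: assumes "C \<in> ob E" shows "code0 elts C \<in> codes0"
proof -
  interpret enr_cat D C using ob_E[OF assms] by simp
  have s: "of_size elts U1 (eob C)" "eob C \<subseteq> W" using ob_E[OF assms] small_subset by auto
  show ?thesis unfolding code0_def codes0_def
    by (rule V2.vtuple_in_tuples) (use s in \<open>auto intro!: V1.vset_in V2.lams_I\<close>)
qed

lemma code0_eq: assumes "C \<in> ob E" "C' \<in> ob E" "code0 elts C = code0 elts C'" shows "C = C'"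
proof -
  interpret C: enr_cat D C using ob_E[OF assms(1)] by simp
  interpret C': enr_cat D C' using ob_E[OF assms(2)] by simp
  have s: "of_size elts U1 (eob C)" "of_size elts U1 (eob C')" "ext_ecat C" "ext_ecat C'"
    using ob_E[OF assms(1)] ob_E[OF assms(2)] by auto
  note s2 = small_large[OF s(1)] small_large[OF s(2)]
  note i = V2.vset_in V2.vlam_in
  have e: "vset elts (eob C) = vset elts (eob C')"
    "vlam elts (eob C) (eext C) = vlam elts (eob C') (eext C')"
    "vlam elts (eob C) (\<lambda>c. vlam elts (eob C) (ehom C c)) = vlam elts (eob C') (\<lambda>c. vlam elts (eob C') (ehom C' c))"
    "vlam elts (eob C) (\<lambda>c. mname (eunit C c)) = vlam elts (eob C') (\<lambda>c. mname (eunit C' c))"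
    "vlam elts (eob C) (\<lambda>k. vlam elts (eob C) (\<lambda>l. vlam elts (eob C) (\<lambda>m. mname (emult C k l m)))) =
     vlam elts (eob C') (\<lambda>k. vlam elts (eob C') (\<lambda>l. vlam elts (eob C') (\<lambda>m. mname (emult C' k l m))))"
    using assms(3) unfolding code0_def
    by (subst (asm) V2.vtuple_inject; use s2 in \<open>auto intro!: i\<close>)+
  have o: "eob C' = eob C" using e(1) s2 by (simp add: V2.vset_inject)
  have x: "eext C c = eext C' c" if "c \<in> eob C" for c
    using e(2) that unfolding o by (subst (asm) V2.vlam_inject[OF s2(1)]) (auto simp: o)
  have h: "ehom C c c' = ehom C' c c'" if "c \<in> eob C" "c' \<in> eob C" for c c'
  proof -
    have "vlam elts (eob C) (ehom C c) = vlam elts (eob C) (ehom C' c)"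
      using e(3) that unfolding o by (subst (asm) V2.vlam_inject[OF s2(1)]) (auto simp: o s2 intro!: i)
    then show ?thesis
      using that by (subst (asm) V2.vlam_inject[OF s2(1)]) (auto simp: o)
  qed
  have u: "eunit C c = eunit C' c" if "c \<in> eob C" for c
  proof -
    have "mname (eunit C c) = mname (eunit C' c)"
      using e(4) that unfolding o by (subst (asm) V2.vlam_inject[OF s2(1)]) (auto simp: o)
    then show ?thesis using that by (intro mcell.expand) (simp add: o x h)
  qed
  have m: "emult C k l m = emult C' k l m" if "k \<in> eob C" "l \<in> eob C" "m \<in> eob C" for k l m
  proof -
    have "vlam elts (eob C) (\<lambda>l. vlam elts (eob C) (\<lambda>m. mname (emult C k l m))) = vlam elts (eob C) (\<lambda>l. vlam elts (eob C) (\<lambda>m. mname (emult C' k l m)))"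
      using e(5) that unfolding o by (subst (asm) V2.vlam_inject[OF s2(1)]) (auto simp: o s2 intro!: i)
    then have "vlam elts (eob C) (\<lambda>m. mname (emult C k l m)) = vlam elts (eob C) (\<lambda>m. mname (emult C' k l m))"
      using that by (subst (asm) V2.vlam_inject[OF s2(1)]) (auto simp: o s2 intro!: i)
    then have "mname (emult C k l m) = mname (emult C' k l m)"
      using that by (subst (asm) V2.vlam_inject[OF s2(1)]) (auto simp: o)
    then show ?thesis using that by (intro mcell.expand) (simp add: o x h)
  qed
  show ?thesis by (rule ecat_eqI[OF s(3,4)]) (simp_all add: o x h u m)
qed

lemma mor_ob: assumes "f \<in> mor E" shows "asrc f \<in> ob E" "atgt f \<in> ob E"
  using assms by (auto simp: arr_enr1)

lemma code1_in: assumes "f \<in> mor E" shows "code1 elts f \<in> codes1"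
proof -
  interpret enr_fun D "asrc f" "atgt f" "amap f" by (rule enr_fun') (use assms in simp_all)
  have s: "eob (asrc f) \<subseteq> W" "eob (atgt f) \<subseteq> W"
    using mor_ob[OF assms] small_subset by auto
  show ?thesis unfolding code1_def codes1_def
    by (rule V2.vtuple_in_tuples) (use s in \<open>auto intro!: V2.lams_I code0_in mor_ob assms dest: fun_facts(1)\<close>)
qed

lemma code0_elems [simp]: "C \<in> ob E \<Longrightarrow> code0 elts C \<in> elts U2"
  using code0_in of_size_codes(1) V2.of_size_elems by blast

lemma code1_eq: assumes "f \<in> mor E" "g \<in> mor E" "code1 elts f = code1 elts g" shows "f = g"
proof -
  interpret F: enr_fun D "asrc f" "atgt f" "amap f" by (rule enr_fun') (use assms in simp_all)
  interpret G: enr_fun D "asrc g" "atgt g" "amap g" by (rule enr_fun') (use assms in simp_all)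
  note ob = mor_ob[OF assms(1)] mor_ob[OF assms(2)]
  have s2: "of_size elts U2 (eob (asrc f))" "of_size elts U2 (eob (asrc g))"
    using small_large ob by auto
  have [simp]: "c \<in> eob (atgt f) \<Longrightarrow> c \<in> elts U2" "c \<in> eob (atgt g) \<Longrightarrow> c \<in> elts U2" for c
    using small_subset elts_U1_U2 ob by auto
  note i = V2.vlam_in
  have e: "code0 elts (asrc f) = code0 elts (asrc g)" "code0 elts (atgt f) = code0 elts (atgt g)"
    "vlam elts (eob (asrc f)) (fob (amap f)) = vlam elts (eob (asrc g)) (fob (amap g))"
    "vlam elts (eob (asrc f)) (fver (amap f)) = vlam elts (eob (asrc g)) (fver (amap g))"
    "vlam elts (eob (asrc f)) (\<lambda>c. vlam elts (eob (asrc f)) (\<lambda>c'. mname (fcell (amap f) c c'))) =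
     vlam elts (eob (asrc g)) (\<lambda>c. vlam elts (eob (asrc g)) (\<lambda>c'. mname (fcell (amap g) c c')))"
    using assms(3) unfolding code1_def
    by (subst (asm) V2.vtuple_inject; use s2 ob in \<open>auto intro!: i simp del: enr_sel\<close>)+
  have o: "asrc g = asrc f" "atgt g = atgt f" using e(1,2) ob code0_eq by metis+
  interpret G': enr_fun D "asrc f" "atgt f" "amap g" by (rule enr_fun') (use assms o in simp_all)
  have fo: "fob (amap f) c = fob (amap g) c" if "c \<in> eob (asrc f)" for c
    using e(3) that unfolding o by (subst (asm) V2.vlam_inject[OF s2(1)]) (auto simp: o)
  have v: "fver (amap f) c = fver (amap g) c" if "c \<in> eob (asrc f)" for c
    using e(4) that unfolding o by (subst (asm) V2.vlam_inject[OF s2(1)]) (auto simp: o)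
  have m: "fcell (amap f) c c' = fcell (amap g) c c'" if "c \<in> eob (asrc f)" "c' \<in> eob (asrc f)" for c c'
  proof -
    have "vlam elts (eob (asrc f)) (\<lambda>c'. mname (fcell (amap f) c c')) = vlam elts (eob (asrc f)) (\<lambda>c'. mname (fcell (amap g) c c'))"
      using e(5) that unfolding o by (subst (asm) V2.vlam_inject[OF s2(1)]) (auto simp: o s2 intro!: i)
    then have "mname (fcell (amap f) c c') = mname (fcell (amap g) c c')"
      using that by (subst (asm) V2.vlam_inject[OF s2(1)]) (auto simp: o)
    then show ?thesis using that by (intro mcell.expand) (simp add: o fo v)
  qed
  have "ext_efun (asrc f) (amap f)" "ext_efun (asrc f) (amap g)" using assms o by (auto simp: arr_enr1)
  then have "amap f = amap g" by (rule efun_eqI) (simp_all add: fo v m)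
  then show ?thesis using o by (intro arrow.expand) simp
qed

lemma cell_mor: assumes "t \<in> cell E" shows "asrc t \<in> mor E" "atgt t \<in> mor E"
  using assms by simp_all

lemma code2_in: assumes "t \<in> cell E" shows "code2 elts t \<in> codes2"
proof -
  interpret enr_nat D "asrc (asrc t)" "atgt (asrc t)" "amap (asrc t)" "amap (atgt t)" "amap t"
    by (rule enr_nat') (use assms in simp_all)
  have s: "eob (asrc (asrc t)) \<subseteq> W"
    using mor_ob[OF cell_mor(1)[OF assms]] small_subset by auto
  show ?thesis unfolding code2_def codes2_def
    by (rule V2.vtuple_in_tuples) (use s code1_in[OF cell_mor(1)[OF assms]] code1_in[OF cell_mor(2)[OF assms]] in
      \<open>auto intro!: V2.lams_I\<close>)
qed

lemma code1_elems [simp]: "f \<in> mor E \<Longrightarrow> code1 elts f \<in> elts U2"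
  using code1_in of_size_codes(2) V2.of_size_elems by blast

lemma code2_eq: assumes "s \<in> cell E" "t \<in> cell E" "code2 elts s = code2 elts t" shows "s = t"
proof -
  interpret S: enr_nat D "asrc (asrc s)" "atgt (asrc s)" "amap (asrc s)" "amap (atgt s)" "amap s"
    by (rule enr_nat') (use assms in simp_all)
  interpret T: enr_nat D "asrc (asrc t)" "atgt (asrc t)" "amap (asrc t)" "amap (atgt t)" "amap t"
    by (rule enr_nat') (use assms in simp_all)
  note mor = cell_mor[OF assms(1)] cell_mor[OF assms(2)]
  have s2: "of_size elts U2 (eob (asrc (asrc s)))" "of_size elts U2 (eob (asrc (asrc t)))"
    using small_large mor mor_ob by auto
  have e: "code1 elts (asrc s) = code1 elts (asrc t)" "code1 elts (atgt s) = code1 elts (atgt t)"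
    "vlam elts (eob (asrc (asrc s))) (\<lambda>c. mname (amap s c)) = vlam elts (eob (asrc (asrc t))) (\<lambda>c. mname (amap t c))"
    using assms(3) unfolding code2_def
    by (subst (asm) V2.vtuple_inject; use s2 mor in \<open>auto intro!: V2.vlam_in simp del: enr_sel\<close>)+
  have o: "asrc t = asrc s" "atgt t = atgt s" using e(1,2) mor code1_eq by metis+
  have m: "mname (amap s c) = mname (amap t c)" if "c \<in> eob (asrc (asrc s))" for c
    using e(3) that unfolding o by (subst (asm) V2.vlam_inject[OF s2(1)]) (auto simp: o)
  show ?thesis by (rule enr2_eqI[where elts=elts and ?U1.0=U1]) (use assms o m in simp_all)
qed

sublocale Co: coding E "code0 elts" "code1 elts" "code2 elts"
  using code0_eq code1_eq code2_eq two_category_enr by unfold_locales (auto intro!: inj_onI simp del: enr_sel)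

lemma large_Enr0: "large_two_category elts U2 Co.K"
proof -
  have "of_size elts U2 (code0 elts ` ob E)" "of_size elts U2 (code1 elts ` mor E)" "of_size elts U2 (code2 elts ` cell E)"
    using of_size_codes code0_in code1_in code2_in V2.of_size_subset by (auto simp del: enr_sel simp: image_subset_iff)
  then show ?thesis
    unfolding large_two_category_def cat_of_size_def Co.coded_sel
    using Co.two_category_coded Co.ext_coded by blast
qed

end


section \<open>Change of base along lax double functors\<close>

context lax_functor
begin

sublocale S: pdc C by unfold_locales simp

abbreviation "V \<equiv> vdbl_fun_of C D F"

lemma V_sel [simp]: "vfob V = lob F" "vfver V = lver F" "vfhor V = lhor F"
  "mtop (vfcell V k) = map (lhor F) (mtop k)" "mleft (vfcell V k) = lver F (mleft k)"
  "mright (vfcell V k) = lver F (mright k)" "mbot (vfcell V k) = lhor F (mbot k)"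
  "mname (vfcell V k) = lcell F (mname k) \<odot> lax_comps C D F (vsrc C (mleft k)) (mtop k)"
  by (simp_all add: vdbl_fun_of_def)

lemma comp_nat':
  assumes "x \<in> cells C" "y \<in> cells C" "cright C x = cleft C y" "x' \<in> cells D" "y' \<in> cells D"
    "cbot D x' = lhor F (ctop C x)" "cbot D y' = lhor F (ctop C y)" "cright D x' = cleft D y'" "cbot C x = g" "cbot C y = d"
    "z \<in> cells D" "cbot D z = hcomp D (ctop D x') (ctop D y')"
  shows "lax_comp F g d \<odot> ((lcell F x \<odot> x') \<otimes> (lcell F y \<odot> y')) \<odot> z =
    lcell F (chcomp C x y) \<odot> lax_comp F (ctop C x) (ctop C y) \<odot> (x' \<otimes> y') \<odot> z"
proof -
  have h: "htgt C (ctop C x) = hsrc C (ctop C y)" "htgt C (cbot C x) = hsrc C (cbot C y)"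
    using htgt_hsrc[OF pdC assms(1-3)] by simp_all
  have gd: "g \<in> hors C" "d \<in> hors C" using assms(1,2,9,10) cat_simps(2)[of "ccat C"] pdC by auto
  have "lax_comp F g d \<odot> ((lcell F x \<odot> x') \<otimes> (lcell F y \<odot> y')) \<odot> z =
    (lax_comp F (cbot C x) (cbot C y) \<odot> (lcell F x \<otimes> lcell F y)) \<odot> (x' \<otimes> y') \<odot> z"
    using assms h gd by (simp add: ichg')
  also have "\<dots> = (lcell F (chcomp C x y) \<odot> lax_comp F (ctop C x) (ctop C y)) \<odot> (x' \<otimes> y') \<odot> z"
    using assms(1-3) by (simp only: comp_nat)
  also have "\<dots> = lcell F (chcomp C x y) \<odot> lax_comp F (ctop C x) (ctop C y) \<odot> (x' \<otimes> y') \<odot> z"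
    using assms by (simp add: h)
  finally show ?thesis .
qed

lemma comp_nat0:
  assumes "x \<in> cells C" "y \<in> cells C" "cright C x = cleft C y" "x' \<in> cells D" "y' \<in> cells D"
    "cbot D x' = lhor F (ctop C x)" "cbot D y' = lhor F (ctop C y)" "cright D x' = cleft D y'" "cbot C x = g" "cbot C y = d"
  shows "lax_comp F g d \<odot> ((lcell F x \<odot> x') \<otimes> (lcell F y \<odot> y')) =
    lcell F (chcomp C x y) \<odot> lax_comp F (ctop C x) (ctop C y) \<odot> (x' \<otimes> y')"
proof -
  have h: "htgt C (ctop C x) = hsrc C (ctop C y)" "htgt C (cbot C x) = hsrc C (cbot C y)"
    using htgt_hsrc[OF pdC assms(1-3)] by simp_all
  then have "htgt C g = hsrc C d" using assms by simp
  moreover have "htgt D (ctop D x') = hsrc D (ctop D y')" using htgt_hsrc[OF pd assms(4,5,8)] by simp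
  ultimately show ?thesis using comp_nat'[OF assms, of "cid D (hcomp D (ctop D x') (ctop D y'))"] assms by (simp add: h)
qed

text \<open>The unit law of a lax functor solved for the image of the inverse constraint, since the inverse constraints
  occur in composites with nullary multicells.\<close>

lemma comp_li:
  assumes "g \<in> hors C"
  shows "lax_comp F (hid C (hsrc C g)) g \<odot> (lax_unit F (hsrc C g) \<otimes> cid D (lhor F g)) \<odot> li (lhor F g) = lcell F (S.li g)"
proof -
  have e: "lcell F (S.li g) \<odot> lcell F (S.lu g) = cid D (lhor F (hcomp C (hid C (hsrc C g)) g))"
    using assms by (simp flip: F_simps(16) add: F_simps(15))
  have "lax_comp F (hid C (hsrc C g)) g \<odot> (lax_unit F (hsrc C g) \<otimes> cid D (lhor F g)) \<odot> li (lhor F g) =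
    (lcell F (S.li g) \<odot> lcell F (S.lu g)) \<odot> lax_comp F (hid C (hsrc C g)) g \<odot> (lax_unit F (hsrc C g) \<otimes> cid D (lhor F g)) \<odot> li (lhor F g)"
    unfolding e using assms by simp
  also have "\<dots> = lcell F (S.li g) \<odot> (lcell F (S.lu g) \<odot> lax_comp F (hid C (hsrc C g)) g \<odot> (lax_unit F (hsrc C g) \<otimes> cid D (lhor F g))) \<odot> li (lhor F g)"
    using assms by simp
  also have "\<dots> = lcell F (S.li g)" unfolding comp_lunit[OF assms] using assms by simp
  finally show ?thesis .
qed

lemma comp_ri:
  assumes "g \<in> hors C"
  shows "lax_comp F g (hid C (htgt C g)) \<odot> (cid D (lhor F g) \<otimes> lax_unit F (htgt C g)) \<odot> ri (lhor F g) = lcell F (S.ri g)"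
proof -
  have e: "lcell F (S.ri g) \<odot> lcell F (S.ru g) = cid D (lhor F (hcomp C g (hid C (htgt C g))))"
    using assms by (simp flip: F_simps(16) add: F_simps(15))
  have "lax_comp F g (hid C (htgt C g)) \<odot> (cid D (lhor F g) \<otimes> lax_unit F (htgt C g)) \<odot> ri (lhor F g) =
    (lcell F (S.ri g) \<odot> lcell F (S.ru g)) \<odot> lax_comp F g (hid C (htgt C g)) \<odot> (cid D (lhor F g) \<otimes> lax_unit F (htgt C g)) \<odot> ri (lhor F g)"
    unfolding e using assms by simp
  also have "\<dots> = lcell F (S.ri g) \<odot> (lcell F (S.ru g) \<odot> lax_comp F g (hid C (htgt C g)) \<odot> (cid D (lhor F g) \<otimes> lax_unit F (htgt C g))) \<odot> ri (lhor F g)"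
    using assms by simp
  also have "\<dots> = lcell F (S.ri g)" unfolding comp_runit[OF assms] using assms by simp
  finally show ?thesis .
qed

lemma comp_unit_unit:
  assumes "a \<in> objs C"
  shows "lax_comp F (hid C a) (hid C a) \<odot> (lax_unit F a \<otimes> lax_unit F a) \<odot> li (hid D (lob F a)) = lcell F (S.li (hid C a)) \<odot> lax_unit F a"
proof -
  have "(lax_unit F a \<otimes> lax_unit F a) \<odot> li (hid D (lob F a)) =
    (lax_unit F a \<otimes> cid D (lhor F (hid C a))) \<odot> (cid D (hid D (lob F a)) \<otimes> lax_unit F a) \<odot> li (hid D (lob F a))"
    using assms by (simp add: ichg')
  also have "\<dots> = (lax_unit F a \<otimes> cid D (lhor F (hid C a))) \<odot> li (lhor F (hid C a)) \<odot> lax_unit F a"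
    using li_nat[of "lax_unit F a"] assms by simp
  finally show ?thesis using comp_li[of "hid C a", symmetric] assms by simp
qed

lemma push_ecat_sel [simp]:
  "eob (push_ecat V X) = eob X"
  "c \<in> eob X \<Longrightarrow> eext (push_ecat V X) c = lob F (eext X c)"
  "c \<in> eob X \<Longrightarrow> c' \<in> eob X \<Longrightarrow> ehom (push_ecat V X) c c' = lhor F (ehom X c c')"
  "c \<in> eob X \<Longrightarrow> eunit (push_ecat V X) c = vfcell V (eunit X c)"
  "k \<in> eob X \<Longrightarrow> l \<in> eob X \<Longrightarrow> m \<in> eob X \<Longrightarrow> emult (push_ecat V X) k l m = vfcell V (emult X k l m)"
  by (simp_all add: push_ecat_def)

lemma enriched_push:
  assumes "enr_cat C X" shows "enr_cat D (push_ecat V X)"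
proof -
  interpret X: enr_cat C X by fact
  have l: "lcell F (X.mu c c c') \<odot> lax_comp F (ehom X c c) (ehom X c c') \<odot> ((lcell F (X.et c) \<odot> lax_unit F (eext X c)) \<otimes> cid D (lhor F (ehom X c c')))
    = lu (lhor F (ehom X c c'))" if "c \<in> eob X" "c' \<in> eob X" for c c'
  proof -
    have "lcell F (X.mu c c c') \<odot> lax_comp F (ehom X c c) (ehom X c c') \<odot> ((lcell F (X.et c) \<odot> lax_unit F (eext X c)) \<otimes> (lcell F (cid C (ehom X c c')) \<odot> cid D (lhor F (ehom X c c')))) =
      lcell F (X.mu c c c') \<odot> lcell F (chcomp C (X.et c) (cid C (ehom X c c'))) \<odot> lax_comp F (hid C (eext X c)) (ehom X c c') \<odot> (lax_unit F (eext X c) \<otimes> cid D (lhor F (ehom X c c')))"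
      by (subst comp_nat0) (use that in simp_all)
    also have "\<dots> = lcell F (cmp (ccat C) (X.mu c c c') (chcomp C (X.et c) (cid C (ehom X c c')))) \<odot> lax_comp F (hid C (eext X c)) (ehom X c c') \<odot> (lax_unit F (eext X c) \<otimes> cid D (lhor F (ehom X c c')))"
      using that by simp
    also have "\<dots> = lu (lhor F (ehom X c c'))"
      unfolding X.mu_lunit[OF that] using comp_lunit[of "ehom X c c'"] that by simp
    finally show ?thesis using that by simp
  qed
  have r: "lcell F (X.mu c c' c') \<odot> lax_comp F (ehom X c c') (ehom X c' c') \<odot> (cid D (lhor F (ehom X c c')) \<otimes> (lcell F (X.et c') \<odot> lax_unit F (eext X c')))
    = ru (lhor F (ehom X c c'))" if "c \<in> eob X" "c' \<in> eob X" for c c'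
  proof -
    have "lcell F (X.mu c c' c') \<odot> lax_comp F (ehom X c c') (ehom X c' c') \<odot> ((lcell F (cid C (ehom X c c')) \<odot> cid D (lhor F (ehom X c c'))) \<otimes> (lcell F (X.et c') \<odot> lax_unit F (eext X c'))) =
      lcell F (X.mu c c' c') \<odot> lcell F (chcomp C (cid C (ehom X c c')) (X.et c')) \<odot> lax_comp F (ehom X c c') (hid C (eext X c')) \<odot> (cid D (lhor F (ehom X c c')) \<otimes> lax_unit F (eext X c'))"
      by (subst comp_nat0) (use that in simp_all)
    also have "\<dots> = lcell F (cmp (ccat C) (X.mu c c' c') (chcomp C (cid C (ehom X c c')) (X.et c'))) \<odot> lax_comp F (ehom X c c') (hid C (eext X c')) \<odot> (cid D (lhor F (ehom X c c')) \<otimes> lax_unit F (eext X c'))"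
      using that by simp
    also have "\<dots> = ru (lhor F (ehom X c c'))"
      unfolding X.mu_runit[OF that] using comp_runit[of "ehom X c c'"] that by simp
    finally show ?thesis using that by simp
  qed
  have a: "lcell F (X.mu k m n) \<odot> lax_comp F (ehom X k m) (ehom X m n) \<odot>
      ((lcell F (X.mu k l m) \<odot> lax_comp F (ehom X k l) (ehom X l m)) \<otimes> cid D (lhor F (ehom X m n))) =
    lcell F (X.mu k l n) \<odot> lax_comp F (ehom X k l) (ehom X l n) \<odot>
      (cid D (lhor F (ehom X k l)) \<otimes> (lcell F (X.mu l m n) \<odot> lax_comp F (ehom X l m) (ehom X m n))) \<odot>
      as (lhor F (ehom X k l)) (lhor F (ehom X l m)) (lhor F (ehom X m n))"
    if c: "k \<in> eob X" "l \<in> eob X" "m \<in> eob X" "n \<in> eob X" for k l m n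
  proof -
    let ?g = "ehom X k l" and ?d = "ehom X l m" and ?e = "ehom X m n"
    have "lcell F (X.mu k m n) \<odot> lax_comp F (ehom X k m) ?e \<odot> ((lcell F (X.mu k l m) \<odot> lax_comp F ?g ?d) \<otimes> (lcell F (cid C ?e) \<odot> cid D (lhor F ?e))) =
      lcell F (X.mu k m n) \<odot> lcell F (chcomp C (X.mu k l m) (cid C ?e)) \<odot> lax_comp F (hcomp C ?g ?d) ?e \<odot> (lax_comp F ?g ?d \<otimes> cid D (lhor F ?e))"
      by (subst comp_nat0) (use that in simp_all)
    also have "\<dots> = lcell F (cmp (ccat C) (X.mu k m n) (chcomp C (X.mu k l m) (cid C ?e))) \<odot> lax_comp F (hcomp C ?g ?d) ?e \<odot> (lax_comp F ?g ?d \<otimes> cid D (lhor F ?e))"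
      using that by simp
    also have "\<dots> = lcell F (X.mu k l n) \<odot> lcell F (chcomp C (cid C ?g) (X.mu l m n)) \<odot>
      (lcell F (hassoc C ?g ?d ?e) \<odot> lax_comp F (hcomp C ?g ?d) ?e \<odot> (lax_comp F ?g ?d \<otimes> cid D (lhor F ?e)))"
      unfolding X.mu_assoc[OF c] using that by simp
    also have "\<dots> = lcell F (X.mu k l n) \<odot> lcell F (chcomp C (cid C ?g) (X.mu l m n)) \<odot>
      (lax_comp F ?g (hcomp C ?d ?e) \<odot> (cid D (lhor F ?g) \<otimes> lax_comp F ?d ?e) \<odot> as (lhor F ?g) (lhor F ?d) (lhor F ?e))"
      using that by (simp add: comp_assoc)
    also have "\<dots> = lcell F (X.mu k l n) \<odot> lax_comp F ?g (ehom X l n) \<odot>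
      ((lcell F (cid C ?g) \<odot> cid D (lhor F ?g)) \<otimes> (lcell F (X.mu l m n) \<odot> lax_comp F ?d ?e)) \<odot> as (lhor F ?g) (lhor F ?d) (lhor F ?e)"
      by (subst comp_nat') (use that in simp_all)
    finally show ?thesis using that by simp
  qed
  have "enriched_category A (push_ecat V X)"
    unfolding enriched_category_iff by (simp add: cell_over_def l r a)
  then show ?thesis by unfold_locales
qed

lemma ext_push: "ext_ecat (push_ecat V X)"
  by (auto simp: ext_ecat_def push_ecat_def cong: restrict_cong)

lemma push_efun_sel [simp]:
  "asrc (push_efun V f) = push_ecat V (asrc f)" "atgt (push_efun V f) = push_ecat V (atgt f)"
  "fob (amap (push_efun V f)) = fob (amap f)"
  "c \<in> eob (asrc f) \<Longrightarrow> fver (amap (push_efun V f)) c = lver F (fver (amap f) c)"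
  "c \<in> eob (asrc f) \<Longrightarrow> c' \<in> eob (asrc f) \<Longrightarrow> fcell (amap (push_efun V f)) c c' = vfcell V (fcell (amap f) c c')"
  by (simp_all add: push_efun_def)

lemma push_enat_sel [simp]:
  "asrc (push_enat V t) = push_efun V (asrc t)" "atgt (push_enat V t) = push_efun V (atgt t)"
  "c \<in> eob (asrc (asrc t)) \<Longrightarrow> amap (push_enat V t) c = vfcell V (amap t c)"
  by (simp_all add: push_enat_def)

lemma push_ecat_ob: "X \<in> obj (enr1 elts U1 (vdbl_of C)) \<Longrightarrow> push_ecat V X \<in> obj (enr1 elts U1 A)"
  using enriched_push[of X] by (simp add: enr_cat_def enr_cat_axioms_def ext_push pdc_axioms S.pdc_axioms)

lemma push_efun_mor:
  assumes "f \<in> arr (enr1 elts U1 (vdbl_of C))" shows "push_efun V f \<in> arr (enr1 elts U1 A)"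
proof -
  interpret f: enr_fun C "asrc f" "atgt f" "amap f" by (rule S.enr_fun') (use assms in simp_all)
  interpret X: enr_cat D "push_ecat V (asrc f)" by (rule enriched_push) unfold_locales
  interpret Y: enr_cat D "push_ecat V (atgt f)" by (rule enriched_push) unfold_locales
  have u: "lcell F (f.om c c) \<odot> lcell F (f.S.et c) \<odot> lax_unit F (eext (asrc f) c) =
      lcell F (f.T.et (fob (amap f) c)) \<odot> lax_unit F (eext (atgt f) (fob (amap f) c)) \<odot> chid D (lver F (fver (amap f) c))"
    if "c \<in> eob (asrc f)" for c
  proof -
    have "lcell F (f.om c c) \<odot> lcell F (f.S.et c) \<odot> lax_unit F (eext (asrc f) c) =
      lcell F (cmp (ccat C) (f.om c c) (f.S.et c)) \<odot> lax_unit F (eext (asrc f) c)" using that by simp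
    then show ?thesis using that unit_nat[of "fver (amap f) c"] by (simp add: f.om_et)
  qed
  have m: "lcell F (f.om k m) \<odot> lcell F (f.S.mu k l m) \<odot> lax_comp F (ehom (asrc f) k l) (ehom (asrc f) l m) =
      lcell F (f.T.mu (fob (amap f) k) (fob (amap f) l) (fob (amap f) m)) \<odot> lax_comp F (ehom (atgt f) (fob (amap f) k) (fob (amap f) l)) (ehom (atgt f) (fob (amap f) l) (fob (amap f) m)) \<odot>
      (lcell F (f.om k l) \<otimes> lcell F (f.om l m))"
    if "k \<in> eob (asrc f)" "l \<in> eob (asrc f)" "m \<in> eob (asrc f)" for k l m
  proof -
    have "lcell F (f.om k m) \<odot> lcell F (f.S.mu k l m) \<odot> lax_comp F (ehom (asrc f) k l) (ehom (asrc f) l m) =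
      lcell F (cmp (ccat C) (f.om k m) (f.S.mu k l m)) \<odot> lax_comp F (ehom (asrc f) k l) (ehom (asrc f) l m)" using that by simp
    then show ?thesis using that comp_nat[of "f.om k l" "f.om l m"] by (simp add: f.om_mu)
  qed
  have "enriched_functor A (push_ecat V (asrc f)) (push_ecat V (atgt f)) (amap (push_efun V f))"
    unfolding enriched_functor_iff[OF X.C Y.C] by (simp add: cell_over_def u m)
  moreover have "ext_efun (asrc f) (amap f)" using assms by (simp add: arr_enr1)
  then have "ext_efun (asrc f) (amap (push_efun V f))"
    by (auto simp: ext_efun_def push_efun_def cong: restrict_cong)
  then have "ext_efun (push_ecat V (asrc f)) (amap (push_efun V f))" by (simp add: ext_efun_def)
  ultimately show ?thesis using X.C Y.C assms by (simp add: arr_enr1 ext_push)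
qed

lemma push_enat_cell:
  assumes "t \<in> arr (enr2 elts U1 (vdbl_of C))" shows "push_enat V t \<in> arr (enr2 elts U1 A)"
proof -
  interpret t: enr_nat C "asrc (asrc t)" "atgt (asrc t)" "amap (asrc t)" "amap (atgt t)" "amap t"
    by (rule S.enr_nat') (use assms in simp_all)
  have m: "asrc t \<in> arr (enr1 elts U1 (vdbl_of C))" "atgt t \<in> arr (enr1 elts U1 (vdbl_of C))"
    and e: "asrc (atgt t) = asrc (asrc t)" "atgt (atgt t) = atgt (asrc t)" using assms by simp_all
  note pm = push_efun_mor[OF m(1)] push_efun_mor[OF m(2)]
  interpret f: enr_fun D "push_ecat V (asrc (asrc t))" "push_ecat V (atgt (asrc t))" "amap (push_efun V (asrc t))"
    by (rule enr_fun'[OF pm(1)]) simp_all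
  interpret g: enr_fun D "push_ecat V (asrc (asrc t))" "push_ecat V (atgt (asrc t))" "amap (push_efun V (atgt t))"
    by (rule enr_fun'[OF pm(2)]) (simp_all add: e)
  let ?f = "fob (amap (asrc t))" and ?g = "fob (amap (atgt t))"
  have n: "lcell F (t.F.T.mu (?f c) (?g c) (?g c')) \<odot> lax_comp F (ehom (atgt (asrc t)) (?f c) (?g c)) (ehom (atgt (asrc t)) (?g c) (?g c')) \<odot>
      ((lcell F (t.ta c) \<odot> lax_unit F (eext (asrc (asrc t)) c)) \<otimes> lcell F (t.G.om c c')) \<odot> li (lhor F (ehom (asrc (asrc t)) c c')) =
    lcell F (t.F.T.mu (?f c) (?f c') (?g c')) \<odot> lax_comp F (ehom (atgt (asrc t)) (?f c) (?f c')) (ehom (atgt (asrc t)) (?f c') (?g c')) \<odot>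
      (lcell F (t.F.om c c') \<otimes> (lcell F (t.ta c') \<odot> lax_unit F (eext (asrc (asrc t)) c'))) \<odot> ri (lhor F (ehom (asrc (asrc t)) c c'))"
    if c: "c \<in> eob (asrc (asrc t))" "c' \<in> eob (asrc (asrc t))" for c c'
  proof -
    let ?h = "ehom (asrc (asrc t)) c c'"
    have "lcell F (t.F.T.mu (?f c) (?g c) (?g c')) \<odot> lax_comp F (ehom (atgt (asrc t)) (?f c) (?g c)) (ehom (atgt (asrc t)) (?g c) (?g c')) \<odot>
      ((lcell F (t.ta c) \<odot> lax_unit F (eext (asrc (asrc t)) c)) \<otimes> (lcell F (t.G.om c c') \<odot> cid D (lhor F ?h))) \<odot> li (lhor F ?h) =
      lcell F (cmp (ccat C) (t.F.T.mu (?f c) (?g c) (?g c')) (cmp (ccat C) (chcomp C (t.ta c) (t.G.om c c')) (S.li ?h)))"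
      using c comp_li[of ?h] by (subst comp_nat') simp_all
    also have "\<dots> = lcell F (t.F.T.mu (?f c) (?f c') (?g c')) \<odot> lax_comp F (ehom (atgt (asrc t)) (?f c) (?f c')) (ehom (atgt (asrc t)) (?f c') (?g c')) \<odot>
      ((lcell F (t.F.om c c') \<odot> cid D (lhor F ?h)) \<otimes> (lcell F (t.ta c') \<odot> lax_unit F (eext (asrc (asrc t)) c'))) \<odot> ri (lhor F ?h)"
      unfolding t.nat[OF c] using c comp_ri[of ?h] by (subst comp_nat') simp_all
    finally show ?thesis using c by simp
  qed
  have "enriched_natural A (push_ecat V (asrc (asrc t))) (push_ecat V (atgt (asrc t))) (amap (push_efun V (asrc t))) (amap (push_efun V (atgt t)))
     (amap (push_enat V t))"
    unfolding f.enriched_natural_iff[OF g.f] by (simp add: cell_over_def n e)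
  moreover have "amap (push_enat V t) \<in> extensional (eob (asrc (asrc t)))" by (simp add: push_enat_def)
  ultimately show ?thesis using pm by (simp add: arr_enr2 e)
qed

definition push :: "('v ecat, 'v earrow, 'v etwo_cell, 'v ecat, 'v earrow, 'v etwo_cell) two_fun" where
  "push = \<lparr>on0 = push_ecat V, on1 = push_efun V, on2 = push_enat V\<rparr>"

lemma push_sel [simp]: "on0 push = push_ecat V" "on1 push = push_efun V" "on2 push = push_enat V"
  by (simp_all add: push_def)

lemma name_push_enat:
  assumes "t \<in> arr (enr2 elts U1 (vdbl_of C))" "c \<in> eob (asrc (asrc t))"
  shows "mname (amap (push_enat V t) c) = lcell F (mname (amap t c)) \<odot> lax_unit F (eext (asrc (asrc t)) c)"
proof -
  interpret t: enr_nat C "asrc (asrc t)" "atgt (asrc t)" "amap (asrc t)" "amap (atgt t)" "amap t"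
    by (rule S.enr_nat') (use assms in simp_all)
  show ?thesis using assms(2) by simp
qed

lemma name_push_efun:
  assumes "f \<in> arr (enr1 elts U1 (vdbl_of C))" "c \<in> eob (asrc f)" "c' \<in> eob (asrc f)"
  shows "mname (fcell (amap (push_efun V f)) c c') = lcell F (mname (fcell (amap f) c c'))"
proof -
  interpret f: enr_fun C "asrc f" "atgt f" "amap f" by (rule S.enr_fun') (use assms in simp_all)
  show ?thesis using assms(2,3) by simp
qed

lemmas push_names = name_push_enat name_push_efun

lemmas push_closed [simp] = push_efun_mor push_enat_cell

lemma push_c1:
  assumes "f \<in> arr (enr1 elts U1 (vdbl_of C))" "g \<in> arr (enr1 elts U1 (vdbl_of C))" "asrc g = atgt f"
  shows "push_efun V (cmp (enr1 elts U1 (vdbl_of C)) g f) = cmp (enr1 elts U1 A) (push_efun V g) (push_efun V f)"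
proof -
  interpret f: enr_fun C "asrc f" "atgt f" "amap f" by (rule S.enr_fun') (use assms in simp_all)
  interpret g: enr_fun C "atgt f" "atgt g" "amap g" by (rule S.enr_fun') (use assms in simp_all)
  show ?thesis
    by (rule enr1_eqI[where elts=elts and ?U1.0=U1])
     (use assms in \<open>simp_all add: S.enr_names enr_names push_names[where elts=elts and ?U1.0=U1] del: push_efun_sel(5)\<close>)
qed

lemma push_i2:
  assumes "f \<in> arr (enr1 elts U1 (vdbl_of C))"
  shows "push_enat V (ide (enr2 elts U1 (vdbl_of C)) f) = ide (enr2 elts U1 A) (push_efun V f)"
proof -
  interpret f: enr_fun C "asrc f" "atgt f" "amap f" by (rule S.enr_fun') (use assms in simp_all)
  have "lcell F (chid C (fver (amap f) c)) \<odot> lax_unit F (eext (asrc f) c) =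
    lax_unit F (eext (atgt f) (fob (amap f) c)) \<odot> chid D (lver F (fver (amap f) c))" if "c \<in> eob (asrc f)" for c
    using unit_nat[of "fver (amap f) c"] that by simp
  then show ?thesis
    by (intro enr2_eqI[where elts=elts and ?U1.0=U1])
     (use assms in \<open>simp_all add: S.enr_names enr_names push_names[where elts=elts and ?U1.0=U1] del: push_enat_sel(3)\<close>)
qed

lemma push_c2:
  assumes "t \<in> arr (enr2 elts U1 (vdbl_of C))" "s \<in> arr (enr2 elts U1 (vdbl_of C))" "asrc s = atgt t"
  shows "push_enat V (cmp (enr2 elts U1 (vdbl_of C)) s t) = cmp (enr2 elts U1 A) (push_enat V s) (push_enat V t)"
proof -
  interpret t: enr_nat C "asrc (asrc t)" "atgt (asrc t)" "amap (asrc t)" "amap (atgt t)" "amap t"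
    by (rule S.enr_nat') (use assms in simp_all)
  interpret s: enr_nat C "asrc (asrc t)" "atgt (asrc t)" "amap (atgt t)" "amap (atgt s)" "amap s"
    by (rule S.enr_nat') (use assms in simp_all)
  show ?thesis
    by (rule enr2_eqI[where elts=elts and ?U1.0=U1])
     (use assms in \<open>simp_all add: S.enr_names enr_names push_names[where elts=elts and ?U1.0=U1] comp_nat' comp_unit_unit del: push_enat_sel(3)\<close>)
qed

lemma push_lwhisker:
  assumes "t \<in> arr (enr2 elts U1 (vdbl_of C))" "g \<in> arr (enr1 elts U1 (vdbl_of C))" "asrc g = atgt (asrc t)"
  shows "push_enat V (enr_lwhisker elts U1 (vdbl_of C) g t) = enr_lwhisker elts U1 A (push_efun V g) (push_enat V t)"
proof -
  interpret t: enr_nat C "asrc (asrc t)" "atgt (asrc t)" "amap (asrc t)" "amap (atgt t)" "amap t"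
    by (rule S.enr_nat') (use assms in simp_all)
  interpret g: enr_fun C "atgt (asrc t)" "atgt g" "amap g" by (rule S.enr_fun') (use assms in simp_all)
  show ?thesis
    by (rule enr2_eqI[where elts=elts and ?U1.0=U1])
     (use assms in \<open>simp_all add: S.enr_names enr_names push_names[where elts=elts and ?U1.0=U1] push_c1 del: push_enat_sel(3) push_efun_sel(5)\<close>)
qed

lemma push_rwhisker:
  assumes "s \<in> arr (enr2 elts U1 (vdbl_of C))" "h \<in> arr (enr1 elts U1 (vdbl_of C))" "asrc (asrc s) = atgt h"
  shows "push_enat V (enr_rwhisker elts U1 (vdbl_of C) s h) = enr_rwhisker elts U1 A (push_enat V s) (push_efun V h)"
proof -
  interpret h: enr_fun C "asrc h" "atgt h" "amap h" by (rule S.enr_fun') (use assms in simp_all)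
  interpret s: enr_nat C "atgt h" "atgt (asrc s)" "amap (asrc s)" "amap (atgt s)" "amap s"
    by (rule S.enr_nat') (use assms in simp_all)
  have "lcell F (chid C (fver (amap h) c)) \<odot> lax_unit F (eext (asrc h) c) =
    lax_unit F (eext (atgt h) (fob (amap h) c)) \<odot> chid D (lver F (fver (amap h) c))" if "c \<in> eob (asrc h)" for c
    using unit_nat[of "fver (amap h) c"] that by simp
  then show ?thesis
    by (intro enr2_eqI[where elts=elts and ?U1.0=U1])
     (use assms in \<open>simp_all add: S.enr_names enr_names push_names[where elts=elts and ?U1.0=U1] push_c1 del: push_enat_sel(3)\<close>)
qed

lemma two_functor_push: "two_functor (enr elts U1 (vdbl_of C)) (enr elts U1 A) push"
proof (rule two_functorI, unfold enr_sel enr1_sel(2,3) enr2_sel(2,3) push_sel, goal_cases)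
  case 1 then show ?case by (rule S.two_category_enr)
next
  case 2 then show ?case by (rule two_category_enr)
next
  case (3 X) then show ?case by (rule push_ecat_ob)
next
  case (4 f) then show ?case using push_efun_mor by simp
next
  case (5 X)
  then interpret X: enr_cat C X by unfold_locales simp
  show ?case
  proof (rule enr1_eqI)
    show "push_efun V (ide (enr1 elts U1 (vdbl_of C)) X) \<in> arr (enr1 elts U1 A)"
      by (rule push_efun_mor) (use cat_simps(3)[OF S.category_enr1 5] in simp)
    show "ide (enr1 elts U1 A) (push_ecat V X) \<in> arr (enr1 elts U1 A)"
      by (rule cat_simps(3)[OF category_enr1 push_ecat_ob[OF 5]])
  qed (simp_all add: enr1_sel(4))
next
  case (6 g f) then show ?case by (simp add: push_c1)
next
  case (7 t) then show ?case using push_enat_cell by simp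
next
  case (8 f) then show ?case by (simp add: push_i2)
next
  case (9 s t) then show ?case by (simp add: push_c2)
next
  case (10 s t)
  then show ?case by (simp add: push_c2 push_lwhisker push_rwhisker)
qed

end


section \<open>The 2-functor of enrichment\<close>

abbreviation "Vf F \<equiv> vdbl_fun_of (asrc F) (atgt F) (amap F)"
abbreviation "component t \<equiv> push_component (on2 PsDBL_to_VDBL t)"

lemma component_sel [simp]:
  "asrc (component t X) = push_ecat (Vf (asrc t)) X"
  "atgt (component t X) = push_ecat (Vf (atgt t)) X"
  "c \<in> eob X \<Longrightarrow> fob (amap (component t X)) c = c"
  "c \<in> eob X \<Longrightarrow> fver (amap (component t X)) c = tob (amap t) (eext X c)"
  "c \<in> eob X \<Longrightarrow> c' \<in> eob X \<Longrightarrow> fcell (amap (component t X)) c c' =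
     MCell [lhor (amap (asrc t)) (ehom X c c')] (tob (amap t) (hsrc (asrc (asrc t)) (ehom X c c')))
      (tob (amap t) (htgt (asrc (asrc t)) (ehom X c c'))) (lhor (amap (atgt t)) (ehom X c c')) (thor (amap t) (ehom X c c'))"
  by (simp_all add: push_component_def PsDBL_to_VDBL_def vdbl_trans_of_def Let_def)

lemma ext_component: "ext_efun (push_ecat (Vf (asrc t)) X) (amap (component t X))"
  by (auto simp: push_component_def ext_efun_def push_ecat_def cong: restrict_cong)

lemma PsDBL_cellD:
  assumes "t \<in> cell (PsDBL elts U)"
  shows "lax_functor (asrc (asrc t)) (atgt (asrc t)) (amap (asrc t))"
    "lax_functor (asrc (asrc t)) (atgt (asrc t)) (amap (atgt t))"
    "asrc (atgt t) = asrc (asrc t)" "atgt (atgt t) = atgt (asrc t)"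
    "vertical_transformation (asrc (asrc t)) (atgt (asrc t)) (amap (asrc t)) (amap (atgt t)) (amap t)"
  using assms lax_functor_PsDBL1[of "asrc t" elts U] lax_functor_PsDBL1[of "atgt t" elts U] unfolding cell_PsDBL by auto

lemma component_mor:
  assumes t: "t \<in> cell (PsDBL elts U)" and X: "X \<in> ob (enr elts U1 (vdbl_of (asrc (asrc t))))"
  shows "component t X \<in> mor (enr elts U1 (vdbl_of (atgt (asrc t))))"
proof -
  let ?C = "asrc (asrc t)" and ?D = "atgt (asrc t)"
  note tt = PsDBL_cellD[OF t]
  interpret F: lax_functor ?C ?D "amap (asrc t)" by fact
  interpret G: lax_functor ?C ?D "amap (atgt t)" by fact
  interpret X: enr_cat ?C X using X by unfold_locales simp
  interpret FX: enr_cat ?D "push_ecat F.V X" by (rule F.enriched_push) unfold_locales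
  interpret GX: enr_cat ?D "push_ecat G.V X" by (rule G.enriched_push) unfold_locales
  note [simp] = vertical_transformationD[OF tt(5) F.pd] F.ichg
  have u: "cmp (ccat ?D) (thor (amap t) (ehom X c c)) (cmp (ccat ?D) (lcell (amap (asrc t)) (X.et c)) (lax_unit (amap (asrc t)) (eext X c))) =
      cmp (ccat ?D) (lcell (amap (atgt t)) (X.et c)) (cmp (ccat ?D) (lax_unit (amap (atgt t)) (eext X c)) (chid ?D (tob (amap t) (eext X c))))"
    if "c \<in> eob X" for c
  proof -
    have "cmp (ccat ?D) (thor (amap t) (cbot ?C (X.et c))) (lcell (amap (asrc t)) (X.et c)) =
      cmp (ccat ?D) (lcell (amap (atgt t)) (X.et c)) (thor (amap t) (ctop ?C (X.et c)))"
      using that vertical_transformationD(10)[OF tt(5) F.pd, of "X.et c"] by simp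
    then have "cmp (ccat ?D) (cmp (ccat ?D) (thor (amap t) (ehom X c c)) (lcell (amap (asrc t)) (X.et c))) (lax_unit (amap (asrc t)) (eext X c)) =
      cmp (ccat ?D) (cmp (ccat ?D) (lcell (amap (atgt t)) (X.et c)) (thor (amap t) (hid ?C (eext X c)))) (lax_unit (amap (asrc t)) (eext X c))"
      using that by simp
    then show ?thesis using that by simp
  qed
  have m: "cmp (ccat ?D) (thor (amap t) (ehom X k m)) (cmp (ccat ?D) (lcell (amap (asrc t)) (X.mu k l m)) (lax_comp (amap (asrc t)) (ehom X k l) (ehom X l m))) =
      cmp (ccat ?D) (lcell (amap (atgt t)) (X.mu k l m)) (cmp (ccat ?D) (lax_comp (amap (atgt t)) (ehom X k l) (ehom X l m)) (chcomp ?D (thor (amap t) (ehom X k l)) (thor (amap t) (ehom X l m))))"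
    if "k \<in> eob X" "l \<in> eob X" "m \<in> eob X" for k l m
  proof -
    have "cmp (ccat ?D) (cmp (ccat ?D) (thor (amap t) (ehom X k m)) (lcell (amap (asrc t)) (X.mu k l m))) (lax_comp (amap (asrc t)) (ehom X k l) (ehom X l m)) =
      cmp (ccat ?D) (cmp (ccat ?D) (lcell (amap (atgt t)) (X.mu k l m)) (thor (amap t) (hcomp ?C (ehom X k l) (ehom X l m)))) (lax_comp (amap (asrc t)) (ehom X k l) (ehom X l m))"
      using vertical_transformationD(10)[OF tt(5) F.pd, of "X.mu k l m"] that by simp
    then show ?thesis using that by simp
  qed
  have "enriched_functor F.A (push_ecat F.V X) (push_ecat G.V X) (amap (component t X))"
    unfolding F.enriched_functor_iff[OF FX.C GX.C] by (simp add: cell_over_def u m)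
  then show ?thesis using FX.C GX.C X ext_component[of t X] tt(3,4) by (simp add: arr_enr1 F.ext_push G.ext_push)
qed

lemma component_natural:
  assumes t: "t \<in> cell (PsDBL elts U)" and f: "f \<in> mor (enr elts U1 (vdbl_of (asrc (asrc t))))"
  shows "c1 (enr elts U1 (vdbl_of (atgt (asrc t)))) (push_efun (Vf (atgt t)) f) (component t (asrc f)) =
    c1 (enr elts U1 (vdbl_of (atgt (asrc t)))) (component t (atgt f)) (push_efun (Vf (asrc t)) f)"
proof -
  let ?C = "asrc (asrc t)" and ?D = "atgt (asrc t)"
  note tt = PsDBL_cellD[OF t]
  interpret F: lax_functor ?C ?D "amap (asrc t)" by fact
  interpret G: lax_functor ?C ?D "amap (atgt t)" by fact
  interpret f: enr_fun ?C "asrc f" "atgt f" "amap f" by (rule F.S.enr_fun') (use f in simp_all)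
  note v = vertical_transformationD[OF tt(5) F.pd]
  have o: "asrc f \<in> ob (enr elts U1 (vdbl_of ?C))" "atgt f \<in> ob (enr elts U1 (vdbl_of ?C))"
    using f by (simp_all add: arr_enr1)
  have m [simp]: "push_efun (F.V) f \<in> arr (enr1 elts U1 F.A)" "push_efun (G.V) f \<in> arr (enr1 elts U1 F.A)"
    "component t (asrc f) \<in> arr (enr1 elts U1 F.A)" "component t (atgt f) \<in> arr (enr1 elts U1 F.A)"
    using f F.push_efun_mor[of f elts U1] G.push_efun_mor[of f elts U1] component_mor[OF t o(1)] component_mor[OF t o(2)] tt(3,4) by simp_all
  have v9: "vcmp ?D (lver (amap (atgt t)) (fver (amap f) c)) (tob (amap t) (eext (asrc f) c)) =
     vcmp ?D (tob (amap t) (eext (atgt f) (fob (amap f) c))) (lver (amap (asrc t)) (fver (amap f) c))" if "c \<in> eob (asrc f)" for c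
    using v(9)[of "fver (amap f) c"] that by simp
  have v10: "cmp (ccat ?D) (lcell (amap (atgt t)) (f.om c c')) (thor (amap t) (ehom (asrc f) c c')) =
     cmp (ccat ?D) (thor (amap t) (ehom (atgt f) (fob (amap f) c) (fob (amap f) c'))) (lcell (amap (asrc t)) (f.om c c'))"
     if "c \<in> eob (asrc f)" "c' \<in> eob (asrc f)" for c c'
    using v(10)[of "f.om c c'"] that by simp
  show ?thesis unfolding enr_sel
    by (rule F.enr1_eqI[where elts=elts and ?U1.0=U1]) (simp_all add: F.enr_names v9 v10 tt(3,4))
qed

lemma component_natural2:
  assumes t: "t \<in> cell (PsDBL elts U)" and s: "s \<in> cell (enr elts U1 (vdbl_of (asrc (asrc t))))"
  shows "hcmp (enr elts U1 (vdbl_of (atgt (asrc t)))) (push_enat (Vf (atgt t)) s)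
      (i2 (enr elts U1 (vdbl_of (atgt (asrc t)))) (component t (asrc (asrc s)))) =
    hcmp (enr elts U1 (vdbl_of (atgt (asrc t)))) (i2 (enr elts U1 (vdbl_of (atgt (asrc t)))) (component t (atgt (asrc s))))
      (push_enat (Vf (asrc t)) s)"
proof -
  let ?C = "asrc (asrc t)" and ?D = "atgt (asrc t)"
  note tt = PsDBL_cellD[OF t]
  interpret F: lax_functor ?C ?D "amap (asrc t)" by fact
  interpret G: lax_functor ?C ?D "amap (atgt t)" by fact
  interpret s: enr_nat ?C "asrc (asrc s)" "atgt (asrc s)" "amap (asrc s)" "amap (atgt s)" "amap s"
    by (rule F.S.enr_nat') (use s in simp_all)
  note [simp] = vertical_transformationD[OF tt(5) F.pd]
  have ms: "asrc s \<in> mor (enr elts U1 (vdbl_of ?C))" "atgt s \<in> mor (enr elts U1 (vdbl_of ?C))" "asrc (atgt s) = asrc (asrc s)" "atgt (atgt s) = atgt (asrc s)"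
    using s by simp_all
  have o: "asrc (asrc s) \<in> ob (enr elts U1 (vdbl_of ?C))" "atgt (asrc s) \<in> ob (enr elts U1 (vdbl_of ?C))"
    using ms(1) by (simp_all add: arr_enr1)
  have m [simp]: "push_enat (F.V) s \<in> arr (enr2 elts U1 F.A)" "push_enat (G.V) s \<in> arr (enr2 elts U1 F.A)"
    "push_efun (F.V) (asrc s) \<in> arr (enr1 elts U1 F.A)" "push_efun (G.V) (asrc s) \<in> arr (enr1 elts U1 F.A)"
    "push_efun (F.V) (atgt s) \<in> arr (enr1 elts U1 F.A)" "push_efun (G.V) (atgt s) \<in> arr (enr1 elts U1 F.A)"
    "component t (asrc (asrc s)) \<in> arr (enr1 elts U1 F.A)" "component t (atgt (asrc s)) \<in> arr (enr1 elts U1 F.A)"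
    using s ms F.push_enat_cell[of s elts U1] G.push_enat_cell[of s elts U1] component_mor[OF t o(1)] component_mor[OF t o(2)] tt(3,4)
      F.push_efun_mor[of "asrc s" elts U1] G.push_efun_mor[of "asrc s" elts U1] F.push_efun_mor[of "atgt s" elts U1] G.push_efun_mor[of "atgt s" elts U1]
    by simp_all
  have R: "hcmp (enr elts U1 F.A) (push_enat (G.V) s) (i2 (enr elts U1 F.A) (component t (asrc (asrc s)))) =
    enr_rwhisker elts U1 F.A (push_enat (G.V) s) (component t (asrc (asrc s)))"
    by (rule F.hcmp_ide_right) (simp_all add: tt(3,4))
  have L: "hcmp (enr elts U1 F.A) (i2 (enr elts U1 F.A) (component t (atgt (asrc s)))) (push_enat (F.V) s) =
    enr_lwhisker elts U1 F.A (component t (atgt (asrc s))) (push_enat (F.V) s)"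
    by (rule F.hcmp_ide_left) (simp_all add: tt(3,4))
  have n: "cmp (ccat ?D) (lcell (amap (atgt t)) (s.ta c)) (cmp (ccat ?D) (lax_unit (amap (atgt t)) (eext (asrc (asrc s)) c)) (chid ?D (tob (amap t) (eext (asrc (asrc s)) c)))) =
    cmp (ccat ?D) (thor (amap t) (ehom (atgt (asrc s)) (fob (amap (asrc s)) c) (fob (amap (atgt s)) c)))
      (cmp (ccat ?D) (lcell (amap (asrc t)) (s.ta c)) (lax_unit (amap (asrc t)) (eext (asrc (asrc s)) c)))"
    if "c \<in> eob (asrc (asrc s))" for c
  proof -
    have "cmp (ccat ?D) (cmp (ccat ?D) (lcell (amap (atgt t)) (s.ta c)) (thor (amap t) (ctop ?C (s.ta c)))) (lax_unit (amap (asrc t)) (eext (asrc (asrc s)) c)) =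
      cmp (ccat ?D) (cmp (ccat ?D) (thor (amap t) (cbot ?C (s.ta c))) (lcell (amap (asrc t)) (s.ta c))) (lax_unit (amap (asrc t)) (eext (asrc (asrc s)) c))"
      using vertical_transformationD(10)[OF tt(5) F.pd, of "s.ta c"] that by simp
    then show ?thesis using that by (simp del: vertical_transformationD(10)[OF tt(5) F.pd])
  qed
  show ?thesis
  proof (unfold tt(3,4) R L, rule F.enr2_eqI[where elts=elts and ?U1.0=U1], goal_cases)
    case 1 show ?case by (rule F.enr_rwhisker_arr) (simp_all add: tt(3,4))
  next
    case 2 show ?case by (rule F.enr_lwhisker_arr) (simp_all add: tt(3,4))
  next
    case 3 show ?case using component_natural[OF t ms(1)] by (simp add: tt(3,4))
  next
    case 4 show ?case using component_natural[OF t ms(2)] ms(3,4) by (simp add: tt(3,4))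
  next
    case (5 c)
    then show ?case using s n[of c] by (simp add: F.enr_names tt(3,4))
  qed
qed

lemma lax_functor_comp: "lax_functor B C F \<Longrightarrow> lax_functor C D G \<Longrightarrow> lax_functor B D (comp_lax_fun B D G F)"
  using lax_double_functor_comp[of B C F D G] by (auto simp: lax_functor_def lax_functor_axioms_def)

lemma lax_functor_id: "pseudo_double_category D \<Longrightarrow> lax_functor D D (id_lax_fun D)"
  by (intro lax_functorI lax_double_functor_id)

context
  fixes B C D :: "'v psdbl" and F G :: "'v lax_fun"
  assumes F: "lax_functor B C F" and G: "lax_functor C D G"
begin

interpretation F: lax_functor B C F by (rule F)
interpretation G: lax_functor C D G by (rule G)
interpretation GF: lax_functor B D "comp_lax_fun B D G F" by (rule lax_functor_comp[OF F G])

lemma push_comp_vfcell: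
  assumes "x \<in> cells B" "mname k = x" "mleft k \<in> vers B" "mright k \<in> vers B" "mbot k \<in> hors B" "ctop B x = hcomps B (vsrc B (mleft k)) (mtop k)"
    "mtop k = [] \<or> (\<exists>g\<in>hors B. mtop k = [g]) \<or> (\<exists>g\<in>hors B. \<exists>d\<in>hors B. htgt B g = hsrc B d \<and> mtop k = [g, d])"
  shows "vfcell GF.V k = vfcell G.V (vfcell F.V k)"
  using assms by (intro mcell.expand) auto

lemma push_comp_ecat:
  assumes "enr_cat B X" shows "push_ecat GF.V X = push_ecat G.V (push_ecat F.V X)"
proof -
  interpret X: enr_cat B X by fact
  show ?thesis by (rule ecat_eqI) (auto simp: GF.ext_push G.ext_push intro!: push_comp_vfcell)
qed

lemma push_comp_efun:
  assumes f: "f \<in> arr (enr1 elts U1 (vdbl_of B))" shows "push_efun GF.V f = push_efun G.V (push_efun F.V f)"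
proof -
  interpret f: enr_fun B "asrc f" "atgt f" "amap f" by (rule F.S.enr_fun') (use f in simp_all)
  show ?thesis
    using f push_comp_ecat[of "asrc f"] push_comp_ecat[of "atgt f"] f.S.enr_cat_axioms f.T.enr_cat_axioms
    by (intro G.enr1_eqI[where elts=elts and ?U1.0=U1]) simp_all
qed

lemma push_comp_enat:
  assumes t: "t \<in> arr (enr2 elts U1 (vdbl_of B))" shows "push_enat GF.V t = push_enat G.V (push_enat F.V t)"
proof -
  interpret t: enr_nat B "asrc (asrc t)" "atgt (asrc t)" "amap (asrc t)" "amap (atgt t)" "amap t"
    by (rule F.S.enr_nat') (use t in simp_all)
  have "asrc t \<in> arr (enr1 elts U1 (vdbl_of B))" "atgt t \<in> arr (enr1 elts U1 (vdbl_of B))" using t by simp_all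
  then show ?thesis
    using t push_comp_efun[of "asrc t" elts U1] push_comp_efun[of "atgt t" elts U1]
    by (intro G.enr2_eqI[where elts=elts and ?U1.0=U1]) simp_all
qed

end

context
  fixes D :: "'v psdbl"
  assumes pd: "pseudo_double_category D"
begin

interpretation I: lax_functor D D "id_lax_fun D" by (rule lax_functor_id[OF pd])

lemma push_id_ecat: assumes "enr_cat D X" "ext_ecat X" shows "push_ecat I.V X = X"
proof -
  interpret X: enr_cat D X by fact
  show ?thesis by (rule ecat_eqI) (auto simp: I.ext_push assms intro!: mcell.expand)
qed

lemma push_id_efun: assumes f: "f \<in> arr (enr1 elts U1 (vdbl_of D))" shows "push_efun I.V f = f"
proof -
  interpret f: enr_fun D "asrc f" "atgt f" "amap f" by (rule I.enr_fun') (use f in simp_all)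
  have "ext_ecat (asrc f)" "ext_ecat (atgt f)" using f by (simp_all add: arr_enr1)
  then show ?thesis
    using f push_id_ecat[of "asrc f"] push_id_ecat[of "atgt f"] f.S.enr_cat_axioms f.T.enr_cat_axioms
    by (intro I.enr1_eqI[where elts=elts and ?U1.0=U1]) simp_all
qed

lemma push_id_enat: assumes t: "t \<in> arr (enr2 elts U1 (vdbl_of D))" shows "push_enat I.V t = t"
proof -
  interpret t: enr_nat D "asrc (asrc t)" "atgt (asrc t)" "amap (asrc t)" "amap (atgt t)" "amap t"
    by (rule I.enr_nat') (use t in simp_all)
  have "asrc t \<in> arr (enr1 elts U1 (vdbl_of D))" "atgt t \<in> arr (enr1 elts U1 (vdbl_of D))" using t by simp_all
  then show ?thesis
    using t push_id_efun[of "asrc t" elts U1] push_id_efun[of "atgt t" elts U1]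
    by (intro I.enr2_eqI[where elts=elts and ?U1.0=U1]) simp_all
qed

end


context two_universes
begin

abbreviation "EN D \<equiv> enr elts U1 (vdbl_of D)"
abbreviation "KN D \<equiv> coded (code0 elts) (code1 elts) (code2 elts) (EN D)"

lemma large_pdcI: "large_pseudo_double_category elts U2 D \<Longrightarrow> large_pdc elts U1 U2 D"
  by (intro large_pdc.intro two_universes_axioms pdc.intro large_pdc_axioms.intro) simp_all

lemma Enr_sel [simp]:
  "on0 (Enr elts U1) D = KN D"
  "asrc (on1 (Enr elts U1) F) = KN (asrc F)" "atgt (on1 (Enr elts U1) F) = KN (atgt F)"
  "asrc (on2 (Enr elts U1) t) = on1 (Enr elts U1) (asrc t)" "atgt (on2 (Enr elts U1) t) = on1 (Enr elts U1) (atgt t)"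
  by (simp_all add: Enr_def Enr_VDBL_def PsDBL_to_VDBL_def Enr1_def Enr2_def Enr0_def coded_def Let_def)

lemma Enr1_eval:
  assumes "F \<in> mor (PsDBL elts U2)"
  shows "X \<in> ob (EN (asrc F)) \<Longrightarrow> on0 (amap (on1 (Enr elts U1) F)) (code0 elts X) = code0 elts (push_ecat (Vf F) X)"
    "f \<in> mor (EN (asrc F)) \<Longrightarrow> on1 (amap (on1 (Enr elts U1) F)) (code1 elts f) = code1 elts (push_efun (Vf F) f)"
    "t \<in> cell (EN (asrc F)) \<Longrightarrow> on2 (amap (on1 (Enr elts U1) F)) (code2 elts t) = code2 elts (push_enat (Vf F) t)"
    "ext_two_fun (KN (asrc F)) (amap (on1 (Enr elts U1) F))"
proof -
  interpret S: large_pdc elts U1 U2 "asrc F" using assms by (intro large_pdcI) (simp add: arr_PsDBL1)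
  show "X \<in> ob (EN (asrc F)) \<Longrightarrow> on0 (amap (on1 (Enr elts U1) F)) (code0 elts X) = code0 elts (push_ecat (Vf F) X)"
    "f \<in> mor (EN (asrc F)) \<Longrightarrow> on1 (amap (on1 (Enr elts U1) F)) (code1 elts f) = code1 elts (push_efun (Vf F) f)"
    "t \<in> cell (EN (asrc F)) \<Longrightarrow> on2 (amap (on1 (Enr elts U1) F)) (code2 elts t) = code2 elts (push_enat (Vf F) t)"
    by (simp_all add: Enr_def Enr_VDBL_def PsDBL_to_VDBL_def Enr1_def Let_def recode_def del: enr_sel)
  show "ext_two_fun (KN (asrc F)) (amap (on1 (Enr elts U1) F))"
    by (simp add: ext_two_fun_def Enr_def Enr_VDBL_def PsDBL_to_VDBL_def Enr1_def Let_def recode_def del: enr_sel)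
qed

lemma Enr2_eval:
  assumes "t \<in> cell (PsDBL elts U2)"
  shows "X \<in> ob (EN (asrc (asrc t))) \<Longrightarrow> amap (on2 (Enr elts U1) t) (code0 elts X) = code1 elts (component t X)"
    "amap (on2 (Enr elts U1) t) \<in> extensional (ob (KN (asrc (asrc t))))"
proof -
  interpret S: large_pdc elts U1 U2 "asrc (asrc t)" using assms by (intro large_pdcI) (simp add: cell_PsDBL arr_PsDBL1)
  have e: "asrc (asrc (on2 PsDBL_to_VDBL t)) = vdbl_of (asrc (asrc t))"
    by (simp add: PsDBL_to_VDBL_def Let_def)
  show "X \<in> ob (EN (asrc (asrc t))) \<Longrightarrow> amap (on2 (Enr elts U1) t) (code0 elts X) = code1 elts (component t X)"
    using S.Co.inv0[of X] by (simp add: Enr_def Enr_VDBL_def Enr2_def recode_def e)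
  show "amap (on2 (Enr elts U1) t) \<in> extensional (ob (KN (asrc (asrc t))))"
    by (simp add: Enr_def Enr_VDBL_def Enr2_def recode_def e)
qed

lemma Enr_mor:
  assumes F: "F \<in> mor (PsDBL elts U2)"
  shows "on1 (Enr elts U1) F \<in> mor (TwoCAT elts U2)"
proof -
  have l: "large_pseudo_double_category elts U2 (asrc F)" "large_pseudo_double_category elts U2 (atgt F)"
    using F by (simp_all add: arr_PsDBL1)
  interpret S: large_pdc elts U1 U2 "asrc F" by (intro large_pdcI l)
  interpret T: large_pdc elts U1 U2 "atgt F" by (intro large_pdcI l)
  interpret F: lax_functor "asrc F" "atgt F" "amap F" using F by (intro lax_functor_PsDBL1) simp
  have "two_functor S.Co.K T.Co.K (comp_two_fun T.Co.enc (comp_two_fun F.push S.Co.dec))"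
    by (rule two_functor_comp[OF two_functor_comp[OF S.Co.two_functor_dec F.two_functor_push] T.Co.two_functor_enc])
  then have "two_functor S.Co.K T.Co.K (amap (on1 (Enr elts U1) F))"
    by (rule two_functor_cong) (auto simp: Enr1_eval[OF F] simp del: enr_sel)
  then show ?thesis using S.large_Enr0 T.large_Enr0 Enr1_eval(4)[OF F] by (simp add: mor_TwoCAT1)
qed

lemma Enr_cell:
  assumes t: "t \<in> cell (PsDBL elts U2)"
  shows "on2 (Enr elts U1) t \<in> cell (TwoCAT elts U2)"
proof -
  have m: "asrc t \<in> mor (PsDBL elts U2)" "atgt t \<in> mor (PsDBL elts U2)" 
    and e [simp]: "asrc (atgt t) = asrc (asrc t)" "atgt (atgt t) = atgt (asrc t)"
    using t by (auto simp: cell_PsDBL)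
  have l: "large_pseudo_double_category elts U2 (asrc (asrc t))" "large_pseudo_double_category elts U2 (atgt (asrc t))"
    using m by (simp_all add: arr_PsDBL1)
  interpret S: large_pdc elts U1 U2 "asrc (asrc t)" by (intro large_pdcI l)
  interpret T: large_pdc elts U1 U2 "atgt (asrc t)" by (intro large_pdcI l)
  interpret F: lax_functor "asrc (asrc t)" "atgt (asrc t)" "amap (asrc t)" using PsDBL_cellD[OF t] by simp
  interpret G: lax_functor "asrc (asrc t)" "atgt (asrc t)" "amap (atgt t)" using PsDBL_cellD[OF t] by simp
  note [simp] = two_functor_simps[OF F.two_functor_push] two_functor_simps[OF G.two_functor_push]
  have cm [simp]: "X \<in> ob S.E \<Longrightarrow> component t X \<in> mor T.E" for X by (rule component_mor[OF t])
  have cs [simp]: "s1 T.E (component t X) = push_ecat F.V X" "t1 T.E (component t X) = push_ecat G.V X" for X by simp_all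
  have n1: "f \<in> mor S.E \<Longrightarrow> c1 T.E (push_efun G.V f) (component t (s1 S.E f)) = c1 T.E (component t (t1 S.E f)) (push_efun F.V f)" for f
    using component_natural[OF t, where f=f and ?U1.0=U1] by simp
  have n2: "a \<in> cell S.E \<Longrightarrow> hcmp T.E (push_enat G.V a) (i2 T.E (component t (s1 S.E (s2 S.E a)))) =
     hcmp T.E (i2 T.E (component t (t1 S.E (s2 S.E a)))) (push_enat F.V a)" for a
    using component_natural2[OF t, where s=a and ?U1.0=U1] by simp
  have p [simp]: "X \<in> ob S.E \<Longrightarrow> push_ecat F.V X \<in> ob T.E" "X \<in> ob S.E \<Longrightarrow> push_ecat G.V X \<in> ob T.E"
    "f \<in> mor S.E \<Longrightarrow> push_efun F.V f \<in> mor T.E" "f \<in> mor S.E \<Longrightarrow> push_efun G.V f \<in> mor T.E"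
    "f \<in> mor S.E \<Longrightarrow> s1 T.E (push_efun F.V f) = push_ecat F.V (s1 S.E f)" "f \<in> mor S.E \<Longrightarrow> t1 T.E (push_efun F.V f) = push_ecat F.V (t1 S.E f)"
    "f \<in> mor S.E \<Longrightarrow> s1 T.E (push_efun G.V f) = push_ecat G.V (s1 S.E f)" "f \<in> mor S.E \<Longrightarrow> t1 T.E (push_efun G.V f) = push_ecat G.V (t1 S.E f)"
    "a \<in> cell S.E \<Longrightarrow> push_enat F.V a \<in> cell T.E" "a \<in> cell S.E \<Longrightarrow> push_enat G.V a \<in> cell T.E"
    "a \<in> cell S.E \<Longrightarrow> s2 T.E (push_enat F.V a) = push_efun F.V (s2 S.E a)" "a \<in> cell S.E \<Longrightarrow> s2 T.E (push_enat G.V a) = push_efun G.V (s2 S.E a)"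
    for X f a
    using two_functor_simps[OF F.two_functor_push[of elts U1]] two_functor_simps[OF G.two_functor_push[of elts U1]]
    by (simp_all del: enr_sel F.push_efun_sel F.push_enat_sel G.push_efun_sel G.push_enat_sel)
  note ev = Enr1_eval[OF m(1)] Enr1_eval[OF m(2), unfolded e] Enr2_eval[OF t]
  have "two_natural S.Co.K T.Co.K (amap (on1 (Enr elts U1) (asrc t))) (amap (on1 (Enr elts U1) (atgt t))) (amap (on2 (Enr elts U1) t))"
  proof (rule two_naturalI, unfold S.Co.coded_sel, goal_cases)
    case (1 x)
    then obtain X where X: "x = code0 elts X" "X \<in> ob S.E" by blast
    then show ?case using cs[of X] by (simp add: ev del: enr_sel component_sel)
  next
    case (2 x)
    then obtain f where f: "x = code1 elts f" "f \<in> mor S.E" by blast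
    have "s1 S.E f \<in> ob S.E" "t1 S.E f \<in> ob S.E" using f by (simp_all del: enr_sel)
    then show ?case using f n1[of f] by (simp add: ev cs del: enr_sel component_sel)
  next
    case (3 x)
    then obtain a where a: "x = code2 elts a" "a \<in> cell S.E" by blast
    have "s1 S.E (s2 S.E a) \<in> ob S.E" "t1 S.E (s2 S.E a) \<in> ob S.E" using a by (simp_all del: enr_sel)
    then show ?case using a n2[of a] by (simp add: ev cs del: enr_sel component_sel)
  qed
  then show ?thesis
    using Enr_mor[OF m(1)] Enr_mor[OF m(2)] Enr2_eval(2)[OF t] by (simp add: cell_TwoCAT del: enr_sel)
qed

lemma component_ide:
  assumes F: "F \<in> mor (PsDBL elts U2)" and X: "X \<in> ob (EN (asrc F))"
  shows "component (i2 (PsDBL elts U2) F) X = i1 (EN (atgt F)) (push_ecat (Vf F) X)"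
proof -
  interpret F: lax_functor "asrc F" "atgt F" "amap F" using F by (intro lax_functor_PsDBL1) simp
  interpret X: enr_cat "asrc F" X using X by unfold_locales simp
  have c: "i2 (PsDBL elts U2) F \<in> cell (PsDBL elts U2)" using two_cat_simps(7)[OF two_category_PsDBL F] .
  show ?thesis unfolding enr_sel
  proof (rule F.enr1_eqI[where elts=elts and ?U1.0=U1])
    show "component (i2 (PsDBL elts U2) F) X \<in> arr (enr1 elts U1 F.A)" using component_mor[OF c, of X U1] X by simp
    show "ide (enr1 elts U1 F.A) (push_ecat F.V X) \<in> arr (enr1 elts U1 F.A)"
      using cat_simps(3)[OF F.category_enr1 F.push_ecat_ob[of X elts U1]] X by simp
  qed (simp_all add: F.name_i1)
qed

lemma component_vcomp:
  assumes t: "t \<in> cell (PsDBL elts U2)" and s: "s \<in> cell (PsDBL elts U2)" and st: "asrc s = atgt t"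
    and X: "X \<in> ob (EN (asrc (asrc t)))"
  shows "component (c2 (PsDBL elts U2) s t) X = c1 (EN (atgt (asrc t))) (component s X) (component t X)"
proof -
  let ?C = "asrc (asrc t)" and ?D = "atgt (asrc t)"
  note tt = PsDBL_cellD[OF t]
  interpret F: lax_functor ?C ?D "amap (asrc t)" by fact
  interpret X: enr_cat ?C X using X by unfold_locales simp
  have c: "c2 (PsDBL elts U2) s t \<in> cell (PsDBL elts U2)"
    by (rule cat_simps(6)[OF category_PsDBL2]) (use t s st in simp_all)
  have m [simp]: "component t X \<in> arr (enr1 elts U1 F.A)" "component s X \<in> arr (enr1 elts U1 F.A)"
    using component_mor[OF t, of X U1] component_mor[OF s, of X U1] X tt(3,4) st by simp_all
  show ?thesis unfolding enr_sel
  proof (rule F.enr1_eqI[where elts=elts and ?U1.0=U1])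
    show "component (c2 (PsDBL elts U2) s t) X \<in> arr (enr1 elts U1 F.A)" using component_mor[OF c, of X U1] X by simp
    show "cmp (enr1 elts U1 F.A) (component s X) (component t X) \<in> arr (enr1 elts U1 F.A)"
      by (rule cat_simps(6)) (simp_all add: st)
  qed (simp_all add: F.enr_names st tt(3,4))
qed

lemma component_hcomp:
  assumes t: "t \<in> cell (PsDBL elts U2)" and s: "s \<in> cell (PsDBL elts U2)" and st: "asrc (asrc s) = atgt (asrc t)"
    and X: "X \<in> ob (EN (asrc (asrc t)))"
  shows "component (hcmp (PsDBL elts U2) s t) X =
    c1 (EN (atgt (asrc s))) (component s (push_ecat (vdbl_fun_of (asrc (asrc t)) (atgt (asrc t)) (amap (atgt t))) X))
      (push_efun (vdbl_fun_of (atgt (asrc t)) (atgt (asrc s)) (amap (asrc s))) (component t X))"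
proof -
  let ?B = "asrc (asrc t)" and ?C = "atgt (asrc t)" and ?D = "atgt (asrc s)"
  note tt = PsDBL_cellD[OF t] and ss = PsDBL_cellD[OF s]
  interpret F: lax_functor ?B ?C "amap (asrc t)" by fact
  interpret F': lax_functor ?B ?C "amap (atgt t)" by fact
  interpret G: lax_functor ?C ?D "amap (asrc s)" using ss(1) st by simp
  interpret G': lax_functor ?C ?D "amap (atgt s)" using ss(2) st by simp
  interpret X: enr_cat ?B X using X by unfold_locales simp
  have c: "hcmp (PsDBL elts U2) s t \<in> cell (PsDBL elts U2)"
    using two_cat_simps(12)[OF two_category_PsDBL s t] st by simp
  have o: "push_ecat F'.V X \<in> ob (EN ?C)" using F'.push_ecat_ob[of X elts U1] X by simp
  have m [simp]: "component t X \<in> arr (enr1 elts U1 F.A)" "component s (push_ecat F'.V X) \<in> arr (enr1 elts U1 G.A)"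
    using component_mor[OF t, of X U1] component_mor[OF s, of "push_ecat F'.V X" U1] X st o by simp_all
  note [simp] = vertical_transformationD(4-8)[OF tt(5) F.pd]
  note p = push_comp_ecat[OF tt(1) G.lax_functor_axioms X.enr_cat_axioms] push_comp_ecat[OF tt(2) G'.lax_functor_axioms X.enr_cat_axioms]
  show ?thesis unfolding enr_sel
  proof (rule G.enr1_eqI[where elts=elts and ?U1.0=U1])
    show "component (hcmp (PsDBL elts U2) s t) X \<in> arr (enr1 elts U1 G.A)" using component_mor[OF c, of X U1] X by simp
    show "cmp (enr1 elts U1 G.A) (component s (push_ecat F'.V X)) (push_efun G.V (component t X)) \<in> arr (enr1 elts U1 G.A)"
      by (rule cat_simps(6)) (simp_all add: st tt(3,4) G.push_efun_mor)
  qed (simp_all add: G.enr_names G.name_push_efun[where elts=elts and ?U1.0=U1] G.push_efun_mor st tt(3,4) ss(3,4) p)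
qed

lemma Enr_c1:
  assumes "G \<in> mor (PsDBL elts U2)" "F \<in> mor (PsDBL elts U2)" "asrc G = atgt F"
  shows "on1 (Enr elts U1) (c1 (PsDBL elts U2) G F) = c1 (TwoCAT elts U2) (on1 (Enr elts U1) G) (on1 (Enr elts U1) F)"
proof -
  let ?B = "asrc F" and ?C = "atgt F" and ?D = "atgt G"
  have e [simp]: "asrc G = atgt F" using assms by simp
  have l: "large_pseudo_double_category elts U2 ?B" "large_pseudo_double_category elts U2 ?C" "large_pseudo_double_category elts U2 ?D"
    using assms by (simp_all add: arr_PsDBL1)
  interpret B: large_pdc elts U1 U2 ?B by (intro large_pdcI l)
  interpret C: large_pdc elts U1 U2 ?C by (intro large_pdcI l)
  interpret F: lax_functor ?B ?C "amap F" using assms by (intro lax_functor_PsDBL1) simp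
  have lG: "lax_functor ?C ?D (amap G)" using assms lax_functor_PsDBL1[of G] by simp
  note lF = F.lax_functor_axioms
  have c: "c1 (PsDBL elts U2) G F \<in> mor (PsDBL elts U2)"
    using cat_simps(6)[OF category_PsDBL1, of G elts U2 F] assms by simp
  note ev = Enr1_eval[OF c, unfolded PsDBL_sel PsDBL1_sel arrow.sel]
  have evF: "X \<in> ob B.E \<Longrightarrow> push_ecat F.V X \<in> ob C.E" "f \<in> mor B.E \<Longrightarrow> push_efun F.V f \<in> mor C.E"
    "t \<in> cell B.E \<Longrightarrow> push_enat F.V t \<in> cell C.E" for X f t
    using two_functor_simps(3,4,9)[OF F.two_functor_push[of elts U1]] by (simp_all del: enr_sel)
  have evG: "X \<in> ob C.E \<Longrightarrow> on0 (amap (on1 (Enr elts U1) G)) (code0 elts X) = code0 elts (push_ecat (vdbl_fun_of ?C ?D (amap G)) X)"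
    "f \<in> mor C.E \<Longrightarrow> on1 (amap (on1 (Enr elts U1) G)) (code1 elts f) = code1 elts (push_efun (vdbl_fun_of ?C ?D (amap G)) f)"
    "t \<in> cell C.E \<Longrightarrow> on2 (amap (on1 (Enr elts U1) G)) (code2 elts t) = code2 elts (push_enat (vdbl_fun_of ?C ?D (amap G)) t)"
    for X f t using Enr1_eval[OF assms(1)] by simp_all
  have p: "X \<in> ob B.E \<Longrightarrow> push_ecat (vdbl_fun_of ?B ?D (comp_lax_fun ?B ?D (amap G) (amap F))) X = push_ecat (vdbl_fun_of ?C ?D (amap G)) (push_ecat F.V X)"
    "f \<in> mor B.E \<Longrightarrow> push_efun (vdbl_fun_of ?B ?D (comp_lax_fun ?B ?D (amap G) (amap F))) f = push_efun (vdbl_fun_of ?C ?D (amap G)) (push_efun F.V f)"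
    "t \<in> cell B.E \<Longrightarrow> push_enat (vdbl_fun_of ?B ?D (comp_lax_fun ?B ?D (amap G) (amap F))) t = push_enat (vdbl_fun_of ?C ?D (amap G)) (push_enat F.V t)"
    for X f t
    by (rule push_comp_ecat[OF lF lG], use B.ob_E[of X] in blast)
      (rule push_comp_efun[OF lF lG, where elts=elts and ?U1.0=U1] push_comp_enat[OF lF lG, where elts=elts and ?U1.0=U1]; simp)+
  have "amap (on1 (Enr elts U1) (c1 (PsDBL elts U2) G F)) =
    restrict_two_fun B.Co.K (comp_two_fun (amap (on1 (Enr elts U1) G)) (amap (on1 (Enr elts U1) F)))"
    by (rule two_fun_eqI[where K=B.Co.K])
      (use ev(4) in \<open>auto simp: ev ext_restrict p Enr1_eval[OF assms(2)] evG evF simp del: enr_sel\<close>)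
  then show ?thesis by (intro arrow.expand) (simp del: enr_sel)
qed

lemma two_functor_Enr: "two_functor (PsDBL elts U2) (TwoCAT elts U2) (Enr elts U1)"
proof (rule two_functorI, goal_cases)
  case 1 then show ?case by (rule two_category_PsDBL)
next
  case 2 then show ?case by (rule two_category_TwoCAT)
next
  case (3 D)
  then interpret large_pdc elts U1 U2 D by (intro large_pdcI) simp
  show ?case using large_Enr0 by (simp del: enr_sel)
next
  case (4 F) then show ?case using Enr_mor by (simp del: enr_sel)
next
  case (5 D)
  then interpret large_pdc elts U1 U2 D by (intro large_pdcI) simp
  have i: "i1 (PsDBL elts U2) D \<in> mor (PsDBL elts U2)"
    using cat_simps(3)[OF category_PsDBL1, of D elts U2] large by simp
  have o: "push_ecat (vdbl_fun_of D D (id_lax_fun D)) X = X" if "X \<in> ob E" for X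
    by (rule push_id_ecat[OF pd]) (use ob_E[OF that] in simp_all)
  note ev = Enr1_eval[OF i, unfolded PsDBL_sel PsDBL1_sel arrow.sel]
  have "amap (on1 (Enr elts U1) (i1 (PsDBL elts U2) D)) = restrict_two_fun Co.K id_two_fun"
    by (rule two_fun_eqI[where K=Co.K])
      (use ev(4) in \<open>auto simp: ev ext_restrict o push_id_efun[OF pd] push_id_enat[OF pd] simp del: enr_sel\<close>,
       simp_all add: push_id_efun[OF pd, of _ elts U1] push_id_enat[OF pd, of _ elts U1])
  then show ?case by (intro arrow.expand) (simp del: enr_sel)
next
  case (6 G F) then show ?case by (intro Enr_c1) simp_all
next
  case (7 t) then show ?case using Enr_cell by (simp del: enr_sel)
next
  case (8 F)
  have l: "large_pseudo_double_category elts U2 (asrc F)" "large_pseudo_double_category elts U2 (atgt F)"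
    using 8 by (simp_all add: arr_PsDBL1)
  interpret S: large_pdc elts U1 U2 "asrc F" by (intro large_pdcI l)
  interpret T: large_pdc elts U1 U2 "atgt F" by (intro large_pdcI l)
  interpret F: lax_functor "asrc F" "atgt F" "amap F" using 8 by (intro lax_functor_PsDBL1) simp
  let ?t = "i2 (PsDBL elts U2) F"
  have c: "?t \<in> cell (PsDBL elts U2)" using two_cat_simps(7)[OF two_category_PsDBL 8] .
  have st [simp]: "asrc ?t = F" "atgt ?t = F" by simp_all
  note ev = Enr2_eval[OF c, unfolded st]
  have p: "X \<in> ob S.E \<Longrightarrow> push_ecat F.V X \<in> ob T.E" for X
    using two_functor_simps(3)[OF F.two_functor_push[of elts U1]] by (simp del: enr_sel)
  have "amap (on2 (Enr elts U1) ?t) = (\<lambda>x\<in>ob S.Co.K. i1 T.Co.K (on0 (amap (on1 (Enr elts U1) F)) x))"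
    by (rule extensionalityI[OF ev(2)[unfolded st]])
      (auto simp: ev component_ide[OF 8] Enr1_eval[OF 8] p simp del: enr_sel PsDBL_sel(5))
  then show ?case by (intro arrow.expand) (simp del: enr_sel)
next
  case (9 s t)
  let ?C = "asrc (asrc t)" and ?D = "atgt (asrc t)"
  have e [simp]: "asrc s = atgt t" using 9 by simp
  have tt: "asrc (atgt t) = ?C" "atgt (atgt t) = ?D" using PsDBL_cellD[OF 9(2)] by simp_all
  have l: "large_pseudo_double_category elts U2 ?C" "large_pseudo_double_category elts U2 ?D"
    using 9(2) by (simp_all add: cell_PsDBL arr_PsDBL1)
  interpret S: large_pdc elts U1 U2 ?C by (intro large_pdcI l)
  interpret T: large_pdc elts U1 U2 ?D by (intro large_pdcI l)
  let ?st = "c2 (PsDBL elts U2) s t"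
  have c: "?st \<in> cell (PsDBL elts U2)" by (rule cat_simps(6)[OF category_PsDBL2]) (use 9 in simp_all)
  have st [simp]: "asrc ?st = asrc t" by simp
  have m: "X \<in> ob S.E \<Longrightarrow> component t X \<in> mor T.E" "X \<in> ob S.E \<Longrightarrow> component s X \<in> mor T.E"
    "s1 T.E (component s X) = t1 T.E (component t X)" for X
    using component_mor[OF 9(2), of X U1] component_mor[OF 9(1), of X U1] tt by simp_all
  have evs: "X \<in> ob S.E \<Longrightarrow> amap (on2 (Enr elts U1) s) (code0 elts X) = code1 elts (component s X)" for X
    using Enr2_eval(1)[OF 9(1), of X] tt by simp
  have "amap (on2 (Enr elts U1) ?st) = (\<lambda>x\<in>ob S.Co.K. c1 T.Co.K (amap (on2 (Enr elts U1) s) x) (amap (on2 (Enr elts U1) t) x))"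
    by (rule extensionalityI[OF Enr2_eval(2)[OF c, unfolded st]])
      (auto simp: Enr2_eval(1)[OF c, unfolded st] Enr2_eval(1)[OF 9(2)] evs m component_vcomp[OF 9(2,1) e] simp del: enr_sel component_sel PsDBL_sel(6))
  then show ?case by (intro arrow.expand) (simp del: enr_sel)
next
  case (10 s t)
  let ?B = "asrc (asrc t)" and ?C = "atgt (asrc t)" and ?D = "atgt (asrc s)"
  have e [simp]: "asrc (asrc s) = ?C" using 10 by simp
  note t = PsDBL_cellD[OF 10(2)] and s = PsDBL_cellD[OF 10(1)]
  have m: "asrc t \<in> mor (PsDBL elts U2)" "atgt t \<in> mor (PsDBL elts U2)" "asrc s \<in> mor (PsDBL elts U2)" "atgt s \<in> mor (PsDBL elts U2)"
    using 10 by (simp_all add: cell_PsDBL)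
  have l: "large_pseudo_double_category elts U2 ?B" "large_pseudo_double_category elts U2 ?C" "large_pseudo_double_category elts U2 ?D"
    using m by (simp_all add: arr_PsDBL1)
  interpret B: large_pdc elts U1 U2 ?B by (intro large_pdcI l)
  interpret C: large_pdc elts U1 U2 ?C by (intro large_pdcI l)
  interpret D: large_pdc elts U1 U2 ?D by (intro large_pdcI l)
  interpret F': lax_functor ?B ?C "amap (atgt t)" using t by simp
  interpret G: lax_functor ?C ?D "amap (asrc s)" using s by simp
  interpret G': lax_functor ?C ?D "amap (atgt s)" using s by simp
  let ?st = "hcmp (PsDBL elts U2) s t"
  have c: "?st \<in> cell (PsDBL elts U2)" using two_cat_simps(12)[OF two_category_PsDBL 10(1,2)] 10(3) by simp
  have st: "asrc (asrc ?st) = ?B" by simp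
  have p: "X \<in> ob B.E \<Longrightarrow> push_ecat F'.V X \<in> ob C.E" "f \<in> mor C.E \<Longrightarrow> push_efun G.V f \<in> mor D.E"
    "f \<in> mor C.E \<Longrightarrow> t1 D.E (push_efun G.V f) = push_ecat G.V (t1 C.E f)" for X f
    using two_functor_simps(3)[OF F'.two_functor_push[of elts U1]] two_functor_simps(4,6)[OF G.two_functor_push[of elts U1]]
    by (simp_all del: enr_sel)
  have mm: "X \<in> ob B.E \<Longrightarrow> component t X \<in> mor C.E" "t1 C.E (component t X) = push_ecat F'.V X"
    "Y \<in> ob C.E \<Longrightarrow> component s Y \<in> mor D.E" "s1 D.E (component s Y) = push_ecat G.V Y" for X Y
    using component_mor[OF 10(2), of X U1] component_mor[OF 10(1), of Y U1] t by simp_all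
  have evs: "Y \<in> ob C.E \<Longrightarrow> amap (on2 (Enr elts U1) s) (code0 elts Y) = code1 elts (component s Y)"
    "f \<in> mor C.E \<Longrightarrow> on1 (amap (on1 (Enr elts U1) (asrc s))) (code1 elts f) = code1 elts (push_efun G.V f)"
    "X \<in> ob B.E \<Longrightarrow> on0 (amap (on1 (Enr elts U1) (atgt t))) (code0 elts X) = code0 elts (push_ecat F'.V X)" for X Y f
    using Enr2_eval(1)[OF 10(1), of Y] Enr1_eval(2)[OF m(3), of f] Enr1_eval(1)[OF m(2), of X] t by simp_all
  have "amap (on2 (Enr elts U1) ?st) = (\<lambda>x\<in>ob B.Co.K. c1 D.Co.K (amap (on2 (Enr elts U1) s) (on0 (amap (on1 (Enr elts U1) (atgt t))) x))
     (on1 (amap (on1 (Enr elts U1) (asrc s))) (amap (on2 (Enr elts U1) t) x)))"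
    by (rule extensionalityI[OF Enr2_eval(2)[OF c, unfolded st]])
      (auto simp: Enr2_eval(1)[OF c, unfolded st] Enr2_eval(1)[OF 10(2)] evs p mm component_hcomp[OF 10(2,1) e] simp del: enr_sel component_sel PsDBL_sel(7))
  moreover have "on1 (Enr elts U1) (c1 (PsDBL elts U2) (asrc s) (asrc t)) = c1 (TwoCAT elts U2) (on1 (Enr elts U1) (asrc s)) (on1 (Enr elts U1) (asrc t))"
    "on1 (Enr elts U1) (c1 (PsDBL elts U2) (atgt s) (atgt t)) = c1 (TwoCAT elts U2) (on1 (Enr elts U1) (atgt s)) (on1 (Enr elts U1) (atgt t))"
    by (rule Enr_c1; use m s t in simp)+
  ultimately show ?case by (intro arrow.expand) (simp del: enr_sel PsDBL1_sel(5) TwoCAT1_sel(5))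
qed

end


section \<open>The terminal pseudo double category\<close>

context
  fixes z :: 'v
begin

definition one_cat :: "('v, 'v) cat" where
  "one_cat = \<lparr>obj = {z}, arr = {z}, src = (\<lambda>x\<in>{z}. z), tgt = (\<lambda>x\<in>{z}. z), ide = (\<lambda>x\<in>{z}. z),
     cmp = (\<lambda>g f. if g = z \<and> f = z then z else undefined)\<rparr>"

definition one_dbl :: "'v psdbl" where
  "one_dbl = \<lparr>vcat = one_cat, ccat = one_cat, hsrc = (\<lambda>x\<in>{z}. z), htgt = (\<lambda>x\<in>{z}. z),
     cleft = (\<lambda>x\<in>{z}. z), cright = (\<lambda>x\<in>{z}. z), hid = (\<lambda>x\<in>{z}. z), chid = (\<lambda>x\<in>{z}. z),
     hcomp = (\<lambda>g d. if g = z \<and> d = z then z else undefined), chcomp = (\<lambda>g d. if g = z \<and> d = z then z else undefined),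
     hassoc = (\<lambda>g d e. if g = z \<and> d = z \<and> e = z then z else undefined), hlunit = (\<lambda>x\<in>{z}. z), hrunit = (\<lambda>x\<in>{z}. z)\<rparr>"

definition bang :: "'v psdbl \<Rightarrow> 'v lax_fun" where
  "bang D = \<lparr>lob = (\<lambda>a\<in>objs D. z), lver = (\<lambda>u\<in>vers D. z), lhor = (\<lambda>g\<in>hors D. z), lcell = (\<lambda>x\<in>cells D. z),
     lax_unit = (\<lambda>a\<in>objs D. z), lax_comp = (\<lambda>g d. if hcomposable D g d then z else undefined)\<rparr>"

lemma one_sel [simp]:
  "objs one_dbl = {z}" "vers one_dbl = {z}" "hors one_dbl = {z}" "cells one_dbl = {z}"
  "vsrc one_dbl z = z" "vtgt one_dbl z = z" "vid one_dbl z = z" "vcmp one_dbl z z = z"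
  "ctop one_dbl z = z" "cbot one_dbl z = z" "cid one_dbl z = z" "cmp (ccat one_dbl) z z = z"
  "hsrc one_dbl z = z" "htgt one_dbl z = z" "cleft one_dbl z = z" "cright one_dbl z = z" "hid one_dbl z = z" "chid one_dbl z = z"
  "hcomp one_dbl z z = z" "chcomp one_dbl z z = z" "hassoc one_dbl z z z = z" "hlunit one_dbl z = z" "hrunit one_dbl z = z"
  by (simp_all add: one_dbl_def one_cat_def)

lemma pseudo_one: "pseudo_double_category one_dbl"
  unfolding pseudo_double_category_def category_def cat_functor_def composable_def hcomposable_def chcomposable_def
    cell_over_def globular_iso_def globular_cell_def inverses_def
  by simp

lemma large_one:
  assumes "of_size elts U2 {z}" shows "large_pseudo_double_category elts U2 one_dbl"
proof -
  have "ext_cat one_cat" by (auto simp: ext_cat_def one_cat_def composable_def)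
  moreover have "cat_of_size elts U2 one_cat" using assms by (simp add: cat_of_size_def one_cat_def)
  moreover have "vcat one_dbl = one_cat" "ccat one_dbl = one_cat" by (simp_all add: one_dbl_def)
  ultimately show ?thesis using pseudo_one
    unfolding large_pseudo_double_category_def hcomposable_def chcomposable_def
    by (auto simp: one_dbl_def one_cat_def)
qed

lemma bang_lax:
  assumes [simp]: "pseudo_double_category D" shows "lax_double_functor D one_dbl (bang D)"
proof -
  interpret pdc D by unfold_locales simp
  show ?thesis
    by (rule lax_double_functorI) (simp_all add: pseudo_one bang_def cell_over_def hcomposable_def)
qed

lemma ext_bang: "ext_lax_fun D (bang D)"
  by (simp add: ext_lax_fun_def bang_def)

lemma lax_to_one:
  assumes F: "lax_functor D one_dbl F" "ext_lax_fun D F" shows "F = bang D"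
proof -
  interpret F: lax_functor D one_dbl F by (rule F(1))
  show ?thesis
    by (rule lax_fun_eqI[OF F(2) ext_bang])
      (use F.F_simps(1,2,7,10,17,22) in \<open>simp_all add: bang_def hcomposable_def\<close>)
qed

lemma terminal_one:
  assumes "of_size elts U2 {z}" shows "terminal_object (PsDBL elts U2) one_dbl"
proof -
  note l = large_one[OF assms]
  have F: "Arrow D (bang D) one_dbl \<in> arr (PsDBL1 elts U2)" if "large_pseudo_double_category elts U2 D" for D
    using that l by (simp add: arr_PsDBL1 bang_lax ext_bang)
  have uF: "f = Arrow D (bang D) one_dbl" if "f \<in> arr (PsDBL1 elts U2)" "asrc f = D" "atgt f = one_dbl" for f D
    using that lax_to_one[of D "amap f"] lax_functor_PsDBL1[of f elts U2] by (intro arrow.expand) (auto simp: arr_PsDBL1)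
  have T: "\<exists>!a. a \<in> cell (PsDBL elts U2) \<and> src (hcat (PsDBL elts U2)) a = D \<and> tgt (hcat (PsDBL elts U2)) a = one_dbl"
    if D: "large_pseudo_double_category elts U2 D" for D
  proof
    let ?i = "i2 (PsDBL elts U2) (Arrow D (bang D) one_dbl)"
    show i: "?i \<in> cell (PsDBL elts U2) \<and> src (hcat (PsDBL elts U2)) ?i = D \<and> tgt (hcat (PsDBL elts U2)) ?i = one_dbl"
      using two_cat_simps(7)[OF two_category_PsDBL, of "Arrow D (bang D) one_dbl" elts U2] F[OF D] by simp
    fix a assume a: "a \<in> cell (PsDBL elts U2) \<and> src (hcat (PsDBL elts U2)) a = D \<and> tgt (hcat (PsDBL elts U2)) a = one_dbl"
    note t = PsDBL_cellD[OF conjunct1[OF a]]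
    have st: "asrc a = Arrow D (bang D) one_dbl" "atgt a = Arrow D (bang D) one_dbl"
      using a t(3,4) by (auto intro!: uF simp: cell_PsDBL)
    have "amap a = amap ?i"
    proof (rule vert_trans_eqI[where D=D])
      show "ext_vert_trans D (amap a)" using a by (auto simp: cell_PsDBL)
      show "ext_vert_trans D (amap ?i)" by (simp add: ext_vert_trans_restrict)
    qed (use vertical_transformationD(1,4)[OF t(5)] st in \<open>simp_all add: pseudo_one bang_def\<close>)
    then show "a = ?i" using st by (intro arrow.expand) simp
  qed
  have "\<exists>!f. f \<in> arr (PsDBL1 elts U2) \<and> asrc f = D \<and> atgt f = one_dbl" if "large_pseudo_double_category elts U2 D" for D
  proof (rule ex1I[of _ "Arrow D (bang D) one_dbl"])
    show "Arrow D (bang D) one_dbl \<in> arr (PsDBL1 elts U2) \<and> asrc (Arrow D (bang D) one_dbl) = D \<and> atgt (Arrow D (bang D) one_dbl) = one_dbl"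
      using F[OF that] by simp
    fix f assume "f \<in> arr (PsDBL1 elts U2) \<and> asrc f = D \<and> atgt f = one_dbl"
    then show "f = Arrow D (bang D) one_dbl" using uF[of f D] by blast
  qed
  then show ?thesis
    unfolding terminal_object_def using l T by (simp del: hcat_sel)
qed

end

section \<open>The double category of elements\<close>

text \<open>The data of a functor from the underlying category of a large 2-category to small sets.\<close>

locale elements = two_universes elts U1 U2 for elts :: "'v \<Rightarrow> 'v set" and U1 U2 +
  fixes X :: "'v ltwo_cat" and S :: "'v \<Rightarrow> 'v set" and act :: "'v \<Rightarrow> 'v \<Rightarrow> 'v"
  assumes X: "large_two_category elts U2 X"
    and S: "x \<in> ob X \<Longrightarrow> of_size elts U1 (S x)"
    and act [simp]: "f \<in> mor X \<Longrightarrow> c \<in> S (s1 X f) \<Longrightarrow> act f c \<in> S (t1 X f)"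
    and act_id [simp]: "x \<in> ob X \<Longrightarrow> c \<in> S x \<Longrightarrow> act (i1 X x) c = c"
    and act_comp [simp]: "g \<in> mor X \<Longrightarrow> f \<in> mor X \<Longrightarrow> s1 X g = t1 X f \<Longrightarrow> c \<in> S (s1 X f) \<Longrightarrow>
      act (c1 X g f) c = act g (act f c)"
begin

lemma two_category_X [simp]: "two_category X"
  using X by simp

lemma X_in: "x \<in> ob X \<Longrightarrow> x \<in> elts U2" "f \<in> mor X \<Longrightarrow> f \<in> elts U2" "a \<in> cell X \<Longrightarrow> a \<in> elts U2"
  "x \<in> ob X \<Longrightarrow> c \<in> S x \<Longrightarrow> c \<in> elts U2"
  using X V2.of_size_elems unfolding large_two_category_def cat_of_size_def
  by (blast, blast, blast, metis S V2.of_size_elems small_large)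

abbreviation "P2 \<equiv> vpair elts"
abbreviation "P3 x c d \<equiv> vpair elts x (vpair elts c d)"
abbreviation "p1 \<equiv> V2.vfst"
abbreviation "p2 v \<equiv> V2.vfst (V2.vsnd v)"
abbreviation "p3 v \<equiv> V2.vsnd (V2.vsnd v)"

definition "FO = {P2 x c | x c. x \<in> ob X \<and> c \<in> S x}"
definition "FV = {P2 f c | f c. f \<in> mor X \<and> c \<in> S (s1 X f)}"
definition "FH = {P3 x c d | x c d. x \<in> ob X \<and> c \<in> S x \<and> d \<in> S x}"
definition "FC = {P3 a c d | a c d. a \<in> cell X \<and> c \<in> S (s1 X (s2 X a)) \<and> d \<in> S (s1 X (s2 X a))}"

definition Fvcat :: "('v, 'v) cat" where
  "Fvcat = \<lparr>obj = FO, arr = FV, src = (\<lambda>v\<in>FV. P2 (s1 X (p1 v)) (V2.vsnd v)),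
     tgt = (\<lambda>v\<in>FV. P2 (t1 X (p1 v)) (act (p1 v) (V2.vsnd v))), ide = (\<lambda>y\<in>FO. P2 (i1 X (p1 y)) (V2.vsnd y)),
     cmp = (\<lambda>w v. if w \<in> FV \<and> v \<in> FV \<and> P2 (s1 X (p1 w)) (V2.vsnd w) = P2 (t1 X (p1 v)) (act (p1 v) (V2.vsnd v))
       then P2 (c1 X (p1 w) (p1 v)) (V2.vsnd v) else undefined)\<rparr>"

text \<open>Cells over 2-cells \<open>a\<close>: their vertical composition is the horizontal composition of \<open>X\<close>, and
  their horizontal composition is the vertical composition of \<open>X\<close>.\<close>

definition Fccat :: "('v, 'v) cat" where
  "Fccat = \<lparr>obj = FH, arr = FC, src = (\<lambda>a\<in>FC. P3 (s1 X (s2 X (p1 a))) (p2 a) (p3 a)),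
     tgt = (\<lambda>a\<in>FC. P3 (t1 X (s2 X (p1 a))) (act (s2 X (p1 a)) (p2 a)) (act (t2 X (p1 a)) (p3 a))),
     ide = (\<lambda>g\<in>FH. P3 (i2 X (i1 X (p1 g))) (p2 g) (p3 g)),
     cmp = (\<lambda>b a. if b \<in> FC \<and> a \<in> FC \<and> P3 (s1 X (s2 X (p1 b))) (p2 b) (p3 b) =
           P3 (t1 X (s2 X (p1 a))) (act (s2 X (p1 a)) (p2 a)) (act (t2 X (p1 a)) (p3 a))
       then P3 (hcmp X (p1 b) (p1 a)) (p2 a) (p3 a) else undefined)\<rparr>"

definition FX :: "'v psdbl" where
  "FX = \<lparr>vcat = Fvcat, ccat = Fccat, hsrc = (\<lambda>g\<in>FH. P2 (p1 g) (p2 g)), htgt = (\<lambda>g\<in>FH. P2 (p1 g) (p3 g)),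
     cleft = (\<lambda>a\<in>FC. P2 (s2 X (p1 a)) (p2 a)), cright = (\<lambda>a\<in>FC. P2 (t2 X (p1 a)) (p3 a)),
     hid = (\<lambda>y\<in>FO. P3 (p1 y) (V2.vsnd y) (V2.vsnd y)), chid = (\<lambda>v\<in>FV. P3 (i2 X (p1 v)) (V2.vsnd v) (V2.vsnd v)),
     hcomp = (\<lambda>g d. if g \<in> FH \<and> d \<in> FH \<and> P2 (p1 g) (p3 g) = P2 (p1 d) (p2 d) then P3 (p1 g) (p2 g) (p3 d) else undefined),
     chcomp = (\<lambda>a b. if a \<in> FC \<and> b \<in> FC \<and> P2 (t2 X (p1 a)) (p3 a) = P2 (s2 X (p1 b)) (p2 b)
        then P3 (c2 X (p1 b) (p1 a)) (p2 a) (p3 b) else undefined),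
     hassoc = (\<lambda>g d e. if (g \<in> FH \<and> d \<in> FH \<and> P2 (p1 g) (p3 g) = P2 (p1 d) (p2 d)) \<and> (d \<in> FH \<and> e \<in> FH \<and> P2 (p1 d) (p3 d) = P2 (p1 e) (p2 e))
        then P3 (i2 X (i1 X (p1 g))) (p2 g) (p3 e) else undefined),
     hlunit = (\<lambda>g\<in>FH. P3 (i2 X (i1 X (p1 g))) (p2 g) (p3 g)), hrunit = (\<lambda>g\<in>FH. P3 (i2 X (i1 X (p1 g))) (p2 g) (p3 g))\<rparr>"

lemma FX_sets: "objs FX = FO" "vers FX = FV" "hors FX = FH" "cells FX = FC"
  by (simp_all add: FX_def Fvcat_def Fccat_def)

lemma P_in [simp]:
  "x \<in> ob X \<Longrightarrow> c \<in> S x \<Longrightarrow> P2 x c \<in> objs FX" "f \<in> mor X \<Longrightarrow> c \<in> S (s1 X f) \<Longrightarrow> P2 f c \<in> vers FX"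
  "x \<in> ob X \<Longrightarrow> c \<in> S x \<Longrightarrow> d \<in> S x \<Longrightarrow> P3 x c d \<in> hors FX"
  "a \<in> cell X \<Longrightarrow> c \<in> S (s1 X (s2 X a)) \<Longrightarrow> d \<in> S (s1 X (s2 X a)) \<Longrightarrow> P3 a c d \<in> cells FX"
  unfolding FX_sets FO_def FV_def FH_def FC_def by blast+

lemma objsE: assumes "v \<in> objs FX" obtains x c where "v = P2 x c" "x \<in> ob X" "c \<in> S x"
  using assms unfolding FX_sets FO_def by blast

lemma versE: assumes "v \<in> vers FX" obtains f c where "v = P2 f c" "f \<in> mor X" "c \<in> S (s1 X f)"
  using assms unfolding FX_sets FV_def by blast

lemma horsE: assumes "v \<in> hors FX" obtains x c d where "v = P3 x c d" "x \<in> ob X" "c \<in> S x" "d \<in> S x"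
  using assms unfolding FX_sets FH_def by blast

lemma cellsE: assumes "v \<in> cells FX"
  obtains a c d where "v = P3 a c d" "a \<in> cell X" "c \<in> S (s1 X (s2 X a))" "d \<in> S (s1 X (s2 X a))"
  using assms unfolding FX_sets FC_def by blast

lemma Fin [simp]: "f \<in> mor X \<Longrightarrow> c \<in> S (s1 X f) \<Longrightarrow> c \<in> elts U2" "a \<in> cell X \<Longrightarrow> c \<in> S (s1 X (s2 X a)) \<Longrightarrow> c \<in> elts U2"
  "f \<in> mor X \<Longrightarrow> c \<in> S (t1 X f) \<Longrightarrow> c \<in> elts U2"
  using X_in(4) by (meson cat_simps two_cat_simps two_category_X)+

lemma act2 [simp]:
  "a \<in> cell X \<Longrightarrow> c \<in> S (s1 X (s2 X a)) \<Longrightarrow> act (s2 X a) c \<in> S (t1 X (s2 X a))"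
  "a \<in> cell X \<Longrightarrow> c \<in> S (s1 X (s2 X a)) \<Longrightarrow> act (t2 X a) c \<in> S (t1 X (s2 X a))"
  using act[of "s2 X a" c] act[of "t2 X a" c] by simp_all

lemma Fact_in [simp]: "f \<in> mor X \<Longrightarrow> c \<in> S (s1 X f) \<Longrightarrow> act f c \<in> elts U2"
  "a \<in> cell X \<Longrightarrow> c \<in> S (s1 X (s2 X a)) \<Longrightarrow> act (t2 X a) c \<in> elts U2"
  using act[of f c] act2[of a c] Fin(3)[of f] Fin(3)[of "s2 X a"] by simp_all

lemma P_eq [simp]:
  "x \<in> elts U2 \<Longrightarrow> c \<in> elts U2 \<Longrightarrow> x' \<in> elts U2 \<Longrightarrow> c' \<in> elts U2 \<Longrightarrow> P2 x c = P2 x' c' \<longleftrightarrow> x = x' \<and> c = c'"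
  "x \<in> elts U2 \<Longrightarrow> c \<in> elts U2 \<Longrightarrow> d \<in> elts U2 \<Longrightarrow> x' \<in> elts U2 \<Longrightarrow> c' \<in> elts U2 \<Longrightarrow> d' \<in> elts U2 \<Longrightarrow>
    P3 x c d = P3 x' c' d' \<longleftrightarrow> x = x' \<and> c = c' \<and> d = d'"
  by (simp_all add: V2.vpair_inject V2.vpair_in)

declare X_in [simp] V2.vpair_in [simp]

lemma Fv [simp]:
  "f \<in> mor X \<Longrightarrow> c \<in> S (s1 X f) \<Longrightarrow> vsrc FX (P2 f c) = P2 (s1 X f) c"
  "f \<in> mor X \<Longrightarrow> c \<in> S (s1 X f) \<Longrightarrow> vtgt FX (P2 f c) = P2 (t1 X f) (act f c)"
  "x \<in> ob X \<Longrightarrow> c \<in> S x \<Longrightarrow> vid FX (P2 x c) = P2 (i1 X x) c"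
  "g \<in> mor X \<Longrightarrow> f \<in> mor X \<Longrightarrow> s1 X g = t1 X f \<Longrightarrow> c \<in> S (s1 X f) \<Longrightarrow>
    vcmp FX (P2 g (act f c)) (P2 f c) = P2 (c1 X g f) c"
  using P_in(1)[of x c] P_in(2)[of f c] P_in(2)[of g "act f c"]
  unfolding FX_sets by (simp_all add: FX_def Fvcat_def)

lemma Fc [simp]:
  "a \<in> cell X \<Longrightarrow> c \<in> S (s1 X (s2 X a)) \<Longrightarrow> d \<in> S (s1 X (s2 X a)) \<Longrightarrow> ctop FX (P3 a c d) = P3 (s1 X (s2 X a)) c d"
  "a \<in> cell X \<Longrightarrow> c \<in> S (s1 X (s2 X a)) \<Longrightarrow> d \<in> S (s1 X (s2 X a)) \<Longrightarrow>
     cbot FX (P3 a c d) = P3 (t1 X (s2 X a)) (act (s2 X a) c) (act (t2 X a) d)"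
  "x \<in> ob X \<Longrightarrow> c \<in> S x \<Longrightarrow> d \<in> S x \<Longrightarrow> cid FX (P3 x c d) = P3 (i2 X (i1 X x)) c d"
  "b \<in> cell X \<Longrightarrow> a \<in> cell X \<Longrightarrow> s1 X (s2 X b) = t1 X (s2 X a) \<Longrightarrow> c \<in> S (s1 X (s2 X a)) \<Longrightarrow> d \<in> S (s1 X (s2 X a)) \<Longrightarrow>
     cmp (ccat FX) (P3 b (act (s2 X a) c) (act (t2 X a) d)) (P3 a c d) = P3 (hcmp X b a) c d"
  using P_in(3)[of x c d] P_in(4)[of a c d] P_in(4)[of b "act (s2 X a) c" "act (t2 X a) d"]
  unfolding FX_sets by (simp_all add: FX_def Fccat_def)

lemma F_cmp [simp]:
  "g \<in> mor X \<Longrightarrow> f \<in> mor X \<Longrightarrow> s1 X g = t1 X f \<Longrightarrow> c \<in> S (s1 X f) \<Longrightarrow> act f c = c' \<Longrightarrow>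
    vcmp FX (P2 g c') (P2 f c) = P2 (c1 X g f) c"
  "b \<in> cell X \<Longrightarrow> a \<in> cell X \<Longrightarrow> s1 X (s2 X b) = t1 X (s2 X a) \<Longrightarrow> c \<in> S (s1 X (s2 X a)) \<Longrightarrow> d \<in> S (s1 X (s2 X a)) \<Longrightarrow>
     act (s2 X a) c = c' \<Longrightarrow> act (t2 X a) d = d' \<Longrightarrow> cmp (ccat FX) (P3 b c' d') (P3 a c d) = P3 (hcmp X b a) c d"
  using Fv(4) Fc(4) by blast+

lemma Fh [simp]:
  "x \<in> ob X \<Longrightarrow> c \<in> S x \<Longrightarrow> d \<in> S x \<Longrightarrow> hsrc FX (P3 x c d) = P2 x c"
  "x \<in> ob X \<Longrightarrow> c \<in> S x \<Longrightarrow> d \<in> S x \<Longrightarrow> htgt FX (P3 x c d) = P2 x d"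
  "a \<in> cell X \<Longrightarrow> c \<in> S (s1 X (s2 X a)) \<Longrightarrow> d \<in> S (s1 X (s2 X a)) \<Longrightarrow> cleft FX (P3 a c d) = P2 (s2 X a) c"
  "a \<in> cell X \<Longrightarrow> c \<in> S (s1 X (s2 X a)) \<Longrightarrow> d \<in> S (s1 X (s2 X a)) \<Longrightarrow> cright FX (P3 a c d) = P2 (t2 X a) d"
  "x \<in> ob X \<Longrightarrow> c \<in> S x \<Longrightarrow> hid FX (P2 x c) = P3 x c c"
  "f \<in> mor X \<Longrightarrow> c \<in> S (s1 X f) \<Longrightarrow> chid FX (P2 f c) = P3 (i2 X f) c c"
  "x \<in> ob X \<Longrightarrow> c \<in> S x \<Longrightarrow> d \<in> S x \<Longrightarrow> e \<in> S x \<Longrightarrow> hcomp FX (P3 x c d) (P3 x d e) = P3 x c e"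
  "a \<in> cell X \<Longrightarrow> b \<in> cell X \<Longrightarrow> t2 X a = s2 X b \<Longrightarrow> c \<in> S (s1 X (s2 X b)) \<Longrightarrow> d \<in> S (s1 X (s2 X b)) \<Longrightarrow> e \<in> S (s1 X (s2 X b)) \<Longrightarrow>
    s1 X (s2 X a) = s1 X (s2 X b) \<Longrightarrow> chcomp FX (P3 a c d) (P3 b d e) = P3 (c2 X b a) c e"
  "x \<in> ob X \<Longrightarrow> c \<in> S x \<Longrightarrow> d \<in> S x \<Longrightarrow> e \<in> S x \<Longrightarrow> k \<in> S x \<Longrightarrow> hassoc FX (P3 x c d) (P3 x d e) (P3 x e k) = P3 (i2 X (i1 X x)) c k"
  "x \<in> ob X \<Longrightarrow> c \<in> S x \<Longrightarrow> d \<in> S x \<Longrightarrow> hlunit FX (P3 x c d) = P3 (i2 X (i1 X x)) c d"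
  "x \<in> ob X \<Longrightarrow> c \<in> S x \<Longrightarrow> d \<in> S x \<Longrightarrow> hrunit FX (P3 x c d) = P3 (i2 X (i1 X x)) c d"
  using P_in(1)[of x c] P_in(2)[of f c] P_in(3)[of x c d] P_in(3)[of x d e] P_in(3)[of x e k] P_in(4)[of a c d] P_in(4)[of b d e]
  unfolding FX_sets by (simp_all add: FX_def)

lemma s1_eq: "a \<in> cell X \<Longrightarrow> b \<in> cell X \<Longrightarrow> t2 X a = s2 X b \<Longrightarrow> s1 X (s2 X a) = s1 X (s2 X b)"
  "a \<in> cell X \<Longrightarrow> b \<in> cell X \<Longrightarrow> t2 X a = s2 X b \<Longrightarrow> t1 X (s2 X a) = t1 X (s2 X b)"
  by (metis two_cat_simps(10,11) two_category_X)+

lemma act3 [simp]: "a \<in> cell X \<Longrightarrow> b \<in> cell X \<Longrightarrow> t2 X a = s2 X b \<Longrightarrow> c \<in> S (s1 X (s2 X b)) \<Longrightarrow> act (s2 X a) c \<in> S (t1 X (s2 X b))"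
  using act2(1)[of a c] s1_eq[of a b] by simp

lemma iso_cid: "x \<in> ob X \<Longrightarrow> c \<in> S x \<Longrightarrow> d \<in> S x \<Longrightarrow> globular_iso FX (P3 (i2 X (i1 X x)) c d) (P3 x c d) (P3 x c d)"
  unfolding globular_iso_def globular_cell_def cell_over_def inverses_def composable_def
  by (auto intro!: exI[of _ "P3 (i2 X (i1 X x)) c d"])

lemma pseudo_FX: "pseudo_double_category FX"
proof -
  have 1: "category (vcat FX)"
    unfolding category_def composable_def by (auto elim!: objsE versE)
  have 2: "category (ccat FX)"
    unfolding category_def composable_def by (auto elim!: horsE cellsE)
  have 3: "cat_functor (ccat FX) (vcat FX) (hsrc FX) (cleft FX)" "cat_functor (ccat FX) (vcat FX) (htgt FX) (cright FX)"
    "cat_functor (vcat FX) (ccat FX) (hid FX) (chid FX)"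
    unfolding cat_functor_def composable_def by (auto elim!: horsE cellsE objsE versE)
  show ?thesis
    unfolding pseudo_double_category_def
  proof (intro conjI 1 2 3, goal_cases)
    case 1 show ?case by (auto elim!: objsE)
  next
    case 2 show ?case by (auto elim!: versE)
  next
    case 3 show ?case by (auto elim!: horsE simp: hcomposable_def)
  next
    case 4 show ?case by (auto elim!: cellsE simp: chcomposable_def cell_over_def s1_eq)
  next
    case 5 show ?case by (auto elim!: horsE simp: hcomposable_def)
  next
    case 6 show ?case by (auto elim!: cellsE simp: chcomposable_def composable_def s1_eq interchange)
  next
    case 7 show ?case by (auto elim!: horsE simp: hcomposable_def iso_cid)
  next
    case 8 show ?case by (auto elim!: horsE simp: iso_cid)
  next
    case 9 show ?case
    proof (intro allI impI)
      fix x y z assume "chcomposable FX x y \<and> chcomposable FX y z"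
      then have "x \<in> cells FX" "y \<in> cells FX" "z \<in> cells FX" and r: "cright FX x = cleft FX y" "cright FX y = cleft FX z"
        unfolding chcomposable_def by simp_all
      then obtain a c d a' c' d' b k l where x: "x = P3 a c d" "a \<in> cell X" "c \<in> S (s1 X (s2 X a))" "d \<in> S (s1 X (s2 X a))"
        and y: "y = P3 a' c' d'" "a' \<in> cell X" "c' \<in> S (s1 X (s2 X a'))" "d' \<in> S (s1 X (s2 X a'))"
        and z: "z = P3 b k l" "b \<in> cell X" "k \<in> S (s1 X (s2 X b))" "l \<in> S (s1 X (s2 X b))"
        by (elim cellsE)
      then have e: "t2 X a = s2 X a'" "c' = d" "t2 X a' = s2 X b" "k = d'" using r by simp_all
      have "s1 X (s2 X a) = s1 X (s2 X b)" "t1 X (s2 X a) = t1 X (s2 X b)" "s1 X (s2 X a') = s1 X (s2 X b)" "t1 X (s2 X a') = t1 X (s2 X b)"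
        using x y z e s1_eq by metis+
      then show "cmp (ccat FX) (hassoc FX (cbot FX x) (cbot FX y) (cbot FX z)) (chcomp FX (chcomp FX x y) z) =
        cmp (ccat FX) (chcomp FX x (chcomp FX y z)) (hassoc FX (ctop FX x) (ctop FX y) (ctop FX z))"
        using x y z e act2[of a c] act2[of a' d] act2[of b d'] act2[of b l] by simp
    qed
  next
    case 10 show ?case by (auto elim!: cellsE)
  next
    case 11 show ?case by (auto elim!: horsE simp: hcomposable_def)
  next
    case 12 show ?case by (auto elim!: horsE simp: hcomposable_def)
  qed
qed

lemma large_FX: "large_pseudo_double_category elts U2 FX"
proof -
  have X': "of_size elts U2 (ob X)" "of_size elts U2 (mor X)" "of_size elts U2 (cell X)"
    using X unfolding large_two_category_def cat_of_size_def by blast+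
  have p: "of_size elts U2 (\<Union>x\<in>B. vpair elts x ` T)" if "of_size elts U2 B" "of_size elts U2 T" for B T
    using that by (intro V2.of_size_UN V2.of_size_image) (auto intro: V2.vpair_in V2.of_size_elems)
  let ?W = "elts U1"
  note w = small_sets p[OF small_sets small_sets]
  have sub: "x \<in> ob X \<Longrightarrow> S x \<subseteq> ?W" for x using S small_subset by blast
  have "FO \<subseteq> (\<Union>x\<in>ob X. P2 x ` ?W)" "FV \<subseteq> (\<Union>x\<in>mor X. P2 x ` ?W)"
    "FH \<subseteq> (\<Union>x\<in>ob X. P2 x ` (\<Union>c\<in>?W. P2 c ` ?W))" "FC \<subseteq> (\<Union>x\<in>cell X. P2 x ` (\<Union>c\<in>?W. P2 c ` ?W))"
    unfolding FO_def FV_def FH_def FC_def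
    using sub[OF cat_simps(1)[OF two_cat_simps(1)[OF two_category_X]]]
      sub[OF cat_simps(1)[OF two_cat_simps(1)[OF two_category_X] two_cat_simps(5)[OF two_category_X]]] sub by fast+
  then have "of_size elts U2 FO" "of_size elts U2 FV" "of_size elts U2 FH" "of_size elts U2 FC"
    using V2.of_size_subset[OF p[OF X'(1) w(1)]] V2.of_size_subset[OF p[OF X'(2) w(1)]]
      V2.of_size_subset[OF p[OF X'(1) w(2)]] V2.of_size_subset[OF p[OF X'(3) w(2)]] by blast+
  then have "cat_of_size elts U2 Fvcat" "cat_of_size elts U2 Fccat"
    by (simp_all add: cat_of_size_def Fvcat_def Fccat_def)
  moreover have "ext_cat Fvcat" "ext_cat Fccat"
    by (auto simp: ext_cat_def Fvcat_def Fccat_def composable_def)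
  moreover have "vcat FX = Fvcat" "ccat FX = Fccat" by (simp_all add: FX_def)
  ultimately show ?thesis
    unfolding large_pseudo_double_category_def hcomposable_def chcomposable_def
    using pseudo_FX by (auto simp: FX_def Fvcat_def Fccat_def)
qed

end


section \<open>Enriched natural transformations as families of cells between hom-objects\<close>

context enr_nat
begin

text \<open>The common value of the two sides of the naturality equation: a transformation, which has components only at
  single objects, as a family of cells indexed by pairs of objects.\<close>

definition wc :: "'v \<Rightarrow> 'v \<Rightarrow> 'v" where
  "wc c d = F.T.mu (fob f c) (fob f' c) (fob f' d) \<odot> (ta c \<otimes> G.om c d) \<odot> li (ehom C c d)"

lemma wc_facts [simp]:
  "c \<in> eob C \<Longrightarrow> d \<in> eob C \<Longrightarrow> wc c d \<in> cells D" "c \<in> eob C \<Longrightarrow> d \<in> eob C \<Longrightarrow> ctop D (wc c d) = ehom C c d"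
  "c \<in> eob C \<Longrightarrow> d \<in> eob C \<Longrightarrow> cbot D (wc c d) = ehom C' (fob f c) (fob f' d)"
  "c \<in> eob C \<Longrightarrow> d \<in> eob C \<Longrightarrow> cleft D (wc c d) = fver f c" "c \<in> eob C \<Longrightarrow> d \<in> eob C \<Longrightarrow> cright D (wc c d) = fver f' d"
  by (simp_all add: wc_def)

lemma li_mu:
  assumes "c \<in> eob C" "d \<in> eob C" "e \<in> eob C"
  shows "li (ehom C c e) \<odot> F.S.mu c d e = (cid D (hid D (eext C c)) \<otimes> F.S.mu c d e) \<odot>
    as (hid D (eext C c)) (ehom C c d) (ehom C d e) \<odot> (li (ehom C c d) \<otimes> cid D (ehom C d e))"
  using li_nat[of "F.S.mu c d e"] as_li[of "ehom C c d" "ehom C d e"] assms by simp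

text \<open>The transformation can be placed on the first factor, with \<open>f'\<close> applied to the second, or by naturality on the
  second factor, with \<open>f\<close> applied to the first (\<open>wc_mu_left\<close>).\<close>

lemma wc_mu_right:
  assumes c: "c \<in> eob C" "d \<in> eob C" "e \<in> eob C"
  shows "wc c e \<odot> F.S.mu c d e = F.T.mu (fob f c) (fob f' d) (fob f' e) \<odot> (wc c d \<otimes> G.om d e)"
proof -
  have "wc c e \<odot> F.S.mu c d e = F.T.mu (fob f c) (fob f' c) (fob f' e) \<odot> (ta c \<otimes> (G.om c e \<odot> F.S.mu c d e)) \<odot>
      as (hid D (eext C c)) (ehom C c d) (ehom C d e) \<odot> (li (ehom C c d) \<otimes> cid D (ehom C d e))"
    unfolding wc_def using c by (simp add: li_mu ichg')
  also have "\<dots> = (F.T.mu (fob f c) (fob f' c) (fob f' e) \<odot> (ta c \<otimes> (F.T.mu (fob f' c) (fob f' d) (fob f' e) \<odot> (G.om c d \<otimes> G.om d e))) \<odot>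
      as (ctop D (ta c)) (ctop D (G.om c d)) (ctop D (G.om d e))) \<odot> (li (ehom C c d) \<otimes> cid D (ehom C d e))"
    using c by (simp add: G.om_mu)
  also have "\<dots> = F.T.mu (fob f c) (fob f' d) (fob f' e) \<odot> (wc c d \<otimes> G.om d e)"
    using c by (subst F.T.mu3[symmetric]) (simp_all add: wc_def ichg)
  finally show ?thesis .
qed

lemma wc_mu_left:
  assumes c: "c \<in> eob C" "d \<in> eob C" "e \<in> eob C"
  shows "wc c e \<odot> F.S.mu c d e = F.T.mu (fob f c) (fob f d) (fob f' e) \<odot> (F.om c d \<otimes> wc d e)"
proof -
  have "wc c e \<odot> F.S.mu c d e = F.T.mu (fob f c) (fob f' d) (fob f' e) \<odot>
     ((F.T.mu (fob f c) (fob f d) (fob f' d) \<odot> (F.om c d \<otimes> ta d) \<odot> ri (ehom C c d)) \<otimes> G.om d e)"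
    unfolding wc_mu_right[OF c] nat[OF c(1,2), symmetric] by (simp only: wc_def)
  also have "\<dots> = (F.T.mu (fob f c) (fob f' d) (fob f' e) \<odot>
     ((F.T.mu (fob f c) (fob f d) (fob f' d) \<odot> (F.om c d \<otimes> ta d)) \<otimes> G.om d e)) \<odot> (ri (ehom C c d) \<otimes> cid D (ehom C d e))"
    using c by (simp add: ichg)
  also have "\<dots> = F.T.mu (fob f c) (fob f d) (fob f' e) \<odot> (F.om c d \<otimes> (F.T.mu (fob f d) (fob f' d) (fob f' e) \<odot> (ta d \<otimes> G.om d e))) \<odot>
     (as (ehom C c d) (hid D (htgt D (ehom C c d))) (ehom C d e) \<odot> (ri (ehom C c d) \<otimes> cid D (ehom C d e)))"
    using c by (subst F.T.mu3) simp_all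
  also have "\<dots> = F.T.mu (fob f c) (fob f d) (fob f' e) \<odot> (F.om c d \<otimes> wc d e)"
    using c by (subst as_ri) (simp_all add: wc_def ichg)
  finally show ?thesis .
qed

lemma wc_et:
  assumes c: "c \<in> eob C" shows "wc c c \<odot> F.S.et c = ta c"
proof -
  have "wc c c \<odot> F.S.et c = F.T.mu (fob f c) (fob f' c) (fob f' c) \<odot> (ta c \<otimes> G.om c c) \<odot> (li (cbot D (F.S.et c)) \<odot> F.S.et c)"
    unfolding wc_def using c by simp
  also have "\<dots> = F.T.mu (fob f c) (fob f' c) (fob f' c) \<odot> (ta c \<otimes> (F.T.et (fob f' c) \<odot> chid D (fver f' c))) \<odot> ri (hid D (eext C c))"
    unfolding li_nat[OF F.S.cat_facts(9)[OF c], symmetric] using c by (simp add: ichg' G.om_et li_hid)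
  also have "\<dots> = ta c" using c by (intro F.T.mu_et_r) simp_all
  finally show ?thesis .
qed

end

context pdc
begin

text \<open>The cells \<open>wc\<close> of a 2-cell of the 2-category of enriched categories, for use where several 2-cells occur.\<close>

definition wcell :: "'v etwo_cell \<Rightarrow> 'v \<Rightarrow> 'v \<Rightarrow> 'v" where
  "wcell a c d = mname (emult (atgt (asrc a)) (fob (amap (asrc a)) c) (fob (amap (atgt a)) c) (fob (amap (atgt a)) d)) \<odot>
     (mname (amap a c) \<otimes> mname (fcell (amap (atgt a)) c d)) \<odot> li (ehom (asrc (asrc a)) c d)"

lemma wcell_i2:
  assumes "f \<in> arr (enr1 elts U1 A)" "c \<in> eob (asrc f)" "d \<in> eob (asrc f)"
  shows "wcell (ide (enr2 elts U1 A) f) c d = mname (fcell (amap f) c d)"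
proof -
  interpret enr_fun D "asrc f" "atgt f" "amap f" by (rule enr_fun') (use assms in simp_all)
  show ?thesis using assms by (simp add: wcell_def enr_names T.mu_et_l)
qed

text \<open>The composite of two transformations is compatible with multiplication: by associativity the second
  transformation can be moved past the first hom-object with \<open>wc_mu_left\<close>.\<close>

lemma wcell_c2:
  assumes a: "a \<in> arr (enr2 elts U1 A)" and b: "b \<in> arr (enr2 elts U1 A)" and ba: "asrc b = atgt a"
    and c: "c \<in> eob (asrc (asrc a))" "d \<in> eob (asrc (asrc a))" "e \<in> eob (asrc (asrc a))"
  shows "wcell (cmp (enr2 elts U1 A) b a) c e \<odot> mname (emult (asrc (asrc a)) c d e) =
    mname (emult (atgt (asrc a)) (fob (amap (asrc a)) c) (fob (amap (atgt a)) d) (fob (amap (atgt b)) e)) \<odot> (wcell a c d \<otimes> wcell b d e)"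
proof -
  let ?C = "asrc (asrc a)" and ?f = "fob (amap (asrc a))" and ?g = "fob (amap (atgt a))" and ?h = "fob (amap (atgt b))"
  interpret A: enr_nat D ?C "atgt (asrc a)" "amap (asrc a)" "amap (atgt a)" "amap a"
    by (rule enr_nat') (use a in simp_all)
  interpret B: enr_nat D ?C "atgt (asrc a)" "amap (atgt a)" "amap (atgt b)" "amap b"
    by (rule enr_nat') (use a b ba in simp_all)
  have w: "wcell a = A.wc" "wcell b = B.wc" using a ba by (auto simp: fun_eq_iff wcell_def A.wc_def B.wc_def)
  have "wcell (cmp (enr2 elts U1 A) b a) c e = A.F.T.mu (?f c) (?h c) (?h e) \<odot>
      ((A.F.T.mu (?f c) (?g c) (?h c) \<odot> (A.ta c \<otimes> B.ta c) \<odot> li (hid D (hsrc D (ehom ?C c e)))) \<otimes> B.G.om c e) \<odot> li (ehom ?C c e)"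
    using a b ba c by (simp add: wcell_def name_c2)
  also have "\<dots> = A.F.T.mu (?f c) (?g c) (?h e) \<odot> (A.ta c \<otimes> B.wc c e) \<odot> li (ehom ?C c e)"
    unfolding B.wc_def using c by (intro A.F.T.mu_001) simp_all
  finally have "wcell (cmp (enr2 elts U1 A) b a) c e \<odot> A.F.S.mu c d e = A.F.T.mu (?f c) (?g c) (?h e) \<odot> (A.ta c \<otimes> (B.wc c e \<odot> A.F.S.mu c d e)) \<odot>
      as (hid D (eext ?C c)) (ehom ?C c d) (ehom ?C d e) \<odot> (li (ehom ?C c d) \<otimes> cid D (ehom ?C d e))"
    using c by (simp add: A.li_mu ichg')
  also have "\<dots> = (A.F.T.mu (?f c) (?g c) (?h e) \<odot> (A.ta c \<otimes> (A.F.T.mu (?g c) (?g d) (?h e) \<odot> (A.G.om c d \<otimes> B.wc d e))) \<odot>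
      as (ctop D (A.ta c)) (ctop D (A.G.om c d)) (ctop D (B.wc d e))) \<odot> (li (ehom ?C c d) \<otimes> cid D (ehom ?C d e))"
    using c by (simp add: B.wc_mu_left)
  also have "\<dots> = A.F.T.mu (?f c) (?g d) (?h e) \<odot> (A.wc c d \<otimes> B.wc d e)"
    using c by (subst A.F.T.mu3[symmetric]) (simp_all add: A.wc_def ichg)
  finally show ?thesis unfolding w .
qed

lemma wcell_hcmp:
  assumes a: "a \<in> cell (enr elts U1 A)" and b: "b \<in> cell (enr elts U1 A)" and ba: "asrc (asrc b) = atgt (asrc a)"
    and c: "c \<in> eob (asrc (asrc a))" "d \<in> eob (asrc (asrc a))"
  shows "wcell (hcmp (enr elts U1 A) b a) c d =
    wcell b (fob (amap (asrc a)) c) (fob (amap (atgt a)) d) \<odot> wcell a c d"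
proof -
  let ?C = "asrc (asrc a)" and ?f = "fob (amap (asrc a))" and ?g = "fob (amap (atgt a))"
    and ?h = "fob (amap (asrc b))" and ?k = "fob (amap (atgt b))"
  interpret A: enr_nat D ?C "atgt (asrc a)" "amap (asrc a)" "amap (atgt a)" "amap a"
    by (rule enr_nat') (use a in simp_all)
  interpret B: enr_nat D "atgt (asrc a)" "atgt (asrc b)" "amap (asrc b)" "amap (atgt b)" "amap b"
    by (rule enr_nat') (use b ba in simp_all)
  have w: "wcell a = A.wc" "wcell b = B.wc" using a b ba by (auto simp: fun_eq_iff wcell_def A.wc_def B.wc_def)
  have "wcell (hcmp (enr elts U1 A) b a) c d = B.F.T.mu (?h (?f c)) (?k (?g c)) (?k (?g d)) \<odot>
      ((B.F.T.mu (?h (?f c)) (?h (?g c)) (?k (?g c)) \<odot> ((B.F.om (?f c) (?g c) \<odot> A.ta c) \<otimes> (B.ta (?g c) \<odot> chid D (fver (amap (atgt a)) c))) \<odot>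
        li (hid D (hsrc D (ehom ?C c d)))) \<otimes> (B.G.om (?g c) (?g d) \<odot> A.G.om c d)) \<odot> li (ehom ?C c d)"
    using a b ba c by (simp add: wcell_def enr_names)
  also have "\<dots> = B.F.T.mu (?h (?f c)) (?h (?g c)) (?k (?g d)) \<odot> ((B.F.om (?f c) (?g c) \<odot> A.ta c) \<otimes>
      (B.F.T.mu (?h (?g c)) (?k (?g c)) (?k (?g d)) \<odot> ((B.ta (?g c) \<odot> chid D (fver (amap (atgt a)) c)) \<otimes> (B.G.om (?g c) (?g d) \<odot> A.G.om c d)) \<odot> li (ehom ?C c d))) \<odot> li (ehom ?C c d)"
    using c by (intro B.F.T.mu_001) simp_all
  also have "B.F.T.mu (?h (?g c)) (?k (?g c)) (?k (?g d)) \<odot> ((B.ta (?g c) \<odot> chid D (fver (amap (atgt a)) c)) \<otimes> (B.G.om (?g c) (?g d) \<odot> A.G.om c d)) \<odot> li (ehom ?C c d) =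
      B.wc (?g c) (?g d) \<odot> A.G.om c d"
    unfolding B.wc_def using c li_nat[of "A.G.om c d"] by (simp flip: ichg')
  also have "B.F.T.mu (?h (?f c)) (?h (?g c)) (?k (?g d)) \<odot> ((B.F.om (?f c) (?g c) \<odot> A.ta c) \<otimes> (B.wc (?g c) (?g d) \<odot> A.G.om c d)) \<odot> li (ehom ?C c d) =
     (B.F.T.mu (?h (?f c)) (?h (?g c)) (?k (?g d)) \<odot> (B.F.om (?f c) (?g c) \<otimes> B.wc (?g c) (?g d))) \<odot> (A.ta c \<otimes> A.G.om c d) \<odot> li (ehom ?C c d)"
    using c by (simp add: ichg')
  also have "\<dots> = (B.wc (?f c) (?g d) \<odot> A.F.T.mu (?f c) (?g c) (?g d)) \<odot> (A.ta c \<otimes> A.G.om c d) \<odot> li (ehom ?C c d)"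
    using c by (simp add: B.wc_mu_left)
  also have "\<dots> = B.wc (?f c) (?g d) \<odot> A.wc c d" using c by (simp add: A.wc_def)
  finally show ?thesis unfolding w .
qed

end


section \<open>The universal family of enriched categories over the double category of elements\<close>

context elements
begin

sublocale el: large_pdc elts U1 U2 FX
  by unfold_locales (simp_all add: pseudo_FX large_FX)

lemma inverse_FX [simp]:
  "x \<in> ob X \<Longrightarrow> c \<in> S x \<Longrightarrow> d \<in> S x \<Longrightarrow> inverse_of (ccat FX) (P3 (i2 X (i1 X x)) c d) = P3 (i2 X (i1 X x)) c d"
  using inverse_of_ide[of "ccat FX" "P3 x c d"] by simp

text \<open>The tautological category over \<open>x\<close>: all units, multiplications and cells are the ones of the double
  category of elements that fit the frame.\<close>

definition univ_ob :: "'v \<Rightarrow> 'v ecat" where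
  "univ_ob x = \<lparr>eob = S x, eext = (\<lambda>c\<in>S x. P2 x c), ehom = (\<lambda>c\<in>S x. \<lambda>d\<in>S x. P3 x c d),
     eunit = (\<lambda>c\<in>S x. MCell [] (P2 (i1 X x) c) (P2 (i1 X x) c) (P3 x c c) (P3 (i2 X (i1 X x)) c c)),
     emult = (\<lambda>c\<in>S x. \<lambda>d\<in>S x. \<lambda>e\<in>S x. MCell [P3 x c d, P3 x d e] (P2 (i1 X x) c) (P2 (i1 X x) e) (P3 x c e)
       (P3 (i2 X (i1 X x)) c e))\<rparr>"

definition univ_mor :: "'v \<Rightarrow> 'v earrow" where
  "univ_mor f = Arrow (univ_ob (s1 X f))
     \<lparr>fob = (\<lambda>c\<in>S (s1 X f). act f c), fver = (\<lambda>c\<in>S (s1 X f). P2 f c),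
      fcell = (\<lambda>c\<in>S (s1 X f). \<lambda>d\<in>S (s1 X f). MCell [P3 (s1 X f) c d] (P2 f c) (P2 f d)
        (P3 (t1 X f) (act f c) (act f d)) (P3 (i2 X f) c d))\<rparr>
     (univ_ob (t1 X f))"

definition univ_cell :: "'v \<Rightarrow> 'v etwo_cell" where
  "univ_cell a = Arrow (univ_mor (s2 X a))
     (\<lambda>c\<in>S (s1 X (s2 X a)). MCell [] (P2 (s2 X a) c) (P2 (t2 X a) c)
        (P3 (t1 X (s2 X a)) (act (s2 X a) c) (act (t2 X a) c)) (P3 a c c))
     (univ_mor (t2 X a))"

lemma univ_ob_sel [simp]:
  "eob (univ_ob x) = S x" "c \<in> S x \<Longrightarrow> eext (univ_ob x) c = P2 x c"
  "c \<in> S x \<Longrightarrow> d \<in> S x \<Longrightarrow> ehom (univ_ob x) c d = P3 x c d"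
  "c \<in> S x \<Longrightarrow> eunit (univ_ob x) c = MCell [] (P2 (i1 X x) c) (P2 (i1 X x) c) (P3 x c c) (P3 (i2 X (i1 X x)) c c)"
  "c \<in> S x \<Longrightarrow> d \<in> S x \<Longrightarrow> e \<in> S x \<Longrightarrow> emult (univ_ob x) c d e =
     MCell [P3 x c d, P3 x d e] (P2 (i1 X x) c) (P2 (i1 X x) e) (P3 x c e) (P3 (i2 X (i1 X x)) c e)"
  by (simp_all add: univ_ob_def)

lemma univ_mor_sel [simp]:
  "asrc (univ_mor f) = univ_ob (s1 X f)" "atgt (univ_mor f) = univ_ob (t1 X f)"
  "c \<in> S (s1 X f) \<Longrightarrow> fob (amap (univ_mor f)) c = act f c" "c \<in> S (s1 X f) \<Longrightarrow> fver (amap (univ_mor f)) c = P2 f c"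
  "c \<in> S (s1 X f) \<Longrightarrow> d \<in> S (s1 X f) \<Longrightarrow> fcell (amap (univ_mor f)) c d =
     MCell [P3 (s1 X f) c d] (P2 f c) (P2 f d) (P3 (t1 X f) (act f c) (act f d)) (P3 (i2 X f) c d)"
  by (simp_all add: univ_mor_def)

lemma univ_cell_sel [simp]:
  "asrc (univ_cell a) = univ_mor (s2 X a)" "atgt (univ_cell a) = univ_mor (t2 X a)"
  "c \<in> S (s1 X (s2 X a)) \<Longrightarrow> amap (univ_cell a) c = MCell [] (P2 (s2 X a) c) (P2 (t2 X a) c)
        (P3 (t1 X (s2 X a)) (act (s2 X a) c) (act (t2 X a) c)) (P3 a c c)"
  by (simp_all add: univ_cell_def)

lemma enr_cat_univ: "x \<in> ob X \<Longrightarrow> enr_cat FX (univ_ob x)"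
proof -
  assume x: "x \<in> ob X"
  have "enriched_category el.A (univ_ob x)"
    unfolding el.enriched_category_iff using x by (simp add: cell_over_def)
  then show ?thesis by unfold_locales
qed

lemma univ_ob: "x \<in> ob X \<Longrightarrow> univ_ob x \<in> ob el.E"
proof -
  assume x: "x \<in> ob X"
  have "ext_ecat (univ_ob x)" by (auto simp: ext_ecat_def univ_ob_def cong: restrict_cong)
  then show ?thesis using enr_cat.C[OF enr_cat_univ[OF x]] S[OF x] by simp
qed

lemma univ_mor: assumes f: "f \<in> mor X" shows "univ_mor f \<in> mor el.E"
proof -
  have x: "s1 X f \<in> ob X" "t1 X f \<in> ob X" using f by simp_all
  interpret s: enr_cat FX "univ_ob (s1 X f)" using enr_cat_univ[OF x(1)] .
  interpret t: enr_cat FX "univ_ob (t1 X f)" using enr_cat_univ[OF x(2)] .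
  have "enriched_functor el.A (univ_ob (s1 X f)) (univ_ob (t1 X f)) (amap (univ_mor f))"
    unfolding el.enriched_functor_iff[OF s.C t.C] using f by (simp add: cell_over_def)
  moreover have "ext_efun (univ_ob (s1 X f)) (amap (univ_mor f))"
    by (auto simp: ext_efun_def univ_mor_def cong: restrict_cong)
  ultimately show ?thesis using univ_ob[OF x(1)] univ_ob[OF x(2)] by (simp add: arr_enr1)
qed

lemma univ_cell: assumes a: "a \<in> cell X" shows "univ_cell a \<in> cell el.E"
proof -
  have f: "s2 X a \<in> mor X" "t2 X a \<in> mor X" using a by simp_all
  note m = univ_mor[OF f(1), unfolded enr_sel] univ_mor[OF f(2), unfolded enr_sel]
  interpret s: enr_fun FX "univ_ob (s1 X (s2 X a))" "univ_ob (t1 X (s2 X a))" "amap (univ_mor (s2 X a))"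
    by (rule el.enr_fun'[OF m(1)]) simp_all
  interpret t: enr_fun FX "univ_ob (s1 X (s2 X a))" "univ_ob (t1 X (s2 X a))" "amap (univ_mor (t2 X a))"
    by (rule el.enr_fun'[OF m(2)]) (use a in simp_all)
  have "enriched_natural el.A (univ_ob (s1 X (s2 X a))) (univ_ob (t1 X (s2 X a))) (amap (univ_mor (s2 X a))) (amap (univ_mor (t2 X a)))
     (amap (univ_cell a))"
    unfolding s.enriched_natural_iff[OF t.f] using a by (simp add: cell_over_def)
  then show ?thesis using m a by (simp add: arr_enr2 univ_cell_def)
qed

definition univ :: "('v, 'v, 'v, 'v ecat, 'v earrow, 'v etwo_cell) two_fun" where
  "univ = \<lparr>on0 = univ_ob, on1 = univ_mor, on2 = univ_cell\<rparr>"

lemma univ_sel [simp]: "on0 univ = univ_ob" "on1 univ = univ_mor" "on2 univ = univ_cell"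
  by (simp_all add: univ_def)

lemma univ_c1:
  assumes "g \<in> mor X" "f \<in> mor X" "s1 X g = t1 X f"
  shows "univ_mor (c1 X g f) = cmp (enr1 elts U1 el.A) (univ_mor g) (univ_mor f)"
proof -
  have m: "univ_mor f \<in> arr (enr1 elts U1 el.A)" "univ_mor g \<in> arr (enr1 elts U1 el.A)"
    using univ_mor[of f] univ_mor[of g] assms by simp_all
  show ?thesis
  proof (rule el.enr1_eqI)
    show "univ_mor (c1 X g f) \<in> arr (enr1 elts U1 el.A)" using univ_mor[of "c1 X g f"] assms by simp
    show "cmp (enr1 elts U1 el.A) (univ_mor g) (univ_mor f) \<in> arr (enr1 elts U1 el.A)"
      by (rule cat_simps(6)) (use assms m in simp_all)
  qed (use assms m in \<open>simp_all add: el.enr_names\<close>)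
qed

lemma two_functor_univ: "two_functor X el.E univ"
proof (rule two_functorI, unfold enr_sel enr1_sel(2,3) enr2_sel(2,3) univ_sel, goal_cases)
  case 2 show ?case by (rule el.two_category_enr)
next
  case (3 x) then show ?case using univ_ob by simp
next
  case (4 f) then show ?case using univ_mor by simp
next
  case (5 x)
  show ?case
  proof (rule el.enr1_eqI)
    show "univ_mor (i1 X x) \<in> arr (enr1 elts U1 el.A)" using univ_mor[of "i1 X x"] 5 by simp
    show "ide (enr1 elts U1 el.A) (univ_ob x) \<in> arr (enr1 elts U1 el.A)"
      using cat_simps(3)[OF el.category_enr1, of "univ_ob x"] univ_ob[OF 5] by simp
  qed (use 5 in \<open>simp_all add: el.name_i1\<close>)
next
  case (6 g f) then show ?case by (rule univ_c1)
next
  case (7 a) then show ?case using univ_cell by simp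
next
  case (8 f)
  have m: "univ_mor f \<in> arr (enr1 elts U1 el.A)" using univ_mor[of f] 8 by simp
  show ?case
    by (rule el.enr2_eqI[where elts=elts and ?U1.0=U1])
      (use 8 m univ_cell[of "i2 X f"] in \<open>simp_all add: el.enr_names\<close>)
next
  case (9 b a)
  have m: "univ_cell a \<in> arr (enr2 elts U1 el.A)" "univ_cell b \<in> arr (enr2 elts U1 el.A)"
    using univ_cell[of a] univ_cell[of b] 9 by simp_all
  have "s1 X (s2 X b) = s1 X (s2 X a)" "t1 X (s2 X b) = t1 X (s2 X a)" using s1_eq[of a b] 9 by simp_all
  then have t: "act (t2 X b) c \<in> S (t1 X (s2 X a))" if "c \<in> S (s1 X (s2 X a))" for c
    using act2(2)[of b c] that 9 by simp
  show ?case
  proof (rule el.enr2_eqI[where elts=elts and ?U1.0=U1])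
    show "univ_cell (c2 X b a) \<in> arr (enr2 elts U1 el.A)" using univ_cell[of "c2 X b a"] 9 by simp
    show "cmp (enr2 elts U1 el.A) (univ_cell b) (univ_cell a) \<in> arr (enr2 elts U1 el.A)"
      by (rule cat_simps(6)) (use 9 m in simp_all)
  qed (use 9 m t in \<open>simp_all add: el.enr_names\<close>)
next
  case (10 b a)
  have m: "univ_cell a \<in> arr (enr2 elts U1 el.A)" "univ_cell b \<in> arr (enr2 elts U1 el.A)"
     "univ_mor (t2 X a) \<in> arr (enr1 elts U1 el.A)" "univ_mor (s2 X b) \<in> arr (enr1 elts U1 el.A)"
    using univ_cell[of a] univ_cell[of b] univ_mor[of "t2 X a"] univ_mor[of "s2 X b"] 10 by simp_all
  have w: "hcmp X b a = c2 X (hcmp X b (i2 X (t2 X a))) (hcmp X (i2 X (s2 X b)) a)"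
    using interchange[OF two_category_X, of b "i2 X (s2 X b)" "i2 X (t2 X a)" a] 10 by simp
  have h: "hcmp el.E (univ_cell b) (univ_cell a) \<in> cell el.E"
    by (rule two_cat_simps(12)[OF el.two_category_enr]) (use 10 m in simp_all)
  show ?case
  proof (rule el.enr2_eqI[where elts=elts and ?U1.0=U1])
    show "univ_cell (hcmp X b a) \<in> arr (enr2 elts U1 el.A)" using univ_cell[of "hcmp X b a"] 10 by simp
  qed (use 10 m h w in \<open>simp_all add: el.enr_names univ_c1\<close>)
qed simp

end


section \<open>Lax double functors on the double category of elements\<close>

locale elements_over = elements elts U1 U2 X S act + large_pdc elts U1 U2 D
  for elts :: "'v \<Rightarrow> 'v set" and U1 U2 and X :: "'v ltwo_cat" and S :: "'v \<Rightarrow> 'v set"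
    and act :: "'v \<Rightarrow> 'v \<Rightarrow> 'v" and D :: "'v psdbl"

text \<open>A 2-functor from \<open>X\<close> to \<open>D\<close>-categories with the object sets and the object functions prescribed by \<open>S\<close> and
  \<open>act\<close>.\<close>

locale family = elements_over elts U1 U2 X S act D
  for elts :: "'v \<Rightarrow> 'v set" and U1 U2 and X :: "'v ltwo_cat" and S :: "'v \<Rightarrow> 'v set"
    and act :: "'v \<Rightarrow> 'v \<Rightarrow> 'v" and D :: "'v psdbl" +
  fixes H :: "('v, 'v, 'v, 'v ecat, 'v earrow, 'v etwo_cell) two_fun"
  assumes H: "two_functor X (enr elts U1 (vdbl_of D)) H"
    and H_ob [simp]: "x \<in> ob X \<Longrightarrow> eob (on0 H x) = S x"
    and H_act [simp]: "f \<in> mor X \<Longrightarrow> c \<in> S (s1 X f) \<Longrightarrow> fob (amap (on1 H f)) c = act f c"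
begin

lemma H_simps [simp]:
  "f \<in> mor X \<Longrightarrow> on1 H f \<in> arr (enr1 elts U1 A)" "f \<in> mor X \<Longrightarrow> asrc (on1 H f) = on0 H (s1 X f)"
  "f \<in> mor X \<Longrightarrow> atgt (on1 H f) = on0 H (t1 X f)" "a \<in> cell X \<Longrightarrow> on2 H a \<in> arr (enr2 elts U1 A)"
  "a \<in> cell X \<Longrightarrow> asrc (on2 H a) = on1 H (s2 X a)" "a \<in> cell X \<Longrightarrow> atgt (on2 H a) = on1 H (t2 X a)"
  "x \<in> ob X \<Longrightarrow> on1 H (i1 X x) = ide (enr1 elts U1 A) (on0 H x)"
  "g \<in> mor X \<Longrightarrow> f \<in> mor X \<Longrightarrow> s1 X g = t1 X f \<Longrightarrow> on1 H (c1 X g f) = cmp (enr1 elts U1 A) (on1 H g) (on1 H f)"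
  "f \<in> mor X \<Longrightarrow> on2 H (i2 X f) = ide (enr2 elts U1 A) (on1 H f)"
  "b \<in> cell X \<Longrightarrow> a \<in> cell X \<Longrightarrow> s2 X b = t2 X a \<Longrightarrow> on2 H (c2 X b a) = cmp (enr2 elts U1 A) (on2 H b) (on2 H a)"
  using two_functor_simps(4-14)[OF H] unfolding enr_sel enr1_sel(2,3) enr2_sel(2,3) by simp_all

lemma H_cat: "x \<in> ob X \<Longrightarrow> enr_cat D (on0 H x)"
  using ob_E two_functor_simps(3)[OF H] by blast

lemma H_fun: "f \<in> mor X \<Longrightarrow> enr_fun D (on0 H (s1 X f)) (on0 H (t1 X f)) (amap (on1 H f))"
  by (rule enr_fun'[of _ elts U1]) simp_all

lemma H_nat: "a \<in> cell X \<Longrightarrow> enr_nat D (on0 H (s1 X (s2 X a))) (on0 H (t1 X (s2 X a)))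
    (amap (on1 H (s2 X a))) (amap (on1 H (t2 X a))) (amap (on2 H a))"
  by (rule enr_nat'[of _ elts U1]) simp_all

lemmas H_cat_facts [simp] = enr_cat.cat_facts[OF H_cat]
lemmas H_fun_facts [simp] = enr_fun.fun_facts(2-)[OF H_fun]

lemma H_et: "f \<in> mor X \<Longrightarrow> c \<in> S (s1 X f) \<Longrightarrow> mname (fcell (amap (on1 H f)) c c) \<odot> mname (eunit (on0 H (s1 X f)) c) =
    mname (eunit (on0 H (t1 X f)) (act f c)) \<odot> chid D (fver (amap (on1 H f)) c)"
  using enr_fun.om_et[OF H_fun, of f c] by simp

lemma wcell_eq: "a \<in> cell X \<Longrightarrow> wcell (on2 H a) = enr_nat.wc D (on0 H (s1 X (s2 X a))) (on0 H (t1 X (s2 X a)))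
    (amap (on1 H (s2 X a))) (amap (on1 H (t2 X a))) (amap (on2 H a))"
  by (simp add: fun_eq_iff wcell_def enr_nat.wc_def[OF H_nat])

lemma wcell_facts [simp]:
  assumes "a \<in> cell X" "c \<in> S (s1 X (s2 X a))" "d \<in> S (s1 X (s2 X a))"
  shows "wcell (on2 H a) c d \<in> cells D" "ctop D (wcell (on2 H a) c d) = ehom (on0 H (s1 X (s2 X a))) c d"
    "cbot D (wcell (on2 H a) c d) = ehom (on0 H (t1 X (s2 X a))) (act (s2 X a) c) (act (t2 X a) d)"
    "cleft D (wcell (on2 H a) c d) = fver (amap (on1 H (s2 X a))) c"
    "cright D (wcell (on2 H a) c d) = fver (amap (on1 H (t2 X a))) d"
  using enr_nat.wc_facts[OF H_nat, of a c d] assms by (simp_all add: wcell_eq)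

lemma wcell_et: "a \<in> cell X \<Longrightarrow> c \<in> S (s1 X (s2 X a)) \<Longrightarrow>
    wcell (on2 H a) c c \<odot> mname (eunit (on0 H (s1 X (s2 X a))) c) = mname (amap (on2 H a) c)"
  using enr_nat.wc_et[OF H_nat, of a c] by (simp add: wcell_eq)

lemma wcell_i2_H [simp]: "f \<in> mor X \<Longrightarrow> c \<in> S (s1 X f) \<Longrightarrow> d \<in> S (s1 X f) \<Longrightarrow>
    wcell (ide (enr2 elts U1 A) (on1 H f)) c d = mname (fcell (amap (on1 H f)) c d)"
  by (rule wcell_i2) simp_all

lemma wcell_i1_H [simp]: "x \<in> ob X \<Longrightarrow> c \<in> S x \<Longrightarrow> d \<in> S x \<Longrightarrow>
    wcell (ide (enr2 elts U1 A) (ide (enr1 elts U1 A) (on0 H x))) c d = cid D (ehom (on0 H x) c d)"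
  using wcell_i2_H[of "i1 X x" c d] by (simp add: name_i1)

lemma wcell_hcmp_H: 
  assumes "a \<in> cell X" "b \<in> cell X" "s1 X (s2 X b) = t1 X (s2 X a)" "c \<in> S (s1 X (s2 X a))" "d \<in> S (s1 X (s2 X a))"
  shows "wcell (on2 H (hcmp X b a)) c d = wcell (on2 H b) (act (s2 X a) c) (act (t2 X a) d) \<odot> wcell (on2 H a) c d"
proof -
  have "on2 H (hcmp X b a) = hcmp E (on2 H b) (on2 H a)"
    by (rule two_functor_simps(14)[OF H]) (use assms in simp_all)
  then show ?thesis using wcell_hcmp[of "on2 H a" elts U1 "on2 H b" c d] assms by (simp del: enr_sel(3))
qed

lemma wcell_c2_H:
  assumes "a \<in> cell X" "b \<in> cell X" "s2 X b = t2 X a" "c \<in> S (s1 X (s2 X a))" "d \<in> S (s1 X (s2 X a))" "e \<in> S (s1 X (s2 X a))"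
  shows "wcell (cmp (enr2 elts U1 A) (on2 H b) (on2 H a)) c e \<odot> mname (emult (on0 H (s1 X (s2 X a))) c d e) =
    mname (emult (on0 H (t1 X (s2 X a))) (act (s2 X a) c) (act (s2 X b) d) (act (t2 X b) e)) \<odot> (wcell (on2 H a) c d \<otimes> wcell (on2 H b) d e)"
proof -
  have "s1 X (s2 X b) = s1 X (s2 X a)" using s1_eq[of a b] assms by simp
  then have "s1 X (t2 X b) = s1 X (s2 X a)" using assms by (metis two_cat_simps(10) two_category_X)
  then show ?thesis
    using wcell_c2[of "on2 H a" elts U1 "on2 H b" c d e] assms by simp
qed

text \<open>The lax double functor that classifies \<open>H\<close>. Laxity is the point: the comparison cells are the units and
  multiplications of the categories \<open>H x\<close>.\<close>

definition K :: "'v lax_fun" where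
  "K = \<lparr>lob = (\<lambda>v\<in>objs FX. eext (on0 H (p1 v)) (V2.vsnd v)), lver = (\<lambda>v\<in>vers FX. fver (amap (on1 H (p1 v))) (V2.vsnd v)),
     lhor = (\<lambda>v\<in>hors FX. ehom (on0 H (p1 v)) (p2 v) (p3 v)), lcell = (\<lambda>v\<in>cells FX. wcell (on2 H (p1 v)) (p2 v) (p3 v)),
     lax_unit = (\<lambda>v\<in>objs FX. mname (eunit (on0 H (p1 v)) (V2.vsnd v))),
     lax_comp = (\<lambda>g d. if hcomposable FX g d then mname (emult (on0 H (p1 g)) (p2 g) (p3 g) (p3 d)) else undefined)\<rparr>"

lemma K_sel [simp]:
  "x \<in> ob X \<Longrightarrow> c \<in> S x \<Longrightarrow> lob K (P2 x c) = eext (on0 H x) c"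
  "f \<in> mor X \<Longrightarrow> c \<in> S (s1 X f) \<Longrightarrow> lver K (P2 f c) = fver (amap (on1 H f)) c"
  "x \<in> ob X \<Longrightarrow> c \<in> S x \<Longrightarrow> d \<in> S x \<Longrightarrow> lhor K (P3 x c d) = ehom (on0 H x) c d"
  "a \<in> cell X \<Longrightarrow> c \<in> S (s1 X (s2 X a)) \<Longrightarrow> d \<in> S (s1 X (s2 X a)) \<Longrightarrow> lcell K (P3 a c d) = wcell (on2 H a) c d"
  "x \<in> ob X \<Longrightarrow> c \<in> S x \<Longrightarrow> lax_unit K (P2 x c) = mname (eunit (on0 H x) c)"
  "x \<in> ob X \<Longrightarrow> c \<in> S x \<Longrightarrow> d \<in> S x \<Longrightarrow> e \<in> S x \<Longrightarrow> lax_comp K (P3 x c d) (P3 x d e) = mname (emult (on0 H x) c d e)"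
  by (simp_all add: K_def hcomposable_def)

lemma ext_K: "ext_lax_fun FX K"
  by (simp add: ext_lax_fun_def K_def)

lemma lax_K: "lax_double_functor FX D K"
proof (rule lax_double_functorI, goal_cases)
  case (3 v) then show ?case by (auto elim!: objsE)
next
  case (4 v) then show ?case by (auto elim!: versE)
next
  case (5 v) then show ?case by (auto elim!: objsE simp: name_i1)
next
  case (6 v u) then show ?case by (auto elim!: versE simp: fver_c1)
next
  case (7 g) then show ?case by (auto elim!: horsE)
next
  case (8 x) then show ?case by (auto elim!: cellsE simp: cell_over_def)
next
  case (9 g) then show ?case by (auto elim!: horsE simp: name_i1)
next
  case (10 y x) then show ?case by (auto elim!: cellsE simp: wcell_hcmp_H)
next
  case (11 x) then show ?case by (auto elim!: objsE simp: cell_over_def)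
next
  case (12 g d) then show ?case by (auto elim!: horsE simp: cell_over_def)
next
  case (13 u) then show ?case by (auto elim!: versE simp: H_et)
next
  case (14 x y)
  then obtain a c d b e k where x: "x = P3 a c d" "a \<in> cell X" "c \<in> S (s1 X (s2 X a))" "d \<in> S (s1 X (s2 X a))"
    and y: "y = P3 b k e" "b \<in> cell X" "k \<in> S (s1 X (s2 X b))" "e \<in> S (s1 X (s2 X b))"
    by (elim cellsE)
  then have e: "t2 X a = s2 X b" "k = d" using 14(3) by simp_all
  have "s1 X (s2 X b) = s1 X (s2 X a)" "t1 X (s2 X b) = t1 X (s2 X a)" using s1_eq[of a b] x y e by simp_all
  then show ?case
    using x y e wcell_c2_H[of a b c d e] act2[of a c] act2[of b d] act2[of b e] by simp
next
  case (15 g d e) then show ?case by (auto elim!: horsE simp: name_i1 enr_cat.mu_assoc[OF H_cat])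
next
  case (16 g) then show ?case by (auto elim!: horsE simp: name_i1 enr_cat.mu_lunit[OF H_cat])
next
  case (17 g) then show ?case by (auto elim!: horsE simp: name_i1 enr_cat.mu_runit[OF H_cat])
qed simp_all

sublocale K: lax_functor FX D K
  by (intro lax_functorI) (simp_all add: lax_K)

lemma push_K_ob: assumes x: "x \<in> ob X" shows "push_ecat K.V (univ_ob x) = on0 H x"
proof (rule ecat_eqI[OF K.ext_push])
  show "ext_ecat (on0 H x)" using ob_E[OF two_functor_simps(3)[OF H x]] by simp
qed (use x in \<open>auto intro!: mcell.expand simp: name_i1\<close>)

lemma push_K_mor: assumes f: "f \<in> mor X" shows "push_efun K.V (univ_mor f) = on1 H f"
proof (rule enr1_eqI)
  have x: "s1 X f \<in> ob X" "t1 X f \<in> ob X" using f by simp_all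
  show "push_efun K.V (univ_mor f) \<in> arr (enr1 elts U1 A)"
    using univ_mor[OF f] by (intro K.push_efun_mor) simp
  show "asrc (push_efun K.V (univ_mor f)) = asrc (on1 H f)" "atgt (push_efun K.V (univ_mor f)) = atgt (on1 H f)"
    using push_K_ob[OF x(1)] push_K_ob[OF x(2)] f by simp_all
qed (use f in simp_all)

lemma push_K_cell: assumes a: "a \<in> cell X" shows "push_enat K.V (univ_cell a) = on2 H a"
proof (rule enr2_eqI)
  have f: "s2 X a \<in> mor X" "t2 X a \<in> mor X" using a by simp_all
  show "push_enat K.V (univ_cell a) \<in> arr (enr2 elts U1 A)"
    using univ_cell[OF a] by (intro K.push_enat_cell) simp
  show "asrc (push_enat K.V (univ_cell a)) = asrc (on2 H a)" "atgt (push_enat K.V (univ_cell a)) = atgt (on2 H a)"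
    using push_K_mor[OF f(1)] push_K_mor[OF f(2)] a by simp_all
qed (use a in \<open>simp_all add: wcell_et\<close>)

end


locale lax_on_elements = elements_over elts U1 U2 X S act D + lax_functor "elements.FX elts U2 X S act" D L
  for elts :: "'v \<Rightarrow> 'v set" and U1 U2 and X :: "'v ltwo_cat" and S :: "'v \<Rightarrow> 'v set"
    and act :: "'v \<Rightarrow> 'v \<Rightarrow> 'v" and D :: "'v psdbl" and L :: "'v lax_fun"
begin

lemma two_functor_push_univ: "two_functor X (enr elts U1 A) (comp_two_fun push univ)"
  by (rule two_functor_comp[OF two_functor_univ two_functor_push])

lemma lcell_ide [simp]: "x \<in> ob X \<Longrightarrow> c \<in> S x \<Longrightarrow> d \<in> S x \<Longrightarrow>
    lcell L (P3 (i2 X (i1 X x)) c d) = cid D (lhor L (P3 x c d))"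
  using F_simps(15)[of "P3 x c d"] by simp

text \<open>The cell \<open>(a, c, d)\<close> is the horizontal composite of \<open>(a, c, c)\<close> and \<open>(1, c, d)\<close>, so naturality of the
  comparison cells expresses its image by a component of the transformation that \<open>L\<close> induces and a cell of the functor that \<open>L\<close> induces.\<close>

lemma wcell_lcell:
  assumes a: "a \<in> cell X" and c: "c \<in> S (s1 X (s2 X a))" "d \<in> S (s1 X (s2 X a))"
  shows "wcell (push_enat V (univ_cell a)) c d = lcell L (P3 a c d)"
proof -
  let ?g = "P3 (s1 X (s2 X a)) c d"
  have b: "act (t2 X a) c \<in> S (t1 X (s2 X a))" "act (t2 X a) d \<in> S (t1 X (s2 X a))" "act (s2 X a) c \<in> S (t1 X (s2 X a))"
    using act2[of a] a c by simp_all
  have "wcell (push_enat V (univ_cell a)) c d =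
     lax_comp L (P3 (t1 X (s2 X a)) (act (s2 X a) c) (act (t2 X a) c)) (P3 (t1 X (s2 X a)) (act (t2 X a) c) (act (t2 X a) d)) \<odot>
       ((lcell L (P3 a c c) \<odot> lax_unit L (P2 (s1 X (s2 X a)) c)) \<otimes> (lcell L (P3 (i2 X (t2 X a)) c d) \<odot> cid D (lhor L ?g))) \<odot> li (lhor L ?g)"
    using a c b by (simp add: wcell_def)
  also have "\<dots> = lcell L (P3 a c d) \<odot> lax_comp L (hid FX (hsrc FX ?g)) ?g \<odot>
      (lax_unit L (hsrc FX ?g) \<otimes> cid D (lhor L ?g)) \<odot> li (lhor L ?g)"
    using a c b by (subst comp_nat') simp_all
  also have "\<dots> = lcell L (P3 a c d)"
    using a c b by (subst comp_li) simp_all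
  finally show ?thesis .
qed

end

context elements_over
begin

lemma lax_on_elementsI: "F \<in> mor (PsDBL elts U2) \<Longrightarrow> asrc F = FX \<Longrightarrow> atgt F = D \<Longrightarrow> lax_on_elements elts U1 U2 X S act D (amap F)"
  using lax_functor_PsDBL1[of F elts U2] lax_on_elements.intro[OF elements_over_axioms, of "amap F"] by simp

text \<open>A lax functor on the double category of elements can be read off from the family of categories that it
  induces; for the images of cells this is \<open>wcell_lcell\<close>.\<close>

lemma lax_on_elements_eqI:
  assumes F: "F \<in> mor (PsDBL elts U2)" "asrc F = FX" "atgt F = D" and G: "G \<in> mor (PsDBL elts U2)" "asrc G = FX" "atgt G = D"
    and e: "\<And>x. x \<in> ob X \<Longrightarrow> push_ecat (Vf F) (univ_ob x) = push_ecat (Vf G) (univ_ob x)"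
      "\<And>f. f \<in> mor X \<Longrightarrow> push_efun (Vf F) (univ_mor f) = push_efun (Vf G) (univ_mor f)"
      "\<And>a. a \<in> cell X \<Longrightarrow> push_enat (Vf F) (univ_cell a) = push_enat (Vf G) (univ_cell a)"
  shows "F = G"
proof -
  interpret F: lax_on_elements elts U1 U2 X S act D "amap F" using F by (rule lax_on_elementsI)
  interpret G: lax_on_elements elts U1 U2 X S act D "amap G" using G by (rule lax_on_elementsI)
  note e = e[unfolded F(2,3) G(2,3)]
  have "amap F = amap G"
  proof (rule lax_fun_eqI[where D=FX])
    show "ext_lax_fun FX (amap F)" "ext_lax_fun FX (amap G)" using F G by (simp_all add: arr_PsDBL1)
    fix v assume "v \<in> objs FX"
    then obtain x c where v: "v = P2 x c" "x \<in> ob X" "c \<in> S x" by (elim objsE)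
    show "lob (amap F) v = lob (amap G) v" using arg_cong[OF e(1)[OF v(2)], of "\<lambda>C. eext C c"] v by simp
    show "lax_unit (amap F) v = lax_unit (amap G) v"
      using arg_cong[OF e(1)[OF v(2)], of "\<lambda>C. mname (eunit C c)"] v by simp
  next
    fix v assume "v \<in> vers FX"
    then obtain f c where v: "v = P2 f c" "f \<in> mor X" "c \<in> S (s1 X f)" by (elim versE)
    show "lver (amap F) v = lver (amap G) v" using arg_cong[OF e(2)[OF v(2)], of "\<lambda>f. fver (amap f) c"] v by simp
  next
    fix v assume "v \<in> hors FX"
    then obtain x c d where v: "v = P3 x c d" "x \<in> ob X" "c \<in> S x" "d \<in> S x" by (elim horsE)
    show "lhor (amap F) v = lhor (amap G) v" using arg_cong[OF e(1)[OF v(2)], of "\<lambda>C. ehom C c d"] v by simp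
  next
    fix v assume "v \<in> cells FX"
    then obtain a c d where v: "v = P3 a c d" "a \<in> cell X" "c \<in> S (s1 X (s2 X a))" "d \<in> S (s1 X (s2 X a))" by (elim cellsE)
    show "lcell (amap F) v = lcell (amap G) v"
      using arg_cong[OF e(3)[OF v(2)], of "\<lambda>t. wcell t c d"] v by (simp only: F.wcell_lcell G.wcell_lcell)
  next
    fix g h assume "g \<in> hors FX" "h \<in> hors FX" and r: "htgt FX g = hsrc FX h"
    then obtain x c d y d' k where g: "g = P3 x c d" "x \<in> ob X" "c \<in> S x" "d \<in> S x"
      and h: "h = P3 y d' k" "y \<in> ob X" "d' \<in> S y" "k \<in> S y" by (elim horsE)
    then have "y = x" "d' = d" using r by simp_all
    then show "lax_comp (amap F) g h = lax_comp (amap G) g h"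
      using arg_cong[OF e(1)[OF g(2)], of "\<lambda>C. mname (emult C c d k)"] g h by simp
  qed
  then show ?thesis using F G by (intro arrow.expand) simp
qed

lemma two_cell_unique:
  assumes t: "s \<in> cell (PsDBL elts U2)" "t \<in> cell (PsDBL elts U2)" and e: "asrc s = asrc t" "atgt s = atgt t"
    and X: "asrc (asrc t) = FX" "atgt (asrc t) = D"
    and c: "\<And>x. x \<in> ob X \<Longrightarrow> component s (univ_ob x) = component t (univ_ob x)"
  shows "s = t"
proof -
  have "amap s = amap t"
  proof (rule vert_trans_eqI[where D=FX])
    show "ext_vert_trans FX (amap s)" "ext_vert_trans FX (amap t)" using t e X unfolding cell_PsDBL by metis+
    fix v assume "v \<in> objs FX"
    then obtain x d where v: "v = P2 x d" "x \<in> ob X" "d \<in> S x" by (elim objsE)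
    show "tob (amap s) v = tob (amap t) v"
      using arg_cong[OF c[OF v(2)], of "\<lambda>f. fver (amap f) d"] v by simp
  next
    fix v assume "v \<in> hors FX"
    then obtain x d k where v: "v = P3 x d k" "x \<in> ob X" "d \<in> S x" "k \<in> S x" by (elim horsE)
    show "thor (amap s) v = thor (amap t) v"
      using arg_cong[OF c[OF v(2)], of "\<lambda>f. mname (fcell (amap f) d k)"] v by simp
  qed
  then show ?thesis using e by (intro arrow.expand) simp
qed

text \<open>The components of \<open>b\<close> are identities on objects, so their vertical morphisms and cells are exactly the data of
  a vertical transformation. Its naturality at the cells of the double category of elements is 2-naturality of \<open>b\<close> after passage to the families \<open>wcell\<close>.\<close>

lemma two_cell_exists:
  assumes F: "F \<in> mor (PsDBL elts U2)" "asrc F = FX" "atgt F = D" and G: "G \<in> mor (PsDBL elts U2)" "asrc G = FX" "atgt G = D"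
    and b: "two_natural X E (comp_two_fun (lax_functor.push FX D (amap F)) univ) (comp_two_fun (lax_functor.push FX D (amap G)) univ) b"
    and id: "\<And>x c. x \<in> ob X \<Longrightarrow> c \<in> S x \<Longrightarrow> fob (amap (b x)) c = c"
  shows "\<exists>t. t \<in> cell (PsDBL elts U2) \<and> asrc t = F \<and> atgt t = G \<and> (\<forall>x\<in>ob X. component t (univ_ob x) = b x)"
proof -
  interpret F: lax_on_elements elts U1 U2 X S act D "amap F" using F by (rule lax_on_elementsI)
  interpret G: lax_on_elements elts U1 U2 X S act D "amap G" using G by (rule lax_on_elementsI)
  note n = two_natural_simps[OF b, unfolded comp_two_fun_sel univ_sel F.push_sel G.push_sel]
  have b1 [simp]: "x \<in> ob X \<Longrightarrow> b x \<in> arr (enr1 elts U1 A)" "x \<in> ob X \<Longrightarrow> asrc (b x) = push_ecat F.V (univ_ob x)"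
    "x \<in> ob X \<Longrightarrow> atgt (b x) = push_ecat G.V (univ_ob x)" for x
    using n(1-3) by simp_all
  have bf: "x \<in> ob X \<Longrightarrow> enr_fun D (push_ecat F.V (univ_ob x)) (push_ecat G.V (univ_ob x)) (amap (b x))" for x
    by (rule enr_fun'[of _ elts U1]) simp_all
  note [simp] = enr_fun.fun_facts(2-)[OF bf] id
  have et: "mname (fcell (amap (b x)) c c) \<odot> lax_unit (amap F) (P2 x c) = lax_unit (amap G) (P2 x c) \<odot> chid D (fver (amap (b x)) c)"
    if "x \<in> ob X" "c \<in> S x" for x c
    using enr_fun.om_et[OF bf, of x c] that by simp
  have mu: "mname (fcell (amap (b x)) c e) \<odot> lax_comp (amap F) (P3 x c d) (P3 x d e) =
     lax_comp (amap G) (P3 x c d) (P3 x d e) \<odot> (mname (fcell (amap (b x)) c d) \<otimes> mname (fcell (amap (b x)) d e))"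
    if "x \<in> ob X" "c \<in> S x" "d \<in> S x" "e \<in> S x" for x c d e
    using enr_fun.om_mu[OF bf, of x c d e] that by simp
  have nv: "vcmp D (lver (amap G) (P2 f c)) (fver (amap (b (s1 X f))) c) = vcmp D (fver (amap (b (t1 X f))) (act f c)) (lver (amap F) (P2 f c))"
    if "f \<in> mor X" "c \<in> S (s1 X f)" for f c
  proof -
    have "univ_mor f \<in> arr (enr1 elts U1 el.A)" using univ_mor[OF that(1)] by simp
    then show ?thesis using arg_cong[OF n(4)[OF that(1)], of "\<lambda>g. fver (amap g) c"] that by (simp add: fver_c1)
  qed
  \<comment> \<open>Both sides of 2-naturality are horizontal composites with an identity, and \<open>wcell_hcmp\<close> turns them into
    vertical composites of cells.\<close>
  have nc: "lcell (amap G) (P3 a c d) \<odot> mname (fcell (amap (b (s1 X (s2 X a)))) c d) =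
     mname (fcell (amap (b (t1 X (s2 X a)))) (act (s2 X a) c) (act (t2 X a) d)) \<odot> lcell (amap F) (P3 a c d)"
    if a: "a \<in> cell X" "c \<in> S (s1 X (s2 X a))" "d \<in> S (s1 X (s2 X a))" for a c d
  proof -
    let ?x = "s1 X (s2 X a)" and ?y = "t1 X (s2 X a)"
    have xy: "?x \<in> ob X" "?y \<in> ob X" using a by simp_all
    have u: "univ_cell a \<in> arr (enr2 elts U1 el.A)" using univ_cell[OF a(1)] by simp
    have p: "push_enat F.V (univ_cell a) \<in> cell E" "push_enat G.V (univ_cell a) \<in> cell E"
      using F.push_enat_cell[OF u] G.push_enat_cell[OF u] by simp_all
    have i: "ide (enr2 elts U1 A) (b ?x) \<in> cell E" "ide (enr2 elts U1 A) (b ?y) \<in> cell E"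
      using xy by simp_all
    have "wcell (hcmp E (push_enat G.V (univ_cell a)) (i2 E (b ?x))) c d = wcell (hcmp E (i2 E (b ?y)) (push_enat F.V (univ_cell a))) c d"
      using n(5)[OF a(1)] by simp
    then show ?thesis
      using p i xy a by (simp add: wcell_hcmp wcell_i2 F.wcell_lcell G.wcell_lcell del: enr_sel(3) F.push_enat_sel(3) G.push_enat_sel(3))
  qed
  define t where "t = \<lparr>tob = (\<lambda>v\<in>objs FX. fver (amap (b (p1 v))) (V2.vsnd v)),
    thor = (\<lambda>v\<in>hors FX. mname (fcell (amap (b (p1 v))) (p2 v) (p3 v)))\<rparr>"
  have t [simp]: "x \<in> ob X \<Longrightarrow> c \<in> S x \<Longrightarrow> tob t (P2 x c) = fver (amap (b x)) c"
    "x \<in> ob X \<Longrightarrow> c \<in> S x \<Longrightarrow> d \<in> S x \<Longrightarrow> thor t (P3 x c d) = mname (fcell (amap (b x)) c d)" for x c d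
    by (simp_all add: t_def)
  have "vertical_transformation FX D (amap F) (amap G) t"
  proof (rule vertical_transformationI, goal_cases)
    case (1 v) then show ?case by (auto elim!: objsE)
  next
    case (2 g) then show ?case by (auto elim!: horsE simp: cell_over_def)
  next
    case (3 u) then show ?case by (auto elim!: versE simp: nv)
  next
    case (4 x) then show ?case by (auto elim!: cellsE simp: nc)
  next
    case (5 v) then show ?case by (auto elim!: objsE simp: et)
  next
    case (6 g d) then show ?case by (auto elim!: horsE simp: mu)
  qed
  moreover have "ext_vert_trans FX t" by (simp add: t_def ext_vert_trans_restrict)
  ultimately have T: "Arrow F t G \<in> cell (PsDBL elts U2)"
    using F G by (simp add: cell_PsDBL)
  have "component (Arrow F t G) (univ_ob x) = b x" if x: "x \<in> ob X" for x
  proof (rule enr1_eqI)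
    show "component (Arrow F t G) (univ_ob x) \<in> arr (enr1 elts U1 A)"
      using component_mor[OF T, of "univ_ob x" U1] univ_ob[OF x] F by simp
  qed (use x F G in simp_all)
  then show ?thesis using T by (intro exI[of _ "Arrow F t G"]) simp
qed

end


section \<open>Enrichment is a parametric right 2-adjoint\<close>

text \<open>Universal arrows in the slice, with the conditions on triangles spelled out in the base.\<close>

lemma parametric_right_2adjointI:
  fixes R :: "('o, 'a, 'c, 'p, 'b, 'd) two_fun"
  assumes R: "two_functor K L R" and t: "terminal_object K t"
    and F0: "\<And>p. p \<in> mor L \<Longrightarrow> t1 L p = on0 R t \<Longrightarrow> F0 p \<in> ob K"
    and u: "\<And>p. p \<in> mor L \<Longrightarrow> t1 L p = on0 R t \<Longrightarrow> u p \<in> mor L \<and> s1 L (u p) = s1 L p \<and> t1 L (u p) = on0 R (F0 p) \<and>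
      c1 L (on1 R (to_terminal K t (F0 p))) (u p) = p"
    and ex1: "\<And>p x h. p \<in> mor L \<Longrightarrow> t1 L p = on0 R t \<Longrightarrow> x \<in> ob K \<Longrightarrow> h \<in> mor L \<Longrightarrow> s1 L h = s1 L p \<Longrightarrow>
      t1 L h = on0 R x \<Longrightarrow> c1 L (on1 R (to_terminal K t x)) h = p \<Longrightarrow>
      \<exists>k. k \<in> mor K \<and> s1 K k = F0 p \<and> t1 K k = x \<and> c1 L (on1 R k) (u p) = h"
    and uniq1: "\<And>p k k'. p \<in> mor L \<Longrightarrow> t1 L p = on0 R t \<Longrightarrow> k \<in> mor K \<Longrightarrow> k' \<in> mor K \<Longrightarrow> s1 K k = F0 p \<Longrightarrow>
      s1 K k' = F0 p \<Longrightarrow> t1 K k = t1 K k' \<Longrightarrow> c1 L (on1 R k) (u p) = c1 L (on1 R k') (u p) \<Longrightarrow> k = k'"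
    and ex2: "\<And>p k k' b. p \<in> mor L \<Longrightarrow> t1 L p = on0 R t \<Longrightarrow> k \<in> mor K \<Longrightarrow> k' \<in> mor K \<Longrightarrow> s1 K k = F0 p \<Longrightarrow>
      s1 K k' = F0 p \<Longrightarrow> t1 K k = t1 K k' \<Longrightarrow> b \<in> cell L \<Longrightarrow> s2 L b = c1 L (on1 R k) (u p) \<Longrightarrow>
      t2 L b = c1 L (on1 R k') (u p) \<Longrightarrow> hcmp L (i2 L (on1 R (to_terminal K t (t1 K k)))) b = i2 L p \<Longrightarrow>
      \<exists>a. a \<in> cell K \<and> s2 K a = k \<and> t2 K a = k' \<and> hcmp L (on2 R a) (i2 L (u p)) = b"
    and uniq2: "\<And>p a a'. p \<in> mor L \<Longrightarrow> t1 L p = on0 R t \<Longrightarrow> a \<in> cell K \<Longrightarrow> a' \<in> cell K \<Longrightarrow> s2 K a = s2 K a' \<Longrightarrow>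
      t2 K a = t2 K a' \<Longrightarrow> s1 K (s2 K a) = F0 p \<Longrightarrow>
      hcmp L (on2 R a) (i2 L (u p)) = hcmp L (on2 R a') (i2 L (u p)) \<Longrightarrow> a = a'"
  shows "parametric_right_2adjoint K L R"
proof -
  let ?q = "\<lambda>x. on1 R (to_terminal K t x)" and ?G = "lift_to_slice K t R" and ?Y = "slice L (on0 R t)"
  note [simp] = two_functor_simps[OF R] to_terminal[OF t]
  have G0: "on0 ?G x = ?q x" for x by (simp add: lift_to_slice_def Let_def)
  have G1: "on1 ?G f = Arrow (?q (s1 K f)) (on1 R f) (?q (t1 K f))" for f by (simp add: lift_to_slice_def Let_def)
  have G2: "on2 ?G a = Arrow (on1 ?G (s2 K a)) (on2 R a) (on1 ?G (t2 K a))" for a by (simp add: lift_to_slice_def Let_def)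
  have "has_left_2adjoint K ?Y ?G"
  proof (rule has_left_2adjointI[where ?F0.0=F0 and u="\<lambda>p. Arrow p (u p) (?q (F0 p))"],
      unfold slice_sel slice1_sel slice2_sel G0 G1 G2 mem_Collect_eq arrow.sel, goal_cases)
    case 1 show ?case by (rule two_functor_lift_to_slice[OF R t])
  next
    case (2 p) then show ?case using F0 by simp
  next
    case (3 p) then show ?case using u[of p] F0[of p] by (simp add: arr_slice1)
  next
    case (4 p x h)
    then have h: "amap h \<in> mor L" "s1 L (amap h) = s1 L p" "t1 L (amap h) = on0 R x" "c1 L (?q x) (amap h) = p" 
      by (simp_all add: arr_slice1)
    obtain k where k: "k \<in> mor K" "s1 K k = F0 p" "t1 K k = x" "c1 L (on1 R k) (u p) = amap h"
      using ex1[OF _ _ 4(2) h] 4(1) by blast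
    then show ?case using 4 by (intro exI[of _ k]) (cases h, simp)
  next
    case (5 p k k') then show ?case using uniq1[of p k k'] by simp
  next
    case (6 p k k' b)
    then have b: "amap b \<in> cell L" "s2 L (amap b) = c1 L (on1 R k) (u p)" "t2 L (amap b) = c1 L (on1 R k') (u p)"
      "hcmp L (i2 L (?q (t1 K k))) (amap b) = i2 L p"
      by (simp_all add: arr_slice2)
    obtain a where a: "a \<in> cell K" "s2 K a = k" "t2 K a = k'" "hcmp L (on2 R a) (i2 L (u p)) = amap b"
      using ex2[OF _ _ 6(2-6) b] 6(1) 6(6) by auto
    have "b = Arrow (asrc b) (amap b) (atgt b)" by simp
    then show ?case using a 6 by (intro exI[of _ a]) simp
  next
    case (7 p a a') then show ?case using uniq2[of p a a'] by simp
  qed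
  then show ?thesis unfolding parametric_right_2adjoint_def using R t by blast
qed

context large_pdc
begin

lemma decoded:
  assumes k: "k \<in> mor (TwoCAT elts U2)" "atgt k = KN D"
  shows "two_functor (asrc k) E (comp_two_fun Co.dec (amap k))"
    "x \<in> ob (asrc k) \<Longrightarrow> code0 elts (on0 (comp_two_fun Co.dec (amap k)) x) = on0 (amap k) x"
    "f \<in> mor (asrc k) \<Longrightarrow> code1 elts (on1 (comp_two_fun Co.dec (amap k)) f) = on1 (amap k) f"
    "a \<in> cell (asrc k) \<Longrightarrow> code2 elts (on2 (comp_two_fun Co.dec (amap k)) a) = on2 (amap k) a"
proof -
  have F: "two_functor (asrc k) Co.K (amap k)" using k by (simp add: mor_TwoCAT1)
  show "two_functor (asrc k) E (comp_two_fun Co.dec (amap k))" by (rule two_functor_comp[OF F Co.two_functor_dec])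
  show "x \<in> ob (asrc k) \<Longrightarrow> code0 elts (on0 (comp_two_fun Co.dec (amap k)) x) = on0 (amap k) x"
    using two_functor_simps(3)[OF F, of x] by (auto simp del: enr_sel)
  show "f \<in> mor (asrc k) \<Longrightarrow> code1 elts (on1 (comp_two_fun Co.dec (amap k)) f) = on1 (amap k) f"
    using two_functor_simps(4)[OF F, of f] by (auto simp del: enr_sel)
  show "a \<in> cell (asrc k) \<Longrightarrow> code2 elts (on2 (comp_two_fun Co.dec (amap k)) a) = on2 (amap k) a"
    using two_functor_simps(9)[OF F, of a] by (auto simp del: enr_sel)
qed

end

text \<open>Over the terminal double category enriched categories, functors and natural transformations are
  determined by the objects, by the functions on objects and by the boundary, respectively.\<close>

lemma one_ecat_eq:
  assumes "enr_cat (one_dbl z) C" "enr_cat (one_dbl z) C'" "ext_ecat C" "ext_ecat C'" "eob C = eob C'" shows "C = C'"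
proof -
  interpret C: enr_cat "one_dbl z" C by fact
  interpret C': enr_cat "one_dbl z" C' by fact
  have o: "c \<in> eob C \<Longrightarrow> eext C c = z \<and> eext C' c = z" for c
    using C.cat_facts(1)[of c] C'.cat_facts(1)[of c] assms(5) by simp
  have h: "c \<in> eob C \<Longrightarrow> d \<in> eob C \<Longrightarrow> ehom C c d = z \<and> ehom C' c d = z" for c d
    using C.cat_facts(2)[of c d] C'.cat_facts(2)[of c d] assms(5) by simp
  have e: "c \<in> eob C \<Longrightarrow> C.et c = z \<and> C'.et c = z" for c
    using C.cat_facts(9)[of c] C'.cat_facts(9)[of c] assms(5) by simp
  have m: "c \<in> eob C \<Longrightarrow> d \<in> eob C \<Longrightarrow> k \<in> eob C \<Longrightarrow> C.mu c d k = z \<and> C'.mu c d k = z" for c d k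
    using C.cat_facts(18)[of c d k] C'.cat_facts(18)[of c d k] assms(5) by simp
  show ?thesis
    by (rule ecat_eqI[OF assms(3,4,5)]) (use assms(5) in \<open>auto intro!: mcell.expand simp: o h e m\<close>)
qed

lemma one_efun_eq:
  assumes f: "f \<in> mor (enr elts U1 (vdbl_of (one_dbl z)))" "g \<in> mor (enr elts U1 (vdbl_of (one_dbl z)))"
    and st: "asrc f = asrc g" "atgt f = atgt g" and fob: "\<And>c. c \<in> eob (asrc g) \<Longrightarrow> fob (amap f) c = fob (amap g) c"
  shows "f = g"
proof -
  interpret pdc "one_dbl z" by unfold_locales (rule pseudo_one)
  interpret f: enr_fun "one_dbl z" "asrc g" "atgt g" "amap f" by (rule enr_fun'[of _ elts U1]) (use f st in simp_all)
  interpret g: enr_fun "one_dbl z" "asrc g" "atgt g" "amap g" by (rule enr_fun'[of _ elts U1]) (use f in simp_all)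
  have v: "c \<in> eob (asrc g) \<Longrightarrow> fver (amap f) c = z \<and> fver (amap g) c = z" for c
    using f.fun_facts(2)[of c] g.fun_facts(2)[of c] by simp
  have h: "c \<in> eob (asrc g) \<Longrightarrow> d \<in> eob (asrc g) \<Longrightarrow> f.om c d = z \<and> g.om c d = z" for c d
    using f.fun_facts(9)[of c d] g.fun_facts(9)[of c d] by simp
  show ?thesis by (rule enr1_eqI[where elts=elts and ?U1.0=U1]) (use f st fob in \<open>simp_all add: v h\<close>)
qed

lemma one_enat_eq:
  assumes a: "a \<in> cell (enr elts U1 (vdbl_of (one_dbl z)))" "b \<in> cell (enr elts U1 (vdbl_of (one_dbl z)))"
    and st: "asrc a = asrc b" "atgt a = atgt b"
  shows "a = b"
proof -
  interpret pdc "one_dbl z" by unfold_locales (rule pseudo_one)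
  interpret a: enr_nat "one_dbl z" "asrc (asrc b)" "atgt (asrc b)" "amap (asrc b)" "amap (atgt b)" "amap a"
    by (rule enr_nat'[of _ elts U1]) (use a st in simp_all)
  interpret b: enr_nat "one_dbl z" "asrc (asrc b)" "atgt (asrc b)" "amap (asrc b)" "amap (atgt b)" "amap b"
    by (rule enr_nat'[of _ elts U1]) (use a st in simp_all)
  have "c \<in> eob (asrc (asrc b)) \<Longrightarrow> a.ta c = z \<and> b.ta c = z" for c
    using a.nat_facts(5)[of c] b.nat_facts(5)[of c] by simp
  then show ?thesis by (intro enr2_eqI[where elts=elts and ?U1.0=U1]) (use a st in simp_all)
qed

text \<open>An object \<open>p\<close> of the slice over the 2-category of categories enriched over the terminal double category.\<close>

locale over_one = two_universes elts U1 U2 for elts :: "'v \<Rightarrow> 'v set" and U1 U2 +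
  fixes z :: 'v and p :: "('v ltwo_cat, 'v ltwo_fun) arrow"
  assumes z: "of_size elts U2 {z}" and p: "p \<in> mor (TwoCAT elts U2)" "atgt p = KN (one_dbl z)"
begin

sublocale one: large_pdc elts U1 U2 "one_dbl z"
  by (rule large_pdcI) (rule large_one[OF z])

abbreviation "X \<equiv> asrc p"
abbreviation "Q \<equiv> comp_two_fun one.Co.dec (amap p)"

definition S :: "'v \<Rightarrow> 'v set" where "S x = eob (on0 Q x)"
definition act :: "'v \<Rightarrow> 'v \<Rightarrow> 'v" where "act f c = fob (amap (on1 Q f)) c"

lemmas Q = one.decoded[OF p]

lemma Q_simps:
  "f \<in> mor X \<Longrightarrow> on1 Q f \<in> arr (enr1 elts U1 one.A)" "f \<in> mor X \<Longrightarrow> asrc (on1 Q f) = on0 Q (s1 X f)"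
  "f \<in> mor X \<Longrightarrow> atgt (on1 Q f) = on0 Q (t1 X f)" 
  "x \<in> ob X \<Longrightarrow> on1 Q (i1 X x) = ide (enr1 elts U1 one.A) (on0 Q x)"
  "g \<in> mor X \<Longrightarrow> f \<in> mor X \<Longrightarrow> s1 X g = t1 X f \<Longrightarrow> on1 Q (c1 X g f) = cmp (enr1 elts U1 one.A) (on1 Q g) (on1 Q f)"
  "a \<in> cell X \<Longrightarrow> on2 Q a \<in> arr (enr2 elts U1 one.A)" 
  "a \<in> cell X \<Longrightarrow> asrc (on2 Q a) = on1 Q (s2 X a)" "a \<in> cell X \<Longrightarrow> atgt (on2 Q a) = on1 Q (t2 X a)"
  using two_functor_simps(4-14)[OF Q(1)] unfolding enr_sel enr1_sel(2,3) enr2_sel(2,3) by blast+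

sublocale elements elts U1 U2 X S act
proof (unfold_locales, goal_cases)
  case 1 show ?case using p by (simp add: mor_TwoCAT1)
next
  case (2 x) then show ?case unfolding S_def using one.ob_E[OF two_functor_simps(3)[OF Q(1)]] by blast
next
  case (3 f c)
  interpret enr_fun "one_dbl z" "on0 Q (s1 X f)" "on0 Q (t1 X f)" "amap (on1 Q f)"
    by (rule one.enr_fun'[of _ elts U1]) (use Q_simps(1-3)[OF 3(1)] in blast)+
  show ?case using 3(2) unfolding S_def act_def by (rule fun_facts(1))
next
  case (4 x c)
  then show ?case unfolding S_def act_def Q_simps(4)[OF 4(1)] by (intro one.name_i1)
next
  case (5 g f c)
  then show ?case unfolding S_def act_def Q_simps(5)[OF 5(1-3)] by (intro one.fob_c1) (simp only: Q_simps(2))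
qed

end


context over_one
begin

lemma terminal: "terminal_object (PsDBL elts U2) (one_dbl z)"
  by (rule terminal_one[OF z])

lemma bang_mor: "large_pseudo_double_category elts U2 D \<Longrightarrow> Arrow D (bang z D) (one_dbl z) \<in> mor (PsDBL elts U2)"
  using one.large by (simp add: arr_PsDBL1 bang_lax ext_bang)

lemma to_one: "large_pseudo_double_category elts U2 D \<Longrightarrow>
    to_terminal (PsDBL elts U2) (one_dbl z) D = Arrow D (bang z D) (one_dbl z)"
  using to_terminal[OF terminal, of D] bang_mor[of D]
  by (intro terminal_unique1[OF terminal _ _ _ _ _ two_category_PsDBL]) simp_all

lemma one_functor_eq:
  assumes R: "two_functor X one.E R" and e0: "\<And>x. x \<in> ob X \<Longrightarrow> eob (on0 R x) = S x"
    and e1: "\<And>f c. f \<in> mor X \<Longrightarrow> c \<in> S (s1 X f) \<Longrightarrow> fob (amap (on1 R f)) c = act f c"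
  shows "x \<in> ob X \<Longrightarrow> on0 R x = on0 Q x" "f \<in> mor X \<Longrightarrow> on1 R f = on1 Q f" "a \<in> cell X \<Longrightarrow> on2 R a = on2 Q a"
proof -
  note R = two_functor_simps[OF R] and Q = two_functor_simps[OF Q(1)]
  show 0: "on0 R x = on0 Q x" if x: "x \<in> ob X" for x
    by (rule one_ecat_eq) (use one.ob_E[OF R(3)[OF x]] one.ob_E[OF Q(3)[OF x]] e0[OF x, unfolded S_def] in blast)+
  show 1: "on1 R f = on1 Q f" if f: "f \<in> mor X" for f
  proof (rule one_efun_eq)
    have x: "s1 X f \<in> ob X" "t1 X f \<in> ob X" using f by simp_all
    show "asrc (on1 R f) = asrc (on1 Q f)" "atgt (on1 R f) = atgt (on1 Q f)"
      using R(5,6)[OF f] Q(5,6)[OF f] 0[OF x(1)] 0[OF x(2)] by simp_all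
    fix c assume "c \<in> eob (asrc (on1 Q f))"
    then show "fob (amap (on1 R f)) c = fob (amap (on1 Q f)) c" using e1[OF f] Q_simps(2)[OF f] unfolding S_def act_def by metis
  qed (use R(4)[OF f] Q(4)[OF f] in blast)+
  show "on2 R a = on2 Q a" if a: "a \<in> cell X" for a
  proof (rule one_enat_eq)
    have x: "s2 X a \<in> mor X" "t2 X a \<in> mor X" using a by simp_all
    show "asrc (on2 R a) = asrc (on2 Q a)" "atgt (on2 R a) = atgt (on2 Q a)"
      using R(10,11)[OF a] Q(10,11)[OF a] 1[OF x(1)] 1[OF x(2)] by simp_all
  qed (use R(9)[OF a] Q(9)[OF a] in blast)+
qed

text \<open>Categories over the terminal double category carry no data besides sets and functions, so lying over \<open>p\<close>
  is a condition on object sets and object functions only.\<close>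

lemma over_iff:
  assumes l: "large_pseudo_double_category elts U2 D" and k: "k \<in> mor (TwoCAT elts U2)" "asrc k = X" "atgt k = KN D"
    and H: "H = comp_two_fun (coding.dec (EN D) (code0 elts) (code1 elts) (code2 elts)) (amap k)"
  shows "c1 (TwoCAT elts U2) (on1 (Enr elts U1) (Arrow D (bang z D) (one_dbl z))) k = p \<longleftrightarrow>
     (\<forall>x\<in>ob X. eob (on0 H x) = S x) \<and> (\<forall>f\<in>mor X. \<forall>c\<in>S (s1 X f). fob (amap (on1 H f)) c = act f c)" (is "?c = p \<longleftrightarrow> ?R")
proof -
  interpret D: large_pdc elts U1 U2 D by (rule large_pdcI[OF l])
  interpret F: lax_functor D "one_dbl z" "bang z D" using lax_functor_PsDBL1[OF bang_mor[OF l, unfolded PsDBL_sel]] by simp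
  note d = D.decoded[OF k(1,3), folded H, unfolded k(2)]
  note ev = Enr1_eval[OF bang_mor[OF l], unfolded arrow.sel]
  let ?R = "comp_two_fun F.push H"
  have R: "two_functor X one.E ?R" by (rule two_functor_comp[OF d(1) F.two_functor_push])
  note Hs = two_functor_simps[OF d(1)]
  have c: "asrc ?c = X" "atgt ?c = KN (one_dbl z)" using k by simp_all
  have c0: "on0 (amap ?c) x = code0 elts (on0 ?R x)" if "x \<in> ob X" for x
    using ev(1)[OF Hs(3)[OF that]] d(2)[OF that] that k by simp
  have c1: "on1 (amap ?c) f = code1 elts (on1 ?R f)" if "f \<in> mor X" for f
    using ev(2)[OF Hs(4)[OF that]] d(3)[OF that] that k by simp
  have c2: "on2 (amap ?c) a = code2 elts (on2 ?R a)" if "a \<in> cell X" for a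
    using ev(3)[OF Hs(9)[OF that]] d(4)[OF that] that k by simp
  have eo: "eob (on0 ?R x) = eob (on0 H x)" for x by simp
  have fo: "fob (amap (on1 ?R f)) = fob (amap (on1 H f))" for f by simp
  show ?thesis
  proof
    assume e: "?c = p"
    have "on0 ?R x = on0 Q x" if "x \<in> ob X" for x
      using c0[OF that, unfolded e] Q(2)[OF that] one.Co.d0_eq[OF two_functor_simps(3)[OF R that] two_functor_simps(3)[OF Q(1) that]] by metis
    moreover have "on1 ?R f = on1 Q f" if "f \<in> mor X" for f
      using c1[OF that, unfolded e] Q(3)[OF that] one.Co.d1_eq[OF two_functor_simps(4)[OF R that] two_functor_simps(4)[OF Q(1) that]] by metis
    ultimately show "(\<forall>x\<in>ob X. eob (on0 H x) = S x) \<and> (\<forall>f\<in>mor X. \<forall>c\<in>S (s1 X f). fob (amap (on1 H f)) c = act f c)"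
      using eo fo unfolding S_def act_def by metis
  next
    assume e: "(\<forall>x\<in>ob X. eob (on0 H x) = S x) \<and> (\<forall>f\<in>mor X. \<forall>c\<in>S (s1 X f). fob (amap (on1 H f)) c = act f c)"
    have e0: "eob (on0 ?R x) = S x" if "x \<in> ob X" for x using e eo that by metis
    have e1: "fob (amap (on1 ?R f)) c = act f c" if "f \<in> mor X" "c \<in> S (s1 X f)" for f c using e fo that by metis
    note eq = one_functor_eq[OF R e0 e1]
    have "amap ?c = amap p"
    proof (rule two_fun_eqI[where K=X])
      show "ext_two_fun X (amap ?c)" using k by (simp add: ext_restrict)
      show "ext_two_fun X (amap p)" using p by (simp add: mor_TwoCAT1)
    qed (use c0 c1 c2 eq Q(2-4) in metis)+
    then show "?c = p" using c p(2) by (intro arrow.expand) simp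
  qed
qed


definition unit :: "('v ltwo_cat, 'v ltwo_fun) arrow" where
  "unit = Arrow X (restrict_two_fun X (comp_two_fun el.Co.enc univ)) (KN FX)"

lemma unit_sel [simp]: "asrc unit = X" "atgt unit = KN FX"
  "x \<in> ob X \<Longrightarrow> on0 (amap unit) x = code0 elts (univ_ob x)" "f \<in> mor X \<Longrightarrow> on1 (amap unit) f = code1 elts (univ_mor f)"
  "a \<in> cell X \<Longrightarrow> on2 (amap unit) a = code2 elts (univ_cell a)"
  by (simp_all add: unit_def)

lemma unit_mor: "unit \<in> mor (TwoCAT elts U2)"
  using X el.large_Enr0 two_functor_restrict[OF two_functor_comp[OF two_functor_univ el.Co.two_functor_enc]]
  by (simp add: mor_TwoCAT1 unit_def ext_restrict)

lemma unit_over: "c1 (TwoCAT elts U2) (on1 (Enr elts U1) (Arrow FX (bang z FX) (one_dbl z))) unit = p"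
proof -
  have u: "inv_into (ob el.E) (code0 elts) (code0 elts (univ_ob x)) = univ_ob x" if "x \<in> ob X" for x
    by (rule el.Co.inv0[OF univ_ob[OF that]])
  have v: "inv_into (mor el.E) (code1 elts) (code1 elts (univ_mor f)) = univ_mor f" if "f \<in> mor X" for f
    by (rule el.Co.inv1[OF univ_mor[OF that]])
  show ?thesis
    by (subst over_iff[OF large_FX unit_mor unit_sel(1,2) refl]) (simp add: u v del: enr_sel)
qed

lemma after_unit:
  assumes k: "k \<in> mor (PsDBL elts U2)" "asrc k = FX"
  shows "x \<in> ob X \<Longrightarrow> on0 (amap (c1 (TwoCAT elts U2) (on1 (Enr elts U1) k) unit)) x = code0 elts (push_ecat (Vf k) (univ_ob x))"
    "f \<in> mor X \<Longrightarrow> on1 (amap (c1 (TwoCAT elts U2) (on1 (Enr elts U1) k) unit)) f = code1 elts (push_efun (Vf k) (univ_mor f))"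
    "a \<in> cell X \<Longrightarrow> on2 (amap (c1 (TwoCAT elts U2) (on1 (Enr elts U1) k) unit)) a = code2 elts (push_enat (Vf k) (univ_cell a))"
  using Enr1_eval(1)[OF k(1), unfolded k(2), OF univ_ob, of x] Enr1_eval(2)[OF k(1), unfolded k(2), OF univ_mor, of f]
    Enr1_eval(3)[OF k(1), unfolded k(2), OF univ_cell, of a] by (simp_all add: k(2))

lemma elements_overI: "large_pseudo_double_category elts U2 D \<Longrightarrow> elements_over elts U1 U2 X S act D"
  using large_pdcI[of D] elements_axioms by (intro elements_over.intro)

lemma unit_factor:
  assumes D: "large_pseudo_double_category elts U2 D" and h: "h \<in> mor (TwoCAT elts U2)" "asrc h = X" "atgt h = KN D"
    and c: "c1 (TwoCAT elts U2) (on1 (Enr elts U1) (Arrow D (bang z D) (one_dbl z))) h = p"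
  shows "\<exists>k. k \<in> mor (PsDBL elts U2) \<and> asrc k = FX \<and> atgt k = D \<and> c1 (TwoCAT elts U2) (on1 (Enr elts U1) k) unit = h"
proof -
  interpret D: elements_over elts U1 U2 X S act D by (rule elements_overI[OF D])
  let ?H = "comp_two_fun D.Co.dec (amap h)"
  note d = D.decoded[OF h(1,3), unfolded h(2)]
  note e = iffD1[OF over_iff[OF D h refl] c]
  interpret F: family elts U1 U2 X S act D ?H
    by (intro family.intro family_axioms.intro D.elements_over_axioms d(1)) (use e in blast)+
  let ?k = "Arrow FX F.K D"
  have k: "?k \<in> mor (PsDBL elts U2)" using D large_FX F.lax_K F.ext_K by (simp add: arr_PsDBL1)
  have "amap (c1 (TwoCAT elts U2) (on1 (Enr elts U1) ?k) unit) = amap h"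
  proof (rule two_fun_eqI[where K=X])
    show "ext_two_fun X (amap (c1 (TwoCAT elts U2) (on1 (Enr elts U1) ?k) unit))" by (simp add: ext_restrict)
    show "ext_two_fun X (amap h)" using h by (simp add: mor_TwoCAT1)
    fix x assume x: "x \<in> ob X"
    show "on0 (amap (c1 (TwoCAT elts U2) (on1 (Enr elts U1) ?k) unit)) x = on0 (amap h) x"
      using after_unit(1)[OF k _ x] F.push_K_ob[OF x] d(2)[OF x] by (metis arrow.sel)
  next
    fix f assume f: "f \<in> mor X"
    show "on1 (amap (c1 (TwoCAT elts U2) (on1 (Enr elts U1) ?k) unit)) f = on1 (amap h) f"
      using after_unit(2)[OF k _ f] F.push_K_mor[OF f] d(3)[OF f] by (metis arrow.sel)
  next
    fix a assume a: "a \<in> cell X"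
    show "on2 (amap (c1 (TwoCAT elts U2) (on1 (Enr elts U1) ?k) unit)) a = on2 (amap h) a"
      using after_unit(3)[OF k _ a] F.push_K_cell[OF a] d(4)[OF a] by (metis arrow.sel)
  qed
  then have "c1 (TwoCAT elts U2) (on1 (Enr elts U1) ?k) unit = h" using h by (intro arrow.expand) simp
  then show ?thesis using k by (intro exI[of _ ?k]) simp
qed

lemma unit_factor_unique:
  assumes k: "k \<in> mor (PsDBL elts U2)" "asrc k = FX" and k': "k' \<in> mor (PsDBL elts U2)" "asrc k' = FX" and t: "atgt k = atgt k'"
    and e: "c1 (TwoCAT elts U2) (on1 (Enr elts U1) k) unit = c1 (TwoCAT elts U2) (on1 (Enr elts U1) k') unit"
  shows "k = k'"
proof -
  interpret D: elements_over elts U1 U2 X S act "atgt k" by (rule elements_overI) (use k in \<open>simp add: arr_PsDBL1\<close>)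
  interpret F: lax_on_elements elts U1 U2 X S act "atgt k" "amap k" using k by (intro D.lax_on_elementsI) simp_all
  interpret G: lax_on_elements elts U1 U2 X S act "atgt k" "amap k'" using k' t by (intro D.lax_on_elementsI) simp_all
  note F = two_functor_simps[OF F.two_functor_push_univ, unfolded comp_two_fun_sel F.push_sel univ_sel]
    and G = two_functor_simps[OF G.two_functor_push_univ, unfolded comp_two_fun_sel G.push_sel univ_sel]
  show ?thesis
  proof (rule D.lax_on_elements_eqI[OF k refl k' t[symmetric]])
    show "push_ecat (Vf k) (univ_ob x) = push_ecat (Vf k') (univ_ob x)" if "x \<in> ob X" for x
      using after_unit(1)[OF k that] after_unit(1)[OF k' that] D.Co.d0_eq[OF F(3)[OF that] G(3)[OF that]] e k(2) k'(2) t by metis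
    show "push_efun (Vf k) (univ_mor f) = push_efun (Vf k') (univ_mor f)" if "f \<in> mor X" for f
      using after_unit(2)[OF k that] after_unit(2)[OF k' that] D.Co.d1_eq[OF F(4)[OF that] G(4)[OF that]] e k(2) k'(2) t by metis
    show "push_enat (Vf k) (univ_cell a) = push_enat (Vf k') (univ_cell a)" if "a \<in> cell X" for a
      using after_unit(3)[OF k that] after_unit(3)[OF k' that] D.Co.d2_eq[OF F(9)[OF that] G(9)[OF that]] e k(2) k'(2) t by metis
  qed
qed

text \<open>Whiskering the image of a vertical transformation with the unit records its components at the tautological
  categories, which are enough to recover the transformation.\<close>

lemma hcmp_unit:
  assumes a: "a \<in> cell (PsDBL elts U2)" "asrc (asrc a) = FX" and x: "x \<in> ob X"
  shows "amap (hcmp (TwoCAT elts U2) (on2 (Enr elts U1) a) (i2 (TwoCAT elts U2) unit)) x = code1 elts (component a (univ_ob x))"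
proof -
  have k: "asrc a \<in> mor (PsDBL elts U2)" using a by (simp add: cell_PsDBL)
  interpret D: elements_over elts U1 U2 X S act "atgt (asrc a)" by (rule elements_overI) (use k in \<open>simp add: arr_PsDBL1\<close>)
  interpret F: lax_on_elements elts U1 U2 X S act "atgt (asrc a)" "amap (asrc a)" using k a by (intro D.lax_on_elementsI) simp_all
  have u: "univ_ob x \<in> ob el.E" by (rule univ_ob[OF x])
  have m: "component a (univ_ob x) \<in> mor D.E" using component_mor[OF a(1), of "univ_ob x" U1] u a by simp
  have P: "push_ecat (vdbl_fun_of FX (atgt (asrc a)) (amap (asrc a))) (univ_ob x) \<in> ob D.E"
    using two_functor_simps(3)[OF F.two_functor_push_univ x] by simp
  have i: "i1 el.E (univ_ob x) \<in> mor el.E" "push_efun F.V (i1 el.E (univ_ob x)) = i1 D.E (push_ecat F.V (univ_ob x))"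
    using two_functor_simps(7)[OF F.two_functor_push u] cat_simps(3)[OF two_cat_simps(1)[OF el.two_category_enr] u] by simp_all
  have "amap (hcmp (TwoCAT elts U2) (on2 (Enr elts U1) a) (i2 (TwoCAT elts U2) unit)) x =
    c1 D.Co.K (code1 elts (component a (univ_ob x))) (code1 elts (i1 D.E (push_ecat F.V (univ_ob x))))"
    using Enr2_eval(1)[OF a(1), unfolded a(2), OF u] Enr1_eval(2)[OF k, unfolded a(2), OF i(1)] x u i(2)
    by (simp add: a(2) del: enr_sel component_sel)
  also have "\<dots> = code1 elts (component a (univ_ob x))"
  proof -
    have "s1 D.E (component a (univ_ob x)) = push_ecat F.V (univ_ob x)" using a(2) by simp
    then show ?thesis
      using D.Co.coded_ops(4)[OF m, of "i1 D.E (push_ecat F.V (univ_ob x))"] P m cat_simps(9)[OF two_cat_simps(1)[OF D.two_category_enr] m]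
        cat_simps(3,5)[OF two_cat_simps(1)[OF D.two_category_enr] P]
      by metis
  qed
  finally show ?thesis .
qed

lemma unit_cell_unique:
  assumes a: "a \<in> cell (PsDBL elts U2)" "b \<in> cell (PsDBL elts U2)" "asrc a = asrc b" "atgt a = atgt b" "asrc (asrc a) = FX"
    and e: "hcmp (TwoCAT elts U2) (on2 (Enr elts U1) a) (i2 (TwoCAT elts U2) unit) = hcmp (TwoCAT elts U2) (on2 (Enr elts U1) b) (i2 (TwoCAT elts U2) unit)"
  shows "a = b"
proof -
  have k: "asrc b \<in> mor (PsDBL elts U2)" using a by (simp add: cell_PsDBL)
  interpret D: elements_over elts U1 U2 X S act "atgt (asrc b)" by (rule elements_overI) (use k in \<open>simp add: arr_PsDBL1\<close>)
  show ?thesis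
  proof (rule D.two_cell_unique[OF a(1-4) a(5)[unfolded a(3)] refl])
    fix x assume x: "x \<in> ob X"
    have m: "component a (univ_ob x) \<in> mor D.E" "component b (univ_ob x) \<in> mor D.E"
      using component_mor[OF a(1), of "univ_ob x" U1] component_mor[OF a(2), of "univ_ob x" U1] univ_ob[OF x] a(3,5) by simp_all
    have b5: "asrc (asrc b) = FX" using a(3,5) by simp
    show "component a (univ_ob x) = component b (univ_ob x)"
      using hcmp_unit[OF a(1,5) x] hcmp_unit[OF a(2) b5 x] D.Co.d1_eq[OF m] e by metis
  qed
qed

end


context over_one
begin

text \<open>The condition that the 2-cell lies over the identity of \<open>p\<close> says that its components are identities on
  objects, which is what \<open>two_cell_exists\<close> asks for.\<close>

lemma unit_cell_factor:
  assumes k: "k \<in> mor (PsDBL elts U2)" "asrc k = FX" and k': "k' \<in> mor (PsDBL elts U2)" "asrc k' = FX" and t: "atgt k = atgt k'"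
    and b: "b \<in> cell (TwoCAT elts U2)" "asrc b = c1 (TwoCAT elts U2) (on1 (Enr elts U1) k) unit"
      "atgt b = c1 (TwoCAT elts U2) (on1 (Enr elts U1) k') unit"
    and e: "hcmp (TwoCAT elts U2) (i2 (TwoCAT elts U2) (on1 (Enr elts U1) (Arrow (atgt k) (bang z (atgt k)) (one_dbl z)))) b =
      i2 (TwoCAT elts U2) p"
  shows "\<exists>a. a \<in> cell (PsDBL elts U2) \<and> asrc a = k \<and> atgt a = k' \<and>
    hcmp (TwoCAT elts U2) (on2 (Enr elts U1) a) (i2 (TwoCAT elts U2) unit) = b"
proof -
  let ?D = "atgt k"
  have D: "large_pseudo_double_category elts U2 ?D" using k by (simp add: arr_PsDBL1)
  interpret D: elements_over elts U1 U2 X S act ?D by (rule elements_overI[OF D])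
  interpret F: lax_on_elements elts U1 U2 X S act ?D "amap k" using k by (intro D.lax_on_elementsI) simp_all
  interpret G: lax_on_elements elts U1 U2 X S act ?D "amap k'" using k' t by (intro D.lax_on_elementsI) simp_all
  interpret B: lax_functor ?D "one_dbl z" "bang z ?D" using lax_functor_PsDBL1[OF bang_mor[OF D, unfolded PsDBL_sel]] by simp
  note F = two_functor_simps[OF F.two_functor_push_univ, unfolded comp_two_fun_sel F.push_sel univ_sel]
    and G = two_functor_simps[OF G.two_functor_push_univ, unfolded comp_two_fun_sel G.push_sel univ_sel]
  have b1: "asrc (asrc b) = X" "atgt (asrc b) = KN ?D" "asrc (atgt b) = X" "atgt (atgt b) = KN ?D" using b(2,3) t by simp_all
  have bm: "two_functor X D.Co.K (amap (asrc b))" "two_functor X D.Co.K (amap (atgt b))"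
    and n: "two_natural X D.Co.K (amap (asrc b)) (amap (atgt b)) (amap b)" and ext: "amap b \<in> extensional (ob X)"
    using b(1) b1 by (simp_all add: cell_TwoCAT mor_TwoCAT1)
  note a = after_unit[OF k, folded b(2), unfolded k(2)] and a' = after_unit[OF k', folded b(3), unfolded k'(2) t[symmetric]]
  define \<beta> where "\<beta> = (\<lambda>x. inv_into (mor D.E) (code1 elts) (amap b x))"
  have \<beta>: "\<beta> x \<in> mor D.E" "code1 elts (\<beta> x) = amap b x" if "x \<in> ob X" for x
    using two_natural_simps(1)[OF n that] by (auto simp: \<beta>_def simp del: enr_sel)
  have nat: "two_natural X D.E (comp_two_fun F.push univ) (comp_two_fun G.push univ) \<beta>"
    by (rule two_natural_cong[OF two_natural_lwhisker[OF bm D.Co.two_functor_dec n]])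
      (simp_all add: \<beta>_def a a' F G del: enr_sel)
  \<comment> \<open>The passage to categories over the terminal double category keeps the functions on objects, and it
    makes \<open>\<beta> x\<close> an identity.\<close>
  have fob: "fob (amap (\<beta> x)) c = c" if x: "x \<in> ob X" and c: "c \<in> S x" for x c
  proof -
    note ev = Enr1_eval[OF bang_mor[OF D], unfolded arrow.sel]
    note \<beta>' = two_natural_simps(1-3)[OF nat x, unfolded comp_two_fun_sel G.push_sel univ_sel]
    note B = two_functor_simps[OF B.two_functor_push[of elts U1], unfolded B.push_sel]
    have "code1 elts (push_efun B.V (\<beta> x)) = code1 elts (i1 one.E (on0 Q x))"
    proof -
      let ?y = "push_ecat B.V (push_ecat G.V (univ_ob x))"
      have y: "?y \<in> ob one.E" "t1 one.E (push_efun B.V (\<beta> x)) = ?y" "push_efun B.V (\<beta> x) \<in> mor one.E"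
        using B(3)[OF G(3)[OF x]] B(6)[OF \<beta>'(1)] B(4)[OF \<beta>'(1)] \<beta>'(3) by simp_all
      note i = cat_simps(3,4)[OF two_cat_simps(1)[OF one.two_category_enr] y(1)]
      have "amap (hcmp (TwoCAT elts U2) (i2 (TwoCAT elts U2) (on1 (Enr elts U1) (Arrow ?D (bang z ?D) (one_dbl z)))) b) x =
        c1 one.Co.K (code1 elts (i1 one.E ?y)) (code1 elts (push_efun B.V (\<beta> x)))"
        using x ev(1)[OF G(3)[OF x]] ev(2)[OF \<beta>(1)[OF x]] \<beta>(2)[OF x] y G(3)[OF x] by (simp add: b1 a' del: enr_sel)
      also have "\<dots> = code1 elts (push_efun B.V (\<beta> x))"
        using one.Co.coded_ops(4)[OF i(1) y(3)] i(2) y cat_simps(10)[OF two_cat_simps(1)[OF one.two_category_enr] y(3,2)] by metis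
      also have "amap (hcmp (TwoCAT elts U2) (i2 (TwoCAT elts U2) (on1 (Enr elts U1) (Arrow ?D (bang z ?D) (one_dbl z)))) b) x = i1 one.Co.K (on0 (amap p) x)"
        unfolding e using x p(2) by simp
      also have "\<dots> = code1 elts (i1 one.E (on0 Q x))"
        using one.Co.coded_ops(3)[OF two_functor_simps(3)[OF Q(1) x]] Q(2)[OF x] by metis
      finally show ?thesis by (rule sym)
    qed
    moreover have "push_efun B.V (\<beta> x) \<in> mor one.E" using B(4)[OF \<beta>'(1)] .
    moreover have "i1 one.E (on0 Q x) \<in> mor one.E"
      by (rule cat_simps(3)[OF two_cat_simps(1)[OF one.two_category_enr] two_functor_simps(3)[OF Q(1) x]])
    ultimately have "push_efun B.V (\<beta> x) = i1 one.E (on0 Q x)" by (metis one.Co.d1_eq)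
    from arg_cong[OF this, of "\<lambda>f. fob (amap f) c"] show ?thesis
      using one.name_i1(1)[OF c[unfolded S_def]] by simp
  qed
  obtain s where s: "s \<in> cell (PsDBL elts U2)" "asrc s = k" "atgt s = k'" "\<And>x. x \<in> ob X \<Longrightarrow> component s (univ_ob x) = \<beta> x"
    using D.two_cell_exists[OF k refl k' t[symmetric] nat fob] by blast
  have sF: "asrc (asrc s) = FX" using s k by simp
  let ?h = "hcmp (TwoCAT elts U2) (on2 (Enr elts U1) s) (i2 (TwoCAT elts U2) unit)"
  have "amap ?h = amap b"
  proof (rule extensionalityI[OF _ ext])
    show "amap ?h \<in> extensional (ob X)" by simp
    show "amap ?h x = amap b x" if "x \<in> ob X" for x
      using hcmp_unit[OF s(1) sF that] s(4)[OF that] \<beta>(2)[OF that] by metis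
  qed
  then have "?h = b" using b(2,3) s(2,3) by (intro arrow.expand) simp
  then show ?thesis using s by (intro exI[of _ s]) simp
qed

end

theorem mainTheorem3:
  fixes elts :: "'v \<Rightarrow> 'v set" and U1 U2 :: 'v
  assumes "universe_pair elts U1 U2"
  shows "parametric_right_2adjoint (PsDBL elts U2) (TwoCAT elts U2) (Enr elts U1)"
proof -
  interpret two_universes elts U1 U2 by unfold_locales (rule assms)
  define z where "z = vset elts {}"
  have z: "of_size elts U2 {z}"
    unfolding z_def by (intro V2.of_size_singleton V2.vset_in V2.of_size_empty)
  let ?P = "PsDBL elts U2" and ?T = "TwoCAT elts U2" and ?R = "Enr elts U1"
  have O: "over_one elts U1 U2 z p" if "p \<in> mor ?T" "t1 ?T p = on0 ?R (one_dbl z)" for p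
    using z that by unfold_locales simp_all
  let ?F = "\<lambda>p. elements.FX elts U2 (asrc p) (over_one.S elts U1 z p) (over_one.act elts U1 z p)"
    and ?u = "\<lambda>p. over_one.unit elts U1 U2 z p"
  show ?thesis
  proof (rule parametric_right_2adjointI[OF two_functor_Enr terminal_one[OF z], where ?F0.0="?F" and u="?u"], goal_cases)
    case (1 p)
    interpret over_one elts U1 U2 z p by (rule O[OF 1])
    show ?case using large_FX by simp
  next
    case (2 p)
    interpret over_one elts U1 U2 z p by (rule O[OF 2])
    show ?case using unit_mor unit_over to_one[OF large_FX] large_FX by simp
  next
    case (3 p D h)
    interpret over_one elts U1 U2 z p by (rule O[OF 3(1,2)])
    show ?case using unit_factor[of D h] 3 to_one[of D] by simp
  next
    case (4 p k k')
    interpret over_one elts U1 U2 z p by (rule O[OF 4(1,2)])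
    show ?case by (rule unit_factor_unique) (use 4 in simp_all)
  next
    case (5 p k k' b)
    interpret over_one elts U1 U2 z p by (rule O[OF 5(1,2)])
    have "large_pseudo_double_category elts U2 (atgt k)" using 5(3) by (simp add: arr_PsDBL1)
    note o = to_one[OF this]
    note sel = PsDBL_sel(1,3,4) PsDBL1_sel(2,3) TwoCAT_sel(3,4)
    show ?case
      using unit_cell_factor[of k k' b] 5(3-)[unfolded sel o] unfolding sel by blast
  next
    case (6 p a a')
    interpret over_one elts U1 U2 z p by (rule O[OF 6(1,2)])
    show ?case by (rule unit_cell_unique) (use 6 in simp_all)
  qed
qed

end
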